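(* Let $a\in\mathbb C$, $m\ge1$, $\alpha\in\mathbb Z$, $\lambda_1,\dots,\lambda_m\in\mathbb C$ with $\lambda_m\ne0$, and let $\phi$ be holomorphic and nonvanishing on a neighborhood of $a$. Set $$F(z):=(z-a)^\alpha\exp\Bigl(\sum_{s=1}^m\lambda_s(z-a)^{-s}\Bigr)\phi(z)$$ on a punctured neighborhood of $a$. Let $r>0$ be any fixed radius such that this representation of $F$ is valid on $0<|z-a|<r$ and $\phi$ is holomorphic and nonvanishing on a neighborhood of $\overline{D(a,r)}$. Then, for every $\chi\in C_c(\mathbb C)$, $$\frac1{mn}\sum_{\substack{F^{(n)}(\zeta)=0\\0<|\zeta-a|<r}}\operatorname{mult}_\zeta(F^{(n)})\,\chi\bigl(n^{1/m}(\zeta-a)\bigr)\longrightarrow\int_{\mathbb C}\chi\,d\widehat\mu_{m,\lambda_m}\qquad(n\to\infty),$$ and for fixed $\chi$ the sum is independent of the admissible choice of $r$ for all large $n$. If moreover $r_n\downarrow0$, $n^{1/m}r_n\to\infty$, and $$\frac1{mn}\sum_{\substack{F^{(n)}(\zeta)=0\\0<|\zeta-a|<r_n}}\operatorname{mult}_\zeta(F^{(n)})\longrightarrow1,$$ then $$\frac1{mn}\sum_{\substack{F^{(n)}(\zeta)=0\\0<|\zeta-a|<r_n}}\operatorname{mult}_\zeta(F^{(n)})\,\delta_{n^{1/m}(\zeta-a)}\longrightarrow\widehat\mu_{m,\lambda_m}$$ weakly on $\widehat{\mathbb C}$ as finite Borel measures.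
   Context: For $m\ge1$ put $c_m=\left(\frac{m+1}m\right)^{m+1}$. $\mu_m$ is the probability measure on $[0,c_m]$ whose Cauchy transform $C_m(\zeta)=\int\frac{d\mu_m(x)}{\zeta-x}$ equals $1-v(\zeta)^{-m}$, where $v$ is the branch, holomorphic on $\mathbb C\setminus[0,c_m]$, of $v^{m+1}=m\zeta(v-1)$ with $v(\zeta)=1+\frac1{m\zeta}+O(\zeta^{-2})$ as $\zeta\to\infty$; it has no atom at $0$. (For $m=1$, $\mu_1$ is the Marchenko–Pastur law $\frac1{2\pi x}\sqrt{x(4-x)}\,dx$ on $(0,4)$.) For $\lambda\in\mathbb C^\times$ choose $\eta$ with $\eta^m=-\lambda$ and define $\phi_\nu:[0,c_m]\to\widehat{\mathbb C}$, $0\le\nu\le m-1$, by $\phi_\nu(0)=\infty$ and $\phi_\nu(x)=e^{2\pi i\nu/m}\eta\,x^{-1/m}$ for $0<x\le c_m$ (positive real root $x^{-1/m}$). Set $\widehat\mu_{m,\lambda}=\frac1m\sum_{\nu=0}^{m-1}(\phi_\nu)_\#\mu_m$, the equal-weight average of push-forward measures; it is a probability measure on the Riemann sphere $\widehat{\mathbb C}=\mathbb C\cup\{\infty\}$, independent of the choice of $\eta$, with no atom at $\infty$. Weak convergence on $\widehat{\mathbb C}$ means convergence against continuous functions on $\widehat{\mathbb C}$. $D(a,r)$ is the open disk and $\operatorname{mult}_\zeta$ the multiplicity of a zero. *)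

theory Defs
  imports "HOL-Complex_Analysis.Complex_Analysis" "HOL-Probability.Probability"
    "HOL-Library.Landau_Symbols"
begin

abbreviation riemann_sphere :: "complex option topology" where
  "riemann_sphere \<equiv> Alexandroff_compactification euclidean"

definition borel_sphere :: "complex option measure" where
  "borel_sphere = sigma (topspace riemann_sphere) {U. openin riemann_sphere U}"

definition weakly_converges_on ::
    "'a topology \<Rightarrow> (nat \<Rightarrow> 'a measure) \<Rightarrow> 'a measure \<Rightarrow> bool" where
  "weakly_converges_on X M N \<longleftrightarrow>
     (\<forall>f :: 'a \<Rightarrow> complex. continuous_map X euclidean f \<longrightarrow>
        (\<lambda>n. \<integral>p. f p \<partial>M n) \<longlonglongrightarrow> (\<integral>p. f p \<partial>N))"

definition c_edge :: "nat \<Rightarrow> real" where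
  "c_edge m = (real (m + 1) / real m) ^ (m + 1)"

definition v_branch :: "nat \<Rightarrow> (complex \<Rightarrow> complex) \<Rightarrow> bool" where
  "v_branch m v \<longleftrightarrow>
     v holomorphic_on - complex_of_real ` {0..c_edge m} \<and>
     (\<forall>\<zeta>\<in>- complex_of_real ` {0..c_edge m}. v \<zeta> ^ (m + 1) = of_nat m * \<zeta> * (v \<zeta> - 1)) \<and>
     (\<lambda>\<zeta>. v \<zeta> - (1 + 1 / (of_nat m * \<zeta>))) \<in> O[at_infinity](\<lambda>\<zeta>. 1 / \<zeta>\<^sup>2)"

definition cauchy_transform :: "real measure \<Rightarrow> complex \<Rightarrow> complex" where
  "cauchy_transform M \<zeta> = (\<integral>x. 1 / (\<zeta> - complex_of_real x) \<partial>M)"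

text \<open>The underlying space of this measure is the interval from 0 to \<open>c_edge m\<close>,
  not the whole real line.\<close>

definition mu :: "nat \<Rightarrow> real measure" where
  "mu m = (THE M. prob_space M \<and> sets M = sets (restrict_space borel {0..c_edge m}) \<and>
     (\<exists>v. v_branch m v \<and>
        (\<forall>\<zeta>\<in>- complex_of_real ` {0..c_edge m}. cauchy_transform M \<zeta> = 1 - 1 / v \<zeta> ^ m)))"

definition root_map :: "nat \<Rightarrow> complex \<Rightarrow> nat \<Rightarrow> real \<Rightarrow> complex option" where
  "root_map m \<eta> \<nu> x =
     (if x = 0 then None
      else Some (exp (2 * of_real pi * \<i> * of_nat \<nu> / of_nat m) * \<eta> *
                 of_real (x powr (- 1 / real m))))"

definition mu_hat :: "nat \<Rightarrow> complex \<Rightarrow> complex option measure" where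
  "mu_hat m l =
     (let \<eta> = (SOME \<eta>. \<eta> ^ m = - l) in
      measure_of (space borel_sphere) (sets borel_sphere)
        (\<lambda>A. (\<Sum>\<nu><m. emeasure (distr (mu m) borel_sphere (root_map m \<eta> \<nu>)) A) / of_nat m))"

definition compactly_supported_continuous :: "(complex \<Rightarrow> complex) \<Rightarrow> bool" where
  "compactly_supported_continuous \<psi> \<longleftrightarrow>
     continuous_on UNIV \<psi> \<and> compact (closure {z. \<psi> z \<noteq> 0})"

definition essential_form ::
    "complex \<Rightarrow> nat \<Rightarrow> int \<Rightarrow> (nat \<Rightarrow> complex) \<Rightarrow> (complex \<Rightarrow> complex) \<Rightarrow> complex \<Rightarrow> complex" where
  "essential_form a m \<alpha> lam \<phi> z =
     (z - a) powi \<alpha> * exp (\<Sum>s = 1..m. lam s / (z - a) ^ s) * \<phi> z"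

definition admissible_radius ::
    "complex \<Rightarrow> nat \<Rightarrow> int \<Rightarrow> (nat \<Rightarrow> complex) \<Rightarrow> (complex \<Rightarrow> complex) \<Rightarrow>
     (complex \<Rightarrow> complex) \<Rightarrow> real \<Rightarrow> bool" where
  "admissible_radius a m \<alpha> lam \<phi> F r \<longleftrightarrow>
     r > 0 \<and>
     (\<forall>z. 0 < cmod (z - a) \<and> cmod (z - a) < r \<longrightarrow> F z = essential_form a m \<alpha> lam \<phi> z) \<and>
     (\<exists>U. open U \<and> cball a r \<subseteq> U \<and> \<phi> holomorphic_on U \<and> (\<forall>z\<in>U. \<phi> z \<noteq> 0))"

definition deriv_zeros :: "(complex \<Rightarrow> complex) \<Rightarrow> complex \<Rightarrow> nat \<Rightarrow> real \<Rightarrow> complex set" where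
  "deriv_zeros F a n r =
     {\<zeta>. (deriv ^^ n) F \<zeta> = 0 \<and> 0 < cmod (\<zeta> - a) \<and> cmod (\<zeta> - a) < r}"

definition rescale :: "nat \<Rightarrow> complex \<Rightarrow> nat \<Rightarrow> complex \<Rightarrow> complex" where
  "rescale m a n \<zeta> = of_real (real n powr (1 / real m)) * (\<zeta> - a)"

text \<open>At a zero of a holomorphic function that does not vanish identically nearby,
  \<^const>\<open>zorder\<close> is the multiplicity. For an admissible radius the set of zeros is finite,
  so that the convention for sums over infinite sets plays no role.\<close>

definition zero_sum ::
    "nat \<Rightarrow> (complex \<Rightarrow> complex) \<Rightarrow> complex \<Rightarrow> (complex \<Rightarrow> complex) \<Rightarrow> nat \<Rightarrow> real \<Rightarrow> complex" where
  "zero_sum m F a \<psi> n r =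
     1 / of_nat (m * n) *
     (\<Sum>\<zeta>\<in>deriv_zeros F a n r.
        of_int (zorder ((deriv ^^ n) F) \<zeta>) * \<psi> (rescale m a n \<zeta>))"

definition zero_mass :: "nat \<Rightarrow> (complex \<Rightarrow> complex) \<Rightarrow> complex \<Rightarrow> nat \<Rightarrow> real \<Rightarrow> real" where
  "zero_mass m F a n r =
     1 / real (m * n) * (\<Sum>\<zeta>\<in>deriv_zeros F a n r. of_int (zorder ((deriv ^^ n) F) \<zeta>))"

text \<open>The weighted sum of point masses at the rescaled zeros, as the push-forward of a
  weighted counting measure.\<close>

definition zero_measure ::
    "nat \<Rightarrow> (complex \<Rightarrow> complex) \<Rightarrow> complex \<Rightarrow> nat \<Rightarrow> real \<Rightarrow> complex option measure" where
  "zero_measure m F a n r =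
     distr
       (density (count_space (deriv_zeros F a n r))
          (\<lambda>\<zeta>. ennreal (of_int (zorder ((deriv ^^ n) F) \<zeta>) / real (m * n))))
       borel_sphere (\<lambda>\<zeta>. Some (rescale m a n \<zeta>))"

end

(* Put z = w / n^(1/m) with w = n^(1/m) (zeta - a). For the model function exp (lam m / z^m) / z the
   n-th derivative is, up to an elementary factor, a polynomial of degree n in lam m / z^m with real
   negative roots; their distribution after division by n is determined by the recurrence of the
   polynomials, whose logarithmic derivatives converge, and its limit is mu m. For a general function
   the Leibniz rule and Cauchy's estimates on discs of radius nearly |z| bound the normalised n-th
   derivative f_n by exp(o(n)) times the model polynomial p_n, locally uniformly off the arms carrying
   the roots. Since f_n and p_n are 1 at the origin, the three circle theorem makes this bound sharp
   near every point off the arms, so (1/n) (ln |f_n| - ln |p_n|) tends to 0 in L^1_loc, because the arms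
   are covered by discs of small total contribution. Averaging the logarithm over small annuli and
   discs turns this into convergence of the smeared zero counting measures. *)

theory Submission
  imports Defs
begin

text \<open>Write q_n for \<open>dpoly m n\<close> and Y = lam m / z^m. The factor 1/z in the model
  function gives q_n(0) = n! instead of 0, so all n roots are strictly negative and yield m n finite
  zeros in w. The obstacle is the upper bound. The Leibniz sum has terms n!/(n-k)! |q_(n-k)| /
  \<delta>^k, and it exceeds |q_n| by no more than exp(o(n)) only if |q_(k+1)(nY)| >= (1 - o(1))
  (k+1) |q_k(nY)| for all k < n. The quotient of consecutive values is expressed by a Cauchy
  transform of the root distribution, and its limit is large enough because the branch satisfies |v
  - 1| <= 1 off the cut. This inequality is where the special form of v enters. \<open>mu m\<close>
  is given only through its Cauchy transform, so its existence has to be proved as well: exp(Y)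
  q_n(Y) has explicit positive Taylor coefficients, their concentration yields the Stieltjes
  transform of the limit on the positive half-line, and moments yield uniqueness and the sharp
  support.\<close>

section \<open>The model polynomials: recursion, negative roots, a linear bound for the
  roots\<close>

primrec dpoly :: "nat => nat => 'a::field_char_0 poly" where
 "dpoly m 0 = 1"
| "dpoly m (Suc n) = smult (of_nat (Suc n)) (dpoly m n) +
  pCons 0 (smult (of_nat m) (dpoly m n + pderiv (dpoly m n)))"

lemma poly_dpoly_Suc:
 "poly (dpoly m (Suc n)) Y = (of_nat (Suc n) + of_nat m * Y) * poly (dpoly m n) Y +
  of_nat m * Y * poly (pderiv (dpoly m n)) Y"
 by (simp add: algebra_simps)

lemma coeff_dpoly_Suc:
 "coeff (dpoly m (Suc n)) k = of_nat (Suc n) * coeff (dpoly m n) k +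
  (case k of 0 => 0 | Suc j => of_nat m * (coeff (dpoly m n) j + of_nat (Suc j) * coeff (dpoly m n) (Suc j)))"
 by (cases k) (simp_all add: coeff_pderiv)

lemma degree_dpoly_le: "degree (dpoly m n :: 'a::field_char_0 poly) <= n"
proof (induction n)
 case (Suc n)
 have "degree (dpoly m n + pderiv (dpoly m n) :: 'a poly) <= n"
  using Suc order.trans[OF diff_le_self Suc] by (intro degree_add_le) (simp_all add: degree_pderiv)
 then show ?case using Suc
  by (auto intro!: degree_add_le order.trans[OF degree_pCons_le] order.trans[OF degree_smult_le])
qed simp

lemma lead_coeff_dpoly: "coeff (dpoly m n :: 'a::field_char_0 poly) n = of_nat m ^ n"
proof (induction n)
 case (Suc n)
 have "coeff (dpoly m n :: 'a poly) (Suc n) = 0"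
  using degree_dpoly_le[of m n] by (intro coeff_eq_0) (simp add: less_Suc_eq_le)
 with Suc show ?case unfolding coeff_dpoly_Suc by simp
qed simp

lemma poly_dpoly_0: "poly (dpoly m n) 0 = fact n"
 by (induction n) simp_all

lemma poly_sum_coeff_le:
 fixes p :: "'a::comm_ring_1 poly"
 assumes "degree p <= n"
 shows "poly p x = (\<Sum>k\<le>n. coeff p k * x ^ k)"
 unfolding poly_altdef using assms
 by (intro sum.mono_neutral_left) (auto simp: coeff_eq_0)

lemma dpoly_of_real:
 "poly (dpoly m n) (of_real y :: complex) = of_real (poly (dpoly m n) y)"
proof -
 have c: "coeff (dpoly m n :: complex poly) k = of_real (coeff (dpoly m n) k)" for k
 proof (induction n arbitrary: k)
  case (Suc n)
  then show ?case unfolding coeff_dpoly_Suc by (cases k) auto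
 qed (auto simp: coeff_1)
 have "poly (dpoly m n) (of_real y :: complex) = (\<Sum>k\<le>n. coeff (dpoly m n) k * of_real y ^ k)"
  by (rule poly_sum_coeff_le) (rule degree_dpoly_le)
 also have "... = of_real (\<Sum>k\<le>n. coeff (dpoly m n) k * y ^ k)" by (simp add: c)
 also have "(\<Sum>k\<le>n. coeff (dpoly m n) k * y ^ k) = poly (dpoly m n) y"
  by (rule poly_sum_coeff_le[symmetric]) (rule degree_dpoly_le)
 finally show ?thesis .
qed

text \<open>In the difference of the two sides the coefficient of index \<open>card A\<close>
  cancels, so a nonzero difference would have more roots than its degree.\<close>

lemma poly_eq_prod_roots:
 fixes p :: "'a::field poly"
 assumes fin: "finite A" and deg: "degree p <= card A" and roots: "!!a. a \<in> A ==> poly p a = 0"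
 shows "p = smult (coeff p (card A)) (\<Prod>a\<in>A. [:- a, 1:])"
proof (rule ccontr)
 let ?P = "\<Prod>a\<in>A. [:- a, 1:]"
 define d where "d = p - smult (coeff p (card A)) ?P"
 assume "\<not> ?thesis"
 then have d: "d ~= 0" by (simp add: d_def)
 have dP: "degree ?P = card A" by (subst degree_prod_eq_sum_degree) auto
 have "lead_coeff ?P = 1" by (simp add: lead_coeff_prod)
 then have cP: "coeff ?P (card A) = 1" by (simp add: dP)
 have "degree d <= card A"
  unfolding d_def by (intro degree_diff_le deg order.trans[OF degree_smult_le]) (simp add: dP)
 moreover have "coeff d (card A) = 0" by (simp add: d_def cP)
 ultimately have "degree d < card A" using d
  by (metis leading_coeff_0_iff order_le_less)
 have "A <= {x. poly d x = 0}"
  using roots fin by (auto simp: d_def poly_prod)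
 then have "card A <= card {x. poly d x = 0}" using poly_roots_finite[OF d] by (rule card_mono[rotated])
 also have "... <= degree d" by (rule card_poly_roots_bound) fact
 finally show False using \<open>degree d < card A\<close> by simp
qed

text \<open>Interlacing. At a root y < 0 of q_n the recursion leaves only m y q_n'(y), whose sign
  alternates along the roots. Together with the signs far to the left and at 0, where the value is
  (n+1)!, this gives n + 1 sign changes on the negative axis.\<close>

lemma dpoly_neg_roots:
 assumes m: "m >= 1"
 shows "\<exists>y::nat => real. (\<forall>i<n. y i < 0) & (\<forall>i j. i < j --> j < n --> y i < y j) \<and>
  (dpoly m n :: real poly) = smult (real m ^ n) (\<Prod>i<n. [:- y i, 1:])"
proof (induction n)
 case (Suc n)
 then obtain y :: "nat => real" where neg: "!!i. i < n ==> y i < 0"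
  and inc: "!!i j. i < j ==> j < n ==> y i < y j"
  and q: "(dpoly m n :: real poly) = smult (real m ^ n) (\<Prod>i<n. [:- y i, 1:])" by blast
 let ?q = "dpoly m (Suc n) :: real poly"
 have sgn_y: "(-1) ^ (n - i) * poly ?q (y i) > 0" if i: "i < n" for i
 proof -
  have q0: "poly (dpoly m n) (y i) = 0" using i by (auto simp: q poly_prod)
  have "poly (pderiv (dpoly m n)) (y i) = real m ^ n * (\<Sum>a<n. (\<Prod>j\<in>{..<n} - {a}. y i - y j))"
   by (simp add: q pderiv_smult pderiv_prod poly_sum poly_prod pderiv_pCons)
  also have "(\<Sum>a<n. (\<Prod>j\<in>{..<n} - {a}. y i - y j)) = (\<Sum>a\<in>{i}. (\<Prod>j\<in>{..<n} - {a}. y i - y j))"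
   using i by (intro sum.mono_neutral_right) auto
  also have "... = (\<Prod>j\<in>{..<i} \<union> {i<..<n}. y i - y j)"
   using i by (auto intro!: prod.cong)
  also have "... = (\<Prod>j<i. y i - y j) * (\<Prod>j\<in>{i<..<n}. y i - y j)"
   by (rule prod.union_disjoint) auto
  also have "(\<Prod>j\<in>{i<..<n}. y i - y j) = (\<Prod>j\<in>{i<..<n}. (-1) * (y j - y i))" by simp
  also have "... = (-1) ^ (n - Suc i) * (\<Prod>j\<in>{i<..<n}. y j - y i)"
   by (subst prod.distrib) simp
  finally have d: "poly (pderiv (dpoly m n)) (y i) = (-1) ^ (n - Suc i) *
    (real m ^ n * (\<Prod>j<i. y i - y j) * (\<Prod>j\<in>{i<..<n}. y j - y i))" by simp
  have pos: "real m ^ n * (\<Prod>j<i. y i - y j) * (\<Prod>j\<in>{i<..<n}. y j - y i) > 0"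
   using m i by (intro mult_pos_pos prod_pos) (auto simp: inc)
  have e: "(-1::real) ^ (n - i) = - ((-1) ^ (n - Suc i))"
   using i by (metis Suc_diff_Suc mult_minus1 power_Suc)
  have "(-1) ^ (n - i) * poly ?q (y i) = real m * (- y i) * ((-1) ^ (n - Suc i) * (-1) ^ (n - Suc i)) *
   (real m ^ n * (\<Prod>j<i. y i - y j) * (\<Prod>j\<in>{i<..<n}. y j - y i))"
   unfolding poly_dpoly_Suc q0 d e by simp
  also have "((-1::real) ^ (n - Suc i) * (-1) ^ (n - Suc i)) = 1"
   by (simp flip: power_mult_distrib)
  also have "real m * (- y i) * 1 * (real m ^ n * (\<Prod>j<i. y i - y j) * (\<Prod>j\<in>{i<..<n}. y j - y i)) > 0"
   using m neg[OF i] by (intro mult_pos_pos pos) auto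
  finally show ?thesis .
 qed
 have degq: "degree ?q = Suc n"
 proof (rule antisym[OF degree_dpoly_le le_degree])
  show "coeff ?q (Suc n) ~= 0" using m unfolding lead_coeff_dpoly by simp
 qed
 \<comment> \<open>Reflection and a sign make the leading coefficient positive, so growth at plus
   infinity gives the sign of the polynomial far to the left.\<close>
 define r where "r = smult ((-1) ^ Suc n) (pcompose ?q [:0, -1:])"
 have "lead_coeff (pcompose ?q [:0, -1:]) = lead_coeff ?q * (-1) ^ Suc n"
  by (subst lead_coeff_comp) (simp_all add: degq del: dpoly.simps)
 then have "lead_coeff r = lead_coeff ?q"
  unfolding r_def lead_coeff_smult by (simp add: power_mult_distrib[symmetric] del: dpoly.simps power_Suc)
 also have "... > 0" using m by (simp only: degq lead_coeff_dpoly) simp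
 finally have lr: "lead_coeff r > 0" .
 from poly_pinfty_gt_lc[OF this] obtain B where B: "!!x. x >= B ==> poly r x >= lead_coeff r" by blast
 define low where "low = - Max (insert (B + 1) (insert 1 ((%i. 1 - y i) ` {..<n})))"
 have low1: "- low >= B + 1" "-low >= 1"
  unfolding low_def minus_minus by (rule Max_ge; simp)+
 have low2: "low < y i" if "i < n" for i
 proof -
  have "1 - y i <= - low" unfolding low_def minus_minus by (rule Max_ge) (use that in auto)
  then show ?thesis by simp
 qed
 have "poly r (- low) > 0" using B[of "-low"] low1 lr by simp
 then have sgn_low: "(-1) ^ Suc n * poly ?q low > 0"
  by (simp add: r_def poly_pcompose del: dpoly.simps)
 \<comment> \<open>The n + 2 test points: \<open>low\<close>, the old roots and 0. A new root lies
   between any two neighbours.\<close>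
 define z where "z i = (if i = 0 then low else if i <= n then y (i - 1) else 0)" for i
 have sgn_z: "(-1) ^ (Suc n - i) * poly ?q (z i) > 0" if i: "i <= Suc n" for i
 proof -
  consider "i = 0" | "0 < i" "i <= n" | "i = Suc n" using i by linarith
  then show ?thesis
  proof cases
   case 2
   then show ?thesis using sgn_y[of "i - 1"] by (simp add: z_def Suc_diff_le del: dpoly.simps)
  qed (use sgn_low in \<open>simp_all add: z_def poly_dpoly_0 del: dpoly.simps\<close>)
 qed
 have z_inc: "z i < z (Suc i)" if "i <= n" for i
  using that low1 low2 neg inc by (auto simp: z_def)
 have "\<exists>x>z i. x < z (Suc i) & poly ?q x = 0" if "i <= n" for i
 proof (rule poly_IVT[OF z_inc[OF that]])
  have "((-1) ^ (Suc n - i) * poly ?q (z i)) * ((-1) ^ (Suc n - Suc i) * poly ?q (z (Suc i))) > 0"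
   by (rule mult_pos_pos[OF sgn_z sgn_z]) (use that in auto)
  moreover have "(-1::real) ^ (Suc n - i) * (-1) ^ (Suc n - Suc i) = -1"
  proof -
   have "(-1::real) ^ (Suc n - i) = - ((-1) ^ (n - i))" using that by (simp add: Suc_diff_le)
   then show ?thesis by (simp flip: power_mult_distrib)
  qed
  moreover have "((-1) ^ (Suc n - i) * poly ?q (z i)) * ((-1) ^ (Suc n - Suc i) * poly ?q (z (Suc i))) =
    ((-1) ^ (Suc n - i) * (-1) ^ (Suc n - Suc i)) * (poly ?q (z i) * poly ?q (z (Suc i)))"
   by (simp only: ac_simps)
  ultimately have "(-1) * (poly ?q (z i) * poly ?q (z (Suc i))) > 0" by metis
  then show "poly ?q (z i) * poly ?q (z (Suc i)) < 0" by (simp only: mult_minus1 neg_0_less_iff_less)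
 qed
 then obtain x where x: "!!i. i <= n ==> z i < x i" "!!i. i <= n ==> x i < z (Suc i)"
  "!!i. i <= n ==> poly ?q (x i) = 0" by metis
 have z_mono: "z i <= z j" if "i <= j" "j <= Suc n" for i j
  using that
 proof (induction j)
  case (Suc j)
  then show ?case using z_inc[of j] by (cases "i = Suc j") auto
 qed simp
 have x_inc: "x i < x j" if "i < j" "j < Suc n" for i j
  using x(2)[of i] x(1)[of j] z_mono[of "Suc i" j] that by force
 have x_neg: "x i < 0" if "i < Suc n" for i
  using x(2)[of i] z_mono[of "Suc i" "Suc n"] that by (auto simp: z_def)
 have inj: "inj_on x {..<Suc n}"
  by (rule linorder_inj_onI) (use x_inc in \<open>auto simp: less_imp_neq\<close>)
 then have card: "card (x ` {..<Suc n}) = Suc n" by (simp add: card_image)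
 have "?q = smult (coeff ?q (Suc n)) (\<Prod>a\<in>x ` {..<Suc n}. [:- a, 1:])"
 proof (rule poly_eq_prod_roots[of "x ` {..<Suc n}" ?q, unfolded card])
  show "poly ?q a = 0" if "a \<in> x ` {..<Suc n}" for a
   using that x(3) by (metis imageE lessThan_iff less_Suc_eq_le)
 qed (use degq in \<open>simp_all only: finite_imageI finite_lessThan order_refl\<close>)
 also have "(\<Prod>a\<in>x ` {..<Suc n}. [:- a, 1:]) = (\<Prod>i<Suc n. [:- x i, 1:])"
  by (simp add: prod.reindex[OF inj] o_def del: lessThan_Suc)
 finally show ?case unfolding lead_coeff_dpoly using x_neg x_inc by blast
qed simp

text \<open>Coefficient extraction from the generating function
 \<open>\<Sum>n. dpoly m n / n! * h^n = exp (Y * ((1 - h)^(-m) - 1)) / (1 - h)\<close>.\<close>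

lemma dpoly_recurrence:
 fixes Y :: "'a::field_char_0"
 shows "poly (dpoly m (Suc n)) Y =
  (\<Sum>i\<le>n. fact n / fact (n - i) * (1 + of_nat m * Y * of_nat ((m + i) choose i)) * poly (dpoly m (n - i)) Y)"
proof -
 define q where "q n = (dpoly m n :: 'a poly)" for n
 define a where "a i = [:1, of_nat m * of_nat ((m + i) choose i) :: 'a:]" for i
 define D where "D p = pCons 0 (smult (of_nat m) (p + pderiv p))" for p :: "'a poly"
 have q_Suc: "q (Suc n) = smult (of_nat (Suc n)) (q n) + D (q n)" for n
  by (simp add: q_def D_def)
 have D_add: "D (p + r) = D p + D r" and D_smult: "D (smult c p) = smult c (D p)" for p r c
  by (simp_all add: D_def pderiv_add pderiv_smult algebra_simps smult_add_right)
 have D_sum: "D (sum f A) = (\<Sum>x\<in>A. D (f x))" if "finite A" for f and A :: "nat set"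
  using that by induction (simp_all add: D_add, simp add: D_def)
 have smult_sumR: "smult c (sum f A) = (\<Sum>x\<in>A. smult c (f x))" for c :: 'a and f and A :: "nat set"
  by (induction A rule: infinite_finite_induct) (simp_all add: smult_add_right)
 \<comment> \<open>\<open>a i\<close> has the form 1 + c Y, so Y times its derivative is
   \<open>a i - 1\<close>.\<close>
 have D_a: "D (a i * p) = a i * D p + smult (of_nat m) ((a i - 1) * p)" for i p
  unfolding D_def a_def
  by (simp add: pderiv_mult pderiv_add pderiv_smult pderiv_pCons algebra_simps smult_add_right one_pCons)
 have a_Suc: "smult (of_nat (Suc i)) (a (Suc i)) = smult (of_nat (m + Suc i)) (a i) - [:of_nat m:]" for i
 proof -
  have "Suc i * ((m + Suc i) choose Suc i) = (m + Suc i) * ((m + i) choose i)"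
   using Suc_times_binomial_eq[of "m + i" i] by simp
  then have "of_nat (Suc i) * of_nat ((m + Suc i) choose Suc i) = of_nat (m + Suc i) * (of_nat ((m + i) choose i) :: 'a)"
   by (metis of_nat_mult)
  then show ?thesis unfolding a_def by (simp add: algebra_simps)
 qed
 have main: "q (Suc n) = (\<Sum>i\<le>n. smult (fact n / fact (n - i)) (a i * q (n - i)))" for n
 proof (induction n)
  case 0
  show ?case by (simp add: q_def a_def one_pCons)
 next
  case (Suc n)
  let ?c = "%i. fact n / fact (n - i) :: 'a"
  have "q (Suc (Suc n)) = smult (of_nat (Suc (Suc n))) (q (Suc n)) + D (q (Suc n))" by (rule q_Suc)
  also have "D (q (Suc n)) = (\<Sum>i\<le>n. smult (?c i) (D (a i * q (n - i))))"
   by (subst Suc.IH) (simp add: D_sum D_smult)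
  also have "smult (of_nat (Suc (Suc n))) (q (Suc n)) = (\<Sum>i\<le>n. smult (?c i) (smult (of_nat (Suc (Suc n))) (a i * q (n - i))))"
   by (subst Suc.IH) (simp add: smult_sumR mult.commute)
  also have "... + (\<Sum>i\<le>n. smult (?c i) (D (a i * q (n - i)))) =
   (\<Sum>i\<le>n. smult (?c i) (smult (of_nat (Suc (Suc n))) (a i * q (n - i)) + D (a i * q (n - i))))"
   by (simp add: smult_add_right sum.distrib)
  \<comment> \<open>The factor n + 2 is split as (n - i + 1) + (i + 1): the first summand advances q
    by one index, the second advances \<open>a\<close>. After an index shift the two sums carry the
    weights n + 1 - i and i, which add up to n + 1.\<close>
  also have "... = (\<Sum>i\<le>n. smult (?c i) (a i * q (Suc n - i) + smult (of_nat (Suc i)) (a (Suc i)) * q (n - i)))"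
  proof (rule sum.cong[OF refl])
   fix i assume i: "i \<in> {..n}"
   have 1: "q (Suc n - i) = smult (of_nat (Suc (n - i))) (q (n - i)) + D (q (n - i))"
    using i q_Suc[of "n - i"] by (simp add: Suc_diff_le)
   have 2: "of_nat (Suc (Suc n)) = (of_nat (Suc (n - i)) + of_nat (Suc i) :: 'a)"
    using i by (simp flip: of_nat_add)
   show "smult (?c i) (smult (of_nat (Suc (Suc n))) (a i * q (n - i)) + D (a i * q (n - i))) =
    smult (?c i) (a i * q (Suc n - i) + smult (of_nat (Suc i)) (a (Suc i)) * q (n - i))"
    unfolding 1 2 a_Suc D_a
    by (rule arg_cong[where f = "smult (?c i)"]) (simp add: algebra_simps smult_add_left smult_add_right smult_diff_right one_pCons numeral_poly)
  qed
  also have "... = (\<Sum>i\<le>n. smult (?c i) (a i * q (Suc n - i))) + (\<Sum>i\<le>n. smult (?c i) (smult (of_nat (Suc i)) (a (Suc i)) * q (n - i)))"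
   by (simp add: smult_add_right sum.distrib)
  also have "(\<Sum>i\<le>n. smult (?c i) (smult (of_nat (Suc i)) (a (Suc i)) * q (n - i))) =
   (\<Sum>i\<le>n. smult (of_nat (Suc i) * fact n / fact (Suc n - Suc i)) (a (Suc i) * q (Suc n - Suc i)))"
   by (simp add: mult.commute)
  also have "... = (\<Sum>i=1..Suc n. smult (of_nat i * fact n / fact (Suc n - i)) (a i * q (Suc n - i)))"
   by (rule sum.reindex_bij_witness[of _ "%i. i - 1" Suc]) auto
  also have "... = (\<Sum>i\<le>Suc n. smult (of_nat i * fact n / fact (Suc n - i)) (a i * q (Suc n - i)))"
   by (rule sum.mono_neutral_left) (auto simp: not_le)
  also have "(\<Sum>i\<le>n. smult (?c i) (a i * q (Suc n - i))) =
   (\<Sum>i\<le>Suc n. smult (of_nat (Suc n - i) * fact n / fact (Suc n - i)) (a i * q (Suc n - i)))"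
  proof -
   have "?c i = of_nat (Suc n - i) * fact n / fact (Suc n - i)" if "i <= n" for i
    using that by (simp add: Suc_diff_le del: of_nat_Suc)
   then show ?thesis by simp
  qed
  also have "... + (\<Sum>i\<le>Suc n. smult (of_nat i * fact n / fact (Suc n - i)) (a i * q (Suc n - i))) =
   (\<Sum>i\<le>Suc n. smult (fact (Suc n) / fact (Suc n - i)) (a i * q (Suc n - i)))"
  proof -
   have "of_nat (Suc n - i) * fact n / fact (Suc n - i) + of_nat i * fact n / fact (Suc n - i) = (fact (Suc n) / fact (Suc n - i) :: 'a)"
    if "i <= Suc n" for i
   proof -
    have "of_nat (Suc n - i) + of_nat i = (of_nat (Suc n) :: 'a)" using that by (simp flip: of_nat_add)
    then show ?thesis by (metis add_divide_distrib distrib_right fact_Suc)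
   qed
   then show ?thesis
    unfolding sum.distrib[symmetric] smult_add_left[symmetric] by (intro sum.cong refl) (simp only: atMost_iff)
  qed
  finally show ?case .
 qed
 show ?thesis using arg_cong[OF main[of n], of "%p. poly p Y"]
  by (simp add: q_def a_def poly_sum mult.assoc del: dpoly.simps) (simp add: algebra_simps)
qed

lemma pderiv_prod_linear:
 fixes x :: "nat => 'a::field_char_0"
 assumes q: "q = smult c (\<Prod>j<n. [:x j, 1:])" and nz: "!!j. j < n ==> Y + x j ~= 0"
 shows "poly (pderiv q) Y = poly q Y * (\<Sum>j<n. 1 / (Y + x j))"
proof -
 have "poly (pderiv q) Y = c * (\<Sum>a<n. \<Prod>j\<in>{..<n} - {a}. x j + Y)"
  by (simp add: q pderiv_smult pderiv_prod poly_sum poly_prod pderiv_pCons)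
 also have "(\<Sum>a<n. \<Prod>j\<in>{..<n} - {a}. x j + Y) = (\<Sum>a<n. (\<Prod>j<n. x j + Y) * (1 / (Y + x a)))"
 proof (rule sum.cong[OF refl])
  fix a assume "a \<in> {..<n}"
  then show "(\<Prod>j\<in>{..<n} - {a}. x j + Y) = (\<Prod>j<n. x j + Y) * (1 / (Y + x a))"
   using nz[of a] by (subst prod.remove[of "{..<n}" a]) (auto simp: field_simps)
 qed
 also have "c * ... = poly q Y * (\<Sum>j<n. 1 / (Y + x j))"
  by (simp add: q poly_prod sum_distrib_left)
 finally show ?thesis .
qed

text \<open>These are the negatives of the roots, chosen all at once for each degree.\<close>

definition droot :: "nat => nat => nat => real" where
 "droot m n = (SOME x. (\<forall>j<n. x j > 0) \<and>
  (dpoly m n :: real poly) = smult (real m ^ n) (\<Prod>j<n. [:x j, 1:]))"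

lemma droot:
 assumes "m >= 1"
 shows droot_pos: "j < n ==> droot m n j > 0"
  and dpoly_real_eq: "(dpoly m n :: real poly) = smult (real m ^ n) (\<Prod>j<n. [:droot m n j, 1:])"
proof -
 from dpoly_neg_roots[OF assms, of n] obtain y where "\<forall>i<n. y i < 0"
  "(dpoly m n :: real poly) = smult (real m ^ n) (\<Prod>i<n. [:- y i, 1:])" by blast
 then have "\<exists>x. (\<forall>j<n. x j > 0) \<and>
  (dpoly m n :: real poly) = smult (real m ^ n) (\<Prod>j<n. [:x j, 1:])"
  by (intro exI[of _ "%j. - y j"]) simp
 from someI_ex[OF this, folded droot_def] show "j < n ==> droot m n j > 0"
  "(dpoly m n :: real poly) = smult (real m ^ n) (\<Prod>j<n. [:droot m n j, 1:])" by auto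
qed

lemma poly_dpoly_real:
 assumes "m >= 1"
 shows "poly (dpoly m n) (y :: real) = real m ^ n * (\<Prod>j<n. y + droot m n j)"
 by (subst dpoly_real_eq[OF assms]) (simp add: poly_prod add.commute)

text \<open>Both sides agree at all real points, and a nonzero polynomial has only finitely many
  roots.\<close>

lemma dpoly_complex_eq:
 assumes "m >= 1"
 shows "(dpoly m n :: complex poly) = smult (of_nat m ^ n) (\<Prod>j<n. [:of_real (droot m n j), 1:])"
  (is "_ = ?r")
proof (rule ccontr)
 assume "dpoly m n ~= ?r"
 then have "finite {x. poly (dpoly m n - ?r) x = 0}" by (intro poly_roots_finite) simp
 moreover have "range complex_of_real <= {x. poly (dpoly m n - ?r) x = 0}"
  by (auto simp: dpoly_of_real poly_dpoly_real[OF assms] poly_prod add.commute)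
 ultimately have "finite (range complex_of_real)" by (rule finite_subset[rotated])
 then show False by (metis finite_imageD infinite_UNIV_char_0 inj_of_real)
qed

lemma poly_dpoly_complex:
 assumes "m >= 1"
 shows "poly (dpoly m n) (Y :: complex) = of_nat m ^ n * (\<Prod>j<n. Y + of_real (droot m n j))"
 by (subst dpoly_complex_eq[OF assms]) (simp add: poly_prod add.commute)

text \<open>After scaling, the sum over the roots becomes a Cauchy transform of their empirical
  distribution. This is how weak convergence of the roots controls the quotient of consecutive
  polynomials.\<close>

lemma dpoly_ratio:
 fixes Y :: complex
 assumes "m >= 1" and nz: "!!j. j < n ==> Y + of_real (droot m n j) ~= 0"
 shows "poly (dpoly m (Suc n)) Y =
  (of_nat (Suc n) + of_nat m * Y * (1 + (\<Sum>j<n. 1 / (Y + of_real (droot m n j))))) * poly (dpoly m n) Y"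
proof -
 have "poly (pderiv (dpoly m n)) Y = poly (dpoly m n) Y * (\<Sum>j<n. 1 / (Y + of_real (droot m n j)))"
  by (rule pderiv_prod_linear[OF dpoly_complex_eq[OF assms(1)] nz])
 then show ?thesis unfolding poly_dpoly_Suc by (simp add: algebra_simps)
qed

lemma dpoly_pos: "m >= 1 ==> y >= 0 ==> poly (dpoly m n) (y::real) > 0"
 by (subst poly_dpoly_real) (auto intro!: mult_pos_pos prod_pos add_nonneg_pos simp: droot_pos)

lemma norm_dpoly_le:
 assumes "m >= 1"
 shows "cmod (poly (dpoly m n) Y) <= poly (dpoly m n) (cmod Y)"
proof -
 have "cmod (Y + of_real (droot m n j)) <= cmod Y + droot m n j" if "j < n" for j
  using norm_triangle_ineq[of Y "of_real (droot m n j)"] droot_pos[OF assms that] by simp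
 then show ?thesis using assms
  by (auto simp: poly_dpoly_complex poly_dpoly_real norm_mult norm_power prod_norm[symmetric]
    intro!: mult_left_mono prod_mono)
qed

text \<open>On the positive axis all terms of the recursion are nonnegative, so growth holds without
  asymptotics. Combined with \<open>norm_dpoly_le\<close> this suffices for the exponential bound in
  \<open>crude\<close>.\<close>

lemma dpoly_Suc_ge:
 assumes "m >= 1" "y >= (0::real)"
 shows "real (Suc n) * poly (dpoly m n) y <= poly (dpoly m (Suc n)) y"
proof -
 have "poly (pderiv (dpoly m n)) y = poly (dpoly m n) y * (\<Sum>j<n. 1 / (y + droot m n j))"
  using droot_pos[OF assms(1), of _ n] assms(2)
  by (intro pderiv_prod_linear[OF dpoly_real_eq[OF assms(1)]]) (force simp: add_nonneg_eq_0_iff)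
 moreover have "(\<Sum>j<n. 1 / (y + droot m n j)) >= 0"
  using droot_pos[OF assms(1), of _ n] assms(2) by (intro sum_nonneg) (auto intro!: add_nonneg_nonneg simp: less_imp_le)
 ultimately have "poly (pderiv (dpoly m n)) y >= 0" using dpoly_pos[OF assms, of n] by simp
 then show ?thesis unfolding poly_dpoly_Suc using assms dpoly_pos[OF assms, of n]
  by (simp add: algebra_simps)
qed

lemma fact_ratio_le_power:
 assumes "i <= n" shows "fact n / fact (n - i) <= (real n ^ i)"
 using assms
proof (induction i)
 case (Suc i)
 have "fact n / fact (n - Suc i) = (fact n / fact (n - i)) * real (n - i)"
  using Suc.prems by (subst fact_reduce[of "n - i"]) (simp_all add: of_nat_diff)
 also have "... <= real n ^ i * real n" using Suc by (intro mult_mono) auto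
 finally show ?case by (simp add: mult.commute)
qed simp

text \<open>In \<open>dpoly_recurrence\<close> the term i = 0 is about m Y q_n. By induction each
  step down gains a factor L, while the coefficients grow at most like (2 N)^i; for |Y| beyond a
  large multiple of N the remaining terms form a small geometric series.\<close>

lemma dpoly_growth:
 fixes Y :: real
 assumes m: "m >= 1" and N: "N >= 1" and Y: "\<bar>Y\<bar> >= 2 ^ (m + 6) * real N" and n: "n < N"
 shows "\<bar>poly (dpoly m (Suc n)) Y\<bar> >= real m * \<bar>Y\<bar> / 2 * \<bar>poly (dpoly m n) Y\<bar>"
 using n
proof (induction n rule: less_induct)
 case (less n)
 let ?q = "%n. poly (dpoly m n) Y"
 define L where "L = real m * \<bar>Y\<bar> / 2"
 have "(2::real) ^ (m + 6) * real N >= 64 * 1"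
  using N by (intro mult_mono) (auto simp: power_add)
 with Y have "\<bar>Y\<bar> >= 64" by simp
 moreover have mY: "real m * \<bar>Y\<bar> >= \<bar>Y\<bar>" using m by (simp add: mult_le_cancel_right1)
 ultimately have L32: "L >= 32" by (simp add: L_def)
 have "2 ^ (m + 6) * real N <= real m * \<bar>Y\<bar>" using Y mY by linarith
 \<comment> \<open>The exponent m + 4 pays for the factor 2^(m+2) in the bound for \<open>T\<close>
   and for the factor 2 of the geometric series, and still leaves 1/2.\<close>
 then have e: "2 * real N / L <= 1 / 2 ^ (m + 4)"
  using L32 by (simp add: L_def field_simps power_add)
 have down: "\<bar>?q (n - i)\<bar> <= \<bar>?q n\<bar> / L ^ i" if "i <= n" for i
  using that
 proof (induction i)
  case (Suc i)
  have "L * \<bar>?q (n - Suc i)\<bar> <= \<bar>?q (Suc (n - Suc i))\<bar>"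
   using less.IH[of "n - Suc i"] less.prems Suc.prems unfolding L_def by simp
  also have "Suc (n - Suc i) = n - i" using Suc.prems by simp
  also have "\<bar>?q (n - i)\<bar> <= \<bar>?q n\<bar> / L ^ i" using Suc by simp
  finally show ?case using L32 by (simp add: field_simps)
 qed simp
 define T where "T i = fact n / fact (n - i) * (1 + real m * Y * real ((m + i) choose i)) * ?q (n - i)" for i
 have T: "\<bar>T i\<bar> <= (L * 2 ^ (m + 2) * \<bar>?q n\<bar>) * (2 * real N / L) ^ i" if "i <= n" for i
 proof -
  have "(m + i) choose i <= 2 ^ (m + i)" by (rule binomial_le_pow2)
  then have "real ((m + i) choose i) <= 2 ^ (m + i)"
   by (metis of_nat_le_iff of_nat_numeral of_nat_power)
  then have "\<bar>1 + real m * Y * real ((m + i) choose i)\<bar> <= 1 + real m * \<bar>Y\<bar> * 2 ^ (m + i)"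
   by (intro order.trans[OF abs_triangle_ineq]) (auto simp: abs_mult intro!: mult_left_mono)
  also have "... <= 2 * L * 2 ^ (m + i) + 2 * L * 2 ^ (m + i)"
  proof -
   have "1 * 1 <= 2 * L * 2 ^ (m + i)" using L32 by (intro mult_mono) auto
   then show ?thesis by (simp add: L_def mult_ac)
  qed
  also have "... = L * 2 ^ (m + 2) * 2 ^ i" by (simp add: power_add)
  finally have 1: "\<bar>1 + real m * Y * real ((m + i) choose i)\<bar> <= L * 2 ^ (m + 2) * 2 ^ i" .
  have 2: "fact n / fact (n - i) <= real N ^ i"
   using fact_ratio_le_power[OF that] power_mono[of "real n" "real N" i] less.prems by simp
  have "\<bar>T i\<bar> = fact n / fact (n - i) * \<bar>1 + real m * Y * real ((m + i) choose i)\<bar> * \<bar>?q (n - i)\<bar>"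
   by (simp add: T_def abs_mult)
  also have "... <= real N ^ i * (L * 2 ^ (m + 2) * 2 ^ i) * (\<bar>?q n\<bar> / L ^ i)"
   using 1 2 down[OF that] L32 by (intro mult_mono) auto
  also have "... = (L * 2 ^ (m + 2) * \<bar>?q n\<bar>) * (2 * real N / L) ^ i"
   by (simp add: power_mult_distrib power_divide)
  finally show ?thesis .
 qed
 let ?e = "1 / 2 ^ (m + 4) :: real"
 have "?e <= 1 / 2 ^ 1" by (intro divide_left_mono power_increasing) auto
 then have e2: "?e <= 1 / 2" by simp
 have geo: "(\<Sum>i=1..n. ?e ^ i) <= 2 * ?e"
 proof -
  have "(\<Sum>i<n. ?e ^ i) <= 1 / (1 - ?e)"
   using e2 by (subst sum_gp_strict) (auto intro!: divide_right_mono)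
  also have "1 / (1 - ?e) <= 2" using e2 by (simp add: field_simps)
  finally have "?e * (\<Sum>i<n. ?e ^ i) <= ?e * 2" by (rule mult_left_mono) simp
  moreover have "(\<Sum>i=1..n. ?e ^ i) = (\<Sum>i<n. ?e ^ Suc i)"
   by (rule sum.reindex_bij_witness[of _ Suc "%i. i - 1"]) auto
  ultimately show ?thesis by (simp add: sum_distrib_left)
 qed
 have "\<bar>\<Sum>i=1..n. T i\<bar> <= (\<Sum>i=1..n. (L * 2 ^ (m + 2) * \<bar>?q n\<bar>) * ?e ^ i)"
 proof (rule order.trans[OF sum_abs sum_mono])
  fix i assume "i \<in> {1..n}"
  then have "\<bar>T i\<bar> <= (L * 2 ^ (m + 2) * \<bar>?q n\<bar>) * (2 * real N / L) ^ i" using T by simp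
  also have "... <= (L * 2 ^ (m + 2) * \<bar>?q n\<bar>) * ?e ^ i"
   using L32 e by (intro mult_left_mono power_mono) auto
  finally show "\<bar>T i\<bar> <= (L * 2 ^ (m + 2) * \<bar>?q n\<bar>) * ?e ^ i" .
 qed
 also have "... = (L * 2 ^ (m + 2) * \<bar>?q n\<bar>) * (\<Sum>i=1..n. ?e ^ i)" by (simp add: sum_distrib_left)
 also have "... <= (L * 2 ^ (m + 2) * \<bar>?q n\<bar>) * (2 * ?e)"
  using geo L32 by (intro mult_left_mono) auto
 also have "... = L * \<bar>?q n\<bar> / 2" by (simp add: power_add field_simps)
 finally have rest: "\<bar>\<Sum>i=1..n. T i\<bar> <= L * \<bar>?q n\<bar> / 2" .
 have T0: "T 0 = (1 + real m * Y) * ?q n" by (simp add: T_def)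
 have "\<bar>1 + real m * Y\<bar> >= 2 * L - 1"
  using abs_triangle_ineq2[of "real m * Y" "-1"] by (simp add: L_def abs_mult add.commute)
 then have "\<bar>1 + real m * Y\<bar> >= 3 / 2 * L" using L32 by simp
 then have "\<bar>T 0\<bar> >= 3 / 2 * L * \<bar>?q n\<bar>" unfolding T0 abs_mult by (rule mult_right_mono) simp
 moreover have "?q (Suc n) = T 0 + (\<Sum>i=1..n. T i)"
  unfolding dpoly_recurrence T_def[symmetric]
  by (simp add: atMost_atLeast0 sum.atLeast_Suc_atMost)
 ultimately show ?case using rest unfolding L_def[symmetric] by linarith
qed

text \<open>At a fixed Y beyond the bound, growth carries nonvanishing from q_0 = 1 up to q_n. The
  constant is far from sharp; it confines the scaled roots of all degrees to one compact
  interval.\<close>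

lemma droot_le:
 assumes m: "m >= 1" and j: "j < n"
 shows "droot m n j <= 2 ^ (m + 6) * real n"
proof (rule ccontr)
 assume neg: "\<not> ?thesis"
 define Y where "Y = - droot m n j"
 have Y: "\<bar>Y\<bar> >= 2 ^ (m + 6) * real n" "Y ~= 0"
  using neg droot_pos[OF m j] by (auto simp: Y_def)
 have "poly (dpoly m k) Y ~= 0" if "k <= n" for k
  using that
 proof (induction k)
  case (Suc k)
  have "\<bar>poly (dpoly m (Suc k)) Y\<bar> >= real m * \<bar>Y\<bar> / 2 * \<bar>poly (dpoly m k) Y\<bar>"
   using Suc Y m by (intro dpoly_growth[where N = n]) auto
  moreover have "real m * \<bar>Y\<bar> / 2 * \<bar>poly (dpoly m k) Y\<bar> > 0" using Suc Y m by simp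
  ultimately show ?case by fastforce
 qed simp
 moreover have "poly (dpoly m n) Y = 0"
  using j m by (auto simp: poly_dpoly_real Y_def intro!: bexI[of _ j])
 ultimately show False by blast
qed

subsection \<open>Asymptotics on the positive half-line\<close>

text \<open>The Taylor coefficients of exp Y * q_n(Y): differentiating z^(-mk-1) n times produces
  the Pochhammer symbol of m k + 1.\<close>

definition dcoef :: "nat => nat => nat => real" where
 "dcoef m n k = pochhammer (real (m * k + 1)) n / fact k"

text \<open>After multiplication by exp Y the recursion is the operator (n+1) + m Y d/dY, which
  multiplies the k-th coefficient by n + 1 + m k and so extends the Pochhammer product by one
  factor.\<close>

lemma dcoef_series:
 shows "(\<forall>Y. summable (%k. dcoef m n k * Y ^ k)) \<and>
  (\<forall>Y. (\<Sum>k. dcoef m n k * Y ^ k) = exp Y * poly (dpoly m n) Y)"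
proof (induction n)
 case 0
 have "(%k. dcoef m 0 k * Y ^ k) sums exp Y" for Y
  using exp_converges[of Y] by (simp add: dcoef_def field_simps)
 then show ?case by (simp add: sums_iff)
next
 case (Suc n)
 let ?c = "dcoef m n" and ?q = "poly (dpoly m n)"
 have sm: "summable (%k. ?c k * Y ^ k)" and sum: "(\<Sum>k. ?c k * Y ^ k) = exp Y * ?q Y" for Y
  using Suc by auto
 have smd: "summable (%k. diffs ?c k * Y ^ k)" for Y by (rule termdiff_converges_all[OF sm])
 have "((%x. \<Sum>k. ?c k * x ^ k) has_field_derivative (\<Sum>k. diffs ?c k * Y ^ k)) (at Y)" for Y
  by (rule termdiffs_strong_converges_everywhere[OF sm])
 moreover have "((%x. \<Sum>k. ?c k * x ^ k) has_field_derivative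
   (exp Y * (?q Y + poly (pderiv (dpoly m n)) Y))) (at Y)" for Y
  unfolding sum by (auto intro!: derivative_eq_intros simp: algebra_simps)
 ultimately have d: "(\<Sum>k. diffs ?c k * Y ^ k) = exp Y * (?q Y + poly (pderiv (dpoly m n)) Y)" for Y
  by (rule DERIV_unique)
 have "(%k. diffs ?c k * Y ^ k) sums (exp Y * (?q Y + poly (pderiv (dpoly m n)) Y))" for Y
  using smd d by (metis summable_sums)
 then have "(%k. Y * (diffs ?c k * Y ^ k)) sums (Y * (exp Y * (?q Y + poly (pderiv (dpoly m n)) Y)))" for Y
  by (rule sums_mult)
 then have "(%k. real (Suc k) * (?c (Suc k) * Y ^ Suc k)) sums (Y * (exp Y * (?q Y + poly (pderiv (dpoly m n)) Y)))" for Y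
  by (simp add: diffs_def mult_ac)
 from sums_Suc_iff[THEN iffD1, OF this]
 have kc: "(%k. real k * (?c k * Y ^ k)) sums (Y * (exp Y * (?q Y + poly (pderiv (dpoly m n)) Y)))" for Y
  by simp
 have c_Suc: "dcoef m (Suc n) k = real (Suc n) * ?c k + real m * (real k * ?c k)" for k
  by (simp add: dcoef_def pochhammer_Suc field_simps)
 have "(%k. real (Suc n) * (?c k * Y ^ k) + real m * (real k * (?c k * Y ^ k))) sums
  (real (Suc n) * (exp Y * ?q Y) + real m * (Y * (exp Y * (?q Y + poly (pderiv (dpoly m n)) Y))))" for Y
  using kc sums_add sums_mult summable_sums[OF sm, unfolded sum] by blast
 then have "(%k. dcoef m (Suc n) k * Y ^ k) sums (exp Y * poly (dpoly m (Suc n)) Y)" for Y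
  unfolding c_Suc poly_dpoly_Suc by (simp add: algebra_simps)
 then show ?case by (metis sums_iff)
qed

lemma dcoef_sums: "(%k. dcoef m n k * Y ^ k) sums (exp Y * poly (dpoly m n) Y)"
 using dcoef_series by (metis summable_sums)

text \<open>Y times the logarithmic derivative of exp Y * q_n(Y) is the mean of k under the weights
  \<open>dcoef m n k * Y ^ k\<close>. The series with the extra factor k is a combination of those
  for n + 1 and n.\<close>

lemma dcoef_mean_sums:
 assumes "m >= 1"
 shows "(%k. real k * (dcoef m n k * Y ^ k)) sums
  (Y * (exp Y * (poly (dpoly m n) Y + poly (pderiv (dpoly m n)) Y)))"
proof -
 have 1: "dcoef m (Suc n) k = real (Suc n) * dcoef m n k + real m * (real k * dcoef m n k)" for k
  by (simp add: dcoef_def pochhammer_Suc field_simps)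
 have "(%k. (dcoef m (Suc n) k * Y ^ k - real (Suc n) * (dcoef m n k * Y ^ k)) / real m) sums
  ((exp Y * poly (dpoly m (Suc n)) Y - real (Suc n) * (exp Y * poly (dpoly m n) Y)) / real m)"
  by (intro sums_divide sums_diff sums_mult dcoef_sums)
 moreover have "(dcoef m (Suc n) k * Y ^ k - real (Suc n) * (dcoef m n k * Y ^ k)) / real m =
  real k * (dcoef m n k * Y ^ k)" for k
  using assms by (simp add: 1 field_simps)
 moreover have "(exp Y * poly (dpoly m (Suc n)) Y - real (Suc n) * (exp Y * poly (dpoly m n) Y)) / real m =
  Y * (exp Y * (poly (dpoly m n) Y + poly (pderiv (dpoly m n)) Y))"
  using assms unfolding poly_dpoly_Suc by (simp add: field_simps)
 ultimately show ?thesis by simp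
qed

text \<open>The mean of a positive sequence lies within a bounded distance of its peak,
 if the ratios of consecutive terms are bounded away from 1 on both sides of it.\<close>

lemma mean_le_of_ratio:
 fixes a :: "nat => real"
 assumes pos: "!!k. a k >= 0" and S: "a sums S" and E: "(%k. real k * a k) sums E"
  and th: "0 <= \<theta>" "\<theta> < 1" and r: "!!k. k >= K ==> a (Suc k) <= \<theta> * a k"
 shows "E <= (real K + \<theta> / (1 - \<theta>)) * S"
proof -
 have sh: "(%j. a (j + K)) sums (S - (\<Sum>k<K. a k))" by (rule sums_split_initial_segment[OF S])
 have she: "(%j. real (j + K) * a (j + K)) sums (E - (\<Sum>k<K. real k * a k))"
  by (rule sums_split_initial_segment[OF E])
 \<comment> \<open>The first moment of the tail, counted from K. Shifting the index by one and using
   the ratio bound gives X <= \<theta> (X + S).\<close>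
 define X where "X = (\<Sum>j. real j * a (j + K))"
 have X: "(%j. real j * a (j + K)) sums X"
 proof -
  have "(%j. real (j + K) * a (j + K) - real K * a (j + K)) sums
   ((E - (\<Sum>k<K. real k * a k)) - real K * (S - (\<Sum>k<K. a k)))"
   by (intro sums_diff she sums_mult sh)
  then show ?thesis unfolding X_def by (simp add: algebra_simps sums_iff)
 qed
 let ?S = "S - (\<Sum>k<K. a k)"
 have X': "(%j. real (Suc j) * a (Suc j + K)) sums X"
  using sums_Suc_iff[of "%j. real j * a (j + K)" X] X by simp
 have "(%j. \<theta> * (real j * a (j + K) + a (j + K))) sums (\<theta> * (X + ?S))"
  by (intro sums_mult sums_add X sh)
 from sums_le[OF _ X' this] have "X <= \<theta> * (X + ?S)"
 proof -
  have "real (Suc j) * a (Suc j + K) <= \<theta> * (real j * a (j + K) + a (j + K))" for j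
   using mult_left_mono[OF r[of "j + K"], of "real (Suc j)"] by (simp add: algebra_simps)
  then show ?thesis using sums_le[OF _ X' \<open>(%j. \<theta> * (real j * a (j + K) + a (j + K))) sums (\<theta> * (X + ?S))\<close>] by blast
 qed
 then have "X * (1 - \<theta>) <= \<theta> * ?S" by (simp add: algebra_simps)
 also have "... <= \<theta> * S" using pos th by (intro mult_left_mono) (auto intro: sum_nonneg)
 finally have XS: "X <= \<theta> / (1 - \<theta>) * S" using th by (simp add: field_simps)
 have "E - (\<Sum>k<K. real k * a k) = X + real K * ?S"
  using sums_unique2[OF she, of "X + real K * ?S"] sums_add[OF X sums_mult[OF sh, of "real K"]]
  by (simp add: algebra_simps)
 moreover have "(\<Sum>k<K. real k * a k) <= (\<Sum>k<K. real K * a k)"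
  using pos by (intro sum_mono mult_right_mono) auto
 ultimately have "E <= X + real K * S" by (simp add: sum_distrib_left algebra_simps)
 with XS show ?thesis by (simp add: algebra_simps)
qed

lemma mean_ge_of_ratio:
 fixes a :: "nat => real"
 assumes pos: "!!k. a k >= 0" and S: "a sums S" and E: "(%k. real k * a k) sums E"
  and th: "0 <= \<theta>" "\<theta> < 1" and r: "!!k. k < K ==> a k <= \<theta> * a (Suc k)"
 shows "E >= (real K - \<theta> / (1 - \<theta>)) * S"
proof -
 \<comment> \<open>The mirror image of the previous argument: the deficit below K, now a finite
   sum.\<close>
 define X where "X = (\<Sum>k<K. (real K - real k) * a k)"
 have fS: "(\<Sum>k\<in>F. a k) <= S" if "finite F" for F
  using sum_le_suminf[OF sums_summable[OF S] that] pos sums_unique[OF S] by auto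
 have "X <= (\<Sum>k<K. \<theta> * ((real K - real (Suc k)) * a (Suc k) + a (Suc k)))"
  unfolding X_def
 proof (rule sum_mono)
  fix k assume k: "k \<in> {..<K}"
  have "(real K - real k) * a k <= (real K - real k) * (\<theta> * a (Suc k))"
   using r k by (intro mult_left_mono) auto
  then show "(real K - real k) * a k <= \<theta> * ((real K - real (Suc k)) * a (Suc k) + a (Suc k))"
   by (simp add: algebra_simps)
 qed
 also have "... = \<theta> * ((\<Sum>k<K. (real K - real (Suc k)) * a (Suc k)) + (\<Sum>k<K. a (Suc k)))"
  by (simp only: sum_distrib_left[symmetric] sum.distrib)
 also have "... <= \<theta> * (X + S)"
 proof (intro mult_left_mono add_mono th(1))
  have "(\<Sum>k<K. (real K - real (Suc k)) * a (Suc k)) = (\<Sum>k\<in>Suc ` {..<K}. (real K - real k) * a k)"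
   by (simp add: sum.reindex)
  also have "... = (\<Sum>k\<in>Suc ` {..<K} - {K}. (real K - real k) * a k)"
   by (rule sum.mono_neutral_right) auto
  also have "... <= X" unfolding X_def using pos by (intro sum_mono2) auto
  finally show "(\<Sum>k<K. (real K - real (Suc k)) * a (Suc k)) <= X" .
  have "(\<Sum>k<K. a (Suc k)) = (\<Sum>k\<in>Suc ` {..<K}. a k)" by (simp add: sum.reindex)
  also have "... <= S" by (rule fS) simp
  finally show "(\<Sum>k<K. a (Suc k)) <= S" .
 qed
 finally have "X * (1 - \<theta>) <= \<theta> * S" by (simp add: algebra_simps)
 then have XS: "X <= \<theta> / (1 - \<theta>) * S" using th by (simp add: field_simps)
 have "(%k. real K * a k - real k * a k) sums (real K * S - E)"
  by (intro sums_diff sums_mult S E)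
 then have *: "(%k. (real K - real k) * a k) sums (real K * S - E)" by (simp add: algebra_simps)
 have "real K * S - E <= X"
 proof (rule sums_le[OF _ * sums_If_finite_set[of "{..<K}" "%k. (real K - real k) * a k", folded X_def]])
  fix k
  show "(real K - real k) * a k <= (if k \<in> {..<K} then (real K - real k) * a k else 0)"
   using pos[of k] by (auto simp: mult_le_0_iff)
 qed simp
 with XS show ?thesis by (simp add: algebra_simps)
qed

lemma dcoef_ratio:
 "dcoef m n (Suc k) * real (Suc k) =
  dcoef m n k * (\<Prod>i<m. (real (m * k + 1 + i) + real n) / real (m * k + 1 + i))"
proof -
 define x where "x = real (m * k + 1)"
 have x: "x > 0" by (simp add: x_def add_pos_nonneg)
 have p: "pochhammer x m > 0" by (rule pochhammer_pos) fact
 \<comment> \<open>Both products are the Pochhammer symbol of length m + n at x, split after m or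
   after n factors.\<close>
 have "pochhammer x m * pochhammer (x + real m) n = pochhammer x n * pochhammer (x + real n) m"
  by (simp add: pochhammer_product'[symmetric] add.commute)
 then have 1: "pochhammer (x + real m) n = pochhammer x n * (pochhammer (x + real n) m / pochhammer x m)"
  using p by (simp add: field_simps)
 have 2: "pochhammer (x + real n) m / pochhammer x m = (\<Prod>i<m. (real (m * k + 1 + i) + real n) / real (m * k + 1 + i))"
  by (simp add: pochhammer_prod prod_dividef x_def atLeast0LessThan ac_simps)
 have 3: "real (m * Suc k + 1) = x + real m" by (simp add: x_def)
 show ?thesis unfolding dcoef_def 3 1 2 x_def[symmetric] by (simp del: of_nat_Suc)
qed

lemma shifted_ratio_mono:
 fixes a b c :: real
 assumes "0 < a" "a <= b" "c >= 0"
 shows "(b + c) / b <= (a + c) / a"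
proof -
 have "c / b <= c / a" using assms by (intro divide_left_mono) auto
 then show ?thesis using assms by (simp add: add_divide_distrib)
qed

lemma dcoef_pos: "dcoef m n k > 0"
 unfolding dcoef_def by (intro divide_pos_pos pochhammer_pos) (auto simp: add_pos_nonneg)

lemma strict_decreasing_R:
 fixes s t :: real
 assumes "0 < s" "s < t" "y > 0" "m >= 1"
 shows "y / t * ((real m * t + 1) / (real m * t)) ^ m < y / s * ((real m * s + 1) / (real m * s)) ^ m"
proof (rule mult_strict_mono)
 show "y / t < y / s" using assms by (simp add: field_simps)
 have "(real m * t + 1) / (real m * t) < (real m * s + 1) / (real m * s)"
  using assms by (simp add: field_simps)
 then show "((real m * t + 1) / (real m * t)) ^ m < ((real m * s + 1) / (real m * s)) ^ m"
  using assms by (intro power_strict_mono) auto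
qed (use assms in auto)

text \<open>Laplace's method for a positive series. At k near t n the ratio of consecutive weights
  is about \<open>R t\<close>, which decreases strictly and equals 1 at \<kappa>. So the weights
  peak near \<kappa> n, and their mean divided by n tends to \<kappa>.\<close>

lemma dpoly_logderiv_tendsto:
 fixes y v :: real
 assumes m: "m >= 1" and y: "y > 0" and v: "0 < v" "v < 1" "v ^ (m + 1) = real m * y * (1 - v)"
 shows "(%n. poly (pderiv (dpoly m n)) (real n * y) / poly (dpoly m n) (real n * y)) \<longlonglongrightarrow> 1 / v ^ m - 1"
proof -
 define R where "R t = y / t * ((real m * t + 1) / (real m * t)) ^ m" for t
 \<comment> \<open>Obtained from v = m \<kappa> / (m \<kappa> + 1), which turns R \<kappa> = 1 into
   the equation for v.\<close>
 define \<kappa> where "\<kappa> = v / (real m * (1 - v))"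
 have \<kappa>: "\<kappa> > 0" using m v by (simp add: \<kappa>_def)
 have mk: "real m * \<kappa> = v / (1 - v)" using m by (simp add: \<kappa>_def)
 have R\<kappa>: "R \<kappa> = 1"
 proof -
  have "(real m * \<kappa> + 1) / (real m * \<kappa>) = 1 / v" unfolding mk using v by (simp add: field_simps)
  then have "R \<kappa> = y / \<kappa> * (1 / v) ^ m" by (simp add: R_def)
  also have "... = (real m * y * (1 - v)) / v ^ (m + 1)" using v m by (simp add: \<kappa>_def field_simps)
  also have "... = 1" using v by (metis divide_self less_irrefl zero_less_power)
  finally show ?thesis .
 qed
 have R_mono: "R t < R s" if "0 < s" "s < t" for s t
  unfolding R_def using strict_decreasing_R[OF that y m] .
 have R_pos: "R t > 0" if "t > 0" for t using that y m by (auto simp: R_def intro!: mult_pos_pos divide_pos_pos add_pos_pos zero_less_power)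
 define E where "E n = real n * y * (1 + poly (pderiv (dpoly m n)) (real n * y) / poly (dpoly m n) (real n * y))" for n
 define a where "a n k = dcoef m n k * (real n * y) ^ k" for n k
 define S where "S n = exp (real n * y) * poly (dpoly m n) (real n * y)" for n
 have qpos: "poly (dpoly m n) (real n * y) > 0" for n using y by (intro dpoly_pos m) auto
 have S_pos: "S n > 0" for n using qpos by (simp add: S_def)
 have a_pos: "a n k >= 0" for n k using dcoef_pos[of m n k] y by (simp add: a_def less_imp_le)
 have aS: "a n sums S n" for n unfolding a_def S_def by (rule dcoef_sums)
 have "(real n * y * (exp (real n * y) * (poly (dpoly m n) (real n * y) + poly (pderiv (dpoly m n)) (real n * y)))) = E n * S n" for n
  using qpos[of n] by (simp add: E_def S_def field_simps)
 then have aE: "(%k. real k * a n k) sums (E n * S n)" for n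
  unfolding a_def using dcoef_mean_sums[OF m, of n "real n * y"] by simp
 have step: "a n (Suc k) = a n k * (real n * y / real (Suc k) * (\<Prod>i<m. (real (m * k + 1 + i) + real n) / real (m * k + 1 + i)))" for n k
 proof -
  have "dcoef m n (Suc k) = dcoef m n k * (\<Prod>i<m. (real (m * k + 1 + i) + real n) / real (m * k + 1 + i)) / real (Suc k)"
   using dcoef_ratio[of m n k] by (simp add: field_simps del: of_nat_Suc of_nat_add of_nat_mult)
  then show ?thesis by (simp add: a_def del: of_nat_Suc of_nat_add of_nat_mult)
 qed
 \<comment> \<open>The exact ratio at k lies between R((k+1)/n) and R(k/n), because its m factors
   have denominators from m k + 1 to m (k+1). The lower half of this is \<open>low\<close>.\<close>
 have up: "a n (Suc k) <= R (real k / real n) * a n k" if "k > 0" "n > 0" for n k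
 proof -
  have "(\<Prod>i<m. (real (m * k + 1 + i) + real n) / real (m * k + 1 + i)) <= (\<Prod>i<m. (real m * (real k / real n) + 1) / (real m * (real k / real n)))"
  proof (intro prod_mono conjI)
   fix i assume "i \<in> {..<m}"
   have "(real m * (real k / real n) + 1) / (real m * (real k / real n)) = (real (m * k) + real n) / real (m * k)"
    using that m by (simp add: field_simps)
   moreover have "(real (m * k + 1 + i) + real n) / real (m * k + 1 + i) <= (real (m * k) + real n) / real (m * k)"
    by (rule shifted_ratio_mono) (use that m in auto)
   ultimately show "(real (m * k + 1 + i) + real n) / real (m * k + 1 + i) <= (real m * (real k / real n) + 1) / (real m * (real k / real n))"
    by (simp only:)
  qed auto
  moreover have "real n * y / real (Suc k) <= y / (real k / real n)" using that y by (simp add: field_simps)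
  ultimately have "(real n * y / real (Suc k) * (\<Prod>i<m. (real (m * k + 1 + i) + real n) / real (m * k + 1 + i))) <= R (real k / real n)"
   unfolding R_def using y that by (intro mult_mono) (auto intro!: prod_nonneg)
  from mult_left_mono[OF this a_pos[of n k]] show ?thesis unfolding step by (simp add: mult.commute)
 qed
 have frac: "(real m * (x / real n) + 1) / (real m * (x / real n)) = (real m * x + real n) / (real m * x)"
  if "n > 0" "x > 0" for n :: nat and x :: real using that m by (simp add: field_simps)
 have low: "R (real (Suc k) / real n) * a n k <= a n (Suc k)" if "n > 0" for n k
 proof -
  have "(\<Prod>i<m. (real m * (real (Suc k) / real n) + 1) / (real m * (real (Suc k) / real n))) <= (\<Prod>i<m. (real (m * k + 1 + i) + real n) / real (m * k + 1 + i))"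
  proof (intro prod_mono conjI)
   fix i assume i: "i \<in> {..<m}"
   have "(real m * (real (Suc k) / real n) + 1) / (real m * (real (Suc k) / real n)) = (real (m * Suc k) + real n) / real (m * Suc k)"
    using frac[OF that, of "real (Suc k)"] by (simp only: of_nat_mult of_nat_0_less_iff zero_less_Suc)
   moreover have "(real (m * Suc k) + real n) / real (m * Suc k) <= (real (m * k + 1 + i) + real n) / real (m * k + 1 + i)"
    by (rule shifted_ratio_mono) (use i in \<open>auto simp del: of_nat_add of_nat_mult\<close>)
   ultimately show "(real m * (real (Suc k) / real n) + 1) / (real m * (real (Suc k) / real n)) <= (real (m * k + 1 + i) + real n) / real (m * k + 1 + i)"
    by (simp only:)
  qed (use m that in auto)
  then have P: "((real m * (real (Suc k) / real n) + 1) / (real m * (real (Suc k) / real n))) ^ m \<le>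
    (\<Prod>i<m. (real (m * k + 1 + i) + real n) / real (m * k + 1 + i))"
   by (simp only: prod_constant card_lessThan)
  have R: "R (real (Suc k) / real n) = real n * y / real (Suc k) *
    ((real m * (real (Suc k) / real n) + 1) / (real m * (real (Suc k) / real n))) ^ m"
   using that by (simp add: R_def del: of_nat_Suc)
  have "R (real (Suc k) / real n) <= (real n * y / real (Suc k) * (\<Prod>i<m. (real (m * k + 1 + i) + real n) / real (m * k + 1 + i)))"
   unfolding R using y by (intro mult_left_mono[OF P]) simp
  from mult_left_mono[OF this a_pos[of n k]] show ?thesis unfolding step by (simp add: mult.commute)
 qed
 have E_lim: "(%n. E n / real n) \<longlonglongrightarrow> \<kappa>"
 proof (rule order_tendstoI)
  fix b assume b: "\<kappa> < b"
  \<comment> \<open>Beyond t n the ratio is at most R t < 1 independently of n, so the mean exceeds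
    t n by at most a constant.\<close>
  define t where "t = (\<kappa> + b) / 2"
  have t: "\<kappa> < t" "t < b" using b by (auto simp: t_def)
  have t0: "t > 0" using t \<kappa> by simp
  define C where "C = R t / (1 - R t)"
  have th: "0 <= R t" "R t < 1" using R_pos[OF t0] R_mono[OF \<kappa> t(1)] R\<kappa> by auto
  have bd: "E n / real n <= t + (1 + C) / real n" if n: "n > 0" for n
  proof -
   define K where "K = nat \<lceil>t * real n\<rceil>"
   have K: "t * real n <= real K" "real K <= t * real n + 1"
    using t0 by (auto simp: K_def of_nat_ceiling)
   have K0: "K > 0" using K(1) t0 n by (metis mult_pos_pos of_nat_0_less_iff order_less_le_trans)
   have "E n * S n <= (real K + C) * S n"
    unfolding C_def
   proof (rule mean_le_of_ratio[OF a_pos aS aE th])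
    fix k assume k: "k >= K"
    then have k0: "k > 0" using K0 by simp
    have "t <= real k / real n" using K(1) k n by (simp add: field_simps)
    then have Rt: "R (real k / real n) <= R t" using R_mono[OF t0, of "real k / real n"] by (cases "t = real k / real n") auto
    show "a n (Suc k) <= R t * a n k"
     by (rule order.trans[OF up[OF k0 n] mult_right_mono[OF Rt a_pos]])
   qed
   then have "E n <= real K + C" using S_pos[of n] by (simp only: mult_le_cancel_right_pos)
   then have "E n <= t * real n + (1 + C)" using K by linarith
   then show ?thesis using n by (simp add: field_simps)
  qed
  have "(%n. t + (1 + C) / real n) \<longlonglongrightarrow> t + 0" by (intro tendsto_intros lim_const_over_n)
  then have "eventually (%n. t + (1 + C) / real n < b) sequentially"
   using t(2) by (simp add: order_tendstoD(2))
  then show "eventually (%n. E n / real n < b) sequentially"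
   using eventually_gt_at_top[of 0]
  proof eventually_elim
   case (elim n)
   then show ?case using bd[of n] by linarith
  qed
 next
  fix b assume b: "b < \<kappa>"
  \<comment> \<open>\<open>max b 0\<close> keeps t positive when b is negative.\<close>
  define t where "t = (\<kappa> + max b 0) / 2"
  have t: "t < \<kappa>" "b < t" "t > 0" using b \<kappa> by (auto simp: t_def)
  define C where "C = (1 / R t) / (1 - 1 / R t)"
  have Rt: "R t > 1" using R_mono[OF t(3) t(1)] R\<kappa> by auto
  have th: "0 <= 1 / R t" "1 / R t < 1" using Rt by auto
  have bd: "E n / real n >= t - (1 + C) / real n" if n: "n > 0" for n
  proof -
   define K where "K = nat \<lfloor>t * real n\<rfloor>"
   have K: "real K <= t * real n" "t * real n - 1 <= real K"
    using t by (auto simp: K_def)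
   have "E n * S n >= (real K - C) * S n"
    unfolding C_def
   proof (rule mean_ge_of_ratio[OF a_pos aS aE th])
    fix k assume k: "k < K"
    have "real (Suc k) <= t * real n" using K(1) k by linarith
    then have le: "real (Suc k) / real n <= t" using n by (simp add: field_simps)
    have Rt': "R t <= R (real (Suc k) / real n)"
    proof (cases "real (Suc k) / real n = t")
     case False
     then show ?thesis using le n by (intro less_imp_le R_mono) auto
    qed simp
    have "R t * a n k <= a n (Suc k)"
     by (rule order.trans[OF mult_right_mono[OF Rt' a_pos] low[OF n]])
    then show "a n k <= 1 / R t * a n (Suc k)" using Rt by (simp add: field_simps)
   qed
   then have "E n >= real K - C" using S_pos[of n] by (simp only: mult_le_cancel_right_pos)
   then have "E n >= t * real n - (1 + C)" using K by linarith
   from divide_right_mono[OF this, of "real n"] show ?thesis using n by (simp add: diff_divide_distrib)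
  qed
  have "(%n. t - (1 + C) / real n) \<longlonglongrightarrow> t - 0" by (intro tendsto_intros lim_const_over_n)
  then have "eventually (%n. t - (1 + C) / real n > b) sequentially"
   using t(2) by (simp add: order_tendstoD(1))
  then show "eventually (%n. E n / real n > b) sequentially"
   using eventually_gt_at_top[of 0]
  proof eventually_elim
   case (elim n)
   then show ?case using bd[of n] by linarith
  qed
 qed
 have "(%n. E n / real n / y - 1) \<longlonglongrightarrow> \<kappa> / y - 1"
  using y by (intro tendsto_intros E_lim) auto
 also have "\<kappa> / y - 1 = 1 / v ^ m - 1"
 proof -
  have "\<kappa> / y = v / v ^ (m + 1)" unfolding v(3) using y by (simp add: \<kappa>_def)
  then show ?thesis using v by simp
 qed
 finally show ?thesis
 proof (rule Lim_transform_eventually)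
  show "\<forall>\<^sub>F n in sequentially. E n / real n / y - 1 =
   poly (pderiv (dpoly m n)) (real n * y) / poly (dpoly m n) (real n * y)"
   using eventually_gt_at_top[of 0] by eventually_elim (use y in \<open>simp add: E_def\<close>)
 qed
qed

subsection \<open>Cauchy transforms of compactly supported distributions\<close>

lemma norm_inverse_le: "0 < d ==> d <= cmod z ==> cmod (1 / z) <= 1 / d"
 by (simp add: norm_divide frac_le)

locale compact_distribution = real_distribution +
 fixes B :: real
 assumes supp: "AE x in M. 0 <= x & x <= B"
begin

definition ct :: "complex => complex" where "ct \<zeta> = (\<integral>x. 1 / (\<zeta> - complex_of_real x) \<partial>M)"

lemma B_nonneg: "B >= 0"
proof (rule ccontr)
 assume "\<not> B >= 0"
 then have "AE x in M. False" by (intro eventually_mono[OF supp]) auto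
 then show False by simp
qed

lemma closed_segm: "closed (complex_of_real ` {0..b})"
 by (intro compact_imp_closed compact_continuous_image continuous_intros) auto

lemma cut_dist:
 assumes "\<zeta> \<notin> complex_of_real ` {0..b}"
 obtains d where "d > 0" "!!x. 0 <= x ==> x <= b ==> d <= cmod (\<zeta> - complex_of_real x)"
proof (cases "b >= 0")
 case True
 then have ne: "complex_of_real ` {0..b} ~= {}" by auto
 have "setdist {\<zeta>} (complex_of_real ` {0..b}) > 0"
  using assms setdist_eq_0_closed[OF closed_segm, of \<zeta> b] ne setdist_pos_le[of "{\<zeta>}" "complex_of_real ` {0..b}"]
  by (metis order_le_less)
 moreover have "setdist {\<zeta>} (complex_of_real ` {0..b}) <= cmod (\<zeta> - complex_of_real x)" if "0 <= x" "x <= b" for x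
  using setdist_le_dist[of \<zeta> "{\<zeta>}" "complex_of_real x" "complex_of_real ` {0..b}"] that
  by (auto simp: dist_norm)
 ultimately show ?thesis using that by blast
qed (use that[of 1] in auto)

lemma integrable_bounded:
 fixes f :: "real => 'b::{banach, second_countable_topology}"
 assumes "f \<in> borel_measurable borel" "!!x. 0 <= x ==> x <= B ==> norm (f x) <= D"
 shows "integrable M f" "norm (\<integral>x. f x \<partial>M) <= D"
proof -
 have ae: "AE x in M. norm (f x) <= D" by (rule eventually_mono[OF supp]) (use assms(2) in auto)
 then show int: "integrable M f" by (intro integrable_const_bound) (use assms(1) in auto)
 have "norm (\<integral>x. f x \<partial>M) <= (\<integral>x. norm (f x) \<partial>M)" by (rule integral_norm_bound)
 also have "... <= (\<integral>x. D \<partial>M)" using int ae by (intro integral_mono_AE) auto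
 also have "... = D" using prob_space by simp
 finally show "norm (\<integral>x. f x \<partial>M) <= D" .
qed

text \<open>The difference quotient of the kernel differs from its derivative by an explicit term
  that is O(h) uniformly on the support, so differentiation under the integral is a direct
  estimate.\<close>

lemma ct_holomorphic: "ct holomorphic_on - complex_of_real ` {0..B}"
proof -
 have "(ct has_field_derivative (\<integral>x. - 1 / (\<zeta> - complex_of_real x) ^ 2 \<partial>M)) (at \<zeta>)"
  if \<zeta>: "\<zeta> \<notin> complex_of_real ` {0..B}" for \<zeta>
 proof -
  let ?D = "\<integral>x. - 1 / (\<zeta> - complex_of_real x) ^ 2 \<partial>M"
  from cut_dist[OF \<zeta>] obtain d where d: "d > 0"
   "!!x. 0 <= x ==> x <= B ==> d <= cmod (\<zeta> - complex_of_real x)" by blast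
  have bd: "cmod ((ct (\<zeta> + h) - ct \<zeta>) / h - ?D) <= cmod h * (2 / d ^ 3)" if h: "h ~= 0" "cmod h < d / 2" for h
  proof -
   have d2: "d / 2 <= cmod (\<zeta> + h - complex_of_real x)" if "0 <= x" "x <= B" for x
    using norm_triangle_ineq2[of "\<zeta> - complex_of_real x" "-h"] d(2)[OF that] h(2) by (simp add: algebra_simps)
   have i1: "integrable M (%x. 1 / (\<zeta> + h - complex_of_real x))"
    by (rule integrable_bounded[where D = "1 / (d / 2)"]) (use d(1) d2 in \<open>auto intro!: norm_inverse_le simp del: divide_divide_eq_right\<close>)
   have i2: "integrable M (%x. 1 / (\<zeta> - complex_of_real x))"
    by (rule integrable_bounded[where D = "1 / d"]) (use d in \<open>auto intro!: norm_inverse_le\<close>)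
   have i3: "integrable M (%x. - 1 / (\<zeta> - complex_of_real x) ^ 2)"
    by (rule integrable_bounded[where D = "1 / d^2"])
     (use d in \<open>auto simp: norm_divide norm_power intro!: frac_le power_mono\<close>)
   have "(ct (\<zeta> + h) - ct \<zeta>) / h - ?D =
    (\<integral>x. (1 / (\<zeta> + h - complex_of_real x) - 1 / (\<zeta> - complex_of_real x)) / h - (- 1 / (\<zeta> - complex_of_real x) ^ 2) \<partial>M)"
    unfolding ct_def using i1 i2 i3 by simp
   also have "cmod ... <= cmod h * (2 / d ^ 3)"
   proof (rule integrable_bounded(2))
    fix x assume x: "0 <= x" "x <= B"
    let ?u = "\<zeta> - complex_of_real x" and ?v = "\<zeta> + h - complex_of_real x"
    have nz: "?u ~= 0" "?v ~= 0" using d(1) d(2)[OF x] d2[OF x] by auto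
    have "(1 / ?v - 1 / ?u) / h - (- 1 / ?u ^ 2) = h / (?v * ?u ^ 2)"
     using nz h(1) by (simp add: divide_simps power2_eq_square)
    also have "cmod ... = cmod h / (cmod ?v * cmod ?u ^ 2)" by (simp add: norm_divide norm_mult norm_power)
    also have "... <= cmod h / (d / 2 * d ^ 2)"
     using d d2[OF x] d(2)[OF x] nz by (intro divide_left_mono mult_mono power_mono mult_pos_pos) auto
    also have "... = cmod h * (2 / d ^ 3)" by (simp add: power2_eq_square power3_eq_cube)
    finally show "cmod ((1 / ?v - 1 / ?u) / h - (- 1 / ?u ^ 2)) <= cmod h * (2 / d ^ 3)" .
   qed simp
   finally show ?thesis .
  qed
  have "((%h. (ct (\<zeta> + h) - ct \<zeta>) / h - ?D) \<longlongrightarrow> 0) (at 0)"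
  proof (rule Lim_null_comparison)
   show "\<forall>\<^sub>F h in at 0. cmod ((ct (\<zeta> + h) - ct \<zeta>) / h - ?D) <= cmod h * (2 / d ^ 3)"
    unfolding eventually_at using d(1) bd by (intro exI[of _ "d/2"]) auto
   have "((%h::complex. cmod h * (2 / d ^ 3)) \<longlongrightarrow> cmod 0 * (2 / d ^ 3)) (at 0)" by (intro tendsto_intros)
   then show "((%h::complex. cmod h * (2 / d ^ 3)) \<longlongrightarrow> 0) (at 0)" by simp
  qed
  then show ?thesis unfolding DERIV_def by (rule LIM_zero_cancel)
 qed
 then show ?thesis using closed_segm by (auto simp: holomorphic_on_open open_Compl)
qed

text \<open>From x^(k+1)/(y+x) = x^k - y x^k/(y+x): the integral of the left side tends to 0 as y
  grows, so the k-th moment is a limit of known quantities. Induction on k carries the equality of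
  the transforms with kernel x^k/(y+x) along.\<close>

lemma moments_eq_stieltjes:
 assumes M': "compact_distribution M' B" and Y: "Y >= 0"
  and eq: "!!y. y > Y ==> (\<integral>x. 1 / (y + x) \<partial>M) = (\<integral>x. 1 / (y + x) \<partial>M')"
 shows "(\<integral>x. x ^ k \<partial>M) = (\<integral>x. x ^ k \<partial>M')"
proof -
 interpret M': compact_distribution M' B by fact
 have B: "x ^ k <= B ^ k" "x ^ k >= 0" if "0 <= x" "x <= B" for x k using that by (auto intro: power_mono)
 have i: "integrable M (%x. x ^ k)" "integrable M' (%x. x ^ k)" for k
  using B by (auto intro!: integrable_bounded(1)[where D = "B^k"] M'.integrable_bounded(1)[where D = "B^k"] simp: abs_if)
 have j: "integrable M (%x. x ^ k / (y + x))" "integrable M' (%x. x ^ k / (y + x))"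
   "norm (\<integral>x. x ^ k / (y + x) \<partial>M) <= B ^ k / y" "norm (\<integral>x. x ^ k / (y + x) \<partial>M') <= B ^ k / y" if "y > 0" for k y
 proof -
  have bd: "norm (x ^ k / (y + x)) <= B ^ k / y" if "0 <= x" "x <= B" for x
   using B[OF that, of k] that \<open>y > 0\<close> by (auto simp: power_abs intro!: frac_le)
  show "integrable M (%x. x ^ k / (y + x))" "norm (\<integral>x. x ^ k / (y + x) \<partial>M) <= B ^ k / y"
   by (rule integrable_bounded[OF _ bd]; simp)+
  show "integrable M' (%x. x ^ k / (y + x))" "norm (\<integral>x. x ^ k / (y + x) \<partial>M') <= B ^ k / y"
   by (rule M'.integrable_bounded[OF _ bd]; simp)+
 qed
 have split: "x ^ Suc k / (y + x) = x ^ k - y * (x ^ k / (y + x))" if "0 <= x" "y > 0" for x y :: real and k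
  using that by (simp add: field_simps)
 have step: "(\<integral>x. x ^ Suc k / (y + x) \<partial>M) = (\<integral>x. x ^ k \<partial>M) - y * (\<integral>x. x ^ k / (y + x) \<partial>M)"
  "(\<integral>x. x ^ Suc k / (y + x) \<partial>M') = (\<integral>x. x ^ k \<partial>M') - y * (\<integral>x. x ^ k / (y + x) \<partial>M')" if y: "y > 0" for k y
 proof -
  have "(\<integral>x. x ^ Suc k / (y + x) \<partial>M) = (\<integral>x. x ^ k - y * (x ^ k / (y + x)) \<partial>M)"
   by (intro integral_cong_AE eventually_mono[OF supp]) (auto simp del: power_Suc simp: split y)
  then show "(\<integral>x. x ^ Suc k / (y + x) \<partial>M) = (\<integral>x. x ^ k \<partial>M) - y * (\<integral>x. x ^ k / (y + x) \<partial>M)"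
   using i(1) j(1)[OF y] by (simp del: times_divide_eq_right power_Suc)
  have "(\<integral>x. x ^ Suc k / (y + x) \<partial>M') = (\<integral>x. x ^ k - y * (x ^ k / (y + x)) \<partial>M')"
   by (intro integral_cong_AE eventually_mono[OF M'.supp]) (auto simp del: power_Suc simp: split y)
  then show "(\<integral>x. x ^ Suc k / (y + x) \<partial>M') = (\<integral>x. x ^ k \<partial>M') - y * (\<integral>x. x ^ k / (y + x) \<partial>M')"
   using i(2) j(2)[OF y] by (simp del: times_divide_eq_right power_Suc)
 qed
 have lim: "((%y. (\<integral>x. x ^ Suc k / (y + x) \<partial>M)) \<longlongrightarrow> 0) at_top" "((%y. (\<integral>x. x ^ Suc k / (y + x) \<partial>M')) \<longlongrightarrow> 0) at_top" for k
 proof -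
  have l: "((%y. B ^ Suc k / y) \<longlongrightarrow> 0) at_top" by (rule real_tendsto_divide_at_top[OF tendsto_const filterlim_ident])
  show "((%y. (\<integral>x. x ^ Suc k / (y + x) \<partial>M)) \<longlongrightarrow> 0) at_top"
   by (rule Lim_null_comparison[OF _ l], rule eventually_mono[OF eventually_gt_at_top[of 0]]) (rule j)
  show "((%y. (\<integral>x. x ^ Suc k / (y + x) \<partial>M')) \<longlongrightarrow> 0) at_top"
   by (rule Lim_null_comparison[OF _ l], rule eventually_mono[OF eventually_gt_at_top[of 0]]) (rule j)
 qed
 have main: "(\<integral>x. x ^ k / (y + x) \<partial>M) = (\<integral>x. x ^ k / (y + x) \<partial>M')" if "y > Y" for k y
  using that
 proof (induction k arbitrary: y)
  case 0
  then show ?case using eq by simp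
 next
  case (Suc k)
  have "((%y. (\<integral>x. x ^ Suc k / (y + x) \<partial>M) - (\<integral>x. x ^ Suc k / (y + x) \<partial>M')) \<longlongrightarrow> 0 - 0) at_top"
   by (intro tendsto_diff lim)
  moreover have "\<forall>\<^sub>F y in at_top. (\<integral>x. x ^ Suc k / (y + x) \<partial>M) - (\<integral>x. x ^ Suc k / (y + x) \<partial>M') = (\<integral>x. x ^ k \<partial>M) - (\<integral>x. x ^ k \<partial>M')"
   using eventually_gt_at_top[of Y]
  proof eventually_elim
   case (elim y)
   then have "y > 0" using Y by simp
   from step[OF this, of k] show ?case unfolding Suc.IH[OF elim] by linarith
  qed
  ultimately have "((%y. (\<integral>x. x ^ k \<partial>M) - (\<integral>x. x ^ k \<partial>M')) \<longlongrightarrow> 0) (at_top :: real filter)"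
   using tendsto_cong by force
  then have "(\<integral>x. x ^ k \<partial>M) - (\<integral>x. x ^ k \<partial>M') = 0" by (simp add: tendsto_const_iff)
  moreover have "y > 0" using Suc.prems Y by simp
  ultimately show ?case using Suc.IH[OF Suc.prems] unfolding step[OF \<open>y > 0\<close>] by simp
 qed
 have "((%y. (\<integral>x. x ^ Suc k / (y + x) \<partial>M) - (\<integral>x. x ^ Suc k / (y + x) \<partial>M')) \<longlongrightarrow> 0 - 0) at_top"
  by (intro tendsto_diff lim)
 moreover have "\<forall>\<^sub>F y in at_top. (\<integral>x. x ^ Suc k / (y + x) \<partial>M) - (\<integral>x. x ^ Suc k / (y + x) \<partial>M') = (\<integral>x. x ^ k \<partial>M) - (\<integral>x. x ^ k \<partial>M')"
  using eventually_gt_at_top[of Y]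
 proof eventually_elim
  case (elim y)
  then have "y > 0" using Y by simp
  from step[OF this, of k] show ?case unfolding main[OF elim, of k] by linarith
 qed
 ultimately have "((%y. (\<integral>x. x ^ k \<partial>M) - (\<integral>x. x ^ k \<partial>M')) \<longlongrightarrow> 0) (at_top :: real filter)"
  using tendsto_cong by force
 then show ?thesis by (simp add: tendsto_const_iff)
qed

text \<open>On a compact support the moments grow at most geometrically, so the characteristic
  function is the sum of its Taylor series and the moments determine it.\<close>

lemma eq_of_stieltjes:
 assumes M': "compact_distribution M' B" and Y: "Y >= 0"
  and eq: "!!y. y > Y ==> (\<integral>x. 1 / (y + x) \<partial>M) = (\<integral>x. 1 / (y + x) \<partial>M')"
 shows "M = M'"
proof (rule Levy_uniqueness)
 interpret M': compact_distribution M' B by fact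
 show "real_distribution M" "real_distribution M'" by unfold_locales
 have B: "norm (x ^ k) <= B ^ k" "norm (\<bar>x\<bar> ^ k) <= B ^ k" if "0 <= x" "x <= B" for x k
  using that by (auto intro!: power_mono simp: power_abs)
 have i: "integrable M (%x. x ^ k)" "integrable M' (%x. x ^ k)"
  "norm (\<integral>x. \<bar>x\<bar> ^ k \<partial>M) <= B ^ k" "norm (\<integral>x. \<bar>x\<bar> ^ k \<partial>M') <= B ^ k" for k
  by (rule integrable_bounded[OF _ B(1)] M'.integrable_bounded[OF _ B(1)]
     integrable_bounded[OF _ B(2)] M'.integrable_bounded[OF _ B(2)]; simp)+
 show "char M = char M'"
 proof
  fix t :: real
  define S where "S n = (\<Sum>k\<le>n. ((\<i> * t)^k / fact k) * expectation (%x. x^k))" for n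
  have S': "S n = (\<Sum>k\<le>n. ((\<i> * t)^k / fact k) * M'.expectation (%x. x^k))" for n
   unfolding S_def by (intro sum.cong refl arg_cong2[where f = "(*)"] arg_cong[where f = complex_of_real])
    (rule moments_eq_stieltjes[OF M' Y eq])
  have l: "(%n. 2 * ((\<bar>t\<bar> * B) ^ n / fact n) :: real) \<longlonglongrightarrow> 0"
   using tendsto_mult[OF tendsto_const[of 2] summable_LIMSEQ_zero[OF summable_exp_generic[of "\<bar>t\<bar> * B"]]]
   by (simp add: field_simps)
  have "(%n. char M t - S n) \<longlonglongrightarrow> 0"
  proof (rule Lim_null_comparison[OF always_eventually l], rule allI)
   fix n
   have "cmod (char M t - S n) <= (2*\<bar>t\<bar>^n / fact n) * expectation (%x. \<bar>x\<bar>^n)"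
    unfolding S_def by (rule char_approx1) (rule i)
   also have "... <= (2*\<bar>t\<bar>^n / fact n) * B ^ n" using i(3)[of n] by (intro mult_left_mono) auto
   finally show "cmod (char M t - S n) <= 2 * ((\<bar>t\<bar> * B) ^ n / fact n)" by (simp add: power_mult_distrib)
  qed
  moreover have "(%n. char M' t - S n) \<longlonglongrightarrow> 0"
  proof (rule Lim_null_comparison[OF always_eventually l], rule allI)
   fix n
   have "cmod (char M' t - S n) <= (2*\<bar>t\<bar>^n / fact n) * M'.expectation (%x. \<bar>x\<bar>^n)"
    unfolding S' by (rule M'.char_approx1) (rule i)
   also have "... <= (2*\<bar>t\<bar>^n / fact n) * B ^ n" using i(4)[of n] by (intro mult_left_mono) auto
   finally show "cmod (char M' t - S n) <= 2 * ((\<bar>t\<bar> * B) ^ n / fact n)" by (simp add: power_mult_distrib)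
  qed
  ultimately have "(%n. (char M t - S n) - (char M' t - S n)) \<longlonglongrightarrow> 0 - 0" by (rule tendsto_diff)
  then show "char M t = char M' t" by (simp add: tendsto_const_iff)
 qed
qed

end

section \<open>Empirical distributions of the scaled roots and their weak limit\<close>

text \<open>Index n belongs to degree n + 1, since degree 0 has no roots and would not give a
  probability measure.\<close>

definition emp :: "nat => nat => real measure" where
 "emp m n = distr (uniform_count_measure {..<Suc n}) borel (%j. droot m (Suc n) j / real (Suc n))"

lemma integral_emp:
 fixes f :: "real => 'b::{banach, second_countable_topology}"
 assumes "f \<in> borel_measurable borel"
 shows "(\<integral>x. f x \<partial>emp m n) = (\<Sum>j<Suc n. f (droot m (Suc n) j / real (Suc n))) /\<^sub>R real (Suc n)"
proof -
 have "(\<integral>x. f x \<partial>emp m n) = (\<integral>j. f (droot m (Suc n) j / real (Suc n)) \<partial>uniform_count_measure {..<Suc n})"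
  unfolding emp_def using assms
  by (intro integral_distr) (auto simp: uniform_count_measure_def point_measure_def)
 also have "... = (\<Sum>j<Suc n. (1 / real (Suc n)) *\<^sub>R f (droot m (Suc n) j / real (Suc n)))"
  unfolding uniform_count_measure_def
  by (subst lebesgue_integral_point_measure_finite) (simp_all del: lessThan_Suc sum.lessThan_Suc)
 finally show ?thesis by (simp add: scaleR_sum_right divide_inverse del: sum.lessThan_Suc)
qed

lemma emp_compact_distribution:
 assumes m: "m >= 1"
 shows "compact_distribution (emp m n) (2 ^ (m + 6))"
proof -
 let ?U = "uniform_count_measure {..<Suc n}"
 interpret U: prob_space ?U by (rule prob_space_uniform_count_measure) auto
 have mb: "(%j. droot m (Suc n) j / real (Suc n)) \<in> borel_measurable ?U"
  by (auto simp: uniform_count_measure_def point_measure_def)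
 have "AE x in emp m n. 0 <= x & x <= 2 ^ (m + 6)"
  unfolding emp_def
 proof (subst AE_distr_iff[OF mb])
  show "AE x in ?U. 0 <= droot m (Suc n) x / real (Suc n) & droot m (Suc n) x / real (Suc n) <= 2 ^ (m + 6)"
   using droot_pos[OF m, of _ "Suc n"] droot_le[OF m, of _ "Suc n"]
   by (intro AE_I2) (auto simp: space_uniform_count_measure less_imp_le divide_le_eq)
 qed simp
 then show ?thesis
  using U.real_distribution_distr[OF mb] unfolding emp_def
  by (intro compact_distribution.intro compact_distribution_axioms.intro)
qed

text \<open>Stated for an arbitrary weak limit along a subsequence. The two conclusions determine
  that limit, and this turns tightness into convergence of the whole sequence.\<close>

lemma emp_limit:
 assumes m: "m >= 1" and s: "strict_mono s" and N: "real_distribution N" and conv: "weak_conv_m (emp m \<circ> s) N"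
 shows "compact_distribution N (2 ^ (m + 6))"
  and "y > 0 ==> 0 < v ==> v < 1 ==> v ^ (m + 1) = real m * y * (1 - v) ==>
   (\<integral>x. 1 / (y + x) \<partial>N) = 1 / v ^ m - 1"
proof -
 let ?K = "2 ^ (m + 6) :: real"
 interpret N: real_distribution N by fact
 interpret E: compact_distribution "emp m n" ?K for n by (rule emp_compact_distribution[OF m])
 have lim: "(%n. \<integral>x. f x \<partial>emp m (s n)) \<longlonglongrightarrow> (\<integral>x. f x \<partial>N)"
  if "!!x. isCont f x" "!!x. norm (f x) <= D" for f :: "real => real" and D
  using weak_conv_imp_integral_bdd_continuous_conv[OF _ N conv that]
  by (auto simp: o_def E.real_distribution_axioms)
 have AE: "AE x in N. 0 <= x & x <= ?K"
 proof -
  \<comment> \<open>A bounded continuous function that vanishes exactly on the interval, so weak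
    convergence transports the support.\<close>
  define f where "f x = min 1 (max 0 (- x) + max 0 (x - ?K))" for x :: real
  have f: "f \<in> borel_measurable borel" "!!x. 0 <= f x" "!!x. norm (f x) <= 1" "!!x. isCont f x"
   unfolding f_def by (auto intro!: continuous_intros)
  have f0: "(\<integral>x. f x \<partial>emp m n) = (\<integral>x. 0 \<partial>emp m n)" for n
   by (intro integral_cong_AE eventually_mono[OF E.supp]) (use f in \<open>auto simp: f_def\<close>)
  have "(%n. 0) \<longlonglongrightarrow> (\<integral>x. f x \<partial>N)" using lim[OF f(4) f(3)] by (simp add: f0)
  then have "(\<integral>x. f x \<partial>N) = 0" by (simp add: LIMSEQ_const_iff)
  moreover have "integrable N f" by (rule N.integrable_const_bound[where B = 1]) (use f in auto)
  ultimately have "AE x in N. f x = 0" using f(2) by (subst (asm) integral_nonneg_eq_0_iff_AE) auto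
  then show ?thesis
   by (rule eventually_mono) (auto simp: f_def min_def max_def split: if_splits)
 qed
 show "compact_distribution N ?K"
  using N AE by (intro compact_distribution.intro compact_distribution_axioms.intro)
 assume y: "y > 0" and v: "0 < v" "v < 1" "v ^ (m + 1) = real m * y * (1 - v)"
 \<comment> \<open>Truncation at 0 makes the kernel bounded and continuous on the whole line and
   changes nothing on the support.\<close>
 define g where "g x = 1 / (y + max 0 x)" for x :: real
 have g: "!!x. isCont g x" "!!x. norm (g x) <= 1 / y"
  unfolding g_def using y by (auto intro!: continuous_intros frac_le simp: abs_if)
 have e: "(\<integral>x. g x \<partial>emp m n) = poly (pderiv (dpoly m (Suc n))) (real (Suc n) * y) / poly (dpoly m (Suc n)) (real (Suc n) * y)" for n
 proof -
  let ?Y = "real (Suc n) * y"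
  have "(\<integral>x. g x \<partial>emp m n) = (\<Sum>j<Suc n. g (droot m (Suc n) j / real (Suc n))) / real (Suc n)"
   by (subst integral_emp)
    (use g(1) in \<open>auto intro!: borel_measurable_continuous_onI continuous_at_imp_continuous_on simp: divide_inverse mult.commute simp del: sum.lessThan_Suc\<close>)
  also have "... = (\<Sum>j<Suc n. 1 / (?Y + droot m (Suc n) j))"
   unfolding sum_divide_distrib
  proof (rule sum.cong[OF refl])
   fix j assume "j \<in> {..<Suc n}"
   then have "droot m (Suc n) j > 0" using droot_pos[OF m] by simp
   then have "g (droot m (Suc n) j / real (Suc n)) = 1 / (y + droot m (Suc n) j / real (Suc n))"
    by (simp add: g_def)
   moreover have "(y + droot m (Suc n) j / real (Suc n)) * real (Suc n) = ?Y + droot m (Suc n) j"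
    by (simp add: distrib_right del: of_nat_Suc)
   ultimately show "g (droot m (Suc n) j / real (Suc n)) / real (Suc n) = 1 / (?Y + droot m (Suc n) j)"
    by (simp only: divide_divide_eq_left)
  qed
  also have "... = poly (pderiv (dpoly m (Suc n))) ?Y / poly (dpoly m (Suc n)) ?Y"
  proof -
   have "?Y > 0" using y by simp
   then have "poly (pderiv (dpoly m (Suc n))) ?Y = poly (dpoly m (Suc n)) ?Y * (\<Sum>j<Suc n. 1 / (?Y + droot m (Suc n) j))"
    by (intro pderiv_prod_linear[OF dpoly_real_eq[OF m]] less_imp_neq[symmetric] add_pos_pos droot_pos[OF m])
   then show ?thesis using dpoly_pos[OF m, of ?Y "Suc n"] \<open>?Y > 0\<close> by simp
  qed
  finally show ?thesis .
 qed
 have "(%n. \<integral>x. g x \<partial>emp m (s n)) \<longlonglongrightarrow> 1 / v ^ m - 1"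
  using LIMSEQ_subseq_LIMSEQ[OF LIMSEQ_Suc[OF dpoly_logderiv_tendsto[OF m y v]] s] by (simp add: e o_def)
 with lim[OF g] have "(\<integral>x. g x \<partial>N) = 1 / v ^ m - 1" by (rule LIMSEQ_unique)
 moreover have "(\<integral>x. g x \<partial>N) = (\<integral>x. 1 / (y + x) \<partial>N)"
  by (intro integral_cong_AE eventually_mono[OF AE]) (auto simp: g_def)
 ultimately show "(\<integral>x. 1 / (y + x) \<partial>N) = 1 / v ^ m - 1" by simp
qed

lemma branch_in_unit_interval:
 assumes "m >= 1" "y > (0::real)"
 shows "\<exists>v. 0 < v & v < 1 & v ^ (m + 1) = real m * y * (1 - v)"
proof -
 have "\<exists>v\<ge>0. v <= 1 & v ^ (m + 1) - real m * y * (1 - v) = 0"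
  using assms by (intro IVT') (auto intro!: continuous_intros)
 then obtain v where v: "0 <= v" "v <= 1" "v ^ (m + 1) - real m * y * (1 - v) = 0" by blast
 moreover have "v ~= 0" "v ~= 1" using v(3) assms by auto
 ultimately show ?thesis by (intro exI[of _ v]) auto
qed

lemma emp_weak_conv:
 assumes m: "m >= 1"
 shows "\<exists>M. compact_distribution M (2 ^ (m + 6)) & weak_conv_m (emp m) M \<and>
  (\<forall>y v. y > 0 --> 0 < v --> v < 1 --> v ^ (m + 1) = real m * y * (1 - v) -->
   (\<integral>x. 1 / (y + x) \<partial>M) = 1 / v ^ m - 1)"
proof -
 interpret E: compact_distribution "emp m n" "2 ^ (m + 6)" for n by (rule emp_compact_distribution[OF m])
 have tight: "tight (emp m)"
  unfolding tight_def
 proof (intro conjI allI impI)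
  fix \<epsilon> :: real assume "\<epsilon> > 0"
  have "measure (emp m n) {-1<..2 ^ (m + 6)} = 1" for n
   by (subst E.prob_eq_1) (auto intro!: eventually_mono[OF E.supp])
  then show "\<exists>a b. a < b & (\<forall>n. 1 - \<epsilon> < measure (emp m n) {a<..b})"
   using \<open>\<epsilon> > 0\<close> by (intro exI[of _ "-1"] exI[of _ "2 ^ (m + 6)"]) (auto simp: less_le_trans[of _ 0])
 qed (rule E.real_distribution_axioms)
 obtain r M where r: "strict_mono (r :: nat => nat)" and M: "real_distribution M"
  and conv: "weak_conv_m (emp m \<circ> id \<circ> r) M"
  using tight_imp_convergent_subsubsequence[OF tight strict_mono_id] by blast
 have convr: "weak_conv_m (emp m \<circ> r) M" using conv by (simp add: o_def)
 interpret M: compact_distribution M "2 ^ (m + 6)" by (rule emp_limit(1)[OF m r M convr])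
 have "weak_conv_m (emp m) M"
 proof (rule tight_subseq_weak_converge[OF E.real_distribution_axioms M tight])
  fix s \<nu> assume s: "strict_mono s" and \<nu>: "real_distribution \<nu>" and c: "weak_conv_m (emp m \<circ> s) \<nu>"
  have "M = \<nu>"
  proof (rule M.eq_of_stieltjes[OF emp_limit(1)[OF m s \<nu> c] order_refl])
   fix y :: real assume y: "y > 0"
   from branch_in_unit_interval[OF m y] obtain v where "0 < v" "v < 1" "v ^ (m + 1) = real m * y * (1 - v)" by blast
   then show "(\<integral>x. 1 / (y + x) \<partial>M) = (\<integral>x. 1 / (y + x) \<partial>\<nu>)"
    using emp_limit(2)[OF m r M convr y] emp_limit(2)[OF m s \<nu> c y] by simp
  qed
  then show "weak_conv_m (emp m \<circ> s) M" using c by simp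
 qed
 then show ?thesis using M.compact_distribution_axioms emp_limit(2)[OF m r M convr] by blast
qed

lemma norm_power_diff_le:
 fixes a c :: complex
 assumes "cmod a <= b" "cmod c <= b"
 shows "cmod (a ^ (m + 1) - c ^ (m + 1)) <= real (m + 1) * b ^ m * cmod (a - c)"
proof -
 have "a ^ (m + 1) - c ^ (m + 1) = (a - c) * (\<Sum>i<m+1. c ^ (m + 1 - Suc i) * a ^ i)"
  by (rule power_diff_sumr2)
 also have "cmod ... = cmod (a - c) * cmod (\<Sum>i<m+1. c ^ (m + 1 - Suc i) * a ^ i)" by (rule norm_mult)
 also have "... <= cmod (a - c) * (\<Sum>i<m+1. b ^ m)"
 proof (rule mult_left_mono[OF sum_norm_le norm_ge_zero])
  fix i assume "i \<in> {..<m+1}"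
  then have i: "i <= m" "m + 1 - Suc i = m - i" by simp_all
  have b: "b >= 0" using assms(1) norm_ge_zero order_trans by blast
  have "cmod (c ^ (m + 1 - Suc i) * a ^ i) <= b ^ (m - i) * b ^ i"
   unfolding norm_mult norm_power i(2) using assms b by (intro mult_mono power_mono) auto
  also have "... = b ^ m" using i by (simp flip: power_add)
  finally show "cmod (c ^ (m + 1 - Suc i) * a ^ i) <= b ^ m" .
 qed
 also have "... = real (m + 1) * b ^ m * cmod (a - c)" by simp
 finally show ?thesis .
qed

section \<open>The branch near infinity and the sharp right edge of the support\<close>

context
 fixes m :: nat
 assumes m: "m >= 1"
begin

text \<open>With Z = 1/(m \<zeta>) the branch equation reads v = 1 + Z v^(m+1). It has a double root
  exactly when also 1 = Z (m+1) v^m, that is at v = \<open>vmax\<close> and Z = \<open>zrad\<close>,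
  which corresponds to \<zeta> = c_edge m.\<close>

abbreviation (input) vmax :: real where "vmax \<equiv> real (m + 1) / real m"
abbreviation (input) zrad :: real where "zrad \<equiv> 1 / (real m * c_edge m)"

lemma c_edge_pos: "c_edge m > 0" using m by (simp add: c_edge_def)

lemma zrad_pos: "zrad > 0" using m c_edge_pos by simp

lemma zrad_eqs: "1 + zrad * vmax ^ (m + 1) = vmax" "zrad * (real (m + 1) * vmax ^ m) = 1"
proof -
 have p: "vmax > 0" using m by simp
 have "zrad * vmax ^ (m + 1) = 1 / real m" using p by (simp add: c_edge_def del: power_Suc)
 then show "1 + zrad * vmax ^ (m + 1) = vmax" using m by (simp only:) (simp add: field_simps)
 have "zrad * (real (m + 1) * vmax ^ m) = (real (m + 1) / real m) * vmax ^ m / vmax ^ (m + 1)"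
  by (simp add: c_edge_def)
 also have "... = 1" using p by (metis divide_self less_irrefl power_Suc Suc_eq_plus1 zero_less_power)
 finally show "zrad * (real (m + 1) * vmax ^ m) = 1" .
qed

text \<open>On the disc of radius \<open>vmax\<close> the map v -> 1 + Z v^(m+1) has Lipschitz
  constant |Z| / zrad.\<close>

lemma branch_unique:
 assumes "cmod Z < zrad" "cmod v <= vmax" "v = 1 + Z * v ^ (m + 1)" "cmod w <= vmax" "w = 1 + Z * w ^ (m + 1)"
 shows "v = w"
proof (rule ccontr)
 assume "v ~= w"
 have "v - w = Z * (v ^ (m + 1) - w ^ (m + 1))" using assms(3,5) by (metis add_diff_cancel_left right_diff_distrib)
 then have "cmod (v - w) <= cmod Z * (real (m + 1) * vmax ^ m * cmod (v - w))"
  using norm_power_diff_le[OF assms(2,4), of m] by (metis mult_left_mono norm_ge_zero norm_mult)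
 also have "... < zrad * (real (m + 1) * vmax ^ m * cmod (v - w))"
  using assms(1) m \<open>v ~= w\<close> by (intro mult_strict_right_mono) auto
 also have "... = cmod (v - w)" by (subst mult.assoc[symmetric]) (simp only: zrad_eqs(2) mult_1)
 finally show False by simp
qed

text \<open>Picard iteration from 1. The iterates stay below \<open>vmax\<close>, the fixed point
  for Z = zrad, and they converge locally uniformly, so the limit is holomorphic.\<close>

lemma branch_exists:
 obtains V where "V holomorphic_on ball 0 zrad" "!!Z. cmod Z < zrad ==> V Z = 1 + Z * V Z ^ (m + 1)"
  "!!Z. cmod Z < zrad ==> cmod (V Z) <= vmax"
proof -
 define f where "f k Z = ((%v. 1 + Z * v ^ (m + 1)) ^^ k) 1" for k :: nat and Z :: complex
 have f0: "f 0 Z = 1" and f_Suc: "f (Suc k) Z = 1 + Z * f k Z ^ (m + 1)" for k Z by (simp_all add: f_def)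
 have hol: "f k holomorphic_on S" for k S
 proof (induction k)
  case 0
  then show ?case using f0 holomorphic_on_const[of 1 S] by (metis (no_types, lifting) holomorphic_cong)
 next
  case (Suc k)
  have "(%Z. 1 + Z * f k Z ^ (m + 1)) holomorphic_on S" by (intro holomorphic_intros Suc)
  then show ?case unfolding f_Suc[abs_def] .
 qed
 have bd: "cmod (f k Z) <= vmax" if Z: "cmod Z <= zrad" for k Z
 proof (induction k)
  case 0
  then show ?case using m by (simp add: f0)
 next
  case (Suc k)
  have "cmod (f (Suc k) Z) <= 1 + cmod Z * cmod (f k Z) ^ (m + 1)"
   unfolding f_Suc by (metis norm_mult norm_one norm_power norm_triangle_ineq)
  also have "... <= 1 + zrad * vmax ^ (m + 1)" using Z Suc zrad_pos by (intro add_left_mono mult_mono power_mono) auto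
  finally show ?case using zrad_eqs(1) by simp
 qed
 have diff: "cmod (f (Suc k) Z - f k Z) <= (cmod Z / zrad) ^ k * cmod Z" if Z: "cmod Z <= zrad" for k Z
 proof (induction k)
  case 0
  then show ?case by (simp add: f0 f_Suc)
 next
  case (Suc k)
  have "f (Suc (Suc k)) Z - f (Suc k) Z = Z * (f (Suc k) Z ^ (m + 1) - f k Z ^ (m + 1))"
   using f_Suc[of "Suc k" Z] f_Suc[of k Z] by (metis add_diff_cancel_left right_diff_distrib)
  then have "cmod (f (Suc (Suc k)) Z - f (Suc k) Z) <= cmod Z * (real (m + 1) * vmax ^ m * cmod (f (Suc k) Z - f k Z))"
   using mult_left_mono[OF norm_power_diff_le[OF bd[OF Z] bd[OF Z], of "Suc k" m k] norm_ge_zero[of Z]]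
   by (simp only: norm_mult)
  also have "real (m + 1) * vmax ^ m = 1 / zrad"
  proof (rule eq_divide_imp)
   show "zrad ~= 0" using zrad_pos by (rule less_imp_neq[symmetric])
   show "real (m + 1) * vmax ^ m * zrad = 1" using zrad_eqs(2) by (simp only: mult.commute)
  qed
  also have "cmod Z * (1 / zrad * cmod (f (Suc k) Z - f k Z)) = (cmod Z / zrad) * cmod (f (Suc k) Z - f k Z)" by simp
  also have "... <= (cmod Z / zrad) * ((cmod Z / zrad) ^ k * cmod Z)"
   using zrad_pos by (intro mult_left_mono Suc) auto
  finally show ?case by simp
 qed
 \<comment> \<open>Written as a telescoping series so that the M-test applies to the
   iterates.\<close>
 define V where "V Z = 1 + (\<Sum>k. f (Suc k) Z - f k Z)" for Z
 have tele: "1 + (\<Sum>k<n. f (Suc k) Z - f k Z) = f n Z" for n Z using sum_lessThan_telescope[of "%k. f k Z" n] by (simp add: f0)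
 have ul: "uniform_limit (cball 0 \<rho>) (%n Z. f n Z) V sequentially" if \<rho>: "0 <= \<rho>" "\<rho> < zrad" for \<rho>
 proof -
  have "uniform_limit (cball 0 \<rho>) (%n Z. \<Sum>k<n. f (Suc k) Z - f k Z) (%Z. \<Sum>k. f (Suc k) Z - f k Z) sequentially"
  proof (rule Weierstrass_m_test[where M = "%k. (\<rho> / zrad) ^ k * \<rho>"])
   fix k Z assume "Z \<in> cball (0::complex) \<rho>"
   then have Z: "cmod Z <= \<rho>" by simp
   then have "cmod (f (Suc k) Z - f k Z) <= (cmod Z / zrad) ^ k * cmod Z" using \<rho> by (intro diff) auto
   also have "... <= (\<rho> / zrad) ^ k * \<rho>" using Z \<rho> zrad_pos by (intro mult_mono power_mono divide_right_mono) auto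
   finally show "cmod (f (Suc k) Z - f k Z) <= (\<rho> / zrad) ^ k * \<rho>" .
  next
   have "norm (\<rho> / zrad) < 1" using \<rho> zrad_pos by (simp add: field_simps)
   then show "summable (%k. (\<rho> / zrad) ^ k * \<rho>)" by (intro summable_mult2 summable_geometric)
  qed
  then have "uniform_limit (cball 0 \<rho>) (%n Z. 1 + (\<Sum>k<n. f (Suc k) Z - f k Z)) (%Z. 1 + (\<Sum>k. f (Suc k) Z - f k Z)) sequentially"
   by (intro uniform_limit_intros)
  then show ?thesis unfolding tele V_def .
 qed
 have ptw: "(%n. f n Z) \<longlonglongrightarrow> V Z" if "cmod Z < zrad" for Z
  using tendsto_uniform_limitI[OF ul[of "cmod Z"], of Z] that by auto
 show ?thesis
 proof (rule that[of V])
  show "V holomorphic_on ball 0 zrad"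
  proof (rule holomorphic_uniform_sequence[OF open_ball hol])
   fix Z assume Z: "Z \<in> ball (0::complex) zrad"
   define d where "d = (zrad - cmod Z) / 2"
   have d: "d > 0" using Z by (simp add: d_def)
   have sub: "cball Z d <= cball 0 (cmod Z + d)"
   proof
    fix x assume "x \<in> cball Z d"
    then have "cmod (x - Z) <= d" by (simp add: dist_norm norm_minus_commute)
    then show "x \<in> cball 0 (cmod Z + d)" using norm_triangle_sub[of x Z] by simp
   qed
   have "cmod Z < zrad" using Z by simp
   moreover have "s + (t - s) / 2 < t" if "s < t" for s t :: real using that by (simp add: field_simps)
   ultimately have lt: "cmod Z + d < zrad" unfolding d_def by blast
   have "cball Z d <= ball 0 zrad"
   proof
    fix x assume "x \<in> cball Z d"
    from subsetD[OF sub this] show "x \<in> ball 0 zrad"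
     unfolding mem_ball mem_cball by (rule le_less_trans[OF _ lt])
   qed
   moreover have "uniform_limit (cball Z d) f V sequentially"
    by (rule uniform_limit_on_subset[OF ul sub]) (use d lt in auto)
   ultimately show "\<exists>d>0. cball Z d <= ball 0 zrad & uniform_limit (cball Z d) f V sequentially" using d by blast
  qed
  fix Z assume Z: "cmod Z < zrad"
  have "(%n. f (Suc n) Z) \<longlonglongrightarrow> 1 + Z * V Z ^ (m + 1)" unfolding f_Suc by (intro tendsto_intros ptw Z)
  with LIMSEQ_Suc[OF ptw[OF Z]] show "V Z = 1 + Z * V Z ^ (m + 1)" by (rule LIMSEQ_unique)
  show "cmod (V Z) <= vmax"
   by (rule tendsto_upperbound[OF tendsto_norm[OF ptw[OF Z]]]) (use bd Z in auto)
 qed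
qed

text \<open>The relation \<open>1 - V^(-m) = Z * (V + ... + V^m)\<close> continues \<open>ct (1/\<xi>) / \<xi>\<close> analytically
 to the disc of radius \<open>1 / c_edge m\<close>; Cauchy's inequalities then bound the moments.\<close>

lemma support_c_edge:
 assumes M: "compact_distribution M B"
  and st: "!!y v. y > 0 ==> 0 < v ==> v < 1 ==> v ^ (m + 1) = real m * y * (1 - v) ==>
   (\<integral>x. 1 / (y + x) \<partial>M) = 1 / v ^ m - 1"
  and ex: "!!y. y > 0 ==> \<exists>v. 0 < v & v < 1 & v ^ (m + 1) = real m * y * (1 - v)"
 shows "AE x in M. 0 <= x & x <= c_edge m"
proof -
 interpret M: compact_distribution M B by fact
 from branch_exists obtain V where V: "V holomorphic_on ball 0 zrad" "!!Z. cmod Z < zrad ==> V Z = 1 + Z * V Z ^ (m + 1)"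
  "!!Z. cmod Z < zrad ==> cmod (V Z) <= vmax" by blast
 let ?c = "c_edge m"
 define W where "W \<xi> = (\<Sum>i=1..m. V (\<xi> / of_nat m) ^ i) / of_nat m" for \<xi>
 have zr: "cmod (\<xi> / of_nat m) < zrad" if "cmod \<xi> < 1 / ?c" for \<xi>
  using that m c_edge_pos by (simp add: norm_divide field_simps)
 have W_hol: "W holomorphic_on ball 0 (1 / ?c)"
  unfolding W_def using m zr
  by (intro holomorphic_intros holomorphic_on_compose_gen[OF _ V(1), unfolded o_def]) auto
 have vm: "vmax >= 1" using m by simp
 have W_bd: "cmod (W \<xi>) <= vmax ^ m" if "cmod \<xi> < 1 / ?c" for \<xi>
 proof -
  have "cmod (\<Sum>i=1..m. V (\<xi> / of_nat m) ^ i) <= (\<Sum>i=1..m. vmax ^ m)"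
  proof (rule sum_norm_le)
   fix i assume i: "i \<in> {1..m}"
   have "cmod (V (\<xi> / of_nat m) ^ i) <= vmax ^ i"
    unfolding norm_power by (intro power_mono V(3) zr that) auto
   also have "... <= vmax ^ m" using i vm by (intro power_increasing) auto
   finally show "cmod (V (\<xi> / of_nat m) ^ i) <= vmax ^ m" .
  qed
  then show ?thesis using m by (simp add: W_def norm_divide field_simps)
 qed
 define B' where "B' = max B (max ?c 1)"
 have B': "B' >= B" "B' >= ?c" "B' >= 1" by (auto simp: B'_def)
 define mom where "mom k = (\<integral>x. x ^ k \<partial>M)" for k :: nat
 \<comment> \<open>For \<xi> other than 0 this is ct(1/\<xi>)/\<xi>, in a form that makes sense at
   0; its Taylor coefficients are the moments.\<close>
 define G where "G \<xi> = (\<integral>x. 1 / (1 - \<xi> * complex_of_real x) \<partial>M)" for \<xi>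
 have G_sums: "(%k. of_real (mom k) * \<xi> ^ k) sums G \<xi>" if \<xi>: "cmod \<xi> < 1 / B'" for \<xi>
 proof -
  define q where "q = cmod \<xi> * B'"
  have q: "q < 1" "q >= 0" using \<xi> B' by (auto simp: q_def field_simps)
  have xq: "cmod (\<xi> * complex_of_real x) <= q" if "0 <= x" "x <= B" for x
   using that B' unfolding q_def norm_mult by (intro mult_left_mono) auto
  have lb: "1 - q <= cmod (1 - \<xi> * complex_of_real x)" if "0 <= x" "x <= B" for x
   using norm_triangle_ineq2[of 1 "\<xi> * complex_of_real x"] xq[OF that] by simp
  have i1: "integrable M (%x. 1 / (1 - \<xi> * complex_of_real x))"
   by (rule M.integrable_bounded[where D = "1 / (1 - q)"]) (use q lb in \<open>auto intro!: norm_inverse_le\<close>)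
  have i2: "integrable M (%x. (\<xi> * complex_of_real x) ^ k)" for k
   by (rule M.integrable_bounded[where D = "q ^ k"]) (use q xq in \<open>auto simp: norm_power intro!: power_mono\<close>)
  have mk: "(\<integral>x. (\<xi> * complex_of_real x) ^ k \<partial>M) = of_real (mom k) * \<xi> ^ k" for k
  proof -
   have "(\<integral>x. (\<xi> * complex_of_real x) ^ k \<partial>M) = (\<integral>x. \<xi> ^ k * complex_of_real (x ^ k) \<partial>M)"
    by (simp add: power_mult_distrib)
   also have "... = \<xi> ^ k * (\<integral>x. complex_of_real (x ^ k) \<partial>M)" by simp
   also have "(\<integral>x. complex_of_real (x ^ k) \<partial>M) = of_real (mom k)" unfolding mom_def by (rule integral_complex_of_real)
   finally show ?thesis by simp
  qed
  have "(%n. (\<Sum>k<n. of_real (mom k) * \<xi> ^ k) - G \<xi>) \<longlonglongrightarrow> 0"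
  proof (rule Lim_null_comparison[OF always_eventually], rule allI)
   fix n
   have "(\<Sum>k<n. of_real (mom k) * \<xi> ^ k) - G \<xi> =
    (\<integral>x. (\<Sum>k<n. (\<xi> * complex_of_real x) ^ k) - 1 / (1 - \<xi> * complex_of_real x) \<partial>M)"
    unfolding G_def using i1 i2 mk by (subst Bochner_Integration.integral_diff) (auto intro!: Bochner_Integration.integrable_sum)
   also have "cmod ... <= q ^ n * (1 / (1 - q))"
   proof (rule M.integrable_bounded(2))
    fix x assume x: "0 <= x" "x <= B"
    let ?u = "\<xi> * complex_of_real x"
    have u1: "1 - ?u ~= 0" using lb[OF x] q by auto
    have "(\<Sum>k<n. ?u ^ k) - 1 / (1 - ?u) = - (?u ^ n * (1 / (1 - ?u)))"
     using u1 by (subst sum_gp_strict) (auto simp: diff_divide_distrib)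
    then have "cmod ((\<Sum>k<n. ?u ^ k) - 1 / (1 - ?u)) = cmod ?u ^ n * cmod (1 / (1 - ?u))"
     by (simp only: norm_minus_cancel norm_mult norm_power)
    also have "... <= q ^ n * (1 / (1 - q))"
     using q xq[OF x] norm_inverse_le[OF _ lb[OF x]] by (intro mult_mono power_mono) auto
    finally show "cmod ((\<Sum>k<n. ?u ^ k) - 1 / (1 - ?u)) <= q ^ n * (1 / (1 - q))" .
   qed simp
   finally show "cmod ((\<Sum>k<n. of_real (mom k) * \<xi> ^ k) - G \<xi>) <= q ^ n * (1 / (1 - q))" .
  next
   show "(%n. q ^ n * (1 / (1 - q))) \<longlonglongrightarrow> 0"
    by (rule tendsto_mult_left_zero[OF LIMSEQ_realpow_zero[OF q(2,1)]])
  qed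
  then show ?thesis unfolding sums_def by (rule LIM_zero_cancel)
 qed
 have G_hol: "G holomorphic_on ball 0 (1 / B')"
  by (rule power_series_holomorphic[where a = "%k. of_real (mom k)"]) (use G_sums in auto)
 \<comment> \<open>A negative \<xi> = -1/y corresponds to the known Stieltjes transform at y, and
   the root v in (0,1) is the value of \<open>V\<close> by \<open>branch_unique\<close>.\<close>
 have GW_real: "G (of_real t) = W (of_real t)" if t: "- 1 / B' < t" "t < 0" for t
 proof -
  define y where "y = - 1 / t"
  have y: "y > B'" "y > 0" "t = - 1 / y" using t B' by (auto simp: y_def field_simps)
  from ex[OF y(2)] obtain v where v: "0 < v" "v < 1" "v ^ (m + 1) = real m * y * (1 - v)" by blast
  let ?Z = "complex_of_real (t / real m)"
  have Z: "cmod ?Z < zrad"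
  proof -
   have "\<bar>t\<bar> < 1 / B'" using t by simp
   also have "... <= 1 / ?c" using B' c_edge_pos by (intro divide_left_mono) auto
   finally show ?thesis using zr[of "of_real t"] by simp
  qed
  have vr: "v = 1 + (t / real m) * v ^ (m + 1)" unfolding v(3) y(3) using m y(2) by (simp add: field_simps)
  have "complex_of_real v = 1 + ?Z * of_real v ^ (m + 1)"
   by (subst vr) (simp only: of_real_add of_real_mult of_real_1 of_real_power)
  moreover have "cmod (of_real v) <= vmax" using v vm by simp
  ultimately have Vv: "V ?Z = of_real v" by (intro branch_unique[OF Z V(3)[OF Z] V(2)[OF Z]])
  have "G (of_real t) = (\<integral>x. complex_of_real (y * (1 / (y + x))) \<partial>M)"
   unfolding G_def
  proof (intro integral_cong_AE eventually_mono[OF M.supp])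
   fix x assume "0 <= x & x <= B"
   then have "y + x > 0" using y by simp
   moreover have "1 - t * x = (y + x) / y" unfolding y(3) using y(2) by (simp add: field_simps)
   ultimately have "1 / (1 - t * x) = y * (1 / (y + x))" by simp
   then show "1 / (1 - of_real t * complex_of_real x) = complex_of_real (y * (1 / (y + x)))"
    by (metis of_real_1 of_real_diff of_real_divide of_real_mult)
  qed auto
  also have "... = of_real (y * (1 / v ^ m - 1))"
   by (simp only: integral_complex_of_real integral_mult_right_zero st[OF y(2) v])
  also have "y * (1 / v ^ m - 1) = (\<Sum>i=1..m. v ^ i) / real m"
  proof -
   have "(\<Sum>i=1..m. v ^ i) = v * (\<Sum>i<m. v ^ i)"
    unfolding sum_distrib_left by (rule sum.reindex_bij_witness[of _ Suc "%i. i - 1"]) (auto simp: power_eq_if)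
   also have "... = v * (1 - v ^ m) / (1 - v)" using v by (subst sum_gp_strict) auto
   also have "... = real m * y * (v * (1 - v ^ m) / v ^ (m + 1))"
    unfolding v(3) using m y v by (simp add: field_simps)
   also have "v * (1 - v ^ m) / v ^ (m + 1) = 1 / v ^ m - 1" using v by (simp add: field_simps)
   finally show ?thesis using m by simp
  qed
  also have "of_real ((\<Sum>i=1..m. v ^ i) / real m) = W (of_real t)" using Vv by (simp add: W_def)
  finally show ?thesis .
 qed
 have rad: "1 / B' <= 1 / ?c" using B' c_edge_pos by (intro divide_left_mono) auto
 have GW: "G \<xi> = W \<xi>" if \<xi>: "cmod \<xi> < 1 / B'" for \<xi>
 proof -
  have "G \<xi> - W \<xi> = 0"
  proof (rule analytic_continuation[of "%\<xi>. G \<xi> - W \<xi>" "ball 0 (1 / B')" "complex_of_real ` {- 1 / B'<..<0}" 0])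
   show "(%\<xi>. G \<xi> - W \<xi>) holomorphic_on ball 0 (1 / B')"
    by (intro holomorphic_intros G_hol holomorphic_on_subset[OF W_hol]) (use rad in auto)
   show "complex_of_real ` {- 1 / B'<..<0} <= ball 0 (1 / B')" using B' by auto
   show "0 islimpt complex_of_real ` {- 1 / B'<..<0}"
    unfolding islimpt_approachable
   proof (intro allI impI)
    fix e :: real assume "e > 0"
    have "min e (1 / B') > 0" using B' \<open>e > 0\<close> by simp
    then obtain u where u: "0 < u" "u < min e (1 / B')" using dense by blast
    define t where "t = - u"
    have "t \<in> {- 1 / B'<..<0}" "\<bar>t\<bar> < e" using u by (auto simp: t_def)
    then show "\<exists>x'\<in>complex_of_real ` {- 1 / B'<..<0}. x' ~= 0 & dist x' 0 < e" by (intro bexI[of _ "of_real t"]) auto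
   qed
  qed (use \<xi> GW_real B' in \<open>auto simp: \<open>cmod \<xi> < 1 / B'\<close>\<close>)
  then show ?thesis by simp
 qed
 have fps: "W has_fps_expansion Abs_fps (%k. of_real (mom k))"
  unfolding has_fps_expansion_def
 proof
  have "cmod (of_real (1 / (2 * B'))) < 1 / B'" unfolding norm_of_real using B' by (simp add: field_simps)
  from sums_summable[OF G_sums[OF this]]
  have "summable (%k. of_real (mom k) * (of_real (1 / (2 * B')) :: complex) ^ k)" .
  then have "conv_radius (%k. complex_of_real (mom k)) >= norm (of_real (1 / (2 * B')) :: complex)" by (rule conv_radius_geI)
  moreover have "ereal (norm (of_real (1 / (2 * B')) :: complex)) > 0" using B' by simp
  ultimately show "fps_conv_radius (Abs_fps (%k. complex_of_real (mom k))) > 0"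
   unfolding fps_conv_radius_def fps_nth_Abs_fps by (rule less_le_trans[rotated])
  have "\<forall>\<^sub>F z in nhds 0. z \<in> ball (0::complex) (1 / B')" using B' by (intro eventually_nhds_in_open) auto
  then show "\<forall>\<^sub>F z in nhds 0. eval_fps (Abs_fps (%k. complex_of_real (mom k))) z = W z"
   by eventually_elim (use G_sums GW in \<open>auto simp: eval_fps_def sums_iff\<close>)
 qed
 \<comment> \<open>\<open>W\<close> is holomorphic on the disc of radius 1 / c_edge m, which may be
   larger than the disc on which \<open>G\<close> was expanded; Cauchy's inequality therefore bounds
   the moments at every smaller radius 1/c'.\<close>
 have mom_bd: "mom k <= vmax ^ m * c' ^ k" if c': "c' > ?c" for k c'
 proof -
  have c0: "c' > 0" using c' c_edge_pos by simp
  have r: "1 / c' < 1 / ?c" using c' c_edge_pos by (simp add: frac_less2)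
  have "complex_of_real (mom k) = (deriv ^^ k) W 0 / fact k"
   using fps_nth_fps_expansion[OF fps, of k] by simp
  moreover have "cmod ((deriv ^^ k) W 0) <= fact k * vmax ^ m / (1 / c') ^ k"
  proof (rule Cauchy_inequality)
   show "W holomorphic_on ball 0 (1 / c')" by (rule holomorphic_on_subset[OF W_hol]) (use r in auto)
   show "continuous_on (cball 0 (1 / c')) W"
    by (rule holomorphic_on_imp_continuous_on[OF holomorphic_on_subset[OF W_hol]]) (use r in auto)
  qed (use c0 r W_bd in auto)
  ultimately have "cmod (complex_of_real (mom k)) <= (fact k * vmax ^ m / (1 / c') ^ k) / fact k"
   by (simp only: norm_divide norm_fact divide_right_mono fact_ge_zero)
  then have "\<bar>mom k\<bar> <= vmax ^ m * c' ^ k" by (simp add: power_divide)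
  then show ?thesis by simp
 qed
 have le: "AE x in M. x <= ?c + 1 / real (Suc n)" for n
 proof -
  define c1 where "c1 = ?c + 1 / real (Suc n)"
  define c2 where "c2 = ?c + 1 / (2 * real (Suc n))"
  have "c2 > ?c" "c2 < c1" by (auto simp: c1_def c2_def field_simps)
  then have c: "c2 > ?c" "c2 < c1" "c2 > 0" using c_edge_pos by auto
  \<comment> \<open>Markov's inequality for the k-th moment; since c2 < c1 the bound tends to 0 as k
    grows.\<close>
  have "M.prob {c1<..} <= vmax ^ m * (c2 / c1) ^ k" for k
  proof -
   have "c1 ^ k * M.prob {c1<..} = (\<integral>x. c1 ^ k * indicator {c1<..} x \<partial>M)" by simp
   also have "... <= mom k"
    unfolding mom_def
   proof (rule integral_mono_AE)
    show "integrable M (%x. x ^ k)"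
     by (rule M.integrable_bounded[where D = "B ^ k"]) (auto simp: power_abs intro!: power_mono)
    show "AE x in M. c1 ^ k * indicat_real {c1<..} x <= x ^ k"
     using c by (intro eventually_mono[OF M.supp]) (auto simp: indicator_def intro!: power_mono)
   qed (auto intro!: integrable_mult_right M.integrable_const_bound[where B = 1])
   also have "... <= vmax ^ m * c2 ^ k" by (rule mom_bd[OF c(1)])
   finally have "M.prob {c1<..} <= vmax ^ m * c2 ^ k / c1 ^ k"
    using c by (subst pos_le_divide_eq) (simp_all add: mult.commute)
   then show ?thesis by (simp add: power_divide)
  qed
  moreover have "(%k. vmax ^ m * (c2 / c1) ^ k) \<longlonglongrightarrow> vmax ^ m * 0"
   using c by (intro tendsto_intros LIMSEQ_realpow_zero) auto
  ultimately have "M.prob {c1<..} <= 0" by (intro LIMSEQ_le_const) auto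
  then have "M.prob {c1<..} = 0" by (simp add: measure_le_0_iff)
  then have "AE x in M. x \<notin> {c1<..}" by (subst (asm) M.prob_eq_0) auto
  then show ?thesis by (rule eventually_mono) (auto simp: c1_def)
 qed
 have "AE x in M. \<forall>n. x <= ?c + 1 / real (Suc n)" using le by (subst AE_all_countable) auto
 then show ?thesis
 proof (rule eventually_elim2[OF M.supp])
  fix x assume x: "0 <= x & x <= B" "\<forall>n. x <= ?c + 1 / real (Suc n)"
  have "(%n. ?c + 1 / real (Suc n)) \<longlonglongrightarrow> ?c + 0" by (intro tendsto_intros LIMSEQ_Suc[OF lim_1_over_n])
  then have "x <= ?c + 0" by (rule LIMSEQ_le_const) (use x in auto)
  then show "0 <= x & x <= ?c" using x by simp
 qed
qed

end

subsection \<open>Identification of the limit distribution\<close>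

lemma Im_of_real_mult: "Im (of_real r * w) = r * Im w"
 by simp

lemma sin_pi_div_ge:
 assumes N: "N >= (2::nat)"
 shows "sin (pi / real N) >= 1 / real N"
proof (cases "N = 2")
 case False
 with N have N3: "real N >= 3" by simp
 define x where "x = pi / real N"
 have x: "0 <= x" "x <= pi / 3" unfolding x_def using N3 by (simp, intro divide_left_mono) auto
 have "sin 0 - 0 / 2 <= sin x - x / 2"
 proof (rule DERIV_nonneg_imp_nondecreasing[OF x(1)])
  fix t assume t: "0 <= t" "t <= x"
  have "cos (pi / 3) <= cos t" by (rule cos_monotone_0_pi_le) (use t x in auto)
  then show "\<exists>y. ((%t. sin t - t / 2) has_real_derivative y) (at t) & 0 <= y"
   by (intro exI[of _ "cos t - 1 / 2"] conjI) (auto intro!: derivative_eq_intros simp: cos_60)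
 qed
 then have "x / 2 <= sin x" by simp
 moreover have "1 / real N <= x / 2"
  unfolding x_def using pi_ge_two N3 by (simp add: field_simps)
 ultimately show ?thesis by (simp add: x_def)
qed simp

locale limit_distribution = compact_distribution M "c_edge m" for M m +
 assumes m: "m >= 1"
 assumes st: "y > 0 ==> 0 < v ==> v < 1 ==> v ^ (m + 1) = real m * y * (1 - v) ==>
   (\<integral>x. 1 / (y + x) \<partial>M) = 1 / v ^ m - 1"
begin

abbreviation (input) cut :: "complex set" where "cut \<equiv> complex_of_real ` {0..c_edge m}"

text \<open>From ct = 1 - v^(-m) and the branch equation, m \<zeta> (1 - ct) = v/(v - 1). Solving
  for v gives a rational expression in \<open>ct\<close>, so no root has to be extracted to define
  the branch.\<close>

definition A :: "complex => complex" where "A \<zeta> = of_nat m * \<zeta> * (1 - ct \<zeta>)"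
definition v :: "complex => complex" where "v \<zeta> = A \<zeta> / (A \<zeta> - 1)"

lemma c_pos: "c_edge m > 0" using m by (rule c_edge_pos)

lemma ct_real:
 assumes "y > 0"
 shows "ct (of_real (- y)) = - of_real (\<integral>x. 1 / (y + x) \<partial>M)"
proof -
 have "ct (of_real (- y)) = (\<integral>x. complex_of_real (- (1 / (y + x))) \<partial>M)"
  unfolding ct_def
 proof (intro integral_cong_AE eventually_mono[OF supp])
  fix x assume "0 <= x & x <= c_edge m"
  then have "y + x > 0" using assms by simp
  then have "1 / (- y - x) = - (1 / (y + x))" by (simp add: field_simps)
  then show "1 / (of_real (- y) - complex_of_real x) = complex_of_real (- (1 / (y + x)))"
   by (metis of_real_1 of_real_diff of_real_divide)
 qed auto
 also have "... = of_real (\<integral>x. - (1 / (y + x)) \<partial>M)" by (rule integral_complex_of_real)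
 finally show ?thesis by simp
qed

lemma A_hol: "A holomorphic_on - cut"
 unfolding A_def
 by (intro holomorphic_on_mult holomorphic_on_diff holomorphic_on_const holomorphic_on_ident ct_holomorphic)

lemma cut_complement: "open (- cut)" "connected (- cut)"
proof -
 show "open (- cut)" using closed_segm by auto
 have "convex cut" by (intro convex_linear_image) (auto simp: linear_of_real)
 moreover have "bounded cut" by (intro compact_imp_bounded compact_continuous_image continuous_intros) auto
 ultimately show "connected (- cut)" by (intro connected_complement_bounded_convex) auto
qed

lemma neg_notin_cut: "y > 0 ==> complex_of_real (- y) \<notin> cut"
 by (metis atLeastAtMost_iff imageE neg_le_0_iff_le not_le of_real_eq_iff order.strict_implies_order order_less_irrefl
   order_less_le_trans neg_less_0_iff_less)

text \<open>With v = A/(A - 1) this is v^(-m) = 1 - ct with denominators cleared. It holds on the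
  negative axis, where the root u in (0,1) is the value of v, and extends to the slit plane by
  analytic continuation.\<close>

lemma A_identity:
 assumes "\<zeta> \<notin> cut"
 shows "A \<zeta> ^ m * (1 - ct \<zeta>) = (A \<zeta> - 1) ^ m"
proof -
 have "A \<zeta> ^ m * (1 - ct \<zeta>) - (A \<zeta> - 1) ^ m = 0"
 proof (rule analytic_continuation[of "%\<zeta>. A \<zeta> ^ m * (1 - ct \<zeta>) - (A \<zeta> - 1) ^ m" "- cut" "(%y. complex_of_real (- y)) ` {0<..}" "of_real (- 1)"])
  show "(%\<zeta>. A \<zeta> ^ m * (1 - ct \<zeta>) - (A \<zeta> - 1) ^ m) holomorphic_on - cut"
   by (intro holomorphic_on_mult holomorphic_on_diff holomorphic_on_power holomorphic_on_const A_hol ct_holomorphic)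
  show "(%y. complex_of_real (- y)) ` {0<..} <= - cut" using neg_notin_cut by auto
  show "complex_of_real (- 1) \<in> - cut" using neg_notin_cut[of 1] by simp
  show "complex_of_real (- 1) islimpt (%y. complex_of_real (- y)) ` {0<..}"
   unfolding islimpt_approachable
  proof (intro allI impI)
   fix e :: real assume "e > 0"
   have d: "complex_of_real (- (1 + e / 2)) - complex_of_real (- 1) = of_real (- (e / 2))"
    by (subst of_real_diff[symmetric]) simp
   have "dist (complex_of_real (- (1 + e / 2))) (complex_of_real (- 1)) = e / 2"
    unfolding dist_norm d norm_of_real using \<open>e > 0\<close> by simp
   moreover have "complex_of_real (- (1 + e / 2)) \<in> (%y. complex_of_real (- y)) ` {0<..}"
    by (rule imageI) (use \<open>e > 0\<close> in simp)
   ultimately show "\<exists>x'\<in>(%y. complex_of_real (- y)) ` {0<..}. x' ~= complex_of_real (- 1) & dist x' (complex_of_real (- 1)) < e"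
    using \<open>e > 0\<close> by (intro bexI[of _ "complex_of_real (- (1 + e / 2))"]) (auto simp del: of_real_minus of_real_add)
  qed
 next
  fix z assume "z \<in> (%y. complex_of_real (- y)) ` {0<..}"
  then obtain y where y: "y > 0" "z = of_real (- y)" by auto
  from branch_in_unit_interval[OF m y(1)] obtain u where u: "0 < u" "u < 1" "u ^ (m + 1) = real m * y * (1 - u)" by blast
  have C: "1 - ct z = of_real (1 / u ^ m)" unfolding y(2) ct_real[OF y(1)] st[OF y(1) u] by simp
  have B: "- real m * y * (1 / u ^ m) = - (u / (1 - u))"
   using u y m by (simp add: field_simps)
  have "A z = of_nat m * z * of_real (1 / u ^ m)" by (simp only: A_def C)
  also have "... = of_real (- real m * y * (1 / u ^ m))" by (simp add: y(2))
  finally have "A z = of_real (- real m * y * (1 / u ^ m))" .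
  then have A: "A z = of_real (- (u / (1 - u)))" by (simp only: B)
  have "(- (u / (1 - u))) ^ m * (1 / u ^ m) = (- (u / (1 - u)) - 1) ^ m"
  proof -
   have 1: "- (u / (1 - u)) - 1 = - (1 / (1 - u))" using u by (simp add: field_simps)
   have "(- (u / (1 - u))) ^ m = u ^ m * (- (1 / (1 - u))) ^ m"
    by (simp flip: power_mult_distrib)
   then show ?thesis unfolding 1 using u by simp
  qed
  then show "A z ^ m * (1 - ct z) - (A z - 1) ^ m = 0"
   unfolding A C by (metis eq_iff_diff_eq_0 of_real_1 of_real_diff of_real_mult of_real_power)
 qed (use assms cut_complement in auto)
 then show ?thesis by simp
qed

text \<open>By \<open>A_identity\<close>: ct = 1 forces A = 0 and then 0 = (-1)^m, while A = 1
  forces 1 - ct = 0.\<close>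

lemma nonzero:
 assumes \<zeta>: "\<zeta> \<notin> cut"
 shows "1 - ct \<zeta> ~= 0" "A \<zeta> ~= 1" "\<zeta> ~= 0"
proof -
 show z: "\<zeta> ~= 0"
 proof
  assume "\<zeta> = 0"
  then have "\<zeta> = complex_of_real 0" by simp
  then show False using \<zeta> c_pos by (metis atLeastAtMost_iff imageI less_imp_le order_refl)
 qed
 show C: "1 - ct \<zeta> ~= 0"
 proof
  assume "1 - ct \<zeta> = 0"
  then have "A \<zeta> = 0" "A \<zeta> ^ m * (1 - ct \<zeta>) = 0" by (simp_all only: A_def mult_zero_right)
  with A_identity[OF \<zeta>] show False by simp
 qed
 show "A \<zeta> ~= 1"
 proof
  assume "A \<zeta> = 1"
  with A_identity[OF \<zeta>] m have "1 - ct \<zeta> = 0" by simp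
  with C show False by blast
 qed
qed

lemma v_props:
 assumes \<zeta>: "\<zeta> \<notin> cut"
 shows "v \<zeta> ^ (m + 1) = of_nat m * \<zeta> * (v \<zeta> - 1)" "ct \<zeta> = 1 - 1 / v \<zeta> ^ m" "v \<zeta> - 1 = 1 / (A \<zeta> - 1)" "v \<zeta> ~= 0"
proof -
 note nz = nonzero[OF \<zeta>]
 have A0: "A \<zeta> ~= 0" using nz m by (simp add: A_def)
 then show "v \<zeta> ~= 0" using nz by (simp add: v_def)
 have "v \<zeta> ^ m = A \<zeta> ^ m / (A \<zeta> ^ m * (1 - ct \<zeta>))"
  unfolding A_identity[OF \<zeta>] by (simp add: v_def power_divide)
 then have vm: "v \<zeta> ^ m = 1 / (1 - ct \<zeta>)" using A0 by simp
 then show "ct \<zeta> = 1 - 1 / v \<zeta> ^ m" by simp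
 show v1: "v \<zeta> - 1 = 1 / (A \<zeta> - 1)" using nz by (simp add: v_def field_simps)
 have "v \<zeta> ^ (m + 1) = v \<zeta> / (1 - ct \<zeta>)" using vm by simp
 also have "... = of_nat m * \<zeta> / (A \<zeta> - 1)" unfolding v_def using nz by (simp add: A_def)
 finally show "v \<zeta> ^ (m + 1) = of_nat m * \<zeta> * (v \<zeta> - 1)" using v1 by simp
qed

lemma v_hol: "v holomorphic_on - cut"
 unfolding v_def using nonzero(2)
 by (intro holomorphic_on_divide holomorphic_on_diff holomorphic_on_const A_hol) auto

text \<open>The expansion at infinity with explicit constants. It serves the O-clause of
  \<open>v_branch\<close>, the uniqueness of the branch, and the choice of a base point in the upper
  half-plane.\<close>

lemma v_near_infinity:
 assumes \<zeta>: "cmod \<zeta> >= 2 * c_edge m + 8"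
 shows "\<zeta> \<notin> cut" "cmod (v \<zeta> - 1) <= 4 / cmod \<zeta>" "cmod (v \<zeta>) <= 2"
  "cmod (v \<zeta> - (1 + 1 / (of_nat m * \<zeta>))) <= (real (m + 1) * 2 ^ m * 4) * cmod (1 / \<zeta>\<^sup>2)"
proof -
 show nc: "\<zeta> \<notin> cut" using \<zeta> c_pos by auto
 have C: "cmod (ct \<zeta>) <= 1 / 4"
  unfolding ct_def
 proof (rule integrable_bounded(2))
  fix x assume x: "0 <= x" "x <= c_edge m"
  have "4 <= cmod (\<zeta> - complex_of_real x)"
   using norm_triangle_ineq2[of \<zeta> "complex_of_real x"] \<zeta> x c_pos by simp
  then show "cmod (1 / (\<zeta> - complex_of_real x)) <= 1 / 4" by (intro norm_inverse_le) auto
 qed simp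
 have "cmod (1 - ct \<zeta>) >= 3 / 4" using norm_triangle_ineq2[of 1 "ct \<zeta>"] C by simp
 moreover have "1 * cmod \<zeta> <= real m * cmod \<zeta>" using m by (intro mult_right_mono) auto
 ultimately have "cmod \<zeta> * (3 / 4) <= cmod (A \<zeta>)"
  unfolding A_def norm_mult norm_of_nat by (intro mult_mono) auto
 then have "cmod \<zeta> / 4 <= cmod (A \<zeta> - 1)"
  using norm_triangle_ineq2[of "A \<zeta>" 1] \<zeta> c_pos by simp
 then have "cmod (1 / (A \<zeta> - 1)) <= 1 / (cmod \<zeta> / 4)" using \<zeta> c_pos by (intro norm_inverse_le) auto
 then show v1: "cmod (v \<zeta> - 1) <= 4 / cmod \<zeta>" unfolding v_props(3)[OF nc] by simp
 also have "... <= 1"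
 proof -
  have "cmod \<zeta> >= 8" using \<zeta> c_pos by linarith
  then show ?thesis by (simp add: divide_le_eq)
 qed
 finally show v2: "cmod (v \<zeta>) <= 2" using norm_triangle_sub[of "v \<zeta>" 1] unfolding norm_one by linarith
 have z0: "\<zeta> ~= 0" using nonzero nc by blast
 have "v \<zeta> - 1 = v \<zeta> ^ (m + 1) / (of_nat m * \<zeta>)" using v_props(1)[OF nc] m z0 by (simp add: field_simps)
 then have "v \<zeta> - (1 + 1 / (of_nat m * \<zeta>)) = (v \<zeta> ^ (m + 1) - 1 ^ (m + 1)) / (of_nat m * \<zeta>)"
  by (simp add: diff_divide_distrib)
 also have "cmod ... <= (real (m + 1) * 2 ^ m * cmod (v \<zeta> - 1)) / (real m * cmod \<zeta>)"
  unfolding norm_divide norm_mult[of "of_nat m"] norm_of_nat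
  by (intro divide_right_mono norm_power_diff_le v2) auto
 also have "... <= (real (m + 1) * 2 ^ m * (4 / cmod \<zeta>)) / (1 * cmod \<zeta>)"
  using v1 m z0 by (intro frac_le mult_left_mono mult_right_mono mult_nonneg_nonneg) auto
 also have "... = (real (m + 1) * 2 ^ m * 4) * cmod (1 / \<zeta>\<^sup>2)"
  by (simp add: norm_divide norm_mult power2_eq_square)
 finally show "cmod (v \<zeta> - (1 + 1 / (of_nat m * \<zeta>))) <= (real (m + 1) * 2 ^ m * 4) * cmod (1 / \<zeta>\<^sup>2)" .
qed

lemma v_branch_v: "v_branch m v"
 unfolding v_branch_def
proof (intro conjI ballI)
 show "v holomorphic_on - cut" by (rule v_hol)
 show "v \<zeta> ^ (m + 1) = of_nat m * \<zeta> * (v \<zeta> - 1)" if "\<zeta> \<in> - cut" for \<zeta> using v_props that by simp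
 have "\<forall>\<^sub>F \<zeta> in at_infinity. cmod (v \<zeta> - (1 + 1 / (of_nat m * \<zeta>))) <= (real (m + 1) * 2 ^ m * 4) * cmod (1 / \<zeta>\<^sup>2)"
  unfolding eventually_at_infinity using v_near_infinity(4) by blast
 then show "(%\<zeta>. v \<zeta> - (1 + 1 / (of_nat m * \<zeta>))) \<in> O[at_infinity](%\<zeta>. 1 / \<zeta>\<^sup>2)" by (rule bigoI)
qed

text \<open>Near infinity both branches have modulus at most 2, where v^(m+1) has a fixed Lipschitz
  constant; for large \<zeta> the factor m |\<zeta>| exceeds it, so the equation has only one such
  root.\<close>

lemma v_branch_eventually_eq:
 assumes "v_branch m u"
 shows "\<exists>R>0. \<forall>\<zeta>. cmod \<zeta> >= R --> u \<zeta> = v \<zeta>"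
proof -
 have "(%\<zeta>. u \<zeta> - (1 + 1 / (of_nat m * \<zeta>))) \<in> O[at_infinity](%\<zeta>. 1 / \<zeta>\<^sup>2)"
  using assms by (simp add: v_branch_def)
 then obtain K where K: "K > 0" "\<forall>\<^sub>F \<zeta> in at_infinity. cmod (u \<zeta> - (1 + 1 / (of_nat m * \<zeta>))) <= K * cmod (1 / \<zeta>\<^sup>2)"
  by (elim landau_o.bigE) auto
 then obtain R where R: "!!\<zeta>. cmod \<zeta> >= R ==> cmod (u \<zeta> - (1 + 1 / (of_nat m * \<zeta>))) <= K * cmod (1 / \<zeta>\<^sup>2)"
  unfolding eventually_at_infinity by blast
 define R' where "R' = Max {R, 2 * c_edge m + 8, K + 2, real (m + 1) * 2 ^ m + 1}"
 have R': "R <= R'" "2 * c_edge m + 8 <= R'" "K + 2 <= R'" "real (m + 1) * 2 ^ m + 1 <= R'" by (auto simp: R'_def)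
 have "u \<zeta> = v \<zeta>" if \<zeta>: "cmod \<zeta> >= R'" for \<zeta>
 proof (rule ccontr)
  assume ne: "u \<zeta> ~= v \<zeta>"
  have nc: "\<zeta> \<notin> cut" and v2: "cmod (v \<zeta>) <= 2" using v_near_infinity[of \<zeta>] \<zeta> R' by auto
  have z1: "cmod \<zeta> >= K + 2" "cmod \<zeta> >= 2" using \<zeta> R' K by auto
  have "K * cmod (1 / \<zeta>\<^sup>2) <= 1 / 2"
  proof -
   have "2 * K <= 2 * cmod \<zeta>" using z1 by simp
   also have "... <= cmod \<zeta> * cmod \<zeta>" using z1 by (intro mult_right_mono) auto
   finally have "2 * K <= cmod \<zeta> * cmod \<zeta>" .
   moreover have "cmod (1 / \<zeta>\<^sup>2) = 1 / (cmod \<zeta> * cmod \<zeta>)"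
    by (simp add: norm_divide norm_mult power2_eq_square)
   moreover have "cmod \<zeta> * cmod \<zeta> > 0" by (rule mult_pos_pos) (use z1 in linarith)+
   ultimately show ?thesis by (simp add: field_simps)
  qed
  moreover have "cmod (1 / (of_nat m * \<zeta>)) <= 1 / 2"
  proof (rule norm_inverse_le)
   have "1 * 2 <= real m * cmod \<zeta>" using m z1 by (intro mult_mono) auto
   then show "2 <= cmod (of_nat m * \<zeta>)" by (simp add: norm_mult)
  qed simp
  ultimately have "cmod (u \<zeta>) <= 2"
   using R[of \<zeta>] \<zeta> R'(1) norm_triangle_sub[of "u \<zeta>" "1 + 1 / (of_nat m * \<zeta>)"] norm_triangle_ineq[of 1 "1 / (of_nat m * \<zeta>)"] by simp
  have "u \<zeta> ^ (m + 1) = of_nat m * \<zeta> * (u \<zeta> - 1)" using assms nc by (simp add: v_branch_def)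
  with v_props(1)[OF nc] have "of_nat m * \<zeta> * (u \<zeta> - v \<zeta>) = u \<zeta> ^ (m + 1) - v \<zeta> ^ (m + 1)"
   by (simp only: right_diff_distrib) simp
  then have "real m * cmod \<zeta> * cmod (u \<zeta> - v \<zeta>) = cmod (u \<zeta> ^ (m + 1) - v \<zeta> ^ (m + 1))"
   by (metis norm_mult norm_of_nat)
  also have "... <= real (m + 1) * 2 ^ m * cmod (u \<zeta> - v \<zeta>)" by (rule norm_power_diff_le) fact+
  finally have "real m * cmod \<zeta> <= real (m + 1) * 2 ^ m" using ne by simp
  moreover have "1 * cmod \<zeta> <= real m * cmod \<zeta>" using m by (intro mult_right_mono) auto
  ultimately show False using \<zeta> R' by simp
 qed
 moreover have "R' > 0" using R' c_pos by simp
 ultimately show ?thesis by blast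
qed

lemma restrict_prob: "prob_space (restrict_space M {0..c_edge m})"
proof (rule prob_spaceI)
 have "emeasure M {0..c_edge m} = 1" by (rule emeasure_eq_1_AE) (use supp in auto)
 then show "emeasure (restrict_space M {0..c_edge m}) (space (restrict_space M {0..c_edge m})) = 1"
  by (subst emeasure_restrict_space) (auto simp: space_restrict_space)
qed

lemma integral_restrict:
 fixes f :: "real => 'b::{banach, second_countable_topology}"
 assumes "f \<in> borel_measurable borel"
 shows "(\<integral>x. f x \<partial>restrict_space M {0..c_edge m}) = (\<integral>x. f x \<partial>M)"
proof -
 have "(\<integral>x. f x \<partial>restrict_space M {0..c_edge m}) = (\<integral>x. indicator {0..c_edge m} x *\<^sub>R f x \<partial>M)"
  by (rule integral_restrict_space) simp
 also have "... = (\<integral>x. f x \<partial>M)"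
  using assms by (intro integral_cong_AE eventually_mono[OF supp]) auto
 finally show ?thesis .
qed

text \<open>The definite description is resolved by \<open>M\<close> cut down to the interval. For
  uniqueness a candidate is moved to the real line; its branch agrees with \<open>v\<close> near
  infinity, so the Stieltjes transforms agree for large y and \<open>eq_of_stieltjes\<close>
  applies.\<close>

lemma mu_eq: "mu m = restrict_space M {0..c_edge m}"
 unfolding mu_def
proof (rule the_equality)
 let ?R = "restrict_space M {0..c_edge m}"
 have "cauchy_transform ?R \<zeta> = 1 - 1 / v \<zeta> ^ m" if "\<zeta> \<in> - cut" for \<zeta>
  using v_props(2)[of \<zeta>] that unfolding cauchy_transform_def ct_def by (subst integral_restrict) auto
 then show "prob_space ?R & sets ?R = sets (restrict_space borel {0..c_edge m}) \<and>
  (\<exists>v. v_branch m v & (\<forall>\<zeta>\<in>- cut. cauchy_transform ?R \<zeta> = 1 - 1 / v \<zeta> ^ m))"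
  using restrict_prob v_branch_v by (auto intro!: restrict_space_sets_cong)
next
 fix N
 assume N: "prob_space N & sets N = sets (restrict_space borel {0..c_edge m}) \<and>
  (\<exists>v. v_branch m v & (\<forall>\<zeta>\<in>- cut. cauchy_transform N \<zeta> = 1 - 1 / v \<zeta> ^ m))"
 then obtain u where u: "v_branch m u" "!!\<zeta>. \<zeta> \<notin> cut ==> cauchy_transform N \<zeta> = 1 - 1 / u \<zeta> ^ m" by auto
 interpret N: prob_space N using N by simp
 have sN: "sets N = sets (restrict_space borel {0..c_edge m})" using N by simp
 have spN: "space N = {0..c_edge m}" using sets_eq_imp_space_eq[OF sN] by (simp add: space_restrict_space)
 have meas: "f \<in> borel_measurable N" if "f \<in> borel_measurable borel" for f :: "real => 'c::topological_space"
  unfolding measurable_cong_sets[OF sN refl] using that by (rule measurable_restrict_space1)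
 \<comment> \<open>The candidate as a measure on the whole line, as \<open>eq_of_stieltjes\<close>
   expects.\<close>
 define P where "P = distr N borel (%x. x)"
 have id: "(%x. x) \<in> borel_measurable N" by (rule meas) simp
 have "AE x in P. 0 <= x & x <= c_edge m"
  unfolding P_def by (subst AE_distr_iff[OF id]) (auto simp: spN intro!: AE_I2)
 moreover have "real_distribution P" unfolding P_def by (rule N.real_distribution_distr[OF id])
 ultimately have cP: "compact_distribution P (c_edge m)"
  by (intro compact_distribution.intro compact_distribution_axioms.intro)
 obtain R where R: "R > 0" "!!\<zeta>. cmod \<zeta> >= R ==> u \<zeta> = v \<zeta>" using v_branch_eventually_eq[OF u(1)] by blast
 have "M = P"
 proof (rule eq_of_stieltjes[OF cP less_imp_le[OF R(1)]])
  fix y assume y: "y > R"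
  then have y0: "y > 0" using R by simp
  let ?z = "complex_of_real (- y)"
  have nc: "?z \<notin> cut" by (rule neg_notin_cut[OF y0])
  have "u ?z = v ?z" using R(2)[of ?z] y by simp
  then have "cauchy_transform N ?z = ct ?z" using u(2)[OF nc] v_props(2)[OF nc] by simp
  moreover have "cauchy_transform N ?z = - of_real (\<integral>x. 1 / (y + x) \<partial>P)"
  proof -
   have "cauchy_transform N ?z = (\<integral>x. complex_of_real (- (1 / (y + x))) \<partial>N)"
    unfolding cauchy_transform_def
   proof (rule Bochner_Integration.integral_cong[OF refl])
    fix x assume "x \<in> space N"
    then have "y + x > 0" using y0 by (simp add: spN)
    then have "1 / (- y - x) = - (1 / (y + x))" by (simp add: field_simps)
    then show "1 / (?z - complex_of_real x) = complex_of_real (- (1 / (y + x)))"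
     by (metis of_real_1 of_real_diff of_real_divide)
   qed
   also have "... = - of_real (\<integral>x. 1 / (y + x) \<partial>N)" by (simp only: integral_complex_of_real integral_minus of_real_minus)
   also have "(\<integral>x. 1 / (y + x) \<partial>N) = (\<integral>x. 1 / (y + x) \<partial>P)"
    unfolding P_def by (subst integral_distr[OF id]) auto
   finally show ?thesis .
  qed
  ultimately show "(\<integral>x. 1 / (y + x) \<partial>M) = (\<integral>x. 1 / (y + x) \<partial>P)"
   using ct_real[OF y0] by simp
 qed
 show "N = restrict_space M {0..c_edge m}"
 proof (rule measure_eqI)
  show "sets N = sets (restrict_space M {0..c_edge m})"
   unfolding sN by (rule restrict_space_sets_cong[symmetric]) auto
  fix X assume X: "X \<in> sets N"
  then have X': "X <= {0..c_edge m}" "X \<in> sets borel" unfolding sN by (auto simp: sets_restrict_space)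
  have "emeasure (restrict_space M {0..c_edge m}) X = emeasure M X"
   by (rule emeasure_restrict_space) (use X' in auto)
  also have "... = emeasure P X" using \<open>M = P\<close> by simp
  also have "... = emeasure N ((%x. x) -` X \<inter> space N)" unfolding P_def using X' id by (intro emeasure_distr) auto
  also have "(%x. x) -` X \<inter> space N = X" using X' spN by auto
  finally show "emeasure N X = emeasure (restrict_space M {0..c_edge m}) X" by simp
 qed
qed

text \<open>On the upper half-plane the branch stays in the sector \<open>-\<pi>/(m+1) < arg v < 0\<close>,
 because \<open>\<zeta>\<close> is not there when \<open>v\<close> is on the boundary of the sector.\<close>

lemma v_upper:
 assumes "Im \<zeta> > 0"
 obtains \<rho> \<theta> where "\<rho> > 0" "0 < \<theta>" "\<theta> < pi / real (m + 1)" "v \<zeta> = rcis \<rho> (- \<theta>)"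
proof -
 let ?H = "{\<zeta>. Im \<zeta> > 0}"
 have Hc: "\<zeta> \<notin> cut" if "\<zeta> \<in> ?H" for \<zeta> using that by auto
 have convH: "convex ?H" by (rule convex_halfspace_Im_gt)
 have contv: "continuous_on ?H v"
  by (rule holomorphic_on_imp_continuous_on[OF holomorphic_on_subset[OF v_hol]]) (use Hc in auto)
 have zv: "\<zeta> = v \<zeta> ^ (m + 1) / (of_nat m * (v \<zeta> - 1))" "v \<zeta> ~= 1" if "\<zeta> \<in> ?H" for \<zeta>
 proof -
  show "v \<zeta> ~= 1" using v_props(3)[OF Hc[OF that]] nonzero(2)[OF Hc[OF that]] by auto
  then show "\<zeta> = v \<zeta> ^ (m + 1) / (of_nat m * (v \<zeta> - 1))"
   using v_props(1)[OF Hc[OF that]] m by (simp add: field_simps)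
 qed
 have Imv: "Im (v \<zeta>) ~= 0" if "\<zeta> \<in> ?H" for \<zeta>
 proof
  assume "Im (v \<zeta>) = 0"
  then have "v \<zeta> \<in> \<real>" by (simp add: complex_is_Real_iff)
  then have "v \<zeta> ^ (m + 1) / (of_nat m * (v \<zeta> - 1)) \<in> \<real>" by (intro Reals_divide Reals_power Reals_mult Reals_diff) auto
  then have "\<zeta> \<in> \<real>" using zv(1)[OF that] by simp
  then show False using that by (simp add: complex_is_Real_iff)
 qed
 \<comment> \<open>Large enough that at the point i T the error of the expansion of v is below 1/(m
   T) and v lies within 1/(25 (m+1)) of 1.\<close>
 define T where "T = 2 * c_edge m + 8 + real (m + 1) * 2 ^ m * 4 * real m + 100 * real (m + 1)"
 have Tpos: "T > 0" "T >= 2 * c_edge m + 8" "T >= 100 * real (m + 1)" "T > real (m + 1) * 2 ^ m * 4 * real m"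
  using c_pos by (auto simp: T_def add_pos_nonneg)
 define z0 where "z0 = \<i> * of_real T"
 have z0: "z0 \<in> ?H" "cmod z0 = T" using Tpos by (auto simp: z0_def norm_mult)
 have v0: "Im (v z0) < 0"
 proof -
  have "\<bar>Im (v z0 - (1 + 1 / (of_nat m * z0)))\<bar> <= (real (m + 1) * 2 ^ m * 4) * cmod (1 / z0\<^sup>2)"
   using v_near_infinity(4)[of z0] abs_Im_le_cmod order_trans z0 Tpos by metis
  also have "... = (real (m + 1) * 2 ^ m * 4) / T\<^sup>2" using z0 by (simp add: norm_divide norm_power)
  also have "... < 1 / (real m * T)"
  proof -
   have "(real (m + 1) * 2 ^ m * 4) * (real m * T) < T * T"
    using Tpos mult_strict_right_mono[OF Tpos(4) Tpos(1)] by (simp add: mult.assoc)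
   then show ?thesis using Tpos m by (simp add: divide_less_eq power2_eq_square field_simps)
  qed
  finally have "\<bar>Im (v z0 - (1 + 1 / (of_nat m * z0)))\<bar> < 1 / (real m * T)" .
  moreover have "Im (1 / (of_nat m * z0)) = - (1 / (real m * T))"
  proof -
   have "1 / (of_nat m * z0) = - \<i> * of_real (1 / (real m * T))" using m Tpos by (simp add: z0_def field_simps)
   then show ?thesis by simp
  qed
  ultimately have "\<bar>Im (v z0) + 1 / (real m * T)\<bar> < 1 / (real m * T)"
   by (simp only: minus_complex.simps plus_complex.simps one_complex.simps)
  then show ?thesis unfolding abs_less_iff by linarith
 qed
 have neg: "Im (v \<zeta>) < 0" if "\<zeta> \<in> ?H" for \<zeta>
 proof (rule ccontr)
  assume "\<not> Im (v \<zeta>) < 0"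
  then have "Im (v \<zeta>) >= 0" by simp
  have "connected ((%\<zeta>. Im (v \<zeta>)) ` ?H)"
   by (intro connected_continuous_image continuous_intros contv convex_connected convH)
  from connectedD_interval[OF this imageI[OF z0(1)] imageI[OF that], of 0]
  have "0 \<in> (%\<zeta>. Im (v \<zeta>)) ` ?H" using v0 \<open>Im (v \<zeta>) >= 0\<close> by simp
  then show False using Imv by auto
 qed
 define th where "th \<zeta> = - Arg (v \<zeta>)" for \<zeta>
 have th: "0 < th \<zeta>" "th \<zeta> < pi" "v \<zeta> = rcis (cmod (v \<zeta>)) (- th \<zeta>)" if "\<zeta> \<in> ?H" for \<zeta>
 proof -
  have "Arg (v \<zeta>) < 0" using Arg_neg_iff neg[OF that] by blast
  then show "0 < th \<zeta>" by (simp add: th_def)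
  show "th \<zeta> < pi" using Arg_bounded[of "v \<zeta>"] by (simp add: th_def)
  show "v \<zeta> = rcis (cmod (v \<zeta>)) (- th \<zeta>)" by (simp add: th_def rcis_cmod_Arg)
 qed
 have cont_th: "continuous_on ?H th"
  unfolding th_def
 proof (intro continuous_on_minus continuous_on_compose2[OF _ contv, of "- \<real>\<^sub>\<le>\<^sub>0" Arg])
  show "continuous_on (- \<real>\<^sub>\<le>\<^sub>0) Arg" by (intro continuous_at_imp_continuous_on ballI continuous_at_Arg) auto
  show "v ` ?H <= - \<real>\<^sub>\<le>\<^sub>0" using Imv by (auto simp: complex_nonpos_Reals_iff)
 qed
 \<comment> \<open>On the ray of argument -pi/(m+1) the power v^(m+1) is negative and 1/(v - 1) has
   positive imaginary part, so \<zeta> would lie in the lower half-plane.\<close>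
 have th_ne: "th \<zeta> ~= pi / real (m + 1)" if "\<zeta> \<in> ?H" for \<zeta>
 proof
  assume e: "th \<zeta> = pi / real (m + 1)"
  have "v \<zeta> ^ (m + 1) = rcis (cmod (v \<zeta>) ^ (m + 1)) (real (m + 1) * (- th \<zeta>))"
   using th(3)[OF that] DeMoivre2 by metis
  also have "real (m + 1) * (- th \<zeta>) = - pi" unfolding e by simp
  also have "rcis (cmod (v \<zeta>) ^ (m + 1)) (- pi) = - of_real (cmod (v \<zeta>) ^ (m + 1))"
   by (simp add: rcis_def complex_eq_iff)
  finally have p: "v \<zeta> ^ (m + 1) = - of_real (cmod (v \<zeta>) ^ (m + 1))" .
  have pos: "cmod (v \<zeta>) ^ (m + 1) / real m > 0" using v_props(4)[OF Hc[OF that]] m by simp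
  have "\<zeta> = of_real (- (cmod (v \<zeta>) ^ (m + 1) / real m)) * (1 / (v \<zeta> - 1))"
   by (subst zv(1)[OF that]) (simp only: p, simp)
  then have "Im \<zeta> = - (cmod (v \<zeta>) ^ (m + 1) / real m) * Im (1 / (v \<zeta> - 1))" by (metis Im_of_real_mult)
  moreover have "Im (1 / (v \<zeta> - 1)) > 0"
  proof -
   have "Im (1 / (v \<zeta> - 1)) = - Im (v \<zeta>) / (cmod (v \<zeta> - 1))\<^sup>2" by (simp add: Im_divide cmod_power2)
   then show ?thesis using neg[OF that] zv(2)[OF that] by (simp add: divide_neg_pos)
  qed
  ultimately have "Im \<zeta> < 0" using pos by (simp only: mult_minus_left neg_less_0_iff_less mult_pos_pos)
  then show False using that by simp
 qed
 \<comment> \<open>At the base point v is so close to 1 that an angle of at least pi/(m+1) would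
   make |Im v| too large.\<close>
 have th0: "th z0 < pi / real (m + 1)"
 proof (rule ccontr)
  assume "\<not> ?thesis"
  then have ge: "pi / real (m + 1) <= th z0" by simp
  have d: "cmod (v z0 - 1) <= 4 / T" using v_near_infinity(2)[of z0] z0 Tpos by simp
  also have "... <= 4 / (100 * real (m + 1))" using Tpos by (intro divide_left_mono) auto
  also have "... = 1 / (25 * real (m + 1))" by (simp add: field_simps)
  finally have d: "cmod (v z0 - 1) <= 1 / (25 * real (m + 1))" .
  have "1 / (25 * real (m + 1)) <= 1 / (25 * 1)" by (intro divide_left_mono) auto
  from order.trans[OF d this] have d': "cmod (v z0 - 1) <= 1 / 25" by simp
  then have re: "Re (v z0) >= 24 / 25" using abs_Re_le_cmod[of "v z0 - 1"] by simp
  have im: "\<bar>Im (v z0)\<bar> <= 1 / (25 * real (m + 1))" using abs_Im_le_cmod[of "v z0 - 1"] d by simp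
  have Rev: "Re (v z0) = cmod (v z0) * cos (th z0)" and Imvv: "Im (v z0) = - (cmod (v z0) * sin (th z0))"
   using arg_cong[OF th(3)[OF z0(1)], of Re] arg_cong[OF th(3)[OF z0(1)], of Im] by simp_all
  have "cos (th z0) > 0" using Rev re by (metis linorder_not_le mult_nonneg_nonpos norm_ge_zero order_less_le_trans divide_pos_pos zero_less_numeral)
  then have thpi: "th z0 < pi / 2"
   using th(1,2)[OF z0(1)] cos_ge_zero[of "th z0"] by (metis cos_monotone_0_pi_le cos_pi_half not_le order_less_imp_le pi_half_ge_zero order_less_le_trans less_irrefl)
  have "sin (pi / real (m + 1)) <= sin (th z0)"
  proof (rule sin_monotone_2pi_le)
   show "- (pi / 2) <= pi / real (m + 1)" by (rule order_trans[of _ 0]) simp_all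
  qed (use ge thpi in simp_all)
  moreover have "sin (pi / real (m + 1)) >= 1 / real (m + 1)" by (rule sin_pi_div_ge) (use m in simp)
  moreover have "cmod (v z0) >= 24 / 25" using re complex_Re_le_cmod[of "v z0"] by simp
  ultimately have "24 / 25 * (1 / real (m + 1)) <= cmod (v z0) * sin (th z0)"
   by (intro mult_mono) auto
  also have "... <= 1 / (25 * real (m + 1))" using im Imvv by simp
  finally show False by (simp add: field_simps)
 qed
 have "th \<zeta> < pi / real (m + 1)"
 proof (rule ccontr)
  assume "\<not> ?thesis"
  then have ge: "pi / real (m + 1) <= th \<zeta>" by simp
  have "connected (th ` ?H)" by (intro connected_continuous_image cont_th convex_connected convH)
  from connectedD_interval[OF this imageI[OF z0(1)] imageI, of \<zeta> "pi / real (m + 1)"]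
  have "pi / real (m + 1) \<in> th ` ?H" using th0 ge assms by simp
  then obtain x where "x \<in> ?H" "pi / real (m + 1) = th x" by blast
  then show False using th_ne[of x] by simp
 qed
 then show ?thesis using that[of "cmod (v \<zeta>)" "th \<zeta>"] th[of \<zeta>] assms v_props(4)[OF Hc[of \<zeta>]] by auto
qed

text \<open>For v = \<rho> exp(-i \<theta>), |v - 1| >= 1 means \<rho> >= 2 cos \<theta>, while Im
  \<zeta> > 0 means \<rho> sin(m \<theta>) < sin((m+1) \<theta>). Since sin((m+1) \<theta>) +
  sin((m-1) \<theta>) = 2 cos \<theta> sin(m \<theta>) and the sector makes all these sines
  nonnegative, the two are incompatible.\<close>

lemma v_upper_bound:
 assumes "Im \<zeta> > 0"
 shows "cmod (v \<zeta> - 1) < 1"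
proof (rule ccontr)
 assume neg: "\<not> cmod (v \<zeta> - 1) < 1"
 obtain \<rho> \<theta> where \<rho>: "\<rho> > 0" and \<theta>: "0 < \<theta>" "\<theta> < pi / real (m + 1)" and v: "v \<zeta> = rcis \<rho> (- \<theta>)"
  using v_upper[OF assms] .
 have nc: "\<zeta> \<notin> cut" using assms by auto
 have mth: "real (m + 1) * \<theta> < pi" using \<theta> by (simp add: field_simps)
 have "(cmod (v \<zeta> - 1))\<^sup>2 = (\<rho> * cos \<theta> - 1)\<^sup>2 + (\<rho> * sin \<theta>)\<^sup>2"
  unfolding v cmod_power2 by simp
 also have "... = \<rho>\<^sup>2 * ((cos \<theta>)\<^sup>2 + (sin \<theta>)\<^sup>2) - 2 * \<rho> * cos \<theta> + 1" by algebra
 also have "(cos \<theta>)\<^sup>2 + (sin \<theta>)\<^sup>2 = 1" by simp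
 finally have "(cmod (v \<zeta> - 1))\<^sup>2 = \<rho> * (\<rho> - 2 * cos \<theta>) + 1" by (simp add: power2_eq_square algebra_simps)
 moreover have "1 <= (cmod (v \<zeta> - 1))\<^sup>2" using neg by (simp add: one_le_power)
 ultimately have \<rho>2: "2 * cos \<theta> <= \<rho>" using \<rho> by (simp add: zero_le_mult_iff)
 have v1: "v \<zeta> - 1 ~= 0" using v_props(3)[OF nc] nonzero(2)[OF nc] by auto
 have "\<zeta> * of_real (real m * (cmod (v \<zeta> - 1))\<^sup>2) = v \<zeta> ^ (m + 1) * cnj (v \<zeta> - 1)"
  unfolding v_props(1)[OF nc] of_real_mult complex_norm_square of_real_of_nat_eq by (simp only: mult_ac)
 then have "Im (v \<zeta> ^ (m + 1) * cnj (v \<zeta> - 1)) = Im \<zeta> * (real m * (cmod (v \<zeta> - 1))\<^sup>2)"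
  by (metis Im_of_real_mult mult.commute)
 also have "... > 0" using assms v1 m by simp
 finally have pos: "Im (v \<zeta> ^ (m + 1) * cnj (v \<zeta> - 1)) > 0" .
 have "v \<zeta> ^ (m + 1) * cnj (v \<zeta> - 1) = rcis (\<rho> ^ (m + 1)) (real (m + 1) * - \<theta>) * (rcis \<rho> \<theta> - 1)"
  unfolding v by (simp only: DeMoivre2) (simp add: rcis_def cis_cnj)
 also have "... = rcis (\<rho> ^ (m + 2)) (real (m + 1) * - \<theta> + \<theta>) - rcis (\<rho> ^ (m + 1)) (real (m + 1) * - \<theta>)"
  by (simp only: right_diff_distrib rcis_mult mult_1_right) (simp add: mult.commute)
 also have "Im ... = \<rho> ^ (m + 1) * (sin (real (m + 1) * \<theta>) - \<rho> * sin (real m * \<theta>))"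
 proof -
  have "real (m + 1) * - \<theta> + \<theta> = - (real m * \<theta>)" by (simp add: algebra_simps)
  then show ?thesis by (simp only: minus_complex.simps Im_rcis mult_minus_right sin_minus) (simp add: algebra_simps)
 qed
 finally have imeq: "Im (v \<zeta> ^ (m + 1) * cnj (v \<zeta> - 1)) = \<rho> ^ (m + 1) * (sin (real (m + 1) * \<theta>) - \<rho> * sin (real m * \<theta>))" .
 have *: "\<rho> * sin (real m * \<theta>) < sin (real (m + 1) * \<theta>)"
  using zero_less_mult_pos[OF pos[unfolded imeq]] \<rho> by simp
 have s1: "sin (real m * \<theta>) >= 0" using mth \<theta> m by (intro sin_ge_zero) (auto simp: algebra_simps)
 have s2: "sin (real (m - 1) * \<theta>) >= 0"
 proof (rule sin_ge_zero)
  have "real (m - 1) * \<theta> <= real (m + 1) * \<theta>" using \<theta> by (intro mult_right_mono) auto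
  then show "real (m - 1) * \<theta> <= pi" using mth by simp
 qed (use \<theta> in auto)
 have "sin (real (m + 1) * \<theta>) + sin (real (m - 1) * \<theta>) = 2 * cos \<theta> * sin (real m * \<theta>)"
 proof -
  have e: "real (m + 1) * \<theta> = real m * \<theta> + \<theta>" "real (m - 1) * \<theta> = real m * \<theta> - \<theta>"
   using m by (simp_all add: algebra_simps of_nat_diff)
  show ?thesis unfolding e by (simp add: sin_add sin_diff)
 qed
 also have "... <= \<rho> * sin (real m * \<theta>)" using \<rho>2 s1 by (intro mult_right_mono)
 finally show False using * s2 by simp
qed

text \<open>Since A - 1 = 1/(v - 1), this is |v - 1| <= 1. Conjugation gives the lower half-plane,
  continuity the real points off the cut. It is the source of the lower bound for quotients of
  consecutive polynomials.\<close>

lemma A_bound: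
 assumes \<zeta>: "\<zeta> \<notin> cut"
 shows "1 <= cmod (A \<zeta> - 1)"
proof -
 have up: "1 <= cmod (A \<zeta> - 1)" if "Im \<zeta> > 0" for \<zeta>
 proof -
  have nc: "\<zeta> \<notin> cut" using that by auto
  have "cmod (1 / (A \<zeta> - 1)) < 1" using v_upper_bound[OF that] v_props(3)[OF nc] by simp
  then show ?thesis using nonzero(2)[OF nc] by (simp add: norm_divide divide_less_eq)
 qed
 have A_cnj: "A (cnj \<zeta>) = cnj (A \<zeta>)"
 proof -
  from cut_dist[OF \<zeta>] obtain d where d: "d > 0"
   "!!x. 0 <= x ==> x <= c_edge m ==> d <= cmod (\<zeta> - complex_of_real x)" by blast
  have i: "integrable M (%x. 1 / (\<zeta> - complex_of_real x))"
   by (rule integrable_bounded[where D = "1 / d"]) (use d in \<open>auto intro!: norm_inverse_le\<close>)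
  have "(%x. 1 / (cnj \<zeta> - complex_of_real x)) = (%x. cnj (1 / (\<zeta> - complex_of_real x)))" by auto
  then have "ct (cnj \<zeta>) = cnj (ct \<zeta>)"
   unfolding ct_def by (simp only: integral_bounded_linear[OF bounded_linear_cnj i])
  then show ?thesis by (simp add: A_def)
 qed
 have cont: "continuous_on (- cut) A" by (rule holomorphic_on_imp_continuous_on[OF A_hol])
 consider "Im \<zeta> > 0" | "Im \<zeta> < 0" | "Im \<zeta> = 0" by linarith
 then show ?thesis
 proof cases
  case 2
  then have "1 <= cmod (A (cnj \<zeta>) - 1)" by (intro up) simp
  also have "A (cnj \<zeta>) - 1 = cnj (A \<zeta> - 1)" by (simp add: A_cnj)
  finally show ?thesis by (simp only: complex_mod_cnj)
 next
  case 3
  have "isCont A \<zeta>" using cont cut_complement(1) \<zeta> by (simp add: continuous_on_eq_continuous_at)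
  then have "((%n. cmod (A (\<zeta> + \<i> * of_real (1 / real (Suc n))) - 1)) \<longlongrightarrow> cmod (A \<zeta> - 1)) sequentially"
  proof (intro tendsto_intros isCont_tendsto_compose[of \<zeta> A])
   have "(%n. \<zeta> + \<i> * of_real (1 / real (Suc n))) \<longlonglongrightarrow> \<zeta> + \<i> * of_real 0"
    by (intro tendsto_intros LIMSEQ_Suc[OF lim_1_over_n])
   then show "(%n. \<zeta> + \<i> * of_real (1 / real (Suc n))) \<longlonglongrightarrow> \<zeta>" by simp
  qed
  then show ?thesis
   by (rule tendsto_lowerbound) (use 3 in \<open>auto intro!: always_eventually up\<close>)
 qed (rule up)
qed

end

lemma limit_distribution_exists:
 assumes m: "m >= 1"
 shows "\<exists>M. limit_distribution M m & weak_conv_m (emp m) M"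
proof -
 from emp_weak_conv[OF m] obtain M where M: "compact_distribution M (2 ^ (m + 6))" "weak_conv_m (emp m) M"
  and st: "!!y v. y > 0 ==> 0 < v ==> v < 1 ==> v ^ (m + 1) = real m * y * (1 - v) ==>
   (\<integral>x. 1 / (y + x) \<partial>M) = 1 / v ^ m - 1" by blast
 have "AE x in M. 0 <= x & x <= c_edge m"
  by (rule support_c_edge[OF m M(1) st branch_in_unit_interval[OF m]])
 moreover have "real_distribution M" using M(1) by (rule compact_distribution.axioms)
 ultimately have "limit_distribution M m"
  using m st by (intro limit_distribution.intro compact_distribution.intro
   compact_distribution_axioms.intro limit_distribution_axioms.intro)
 then show ?thesis using M(2) by blast
qed

subsection \<open>Area means of logarithms\<close>

text \<open>The product form makes one-variable substitutions and Fubini available in the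
  plane.\<close>

lemma lborel_complex: "(lborel :: complex measure) = distr (lborel \<Otimes>\<^sub>M lborel) borel (%(x, y). Complex x y)"
proof (rule lborel_eqI)
 have meas: "(%(x, y). Complex x y) \<in> borel_measurable (lborel \<Otimes>\<^sub>M lborel)"
  unfolding Complex_eq by measurable
 fix l u :: complex assume lu: "!!b. b \<in> Basis ==> l \<bullet> b <= u \<bullet> b"
 have le: "Re l <= Re u" "Im l <= Im u" using lu[of 1] lu[of \<i>] by (auto simp: Basis_complex_def)
 have "(%(x, y). Complex x y) -` box l u \<inter> space (lborel \<Otimes>\<^sub>M lborel) = {Re l<..<Re u} \<times> {Im l<..<Im u}"
  by (auto simp: box_def Basis_complex_def space_pair_measure)
 then have "emeasure (distr (lborel \<Otimes>\<^sub>M lborel) borel (%(x, y). Complex x y)) (box l u) =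
  emeasure (lborel \<Otimes>\<^sub>M lborel) ({Re l<..<Re u} \<times> {Im l<..<Im u})"
  by (subst emeasure_distr[OF meas]) auto
 also have "... = ennreal (Re u - Re l) * ennreal (Im u - Im l)"
  using le by (subst lborel.emeasure_pair_measure_Times) auto
 also have "... = ennreal (prod ((\<bullet>) (u - l)) Basis)"
  using le by (simp add: Basis_complex_def ennreal_mult)
 finally show "emeasure (distr (lborel \<Otimes>\<^sub>M lborel) borel (%(x, y). Complex x y)) (box l u) =
  ennreal (prod ((\<bullet>) (u - l)) Basis)" .
qed simp

lemma nn_integral_complex:
 assumes [measurable]: "f \<in> borel_measurable borel"
 shows "(\<integral>\<^sup>+z. f z \<partial>lborel) = (\<integral>\<^sup>+y. \<integral>\<^sup>+x. f (Complex x y) \<partial>lborel \<partial>lborel)"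
proof -
 have meas: "(%(x, y). Complex x y) \<in> borel_measurable (lborel \<Otimes>\<^sub>M lborel)"
  unfolding Complex_eq by measurable
 have "(\<integral>\<^sup>+z. f z \<partial>lborel) = (\<integral>\<^sup>+p. f (case p of (x, y) => Complex x y) \<partial>(lborel \<Otimes>\<^sub>M lborel))"
  by (subst lborel_complex) (rule nn_integral_distr[OF meas], simp)
 also have "... = (\<integral>\<^sup>+y. \<integral>\<^sup>+x. f (Complex x y) \<partial>lborel \<partial>lborel)"
  using lborel_pair.nn_integral_snd[OF measurable_compose[OF meas assms]] by simp
 finally show ?thesis .
qed

text \<open>The rotation is composed of affine substitutions in one variable: first in x for fixed
  y, then, after the order of integration is exchanged, in y for fixed x. The intermediate
  coordinate is divided by the cosine.\<close>

lemma nn_integral_rotate_aux: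
 assumes [measurable]: "f \<in> borel_measurable borel" and c: "cos \<theta> ~= 0"
 shows "(\<integral>\<^sup>+z. f (cis \<theta> * z) \<partial>lborel) = (\<integral>\<^sup>+z. f z \<partial>lborel)"
proof -
 let ?c = "cos \<theta>" and ?s = "sin \<theta>"
 have cs: "?s * ?s + ?c * ?c = 1" using sin_cos_squared_add[of \<theta>] by (simp add: power2_eq_square)
 have mC: "(%p. Complex (fst p) (snd p)) \<in> borel_measurable (lborel \<Otimes>\<^sub>M lborel)"
  unfolding Complex_eq by measurable
 have mC2: "(%p. f (Complex (fst p) ((?s * fst p + snd p) / ?c))) \<in> borel_measurable (lborel \<Otimes>\<^sub>M lborel)"
  unfolding Complex_eq by measurable
 have mf1: "(%u. f (Complex u (g u))) \<in> borel_measurable borel" if "g \<in> borel_measurable borel" for g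
  unfolding Complex_eq using that by measurable
 have mf2: "(%u. f (Complex a u)) \<in> borel_measurable borel" for a unfolding Complex_eq by measurable
 have "(\<integral>\<^sup>+z. f (cis \<theta> * z) \<partial>lborel) = (\<integral>\<^sup>+y. \<integral>\<^sup>+x. f (cis \<theta> * Complex x y) \<partial>lborel \<partial>lborel)"
  by (rule nn_integral_complex) measurable
 also have "... = (\<integral>\<^sup>+y. \<integral>\<^sup>+x. ennreal \<bar>1 / ?c\<bar> * f (Complex x ((?s * x + y) / ?c)) \<partial>lborel \<partial>lborel)"
 proof (rule nn_integral_cong)
  fix y
  let ?g = "%u. f (Complex u ((?s * u + y) / ?c))"
  have "(\<integral>\<^sup>+u. ?g u \<partial>lborel) = ennreal \<bar>?c\<bar> * (\<integral>\<^sup>+x. ?g (- ?s * y + ?c * x) \<partial>lborel)"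
   by (rule nn_integral_real_affine[OF mf1 c]) measurable
  moreover have "?g (- ?s * y + ?c * x) = f (cis \<theta> * Complex x y)" for x
  proof -
   have "(?s * (- ?s * y + ?c * x) + y) / ?c = (?s * ?c * x + (1 - ?s * ?s) * y) / ?c" by (simp add: algebra_simps)
   also have "1 - ?s * ?s = ?c * ?c" using cs by simp
   also have "(?s * ?c * x + ?c * ?c * y) / ?c = ?s * x + ?c * y" using c by (simp add: field_simps)
   finally have "Complex (- ?s * y + ?c * x) ((?s * (- ?s * y + ?c * x) + y) / ?c) = cis \<theta> * Complex x y"
    by (simp add: complex_eq_iff)
   then show ?thesis by simp
  qed
  ultimately have "(\<integral>\<^sup>+x. f (cis \<theta> * Complex x y) \<partial>lborel) * ennreal \<bar>?c\<bar> = (\<integral>\<^sup>+u. ?g u \<partial>lborel)"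
   by (simp add: mult.commute)
  then have "ennreal \<bar>1 / ?c\<bar> * ((\<integral>\<^sup>+x. f (cis \<theta> * Complex x y) \<partial>lborel) * ennreal \<bar>?c\<bar>) = (\<integral>\<^sup>+u. ennreal \<bar>1 / ?c\<bar> * ?g u \<partial>lborel)"
   by (subst nn_integral_cmult) (use mf1[of "%u. (?s * u + y) / ?c"] in auto)
  moreover have "ennreal \<bar>1 / ?c\<bar> * (X * ennreal \<bar>?c\<bar>) = X" for X
  proof -
   have "ennreal \<bar>1 / ?c\<bar> * ennreal \<bar>?c\<bar> = 1" using c by (simp flip: ennreal_mult abs_mult)
   then show ?thesis by (metis mult.assoc mult.commute mult_1)
  qed
  ultimately show "(\<integral>\<^sup>+x. f (cis \<theta> * Complex x y) \<partial>lborel) = (\<integral>\<^sup>+x. ennreal \<bar>1 / ?c\<bar> * ?g x \<partial>lborel)" by simp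
 qed
 also have "... = (\<integral>\<^sup>+x. \<integral>\<^sup>+y. ennreal \<bar>1 / ?c\<bar> * f (Complex x ((?s * x + y) / ?c)) \<partial>lborel \<partial>lborel)"
  using lborel_pair.Fubini[of "%p. ennreal \<bar>1 / ?c\<bar> * f (Complex (fst p) ((?s * fst p + snd p) / ?c))"] mC2 by simp
 also have "... = (\<integral>\<^sup>+x. \<integral>\<^sup>+y. f (Complex x y) \<partial>lborel \<partial>lborel)"
 proof (rule nn_integral_cong)
  fix x
  have "(\<integral>\<^sup>+y. f (Complex x y) \<partial>lborel) = ennreal \<bar>1 / ?c\<bar> * (\<integral>\<^sup>+y. f (Complex x (?s * x / ?c + 1 / ?c * y)) \<partial>lborel)"
   by (rule nn_integral_real_affine[OF mf2]) (use c in simp)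
  also have "... = (\<integral>\<^sup>+y. ennreal \<bar>1 / ?c\<bar> * f (Complex x ((?s * x + y) / ?c)) \<partial>lborel)"
   by (subst nn_integral_cmult[symmetric]) (auto simp: add_divide_distrib Complex_eq)
  finally show "(\<integral>\<^sup>+y. ennreal \<bar>1 / ?c\<bar> * f (Complex x ((?s * x + y) / ?c)) \<partial>lborel) = (\<integral>\<^sup>+y. f (Complex x y) \<partial>lborel)" by simp
 qed
 also have "... = (\<integral>\<^sup>+y. \<integral>\<^sup>+x. f (Complex x y) \<partial>lborel \<partial>lborel)"
  using lborel_pair.Fubini[of "%p. f (Complex (fst p) (snd p))"] mC by simp
 also have "... = (\<integral>\<^sup>+z. f z \<partial>lborel)" by (rule nn_integral_complex[symmetric]) measurable
 finally show ?thesis .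
qed

text \<open>When the cosine vanishes the rotation is carried out in two halves.\<close>

lemma nn_integral_rotate:
 assumes [measurable]: "f \<in> borel_measurable borel"
 shows "(\<integral>\<^sup>+z. f (cis \<theta> * z) \<partial>lborel) = (\<integral>\<^sup>+z. f z \<partial>lborel)"
proof (cases "cos \<theta> = 0")
 case True
 have c: "cos (\<theta> / 2) ~= 0"
 proof
  assume "cos (\<theta> / 2) = 0"
  then have "cos (2 * (\<theta> / 2)) = - 1" unfolding cos_double by (metis cos_double cos_double_cos power2_eq_square mult_zero_left mult_zero_right diff_0)
  with True show False by simp
 qed
 have "(\<integral>\<^sup>+z. f (cis \<theta> * z) \<partial>lborel) = (\<integral>\<^sup>+z. f (cis (\<theta> / 2) * (cis (\<theta> / 2) * z)) \<partial>lborel)"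
  by (simp add: mult.assoc[symmetric] cis_mult)
 also have "... = (\<integral>\<^sup>+z. f (cis (\<theta> / 2) * z) \<partial>lborel)"
  by (rule nn_integral_rotate_aux[of "%z. f (cis (\<theta> / 2) * z)", OF _ c]) measurable
 also have "... = (\<integral>\<^sup>+z. f z \<partial>lborel)" by (rule nn_integral_rotate_aux[OF _ c]) measurable
 finally show ?thesis .
qed (rule nn_integral_rotate_aux[OF assms])

abbreviation circ :: "real => complex" where "circ x \<equiv> cis (2 * pi * x)"

text \<open>Rotation invariance for each angle, averaged over the angle and rearranged by Fubini;
  this takes the place of polar coordinates.\<close>

lemma nn_integral_ball_circle_mean:
 assumes [measurable]: "f \<in> borel_measurable borel"
 shows "(\<integral>\<^sup>+z. f z * indicator (ball 0 r) z \<partial>lborel) =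
  (\<integral>\<^sup>+z. (\<integral>\<^sup>+x. f (circ x * z) * indicator {0..1::real} x \<partial>lborel) * indicator (ball 0 r) z \<partial>lborel)"
proof -
 have mcis: "circ \<in> borel_measurable borel"
  by (intro borel_measurable_continuous_onI continuous_intros)
 have [measurable]: "ball (0::complex) r \<in> sets borel" by simp
 have mcf: "(%p. f (circ (fst p) * snd p)) \<in> borel_measurable (lborel \<Otimes>\<^sub>M lborel)"
  using mcis by measurable
 have m: "(%p. f (circ (fst p) * snd p) * indicator (ball 0 r) (snd p) * indicator {0..1} (fst p)) \<in> borel_measurable (lborel \<Otimes>\<^sub>M lborel)"
  by (intro borel_measurable_times_ennreal mcf measurable_compose[OF measurable_fst borel_measurable_indicator]
    measurable_compose[OF measurable_snd borel_measurable_indicator]) auto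
 have "(\<integral>\<^sup>+z. (\<integral>\<^sup>+x. f (circ x * z) * indicator {0..1} x \<partial>lborel) * indicator (ball 0 r) z \<partial>lborel) =
  (\<integral>\<^sup>+z. \<integral>\<^sup>+x. f (circ x * z) * indicator (ball 0 r) z * indicator {0..1} x \<partial>lborel \<partial>lborel)"
  using mcis by (subst nn_integral_multc[symmetric]) (auto simp: mult_ac)
 also have "... = (\<integral>\<^sup>+x. \<integral>\<^sup>+z. f (circ x * z) * indicator (ball 0 r) z * indicator {0..1} x \<partial>lborel \<partial>lborel)"
  using lborel_pair.Fubini[OF m] by simp
 also have "... = (\<integral>\<^sup>+x. (\<integral>\<^sup>+z. f z * indicator (ball 0 r) z \<partial>lborel) * indicator {0..1::real} x \<partial>lborel)"
 proof (rule nn_integral_cong)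
  fix x :: real
  have "(\<integral>\<^sup>+z. f (circ x * z) * indicator (ball 0 r) z * indicator {0..1} x \<partial>lborel) =
   (\<integral>\<^sup>+z. f (circ x * z) * indicator (ball 0 r) (circ x * z) * indicator {0..1} x \<partial>lborel)"
   by (intro nn_integral_cong) (auto simp: indicator_def norm_mult)
  also have "... = (\<integral>\<^sup>+z. f (circ x * z) * indicator (ball 0 r) (circ x * z) \<partial>lborel) * indicator {0..1} x"
   by (rule nn_integral_multc) measurable
  also have "(\<integral>\<^sup>+z. f (circ x * z) * indicator (ball 0 r) (circ x * z) \<partial>lborel) = (\<integral>\<^sup>+z. f z * indicator (ball 0 r) z \<partial>lborel)"
   by (rule nn_integral_rotate) measurable
  finally show "(\<integral>\<^sup>+z. f (circ x * z) * indicator (ball 0 r) z * indicator {0..1} x \<partial>lborel) =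
   (\<integral>\<^sup>+z. f z * indicator (ball 0 r) z \<partial>lborel) * indicator {0..1} x" .
 qed
 also have "... = (\<integral>\<^sup>+z. f z * indicator (ball 0 r) z \<partial>lborel)"
  by (subst nn_integral_cmult) auto
 finally show ?thesis by simp
qed

text \<open>The nonnegative function A - u may be averaged without knowing that it is integrable.
  Integrability of u is then a conclusion, which covers logarithmic singularities.\<close>

lemma ball_mean:
 fixes u Mn :: "complex => real"
 assumes [measurable]: "u \<in> borel_measurable borel" and uA: "!!z. z \<in> ball 0 r ==> u z <= A"
  and mean: "AE z in lborel. z \<in> ball 0 r --> ((%x. u (circ x * z)) has_integral Mn z) {0..1}"
  and int: "set_integrable lborel (ball 0 r) Mn"
 shows "set_integrable lborel (ball 0 r) u" "(LINT z:ball 0 r|lborel. u z) = (LINT z:ball 0 r|lborel. Mn z)"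
proof -
 have fin: "emeasure lborel (ball (0::complex) r) < \<infinity>" by (rule emeasure_bounded_finite) auto
 have mMn: "(%z. indicator (ball 0 r) z * Mn z) \<in> borel_measurable borel"
  using int unfolding set_integrable_def by (auto dest: borel_measurable_integrable)
 have ic: "integrable lborel (%z. indicat_real (ball (0::complex) r) z * A)"
  using fin by (intro integrable_mult_left integrable_real_indicator) auto
 have MnA: "AE z in lborel. z \<in> ball 0 r --> Mn z <= A"
  using mean
 proof eventually_elim
  case (elim z)
  show ?case
  proof
   assume z: "z \<in> ball 0 r"
   then have 1: "((%x. u (circ x * z)) has_integral Mn z) {0..1}" using elim by simp
   have 2: "((%x::real. A) has_integral A) {0..1}" using has_integral_const_real[of A 0 1] by simp
   show "Mn z <= A" by (rule has_integral_le[OF 1 2]) (use z in \<open>auto intro!: uA simp: norm_mult\<close>)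
  qed
 qed
 have iA: "integrable lborel (%z. indicator (ball 0 r) z * (A - Mn z))"
  using ic int unfolding set_integrable_def
  by (subst right_diff_distrib) (auto intro!: Bochner_Integration.integrable_diff)
 have "(\<integral>\<^sup>+z. ennreal (A - u z) * indicator (ball 0 r) z \<partial>lborel) =
  (\<integral>\<^sup>+z. (\<integral>\<^sup>+x. ennreal (A - u (circ x * z)) * indicator {0..1::real} x \<partial>lborel) * indicator (ball 0 r) z \<partial>lborel)"
  by (rule nn_integral_ball_circle_mean) measurable
 also have "... = (\<integral>\<^sup>+z. ennreal (A - Mn z) * indicator (ball 0 r) z \<partial>lborel)"
 proof (rule nn_integral_cong_AE, use mean in eventually_elim)
  case (elim z)
  show ?case
  proof (cases "z \<in> ball 0 r")
   case True
   have "((%x. A - u (circ x * z)) has_integral (A - Mn z)) {0..1}"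
    using has_integral_diff[OF has_integral_const_real[of A 0 1] elim[rule_format, OF True]] by simp
   moreover have "0 <= A - u (circ x * z)" for x using uA[of "circ x * z"] True by (simp add: norm_mult)
   ultimately have "(\<integral>\<^sup>+x. ennreal (A - u (circ x * z)) * indicator {0..1::real} x \<partial>lborel) = ennreal (A - Mn z)"
    by (intro nn_integral_has_integral_lebesgue')
   then show ?thesis by simp
  qed simp
 qed
 also have "... = (\<integral>\<^sup>+z. ennreal (indicator (ball 0 r) z * (A - Mn z)) \<partial>lborel)"
  by (intro nn_integral_cong) (auto simp: indicator_def)
 also have "... = ennreal (\<integral>z. indicator (ball 0 r) z * (A - Mn z) \<partial>lborel)"
  by (rule nn_integral_eq_integral[OF iA]) (use MnA in eventually_elim, auto simp: indicator_def)
 finally have nn: "(\<integral>\<^sup>+z. ennreal (indicator (ball 0 r) z * (A - u z)) \<partial>lborel) = ennreal (\<integral>z. indicator (ball 0 r) z * (A - Mn z) \<partial>lborel)"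
  by (subst nn_integral_cong[of _ _ "%z. ennreal (A - u z) * indicator (ball 0 r) z"]) (auto simp: indicator_def)
 have nonneg: "0 <= indicator (ball 0 r) z * (A - u z)" for z using uA[of z] by (auto simp: indicator_def)
 have "integrable lborel (%z. indicator (ball 0 r) z * (A - u z)) \<and>
   (\<integral>z. indicator (ball 0 r) z * (A - u z) \<partial>lborel) = (\<integral>z. indicator (ball 0 r) z * (A - Mn z) \<partial>lborel)"
 proof (rule nn_integral_eq_integrable[THEN iffD1, OF _ _ _ nn])
  show "0 <= (\<integral>z. indicator (ball 0 r) z * (A - Mn z) \<partial>lborel)"
   by (intro integral_nonneg_AE) (use MnA in eventually_elim, auto simp: indicator_def)
  show "(%z. indicator (ball 0 r) z * (A - u z)) \<in> borel_measurable lborel"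
   by (intro borel_measurable_times borel_measurable_indicator) auto
  show "AE z in lborel. 0 <= indicator (ball 0 r) z * (A - u z)" using nonneg by (rule AE_I2)
 qed
 then have iu: "integrable lborel (%z. indicator (ball 0 r) z * (A - u z))"
  and eq: "(\<integral>z. indicator (ball 0 r) z * (A - u z) \<partial>lborel) = (\<integral>z. indicator (ball 0 r) z * (A - Mn z) \<partial>lborel)"
  by auto
 have "integrable lborel (%z. indicator (ball 0 r) z * A - indicator (ball 0 r) z * (A - u z))"
  by (intro Bochner_Integration.integrable_diff ic iu)
 then show su: "set_integrable lborel (ball 0 r) u" unfolding set_integrable_def by (simp add: algebra_simps)
 have split: "(\<integral>z. indicator (ball 0 r) z * (A - h z) \<partial>lborel) = (\<integral>z. indicator (ball (0::complex) r) z * A \<partial>lborel) - (LINT z:ball 0 r|lborel. h z)"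
  if "set_integrable lborel (ball 0 r) h" for h :: "complex => real"
 proof -
  have ih: "integrable lborel (%z. indicat_real (ball 0 r) z * h z)"
   using that unfolding set_integrable_def by simp
  have "(\<integral>z. indicator (ball 0 r) z * (A - h z) \<partial>lborel) = (\<integral>z. indicator (ball 0 r) z * A - indicator (ball 0 r) z * h z \<partial>lborel)"
   by (simp only: right_diff_distrib)
  also have "... = (\<integral>z. indicator (ball (0::complex) r) z * A \<partial>lborel) - (\<integral>z. indicator (ball 0 r) z * h z \<partial>lborel)"
   by (rule Bochner_Integration.integral_diff[OF ic ih])
  finally show ?thesis by (simp only: set_lebesgue_integral_def real_scaleR_def)
 qed
 show "(LINT z:ball 0 r|lborel. u z) = (LINT z:ball 0 r|lborel. Mn z)"
  using eq unfolding split[OF su] split[OF int] by simp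
qed

text \<open>Cauchy's formula on the unit circle for w -> k(w z), so the radius |z| enters only
  through the function.\<close>

lemma circle_mean_holomorphic:
 assumes k: "k holomorphic_on ball 0 R" and z: "cmod z < R"
 shows "((%x. Re (k (circ x * z))) has_integral Re (k 0)) {0..1}"
proof -
 have sub: "w * z \<in> ball 0 R" if "w \<in> cball 0 1" for w
 proof -
  have "cmod (w * z) <= 1 * cmod z" unfolding norm_mult using that by (intro mult_right_mono) auto
  then show ?thesis using z by simp
 qed
 have hol: "(%w. k (w * z)) holomorphic_on ball 0 1"
  by (intro holomorphic_on_compose_gen[OF _ k, unfolded o_def] holomorphic_intros) (use sub in auto)
 have cont: "continuous_on (cball 0 1) (%w. k (w * z))"
  by (intro continuous_on_compose2[OF holomorphic_on_imp_continuous_on[OF k]] continuous_intros) (use sub in auto)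
 have e: "circlepath 0 1 x = circ x" for x
  by (simp add: circlepath cis_conv_exp mult_ac)
 have "((%u. k (u * z) / (u - 0)) has_contour_integral 2 * of_real pi * \<i> * k (0 * z)) (circlepath 0 1)"
  by (rule Cauchy_integral_circlepath[OF cont hol]) simp
 then have hi: "((%x. k (circ x * z) / circ x * vector_derivative (circlepath 0 1) (at x within {0..1})) has_integral 2 * of_real pi * \<i> * k 0) {0..1}"
  unfolding has_contour_integral_def e by simp
 have eq: "k (circ x * z) / circ x * vector_derivative (circlepath 0 1) (at x within {0..1}) = k (circ x * z) * (2 * of_real pi * \<i>)"
  if x: "x \<in> {0..1}" for x :: real
 proof -
  have "exp (2 * of_real pi * \<i> * of_real x) = circ x" by (simp add: cis_conv_exp mult_ac)
  then have "vector_derivative (circlepath 0 1) (at x within {0..1}) = 2 * of_real pi * \<i> * circ x"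
   using x by (subst vector_derivative_circlepath01) auto
  then show ?thesis by (simp add: field_simps)
 qed
 have "((%x. k (circ x * z) * (2 * of_real pi * \<i>)) has_integral 2 * of_real pi * \<i> * k 0) {0..1}"
  by (rule has_integral_eq[OF eq hi])
 from has_integral_mult_left[OF this, of "1 / (2 * of_real pi * \<i>)"]
 have "((%x. k (circ x * z)) has_integral k 0) {0..1}" by simp
 then show ?thesis by (rule has_integral_Re)
qed

lemma AE_norm_neq: "AE z in lborel. cmod z ~= d"
proof -
 have "sphere (0::complex) d \<in> null_sets (completion lborel)"
  using negligible_sphere[of "0::complex" d] by (simp add: negligible_iff_null_sets)
 then have "sphere (0::complex) d \<in> null_sets lborel" by (subst (asm) null_sets_completion_iff) auto
 from AE_not_in[OF this] show ?thesis by simp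
qed

text \<open>Jensen's formula for a single zero: the larger of z and s is factored out, and ln |1 -
  w| is the real part of a function holomorphic for |w| < 1 that vanishes at 0. The excluded case
  |z| = |s| is a null set in the later area integrals.\<close>

lemma ln_circle_mean:
 assumes ne: "cmod z ~= cmod s" and s0: "s ~= 0"
 shows "((%x. ln (cmod (circ x * z - s))) has_integral ln (max (cmod z) (cmod s))) {0..1}"
proof -
 have hol: "(%w. Ln (1 - w)) holomorphic_on ball 0 1"
 proof (intro holomorphic_intros)
  fix w :: complex assume "w \<in> ball 0 1"
  then have "Re (1 - w) > 0" using complex_Re_le_cmod[of w] by simp
  then show "1 - w \<notin> \<real>\<^sub>\<le>\<^sub>0" by (auto simp: complex_nonpos_Reals_iff)
 qed
 have base: "((%x. ln C + ln (cmod (1 - circ x * t))) has_integral ln C) {0..1}" if t: "cmod t < 1" for t and C :: real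
 proof -
  have "((%x. Re (Ln (1 - circ x * t))) has_integral 0) {0..1}"
   using circle_mean_holomorphic[OF hol t] by simp
  moreover have "Re (Ln (1 - circ x * t)) = ln (cmod (1 - circ x * t))" for x
  proof (rule Re_Ln)
   have "cmod (circ x * t) < 1" using t by (simp add: norm_mult)
   then show "1 - circ x * t ~= 0" by auto
  qed
  ultimately have "((%x. ln (cmod (1 - circ x * t))) has_integral 0) {0..1}" by simp
  from has_integral_add[OF has_integral_const_real[of "ln C" 0 1] this] show ?thesis by simp
 qed
 show ?thesis
 proof (cases "cmod z < cmod s")
  case True
  have "ln (cmod (circ x * z - s)) = ln (cmod s) + ln (cmod (1 - circ x * (z / s)))" for x
  proof -
   have "cmod (circ x * (z / s)) < 1" using True s0 by (simp add: norm_mult norm_divide)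
   then have nz: "cmod (1 - circ x * (z / s)) > 0" by auto
   have "circ x * z - s = - s * (1 - circ x * (z / s))" using s0 by (simp add: field_simps)
   then have "cmod (circ x * z - s) = cmod s * cmod (1 - circ x * (z / s))" by (metis norm_minus_cancel norm_mult)
   then show ?thesis using nz s0 by (simp add: ln_mult)
  qed
  moreover have "cmod (z / s) < 1" using True s0 by (simp add: norm_divide)
  ultimately show ?thesis using base[of "z / s" "cmod s"] True by (simp add: max_def)
 next
  case False
  with ne have lt: "cmod s < cmod z" by simp
  then have z0: "z ~= 0" by auto
  \<comment> \<open>Conjugation restores the factor \<open>circ x\<close>, so \<open>base\<close>
    applies with cnj (s/z) in the place of z/s.\<close>
  have "ln (cmod (circ x * z - s)) = ln (cmod z) + ln (cmod (1 - circ x * cnj (s / z)))" for x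
  proof -
   have "cmod (circ x * cnj (s / z)) < 1" using lt z0 by (simp add: norm_mult norm_divide)
   then have nz: "cmod (1 - circ x * cnj (s / z)) > 0" by auto
   have "circ x * z - s = circ x * z * (1 - cnj (circ x) * (s / z))"
    using z0 by (simp add: field_simps cis_cnj cis_mult)
   then have "cmod (circ x * z - s) = cmod z * cmod (1 - cnj (circ x) * (s / z))" by (simp add: norm_mult)
   also have "cmod (1 - cnj (circ x) * (s / z)) = cmod (cnj (1 - cnj (circ x) * (s / z)))"
    by (simp only: complex_mod_cnj)
   also have "cnj (1 - cnj (circ x) * (s / z)) = 1 - circ x * cnj (s / z)" by simp
   finally show ?thesis using nz z0 by (simp add: ln_mult)
  qed
  moreover have "cmod (cnj (s / z)) < 1" using lt z0 by (simp add: norm_divide)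
  ultimately show ?thesis using base[of "cnj (s / z)" "cmod z"] lt by (simp add: max_def)
 qed
qed

definition ballm :: "real => real" where "ballm r = measure lborel (ball (0::complex) r)"

text \<open>The integral of ln |z - s| over a disc of radius r whose centre has distance d from s;
  \<open>ln_norm_ball\<close> proves this.\<close>

definition logball :: "real => real => real" where
 "logball r d = (LINT z:ball (0::complex) r|lborel. ln (max (cmod z) d))"

lemma ballm_eq: "r >= 0 ==> ballm r = pi * r\<^sup>2"
 unfolding ballm_def using emeasure_ball[of r "0::complex"]
 by (simp add: measure_def unit_ball_vol_2 enn2real_mult)

lemma set_integrable_ball_bounded:
 fixes f :: "complex => real"
 assumes "f \<in> borel_measurable borel" "!!z. z \<in> ball b r ==> \<bar>f z\<bar> <= D"
 shows "set_integrable lborel (ball b r) f"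
proof -
 have "emeasure lborel (ball b r) < \<infinity>" by (rule emeasure_bounded_finite) auto
 then show ?thesis
  unfolding set_integrable_def using assms
  by (intro integrableI_bounded_set[of "ball b r" _ _ D]) (auto simp: indicator_def intro!: AE_I2)
qed

lemma set_integral_ball_shift:
 fixes f :: "complex => real"
 assumes f: "f \<in> borel_measurable borel"
 shows "set_integrable lborel (ball b r) f \<longleftrightarrow> set_integrable lborel (ball 0 r) (%z. f (b + z))"
  "(LINT z:ball b r|lborel. f z) = (LINT z:ball 0 r|lborel. f (b + z))"
proof -
 have ind: "indicat_real (ball b r) (b + z) = indicat_real (ball 0 r) z" for z by (simp add: indicator_def dist_norm)
 have g: "(%z. indicat_real (ball b r) z *\<^sub>R f z) \<in> borel_measurable borel"
  using f by (intro borel_measurable_scaleR borel_measurable_indicator) auto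
 have "integrable (distr lborel borel ((+) b)) (%z. indicat_real (ball b r) z *\<^sub>R f z) \<longleftrightarrow>
  integrable lborel (%z. indicat_real (ball b r) (b + z) *\<^sub>R f (b + z))"
  by (rule integrable_distr_eq[OF _ g]) simp
 then show "set_integrable lborel (ball b r) f \<longleftrightarrow> set_integrable lborel (ball 0 r) (%z. f (b + z))"
  unfolding set_integrable_def lborel_distr_plus ind .
 have "integral\<^sup>L (distr lborel borel ((+) b)) (%z. indicat_real (ball b r) z *\<^sub>R f z) =
  integral\<^sup>L lborel (%z. indicat_real (ball b r) (b + z) *\<^sub>R f (b + z))"
  by (rule integral_distr[OF _ g]) simp
 then show "(LINT z:ball b r|lborel. f z) = (LINT z:ball 0 r|lborel. f (b + z))"
  unfolding set_lebesgue_integral_def lborel_distr_plus ind .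
qed

lemma measure_ball_eq: "measure lborel (ball (b::complex) r) = ballm r"
proof -
 have ind: "indicat_real (ball b r) (b + z) = indicat_real (ball 0 r) z" for z by (simp add: indicator_def dist_norm)
 have "measure lborel (ball b r) = (LINT z:ball b r|lborel. 1)" by (simp add: set_lebesgue_integral_def)
 also have "... = ballm r" by (subst set_integral_ball_shift(2)) (simp_all add: set_lebesgue_integral_def ballm_def)
 finally show ?thesis .
qed

lemma set_integral_ball_const: "(LINT z:ball (b::complex) r|lborel. (C::real)) = ballm r * C"
 by (simp add: set_lebesgue_integral_def measure_ball_eq)

lemma max_ln_integrable:
 assumes "d > 0"
 shows "set_integrable lborel (ball 0 r) (%z. ln (max (cmod z) d))"
proof (rule set_integrable_ball_bounded)
 fix z :: complex assume z: "z \<in> ball 0 r"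
 have "ln d <= ln (max (cmod z) d)" "ln (max (cmod z) d) <= ln (max r d)" using assms z by auto
 then show "\<bar>ln (max (cmod z) d)\<bar> <= \<bar>ln d\<bar> + \<bar>ln (max r d)\<bar>" by linarith
qed measurable

lemma ln_norm_center:
 assumes r: "r > 0" and s: "s ~= 0"
 shows "set_integrable lborel (ball 0 r) (%z. ln (cmod (z - s)))"
  "(LINT z:ball 0 r|lborel. ln (cmod (z - s))) = logball r (cmod s)"
proof -
 have A: "ln (cmod (z - s)) <= max 0 (ln (r + cmod s))" if "z \<in> ball 0 r" for z
 proof (cases "z = s")
  case False
  have "cmod (z - s) <= r + cmod s" using norm_triangle_ineq4[of z s] that by simp
  then have "ln (cmod (z - s)) <= ln (r + cmod s)" using False r by (subst ln_le_cancel_iff) (auto intro: add_pos_nonneg)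
  then show ?thesis by simp
 qed simp
 have mean: "AE z in lborel. z \<in> ball 0 r --> ((%x. ln (cmod (circ x * z - s))) has_integral ln (max (cmod z) (cmod s))) {0..1}"
  using AE_norm_neq[of "cmod s"] by eventually_elim (use ln_circle_mean s in auto)
 have m: "(%z. ln (cmod (z - s))) \<in> borel_measurable borel" by measurable
 have i: "set_integrable lborel (ball 0 r) (%z. ln (max (cmod z) (cmod s)))" using max_ln_integrable s by simp
 show "set_integrable lborel (ball 0 r) (%z. ln (cmod (z - s)))"
  "(LINT z:ball 0 r|lborel. ln (cmod (z - s))) = logball r (cmod s)"
  unfolding logball_def by (rule ball_mean[OF m A mean i]; assumption)+
qed

lemma ln_norm_ball:
 assumes r: "r > 0"
 shows "set_integrable lborel (ball b r) (%z. ln (cmod (z - s)))"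
  "(LINT z:ball b r|lborel. ln (cmod (z - s))) = logball r (cmod (s - b))"
proof -
 have m: "(%z. ln (cmod (z - s))) \<in> borel_measurable borel" by measurable
 have e: "b + z - s = z - (s - b)" for z by simp
 \<comment> \<open>A pole at the centre is not covered by \<open>ln_norm_center\<close>. It is
   treated as an off-centre pole of the larger disc around -1.\<close>
 have i0: "set_integrable lborel (ball 0 r) (%z. ln (cmod z))"
 proof -
  have "set_integrable lborel (ball 0 (r + 1)) (%z. ln (cmod (z - 1)))" using r by (intro ln_norm_center) auto
  moreover have "(%z. ln (cmod (z::complex))) \<in> borel_measurable borel" by measurable
  ultimately have "set_integrable lborel (ball (-1) (r + 1)) (%z. ln (cmod z))"
   by (subst set_integral_ball_shift(1)) auto
  then show ?thesis
  proof (rule set_integrable_subset)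
   show "ball 0 r <= ball (-1::complex) (r + 1)"
   proof
    fix z :: complex assume "z \<in> ball 0 r"
    then have "cmod (-1 - z) < 1 + r" using norm_triangle_ineq4[of "-1" z] by simp
    then show "z \<in> ball (-1) (r + 1)" by (simp add: dist_norm)
   qed
  qed auto
 qed
 show "set_integrable lborel (ball b r) (%z. ln (cmod (z - s)))"
  unfolding set_integral_ball_shift(1)[OF m] e
  by (cases "s = b") (use i0 ln_norm_center(1)[OF r] in auto)
 show "(LINT z:ball b r|lborel. ln (cmod (z - s))) = logball r (cmod (s - b))"
  unfolding set_integral_ball_shift(2)[OF m] e
  by (cases "s = b") (use ln_norm_center(2)[OF r] in \<open>auto simp: logball_def\<close>)
qed

lemma Re_holomorphic_ball:
 assumes k: "k holomorphic_on ball b R" and r: "0 < r" "r < R"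
 shows "set_integrable lborel (ball b r) (%z. Re (k z))"
  "(LINT z:ball b r|lborel. Re (k z)) = ballm r * Re (k b)"
proof -
 \<comment> \<open>k is known only on the disc; multiplication by the indicator gives a Borel
   function on the plane.\<close>
 define u where "u z = indicator (ball b R) z *\<^sub>R Re (k z)" for z
 have u: "u \<in> borel_measurable borel" unfolding u_def
  by (intro borel_measurable_continuous_on_indicator continuous_intros holomorphic_on_imp_continuous_on k) auto
 have ue: "u z = Re (k z)" if "z \<in> ball b r" for z using that r by (simp add: u_def)
 have "compact (k ` cball b r)"
  by (intro compact_continuous_image holomorphic_on_imp_continuous_on holomorphic_on_subset[OF k]) (use r in auto)
 then obtain A where A: "!!z. z \<in> cball b r ==> cmod (k z) <= A"
  using compact_imp_bounded bounded_iff by (metis imageI)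
 have cm: "((%x. u (b + circ x * z)) has_integral Re (k b)) {0..1}" if z: "z \<in> ball 0 r" for z
 proof -
  have "(%w. k (b + w)) holomorphic_on ball 0 R"
   by (intro holomorphic_on_compose_gen[OF _ k, unfolded o_def] holomorphic_intros) (auto simp: dist_norm)
  from circle_mean_holomorphic[OF this, of z]
  have "((%x. Re (k (b + circ x * z))) has_integral Re (k b)) {0..1}" using z r by simp
  moreover have "b + circ x * z \<in> ball b r" for x using z by (simp add: dist_norm norm_mult)
  ultimately show ?thesis by (simp add: ue)
 qed
 have m': "(%z. u (b + z)) \<in> borel_measurable borel" using u by measurable
 have uA: "u (b + z) <= A" if "z \<in> ball 0 r" for z
 proof -
  have "b + z \<in> ball b r" using that by (simp add: dist_norm)
  then show ?thesis using A[of "b + z"] complex_Re_le_cmod[of "k (b + z)"] by (simp add: ue)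
 qed
 have ci: "set_integrable lborel (ball 0 r) (%z::complex. Re (k b))"
  by (rule set_integrable_ball_bounded) auto
 have bm: "set_integrable lborel (ball 0 r) (%z. u (b + z))"
  "(LINT z:ball 0 r|lborel. u (b + z)) = (LINT z:ball (0::complex) r|lborel. Re (k b))"
  by (rule ball_mean[OF m' uA _ ci]; use cm in auto)+
 have eq1: "set_integrable lborel (ball b r) (%z. Re (k z)) = set_integrable lborel (ball b r) u"
  by (intro set_integrable_cong refl) (use ue in auto)
 then show "set_integrable lborel (ball b r) (%z. Re (k z))"
  using set_integral_ball_shift(1)[OF u] bm(1) by simp
 have "(LINT z:ball b r|lborel. Re (k z)) = (LINT z:ball b r|lborel. u z)"
  by (intro set_lebesgue_integral_cong) (use ue in auto)
 then show "(LINT z:ball b r|lborel. Re (k z)) = ballm r * Re (k b)"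
  using set_integral_ball_shift(2)[OF u] bm(2) set_integral_ball_const by simp
qed

text \<open>Equality is asked only almost everywhere because the value ln 0 = 0 spoils the formula
  at the points \<open>s i\<close>.\<close>

lemma log_potential_ball:
 fixes s :: "'i => complex" and c :: "'i => real"
 assumes I: "finite I" and k: "k holomorphic_on ball b R" and r: "0 < r" "r < R"
  and eq: "AE z in lborel. z \<in> ball b r --> u z = (\<Sum>i\<in>I. c i * ln (cmod (z - s i))) + Re (k z)"
  and u: "u \<in> borel_measurable borel"
 shows "set_integrable lborel (ball b r) u"
  "(LINT z:ball b r|lborel. u z) = (\<Sum>i\<in>I. c i * logball r (cmod (s i - b))) + ballm r * Re (k b)"
proof -
 let ?v = "%z. (\<Sum>i\<in>I. c i * ln (cmod (z - s i))) + Re (k z)"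
 have ih: "has_bochner_integral lborel (%z. (\<Sum>i\<in>I. c i * (indicator (ball b r) z *\<^sub>R ln (cmod (z - s i)))) + indicator (ball b r) z *\<^sub>R Re (k z))
  ((\<Sum>i\<in>I. c i * logball r (cmod (s i - b))) + ballm r * Re (k b))"
 proof (intro has_bochner_integral_add has_bochner_integral_sum has_bochner_integral_mult_right)
  fix i
  show "has_bochner_integral lborel (%z. indicat_real (ball b r) z *\<^sub>R ln (cmod (z - s i))) (logball r (cmod (s i - b)))"
   using ln_norm_ball[OF r(1), of b "s i"] unfolding set_integrable_def set_lebesgue_integral_def has_bochner_integral_iff by simp
  show "has_bochner_integral lborel (%z. indicat_real (ball b r) z *\<^sub>R Re (k z)) (ballm r * Re (k b))"
   using Re_holomorphic_ball[OF k r] unfolding set_integrable_def set_lebesgue_integral_def has_bochner_integral_iff by simp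
 qed
 have mu: "(%z. indicat_real (ball b r) z *\<^sub>R u z) \<in> borel_measurable lborel"
  using u by (intro borel_measurable_scaleR borel_measurable_indicator) auto
 have e: "AE z in lborel. indicat_real (ball b r) z *\<^sub>R u z = (\<Sum>i\<in>I. c i * (indicator (ball b r) z *\<^sub>R ln (cmod (z - s i)))) + indicator (ball b r) z *\<^sub>R Re (k z)"
  using eq by eventually_elim (auto simp: indicator_def)
 have "has_bochner_integral lborel (%z. indicat_real (ball b r) z *\<^sub>R u z)
  ((\<Sum>i\<in>I. c i * logball r (cmod (s i - b))) + ballm r * Re (k b))"
  by (rule has_bochner_integral_cong_AE[THEN iffD2, OF mu borel_measurable_has_bochner_integral[OF ih] e ih])
 then show "set_integrable lborel (ball b r) u"
  "(LINT z:ball b r|lborel. u z) = (\<Sum>i\<in>I. c i * logball r (cmod (s i - b))) + ballm r * Re (k b)"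
  unfolding set_integrable_def set_lebesgue_integral_def has_bochner_integral_iff by auto
qed

lemma logball_ge:
 assumes "d > 0" shows "logball r d >= ballm r * ln d"
proof -
 have "(LINT z:ball (0::complex) r|lborel. ln d) <= logball r d"
  unfolding logball_def
  by (intro set_integral_mono max_ln_integrable assms set_integrable_ball_bounded) (use assms in auto)
 then show ?thesis by (simp add: set_integral_ball_const)
qed

subsection \<open>Zeros and the logarithm of the modulus\<close>

text \<open>The larger radius R makes the zeros in the disc of radius \<rho> finite in number.
  Dividing them out leaves a zero-free function on a disc, which has a holomorphic
  logarithm.\<close>

lemma holomorphic_zero_factorization:
 assumes f: "f holomorphic_on ball c R" and nz: "\<exists>w\<in>ball c R. f w ~= 0" and \<rho>: "\<rho> < R"
 defines "Z \<equiv> {s \<in> ball c \<rho>. f s = 0}"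
 obtains k where "finite Z" "k holomorphic_on ball c \<rho>"
  "!!w. w \<in> ball c \<rho> ==> f w = (\<Prod>s\<in>Z. (w - s) ^ nat (zorder f s)) * exp (k w)"
  "!!s. s \<in> Z ==> zorder f s > 0"
proof -
 let ?S = "ball c \<rho>"
 have sub: "?S <= ball c R" using \<rho> by auto
 have conn: "connected (ball c R)" by simp
 note zo = zorder_exist_zero[OF f open_ball conn _ nz]
 have fin: "finite Z"
 proof -
  from nz obtain w0 where w0: "w0 \<in> ball c R" "f w0 ~= 0" by blast
  have "finite {z \<in> cball c \<rho>. f z = 0}"
  proof (cases "f constant_on ball c R")
   case True
   then obtain y where y: "!!z. z \<in> ball c R ==> f z = y" by (auto simp: constant_on_def)
   then have "y ~= 0" using w0 by auto
   then have "{z \<in> cball c \<rho>. f z = 0} = {}" using y \<rho> by force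
   then show ?thesis by (metis finite.emptyI)
  next
   case False
   then show ?thesis
    by (intro holomorphic_compact_finite_zeros[OF f open_ball conn]) (use \<rho> in auto)
  qed
  then show ?thesis by (rule finite_subset[rotated]) (auto simp: Z_def)
 qed
 have zpos: "zorder f s > 0" if "s \<in> Z" for s
  using zo[of s] that sub by (auto simp: Z_def)
 define P where "P Y w = (\<Prod>s\<in>Y. (w - s) ^ nat (zorder f s))" for Y and w :: complex
 \<comment> \<open>At a zero the quotient is given its limit value through \<open>zor_poly\<close>,
   which removes the singularity.\<close>
 define g where "g w = (if w \<in> Z then zor_poly f w w / P (Z - {w}) w else f w / P Z w)" for w
 have P0: "P Y w ~= 0" if "Y <= Z" "w \<notin> Y" for Y w
  using that finite_subset[OF that(1) fin] by (auto simp: P_def)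
 have Phol: "P Y holomorphic_on T" for Y T unfolding P_def by (intro holomorphic_intros)
 have loc: "\<exists>T. open T & s \<in> T & g holomorphic_on T & g s ~= 0" if s: "s \<in> ?S" for s
 proof (cases "s \<in> Z")
  case True
  from zo[of s] s sub obtain r where r: "r > 0" "cball s r <= ball c R" "zor_poly f s holomorphic_on cball s r"
   "!!w. w \<in> cball s r ==> f w = zor_poly f s w * (w - s) ^ nat (zorder f s) & zor_poly f s w ~= 0" by blast
  define T where "T = ball s r - (Z - {s})"
  have T: "open T" "s \<in> T" unfolding T_def using r(1) fin by (auto intro!: open_Diff finite_imp_closed)
  have gT: "g w = zor_poly f s w / P (Z - {s}) w" if w: "w \<in> T" for w
  proof (cases "w = s")
   case False
   then have "w \<notin> Z" using w by (auto simp: T_def)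
   have "P Z w = (w - s) ^ nat (zorder f s) * P (Z - {s}) w"
    unfolding P_def using fin True by (subst prod.remove[of Z s]) auto
   then show ?thesis using \<open>w \<notin> Z\<close> False r(4)[of w] w by (simp add: g_def T_def)
  qed (use True in \<open>simp add: g_def\<close>)
  have "(%w. zor_poly f s w / P (Z - {s}) w) holomorphic_on T"
   by (intro holomorphic_intros Phol holomorphic_on_subset[OF r(3)] P0) (auto simp: T_def)
  then have "g holomorphic_on T" by (rule holomorphic_transform) (simp add: gT)
  moreover have "g s ~= 0" using gT[OF T(2)] r(4)[of s] r(1) P0[of "Z - {s}" s] by auto
  ultimately show ?thesis using T by blast
 next
  case False
  define T where "T = ?S - Z"
  have T: "open T" "s \<in> T" unfolding T_def using fin s False by (auto intro!: open_Diff finite_imp_closed)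
  have "(%w. f w / P Z w) holomorphic_on T"
   by (intro holomorphic_intros Phol holomorphic_on_subset[OF f] P0) (use sub in \<open>auto simp: T_def\<close>)
  then have "g holomorphic_on T" by (rule holomorphic_transform) (auto simp: g_def T_def)
  moreover have "g s ~= 0" using False s P0[of Z s] by (auto simp: g_def Z_def)
  ultimately show ?thesis using T by blast
 qed
 have ghol: "g holomorphic_on ?S"
  unfolding holomorphic_on_def
 proof
  fix s assume "s \<in> ?S"
  from loc[OF this] obtain T where "open T" "s \<in> T" "g holomorphic_on T" by blast
  then have "g field_differentiable at s" by (metis holomorphic_on_imp_differentiable_at)
  then show "g field_differentiable at s within ?S" by (rule field_differentiable_at_within)
 qed
 have gnz: "g s ~= 0" if "s \<in> ?S" for s using loc[OF that] by blast
 have fg: "f w = P Z w * g w" if w: "w \<in> ?S" for w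
 proof (cases "w \<in> Z")
  case True
  then have "P Z w = 0" unfolding P_def using fin zpos[OF True] by (auto intro!: bexI[of _ w])
  then show ?thesis using True by (simp add: Z_def)
 qed (use P0[of Z w] in \<open>simp add: g_def\<close>)
 obtain k where k: "k holomorphic_on ?S" "!!w. w \<in> ?S ==> g w = exp (k w)"
  using contractible_imp_holomorphic_log[OF ghol convex_imp_contractible[OF convex_ball] gnz] by blast
 show ?thesis by (rule that[of k]) (use fin k fg zpos in \<open>auto simp: P_def\<close>)
qed

lemma ln_norm_factorization:
 assumes "finite Z" "f w = (\<Prod>s\<in>Z. (w - s) ^ d s) * exp (k w)" "w \<notin> Z"
 shows "ln (cmod (f w)) = (\<Sum>s\<in>Z. real (d s) * ln (cmod (w - s))) + Re (k w)"
proof -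
 have nz: "w - s ~= 0" if "s \<in> Z" for s using that assms by auto
 have "cmod (f w) = (\<Prod>s\<in>Z. cmod (w - s) ^ d s) * exp (Re (k w))"
  by (simp add: assms norm_mult prod_norm[symmetric] norm_power)
 also have "ln ... = ln (\<Prod>s\<in>Z. cmod (w - s) ^ d s) + Re (k w)"
  using nz by (subst ln_mult_pos) (auto intro!: prod_pos)
 also have "ln (\<Prod>s\<in>Z. cmod (w - s) ^ d s) = (\<Sum>s\<in>Z. ln (cmod (w - s) ^ d s))"
  using nz assms(1) by (intro ln_prod) auto
 also have "... = (\<Sum>s\<in>Z. real (d s) * ln (cmod (w - s)))"
  using nz by (intro sum.cong) (auto simp: ln_realpow)
 finally show ?thesis .
qed

lemma AE_notin_finite: "finite Z ==> AE z in lborel. z \<notin> (Z :: complex set)"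
 by (intro AE_not_in finite_imp_null_set_lborel)

text \<open>Each zero contributes \<open>logball r d\<close>, at least the area times ln d, and the
  harmonic part has the mean value property. \<open>F\<close> supplies a Borel function on the
  plane, while f is controlled only on the disc.\<close>

lemma ln_norm_submean:
 assumes f: "f holomorphic_on ball b R" and r: "0 < r" "r < R" and fb: "f b ~= 0" and F: "F \<in> borel_measurable borel"
  and Ff: "!!z. z \<in> ball b r ==> F z = ln (cmod (f z))"
 shows "set_integrable lborel (ball b r) F" "(LINT z:ball b r|lborel. F z) >= ballm r * ln (cmod (f b))"
proof -
 define \<rho> where "\<rho> = (r + R) / 2"
 have \<rho>: "r < \<rho>" "\<rho> < R" using r by (auto simp: \<rho>_def)
 have nz: "\<exists>w\<in>ball b R. f w ~= 0" using fb r by (intro bexI[of _ b]) auto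
 define Z where "Z = {s \<in> ball b \<rho>. f s = 0}"
 obtain k where k: "finite Z" "k holomorphic_on ball b \<rho>"
  "!!w. w \<in> ball b \<rho> ==> f w = (\<Prod>s\<in>Z. (w - s) ^ nat (zorder f s)) * exp (k w)"
  using holomorphic_zero_factorization[OF f nz \<rho>(2)] unfolding Z_def by metis
 have ae: "AE z in lborel. z \<in> ball b r --> F z = (\<Sum>s\<in>Z. real (nat (zorder f s)) * ln (cmod (z - s))) + Re (k z)"
  using AE_notin_finite[OF k(1)]
 proof eventually_elim
  case (elim z)
  then show ?case using ln_norm_factorization[of Z f z "%s. nat (zorder f s)" k, OF k(1) k(3) elim] Ff[of z] \<rho> by auto
 qed
 note P = log_potential_ball[OF k(1,2) r(1) \<rho>(1) ae F]
 show "set_integrable lborel (ball b r) F" by (rule P)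
 have bZ: "b \<notin> Z" using fb by (auto simp: Z_def)
 have "ballm r * ln (cmod (f b)) = (\<Sum>s\<in>Z. real (nat (zorder f s)) * (ballm r * ln (cmod (s - b)))) + ballm r * Re (k b)"
  using ln_norm_factorization[of Z f b "%s. nat (zorder f s)" k, OF k(1) k(3) bZ] r \<rho>
  by (simp add: sum_distrib_left algebra_simps norm_minus_commute)
 also have "... <= (\<Sum>s\<in>Z. real (nat (zorder f s)) * logball r (cmod (s - b))) + ballm r * Re (k b)"
  using bZ by (intro add_right_mono sum_mono mult_left_mono logball_ge) auto
 also have "... = (LINT z:ball b r|lborel. F z)" by (rule P(2)[symmetric])
 finally show "(LINT z:ball b r|lborel. F z) >= ballm r * ln (cmod (f b))" .
qed

subsection \<open>Comparison of logarithmic potentials\<close>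

lemma exp_decay_mono: "b <= a ==> exp (- a * real n) <= exp (- b * real n)"
 using mult_right_mono[of b a "real n"] by simp

text \<open>A weak Hadamard theorem from the maximum principle alone, applied to g/(w - a)^k on the
  annulus with an integer k proportional to n. All functions g are treated at once because the later
  ones depend on n.\<close>

lemma three_circles:
 fixes g :: "nat => complex => complex"
 assumes r: "0 < r1" "r1 < r2" "r2 < r3" and c: "c > 0"
 obtains c' \<epsilon> where "c' > 0" "\<epsilon> > 0"
  "\<forall>\<^sub>F n in sequentially. \<forall>g. g holomorphic_on ball a r3 --> continuous_on (cball a r3) g -->
   (\<forall>w\<in>cball a r1. cmod (g w) <= exp (- c * real n)) --> (\<forall>w\<in>sphere a r3. cmod (g w) <= exp (\<epsilon> * real n)) -->
   (\<forall>w\<in>cball a r2. cmod (g w) <= exp (- c' * real n))"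
proof -
 \<comment> \<open>Then (r3/r1)^(\<kappa> n) = exp(c n/2), so the power costs half of the decay on
   the inner disc, while \<delta> measures the gain (r2/r3)^(\<kappa> n) = exp(-\<delta> n) on the
   outer circle.\<close>
 define \<kappa> where "\<kappa> = c / (2 * ln (r3 / r1))"
 define \<delta> where "\<delta> = \<kappa> * ln (r3 / r2)"
 have l31: "ln (r3 / r1) > 0" and l32: "ln (r3 / r2) > 0" using r by auto
 have \<kappa>: "\<kappa> > 0" using c l31 by (simp add: \<kappa>_def)
 have \<delta>: "\<delta> > 0" using \<kappa> l32 by (simp add: \<delta>_def)
 define c' where "c' = min (c / 2) (\<delta> / 4)"
 have c': "c' > 0" "c' <= c / 2" "c' <= \<delta> / 4" using c \<delta> by (auto simp: c'_def)
 have "filterlim (%n. \<delta> / 4 * real n) at_top sequentially"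
  using \<delta> by (intro filterlim_tendsto_pos_mult_at_top[OF tendsto_const] filterlim_real_sequentially) auto
 then have "\<forall>\<^sub>F n in sequentially. ln (r3 / r2) <= \<delta> / 4 * real n" by (simp add: filterlim_at_top)
 then have ev: "\<forall>\<^sub>F n in sequentially. \<forall>g. g holomorphic_on ball a r3 --> continuous_on (cball a r3) g -->
   (\<forall>w\<in>cball a r1. cmod (g w) <= exp (- c * real n)) --> (\<forall>w\<in>sphere a r3. cmod (g w) <= exp (\<delta> / 2 * real n)) -->
   (\<forall>w\<in>cball a r2. cmod (g w) <= exp (- c' * real n))"
 proof eventually_elim
  case (elim n)
  show ?case
  proof (intro allI impI ballI)
   fix g w
   assume hol: "g holomorphic_on ball a r3" and cont: "continuous_on (cball a r3) g"
    and in1: "\<forall>w\<in>cball a r1. cmod (g w) <= exp (- c * real n)"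
    and in3: "\<forall>w\<in>sphere a r3. cmod (g w) <= exp (\<delta> / 2 * real n)" and w: "w \<in> cball a r2"
   have cc: "exp (- c * real n) <= exp (- c' * real n)" by (rule exp_decay_mono) (use c' c in simp)
   show "cmod (g w) <= exp (- c' * real n)"
   proof (cases "w \<in> cball a r1")
    case True
    then show ?thesis using in1 cc by (meson order_trans)
   next
    case False
    define k where "k = nat \<lfloor>\<kappa> * real n\<rfloor>"
    have k: "real k <= \<kappa> * real n" "\<kappa> * real n - 1 <= real k" using \<kappa> by (auto simp: k_def)
    define S where "S = ball a r3 \<inter> - cball a r1"
    define h where "h w = g w / (w - a) ^ k" for w
    define t where "t = cmod (w - a)"
    have t: "r1 < t" "t <= r2" using False w by (auto simp: t_def dist_norm norm_minus_commute)
    have wS: "w \<in> S" using False w r by (auto simp: S_def)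
    have S_open: "open S" by (auto simp: S_def)
    have clS: "closure S <= cball a r3 \<inter> {z. r1 <= cmod (z - a)}"
     by (rule closure_minimal) (auto simp: S_def dist_norm norm_minus_commute intro!: closed_Collect_le continuous_intros closed_Int)
    have frS: "frontier S <= sphere a r3 \<union> sphere a r1"
     using frontier_Int_subset[of "ball a r3" "- cball a r1"] r unfolding S_def by (auto simp: frontier_complement)
    have hb: "cmod (h w) <= max (exp (- c * real n) / r1 ^ k) (exp (\<delta> / 2 * real n) / r3 ^ k)"
    proof (rule maximum_modulus_frontier[of h S])
     show "h holomorphic_on interior S"
      unfolding h_def interior_open[OF S_open]
      by (intro holomorphic_on_divide holomorphic_on_power holomorphic_on_diff holomorphic_on_ident holomorphic_on_const
        holomorphic_on_subset[OF hol]) (use r in \<open>auto simp: S_def\<close>)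
     show "continuous_on (closure S) h"
      unfolding h_def using clS r
      by (intro continuous_on_divide continuous_on_power continuous_on_diff continuous_on_id continuous_on_const
        continuous_on_subset[OF cont]) auto
     show "bounded S" unfolding S_def by (simp add: bounded_Int)
     fix z assume "z \<in> frontier S"
     then consider "z \<in> sphere a r3" | "z \<in> sphere a r1" using frS by blast
     then show "cmod (h z) <= max (exp (- c * real n) / r1 ^ k) (exp (\<delta> / 2 * real n) / r3 ^ k)"
     proof cases
      case 1
      then have "cmod (h z) = cmod (g z) / r3 ^ k" by (simp add: h_def norm_divide norm_power dist_norm norm_minus_commute)
      also have "... <= exp (\<delta> / 2 * real n) / r3 ^ k" using in3 1 r by (intro divide_right_mono) auto
      finally show ?thesis by simp
     next
      case 2
      then have "cmod (h z) = cmod (g z) / r1 ^ k" by (simp add: h_def norm_divide norm_power dist_norm norm_minus_commute)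
      also have "... <= exp (- c * real n) / r1 ^ k" using in1 2 r by (intro divide_right_mono) auto
      finally show ?thesis by simp
     qed
    qed (use wS in auto)
    have "cmod (g w) = t ^ k * cmod (h w)" using t r by (auto simp: h_def t_def norm_divide norm_power)
    also have "... <= t ^ k * max (exp (- c * real n) / r1 ^ k) (exp (\<delta> / 2 * real n) / r3 ^ k)"
     using hb t r by (intro mult_left_mono) auto
    also have "... = max (exp (- c * real n) * (t / r1) ^ k) (exp (\<delta> / 2 * real n) * (t / r3) ^ k)"
     using t r by (subst max_mult_distrib_left) (auto simp: power_divide mult_ac)
    also have "... <= exp (- c' * real n)"
    proof (rule max.boundedI)
     have "(t / r1) ^ k <= (r3 / r1) ^ k" using t r by (intro power_mono divide_right_mono) auto
     also have "... = exp (real k * ln (r3 / r1))" using r by (simp add: exp_of_nat_mult)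
     also have "... <= exp (\<kappa> * real n * ln (r3 / r1))" using k l31 by (simp add: mult_right_mono)
     also have "\<kappa> * real n * ln (r3 / r1) = c / 2 * real n" using l31 by (simp add: \<kappa>_def)
     finally have "exp (- c * real n) * (t / r1) ^ k <= exp (- c * real n) * exp (c / 2 * real n)"
      by (intro mult_left_mono) auto
     also have "... = exp (- (c / 2) * real n)" by (simp add: exp_add[symmetric] algebra_simps)
     also have "... <= exp (- c' * real n)" by (rule exp_decay_mono) (use c' in simp)
     finally show "exp (- c * real n) * (t / r1) ^ k <= exp (- c' * real n)" .
    next
     have "(t / r3) ^ k <= (r2 / r3) ^ k" using t r by (intro power_mono divide_right_mono) auto
     also have "... = exp (- (real k * ln (r3 / r2)))"
     proof -
      have "exp (- (real k * ln (r3 / r2))) = exp (real k * ln (r2 / r3))" using r by (simp add: ln_div algebra_simps)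
      then show ?thesis using r by (simp add: exp_of_nat_mult)
     qed
     also have "... <= exp (- ((\<kappa> * real n - 1) * ln (r3 / r2)))" using k l32 by (simp add: mult_right_mono)
     also have "- ((\<kappa> * real n - 1) * ln (r3 / r2)) = ln (r3 / r2) - \<delta> * real n" by (simp add: \<delta>_def algebra_simps)
     also have "exp (ln (r3 / r2) - \<delta> * real n) <= exp (- (3 / 4 * \<delta>) * real n)" using elim by simp
     finally have "exp (\<delta> / 2 * real n) * (t / r3) ^ k <= exp (\<delta> / 2 * real n) * exp (- (3 / 4 * \<delta>) * real n)"
      by (intro mult_left_mono) auto
     also have "... = exp (- (\<delta> / 4) * real n)" by (simp add: exp_add[symmetric] algebra_simps)
     also have "... <= exp (- c' * real n)" by (rule exp_decay_mono) (use c' in simp)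
     finally show "exp (\<delta> / 2 * real n) * (t / r3) ^ k <= exp (- c' * real n)" .
    qed
    finally show ?thesis .
   qed
  qed
 qed
 show ?thesis by (rule that[OF c'(1) _ ev]) (use \<delta> in simp)
qed

lemma set_integral_mono_subset:
 fixes g :: "complex => real"
 assumes int: "set_integrable lborel T g" and g: "!!w. g w >= 0" and S: "S <= T" "S \<in> sets borel"
 shows "(LINT w:S|lborel. g w) <= (LINT w:T|lborel. g w)"
 unfolding set_lebesgue_integral_def
proof (rule integral_mono)
 have "set_integrable lborel S g" by (rule set_integrable_subset[OF int _ S(1)]) (use S in simp)
 then show "integrable lborel (%w. indicat_real S w *\<^sub>R g w)" "integrable lborel (%w. indicat_real T w *\<^sub>R g w)"
  using int unfolding set_integrable_def by auto
 show "indicat_real S w *\<^sub>R g w <= indicat_real T w *\<^sub>R g w" for w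
  using S g[of w] by (auto simp: indicator_def)
qed

lemma set_integral_cover:
 fixes g :: "complex => real"
 assumes I: "finite I" and cover: "S <= (\<Union>i\<in>I. A i)" and S: "S \<in> sets borel"
  and g: "g \<in> borel_measurable borel" "!!w. g w >= 0"
  and int: "!!i. i \<in> I ==> set_integrable lborel (A i) g"
 shows "set_integrable lborel S g" "(LINT w:S|lborel. g w) <= (\<Sum>i\<in>I. LINT w:A i|lborel. g w)"
proof -
 have le: "indicat_real S w *\<^sub>R g w <= (\<Sum>i\<in>I. indicat_real (A i) w *\<^sub>R g w)" for w
 proof (cases "w \<in> S")
  case True
  then obtain i where i: "i \<in> I" "w \<in> A i" using cover by blast
  then have "indicat_real (A i) w *\<^sub>R g w <= (\<Sum>i\<in>I. indicat_real (A i) w *\<^sub>R g w)"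
   using I g(2) by (intro member_le_sum) auto
  then show ?thesis using True i by simp
 qed (use g(2) in \<open>auto intro!: sum_nonneg\<close>)
 have ib: "integrable lborel (%w. \<Sum>i\<in>I. indicat_real (A i) w *\<^sub>R g w)"
  using int unfolding set_integrable_def by (intro Bochner_Integration.integrable_sum) auto
 have iS: "integrable lborel (%w. indicat_real S w *\<^sub>R g w)"
 proof (rule Bochner_Integration.integrable_bound[OF ib])
  show "(%w. indicat_real S w *\<^sub>R g w) \<in> borel_measurable lborel" using S g(1) by measurable
  show "AE w in lborel. norm (indicat_real S w *\<^sub>R g w) <= norm (\<Sum>i\<in>I. indicat_real (A i) w *\<^sub>R g w)"
  proof (rule AE_I2)
   fix w
   have "0 <= indicat_real S w *\<^sub>R g w" using g(2) by simp
   then show "norm (indicat_real S w *\<^sub>R g w) <= norm (\<Sum>i\<in>I. indicat_real (A i) w *\<^sub>R g w)" using le[of w] by simp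
  qed
 qed
 then show "set_integrable lborel S g" unfolding set_integrable_def .
 have "(LINT w:S|lborel. g w) <= (\<integral>w. (\<Sum>i\<in>I. indicat_real (A i) w *\<^sub>R g w) \<partial>lborel)"
  unfolding set_lebesgue_integral_def by (rule integral_mono[OF iS ib le])
 also have "... = (\<Sum>i\<in>I. LINT w:A i|lborel. g w)"
  unfolding set_lebesgue_integral_def using int unfolding set_integrable_def by (intro Bochner_Integration.integral_sum) auto
 finally show "(LINT w:S|lborel. g w) <= (\<Sum>i\<in>I. LINT w:A i|lborel. g w)" .
qed

text \<open>Pointwise |F| <= 2 A - F, so an upper bound for F and a lower bound for its integral
  control the L1 norm.\<close>

lemma abs_mean_le:
 fixes F :: "complex => real"
 assumes int: "set_integrable lborel (ball b r) F" and up: "!!w. w \<in> ball b r ==> F w <= A" and A: "A >= 0"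
  and low: "(LINT w:ball b r|lborel. F w) >= - (ballm r * B)"
 shows "(LINT w:ball b r|lborel. \<bar>F w\<bar>) <= ballm r * (2 * A + B)"
proof -
 have ci: "set_integrable lborel (ball b r) (%w. 2 * A)" by (rule set_integrable_ball_bounded) auto
 have "(LINT w:ball b r|lborel. \<bar>F w\<bar>) <= (LINT w:ball b r|lborel. 2 * A - F w)"
  by (rule set_integral_mono[OF set_integrable_abs[OF int] set_integral_diff(1)[OF ci int]]) (use up A in \<open>force simp: abs_if\<close>)
 also have "... = (LINT w:ball b r|lborel. 2 * A) - (LINT w:ball b r|lborel. F w)"
  by (rule set_integral_diff(2)[OF ci int])
 also have "... <= ballm r * (2 * A + B)" using low by (simp add: set_integral_ball_const algebra_simps)
 finally show ?thesis .
qed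

text \<open>The abstract setting of the comparison. In \<open>thin\<close> the complement of
  \<Omega> is covered by small discs, each containing an open part of \<Omega> on which |p n| is at
  least exp(-L n); the weight r^2 (1 + L) is what such a disc costs in the L1 estimate.\<close>

locale potential_pair =
 fixes f p :: "nat => complex => complex" and \<Omega> :: "complex set"
 assumes \<Omega>: "open \<Omega>" "connected \<Omega>" "0 \<in> \<Omega>"
  and f0: "f n 0 = 1" and p0: "p n 0 = 1"
  and f_borel: "f n \<in> borel_measurable borel" and p_hol: "p n holomorphic_on S"
  and f_hol: "\<forall>\<^sub>F n in sequentially. f n holomorphic_on ball 0 \<rho>"
  and p_nz: "w \<in> \<Omega> ==> p n w ~= 0"
  and crude: "\<exists>C\<ge>0. \<forall>\<^sub>F n in sequentially. \<forall>w\<in>ball 0 \<rho>. cmod (f n w) <= exp (C * real n) & cmod (p n w) <= exp (C * real n)"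
  and upper: "compact K ==> K <= \<Omega> ==> \<eta> > 0 ==>
   \<forall>\<^sub>F n in sequentially. \<forall>w\<in>K. cmod (f n w) <= exp (\<eta> * real n) * cmod (p n w)"
  and thin: "\<eta> > 0 ==> \<rho> > 0 ==> \<exists>(J :: (nat \<times> nat) set) c r L B. finite J \<and>
   (\<forall>j\<in>J. c j \<in> cball 0 \<rho> & 0 < r j & r j <= 1 & 0 <= L j & open (B j) & B j ~= {} & B j <= \<Omega> \<and>
    B j <= ball (c j) (r j) & (\<forall>w\<in>B j. \<forall>n. exp (- L j * real n) <= cmod (p n w))) \<and>
   cball 0 \<rho> - \<Omega> <= (\<Union>j\<in>J. ball (c j) (r j)) & (\<Sum>j\<in>J. (r j)\<^sup>2 * (1 + L j)) <= \<eta>"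
begin

lemma p_borel: "p n \<in> borel_measurable borel"
 using holomorphic_on_imp_continuous_on[OF p_hol[of n UNIV]] by (rule borel_measurable_continuous_onI)

lemma quotient_holomorphic:
 assumes "f n holomorphic_on ball 0 \<rho>" "S <= \<Omega>" "S <= ball 0 \<rho>"
 shows "(%w. f n w / p n w) holomorphic_on S"
 using assms p_nz by (intro holomorphic_on_divide p_hol holomorphic_on_subset[OF assms(1)]) auto

text \<open>If |f n| were below exp(-\<eta> n) |p n| throughout B for infinitely many n, exponential
  smallness of f/p along these n would spread: the set of points with a neighbourhood where it holds
  is open, and relatively closed in \<Omega> by the three circles. So it would reach 0, where f/p =
  1.\<close>

lemma near_points:
 assumes B: "open B" "B ~= {}" "B <= \<Omega>" and \<eta>: "\<eta> > 0"
 shows "\<forall>\<^sub>F n in sequentially. \<exists>b\<in>B. exp (- \<eta> * real n) * cmod (p n b) <= cmod (f n b)"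
proof (rule ccontr)
 define D where "D n w = f n w / p n w" for n w
 define N where "N = {n. \<forall>b\<in>B. cmod (f n b) < exp (- \<eta> * real n) * cmod (p n b)}"
 assume "\<not> ?thesis"
 then have N_inf: "\<not> (\<forall>\<^sub>F n in sequentially. n \<notin> N)" by (simp add: N_def not_less)
 \<comment> \<open>P holds for all but finitely many of the bad indices.\<close>
 define E where "E P = (\<forall>\<^sub>F n in sequentially. n \<in> N --> P n)" for P
 define A where "A = {b \<in> \<Omega>. \<exists>r>0. \<exists>c>0. ball b r <= \<Omega> & E (%n. \<forall>w\<in>ball b r. cmod (D n w) <= exp (- c * real n))}"
 have A_I: "b \<in> A" if "b \<in> \<Omega>" "r > 0" "c > 0" "ball b r <= \<Omega>" "E (%n. \<forall>w\<in>ball b r. cmod (D n w) <= exp (- c * real n))" for b r c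
  unfolding A_def using that by blast
 have A_open: "open A"
  unfolding open_contains_ball
 proof
  fix b assume "b \<in> A"
  then obtain r c where rc: "r > 0" "c > 0" "ball b r <= \<Omega>" "E (%n. \<forall>w\<in>ball b r. cmod (D n w) <= exp (- c * real n))"
   by (auto simp: A_def)
  have "ball b (r / 2) <= A"
  proof
   fix b' assume b': "b' \<in> ball b (r / 2)"
   have sub: "ball b' (r / 2) <= ball b r"
   proof
    fix x assume "x \<in> ball b' (r / 2)"
    then show "x \<in> ball b r" using b' dist_triangle[of b x b'] by (simp add: dist_commute)
   qed
   have "E (%n. \<forall>w\<in>ball b' (r / 2). cmod (D n w) <= exp (- c * real n))"
    using rc(4) unfolding E_def by eventually_elim (use sub in auto)
   moreover have "ball b' (r / 2) <= \<Omega>" using sub rc(3) by blast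
   moreover have "b' \<in> \<Omega>" using b' rc by auto
   ultimately show "b' \<in> A" using rc by (intro A_I[of b' "r / 2" c]) auto
  qed
  then show "\<exists>e>0. ball b e <= A" using rc by (intro exI[of _ "r / 2"]) auto
 qed
 have A_closed: "open (\<Omega> - A)"
  unfolding open_contains_ball
 proof
  fix b assume b: "b \<in> \<Omega> - A"
  then obtain R0 where R0: "R0 > 0" "ball b R0 <= \<Omega>" using \<Omega>(1) by (auto simp: open_contains_ball)
  \<comment> \<open>With 5 R available around b, a point b' of A within R of b has its disc of
    radius 3 R inside \<Omega>, and its disc of radius 2 R contains \<open>ball b R\<close>.\<close>
  define R where "R = R0 / 5"
  have R: "R > 0" using R0 by (simp add: R_def)
  have "ball b R \<inter> A = {}"
  proof (rule ccontr)
   assume "ball b R \<inter> A ~= {}"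
   then obtain b' where b': "b' \<in> ball b R" "b' \<in> A" by blast
   then obtain r c where rc: "r > 0" "c > 0" "ball b' r <= \<Omega>" "E (%n. \<forall>w\<in>ball b' r. cmod (D n w) <= exp (- c * real n))"
    by (auto simp: A_def)
   define r1 where "r1 = min (r / 2) R"
   have r1: "0 < r1" "r1 < r" "r1 < 2 * R" using rc R by (auto simp: r1_def min_def)
   have sub: "cball b' (3 * R) <= \<Omega>"
   proof
    fix x assume "x \<in> cball b' (3 * R)"
    then have "x \<in> ball b R0" using b'(1) dist_triangle[of b x b'] R by (simp add: R_def dist_commute)
    then show "x \<in> \<Omega>" using R0 by blast
   qed
   obtain c' \<epsilon> where c': "c' > 0" "\<epsilon> > 0" and tc: "\<forall>\<^sub>F n in sequentially. \<forall>g. g holomorphic_on ball b' (3 * R) --> continuous_on (cball b' (3 * R)) g -->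
    (\<forall>w\<in>cball b' r1. cmod (g w) <= exp (- c * real n)) --> (\<forall>w\<in>sphere b' (3 * R). cmod (g w) <= exp (\<epsilon> * real n)) -->
    (\<forall>w\<in>cball b' (2 * R). cmod (g w) <= exp (- c' * real n))"
    using three_circles[of r1 "2 * R" "3 * R" c b'] r1 R rc by auto
   have "E (%n. \<forall>w\<in>ball b R. cmod (D n w) <= exp (- c' * real n))"
    using tc rc(4) f_hol[of "cmod b' + 3 * R + 1"] upper[OF compact_cball sub c'(2)] unfolding E_def
   proof eventually_elim
    case (elim n)
    show ?case
    proof (intro impI ballI)
     fix w assume n: "n \<in> N" and w: "w \<in> ball b R"
     have sub2: "cball b' (3 * R) <= ball 0 (cmod b' + 3 * R + 1)"
     proof
      fix x assume "x \<in> cball b' (3 * R)"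
      then have "cmod (x - b') <= 3 * R" by (simp add: dist_norm norm_minus_commute)
      then show "x \<in> ball 0 (cmod b' + 3 * R + 1)" using norm_triangle_sub[of x b'] by simp
     qed
     have hD: "D n holomorphic_on cball b' (3 * R)"
      unfolding D_def by (rule quotient_holomorphic[OF elim(3) sub sub2])
     have "\<forall>w\<in>cball b' (2 * R). cmod (D n w) <= exp (- c' * real n)"
     proof (rule elim(1)[THEN spec, THEN mp, THEN mp, THEN mp, THEN mp])
      show "D n holomorphic_on ball b' (3 * R)" by (rule holomorphic_on_subset[OF hD ball_subset_cball])
      show "continuous_on (cball b' (3 * R)) (D n)" by (rule holomorphic_on_imp_continuous_on[OF hD])
      show "\<forall>x\<in>cball b' r1. cmod (D n x) <= exp (- c * real n)"
      proof
       fix x assume "x \<in> cball b' r1"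
       then have "x \<in> ball b' r" using r1 by auto
       then show "cmod (D n x) <= exp (- c * real n)" using elim(2) n by blast
      qed
      show "\<forall>x\<in>sphere b' (3 * R). cmod (D n x) <= exp (\<epsilon> * real n)"
      proof
       fix x assume "x \<in> sphere b' (3 * R)"
       then have x: "x \<in> cball b' (3 * R)" by auto
       then have "p n x ~= 0" using sub p_nz by blast
       then show "cmod (D n x) <= exp (\<epsilon> * real n)" using elim(4) x by (auto simp: D_def norm_divide divide_le_eq)
      qed
     qed
     moreover have "w \<in> cball b' (2 * R)" using w b'(1) dist_triangle[of b' w b] by (simp add: dist_commute)
     ultimately show "cmod (D n w) <= exp (- c' * real n)" by blast
    qed
   qed
   moreover have "ball b R <= \<Omega>" using R0 R by (auto simp: R_def)
   ultimately have "b \<in> A" using b c' R by (intro A_I[of b R c']) auto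
   then show False using b by simp
  qed
  moreover have "ball b R <= \<Omega>" using R0 R by (auto simp: R_def)
  ultimately show "\<exists>e>0. ball b e <= \<Omega> - A" using R by blast
 qed
 obtain b r where br: "r > 0" "ball b r <= B" using B by (meson ex_in_conv openE)
 then have bB: "b \<in> B" by auto
 have "E (%n. \<forall>w\<in>ball b r. cmod (D n w) <= exp (- \<eta> * real n))"
  unfolding E_def
 proof (intro always_eventually allI impI ballI)
  fix n w assume "n \<in> N" "w \<in> ball b r"
  then have wB: "w \<in> B" and "cmod (f n w) < exp (- \<eta> * real n) * cmod (p n w)"
   using br by (auto simp: N_def subset_iff)
  moreover have "p n w ~= 0" using wB B p_nz by blast
  ultimately have "cmod (f n w) < exp (- \<eta> * real n) * cmod (p n w)" and "p n w ~= 0" by auto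
  then show "cmod (D n w) <= exp (- \<eta> * real n)" by (simp add: D_def norm_divide divide_le_eq)
 qed
 moreover have "b \<in> \<Omega>" "ball b r <= \<Omega>" using bB B br by auto
 ultimately have bA: "b \<in> A" using br \<eta> by (intro A_I[of b r \<eta>]) auto
 have "A \<inter> (\<Omega> - A) = {}" "\<Omega> <= A \<union> (\<Omega> - A)" by auto
 from connectedD[OF \<Omega>(2) A_open A_closed _ this(2)] have "A \<inter> \<Omega> = {} | (\<Omega> - A) \<inter> \<Omega> = {}" by auto
 then have "0 \<in> A" using bA \<Omega>(3) unfolding A_def by blast
 then obtain r c where "r > 0" "c > 0" "E (%n. \<forall>w\<in>ball 0 r. cmod (D n w) <= exp (- c * real n))"
  by (auto simp: A_def)
 then have "E (%n. 1 <= exp (- c * real n))"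
  unfolding E_def by (auto elim!: eventually_mono dest!: bspec[of _ _ 0] simp: D_def f0 p0)
 then have "\<forall>\<^sub>F n in sequentially. n \<notin> N"
  unfolding E_def using eventually_gt_at_top[of 0]
 proof eventually_elim
  case (elim n)
  have "- c * real n < 0" using elim \<open>c > 0\<close> by simp
  then show ?case using elim by auto
 qed
 with N_inf show False by blast
qed

text \<open>Inside \<Omega> the quotient f/p has a small upper bound and, by
  \<open>near_points\<close>, a centre where it is not small, so the sub-mean value property bounds
  its logarithm in L1. On the exceptional discs ln |f| and ln |p| are estimated separately, at a
  cost proportional to n times the weight of the disc.\<close>

lemma L1_convergence:
 assumes \<rho>: "\<rho> > 0" and e: "e > 0"
 shows "\<forall>\<^sub>F n in sequentially. set_integrable lborel (ball 0 \<rho>) (%w. ln (cmod (f n w)) - ln (cmod (p n w))) \<and>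
  (LINT w:ball 0 \<rho>|lborel. \<bar>ln (cmod (f n w)) - ln (cmod (p n w))\<bar>) <= e * real n"
proof -
 define W where "W n w = ln (cmod (f n w)) - ln (cmod (p n w))" for n w
 have W_borel: "W n \<in> borel_measurable borel" for n unfolding W_def using f_borel p_borel by measurable
 \<comment> \<open>Room for the discs used below: radius at most 4 around points of
   \<open>cball 0 \<rho>\<close>, or at most 3 around points at distance at most 1 from it.\<close>
 define P where "P = \<rho> + 10"
 obtain C where C: "C >= 0" and crudeC: "\<forall>\<^sub>F n in sequentially. \<forall>w\<in>ball 0 P. cmod (f n w) <= exp (C * real n) & cmod (p n w) <= exp (C * real n)"
  using crude by blast
 \<comment> \<open>From two integrals over a disc of radius 2 r: 4 pi r^2 (4 C + 2 (1 + L)) is at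
   most C1 r^2 (1 + L).\<close>
 define C1 where "C1 = 4 * pi * (4 * C + 2)"
 have C1: "C1 > 0" using C by (simp add: C1_def add_nonneg_pos)
 have eC: "e / (2 * C1) > 0" using e C1 by simp
 from thin[OF eC \<rho>] obtain J :: "(nat \<times> nat) set" and c r L B where JJ: "finite J"
  "\<forall>j\<in>J. c j \<in> cball 0 \<rho> & 0 < r j & r j <= 1 & 0 <= L j & open (B j) & B j ~= {} & B j <= \<Omega> \<and>
    B j <= ball (c j) (r j) & (\<forall>w\<in>B j. \<forall>n. exp (- L j * real n) <= cmod (p n w))"
  "cball 0 \<rho> - \<Omega> <= (\<Union>j\<in>J. ball (c j) (r j))" "(\<Sum>j\<in>J. (r j)\<^sup>2 * (1 + L j)) <= e / (2 * C1)"
  by (elim exE conjE) (rule that)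
 note J = JJ(1) and Jp = JJ(2)[rule_format] and Jcov = JJ(3) and Jsum = JJ(4)
 define K where "K = cball 0 \<rho> - (\<Union>j\<in>J. ball (c j) (r j))"
 have K: "compact K" "K <= \<Omega>" using Jcov unfolding K_def by (auto intro!: compact_diff)
 have "\<exists>s>0. s <= 1 & cball x (4 * s) <= \<Omega>" if xK: "x \<in> K" for x
 proof -
  obtain t where t: "t > 0" "cball x t <= \<Omega>" using K(2) xK \<Omega>(1) unfolding open_contains_cball by blast
  have "cball x (4 * min (t / 4) 1) <= cball x t" by (rule subset_cball) simp
  then show ?thesis using t by (intro exI[of _ "min (t / 4) 1"]) auto
 qed
 then obtain s where s: "!!x. x \<in> K ==> s x > 0 & s x <= 1 & cball x (4 * s x) <= \<Omega>" by metis
 obtain X where X: "X <= K" "finite X" "K <= (\<Union>x\<in>X. ball x (s x))"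
 proof (rule compactE_image[OF K(1), of K "%x. ball x (s x)"])
  show "K <= (\<Union>x\<in>K. ball x (s x))" using s by force
 qed auto
 define S where "S = (\<Sum>x\<in>X. ballm (2 * s x))"
 have ballm_nonneg: "ballm t >= 0" for t by (simp add: ballm_def)
 have S0: "S >= 0" unfolding S_def by (intro sum_nonneg ballm_nonneg)
 \<comment> \<open>The good discs contribute 3 \<eta> S per unit of n, and this choice keeps it
   below e/2.\<close>
 define \<eta> where "\<eta> = e / (2 * (3 * S + 1))"
 have \<eta>: "\<eta> > 0" using e S0 by (simp add: \<eta>_def)
 have evX: "\<forall>\<^sub>F n in sequentially. \<forall>x\<in>X. (\<forall>w\<in>cball x (4 * s x). cmod (f n w) <= exp (\<eta> * real n) * cmod (p n w)) \<and>
  (\<exists>b\<in>ball x (s x). exp (- \<eta> * real n) * cmod (p n b) <= cmod (f n b))"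
 proof (rule eventually_ball_finite[OF X(2)], intro ballI eventually_conj)
  fix x assume "x \<in> X"
  then have x: "s x > 0" "cball x (4 * s x) <= \<Omega>" using s X by auto
  show "\<forall>\<^sub>F n in sequentially. \<forall>w\<in>cball x (4 * s x). cmod (f n w) <= exp (\<eta> * real n) * cmod (p n w)"
   by (rule upper[OF compact_cball x(2) \<eta>])
  have "ball x (s x) <= \<Omega>" using x by (auto intro!: subsetD[OF x(2)])
  then show "\<forall>\<^sub>F n in sequentially. \<exists>b\<in>ball x (s x). exp (- \<eta> * real n) * cmod (p n b) <= cmod (f n b)"
   using x by (intro near_points \<eta>) auto
 qed
 \<comment> \<open>On an exceptional disc one point with |f| >= exp(-n) |p| is enough: the estimate
   there is only of order n and becomes small through the area.\<close>
 have evJ: "\<forall>\<^sub>F n in sequentially. \<forall>j\<in>J. \<exists>b\<in>B j. exp (- 1 * real n) * cmod (p n b) <= cmod (f n b)"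
  using Jp by (intro eventually_ball_finite[OF J] ballI near_points) auto
 show ?thesis
  using evX evJ f_hol[of P] crudeC
 proof eventually_elim
  case (elim n)
  have good: "set_integrable lborel (ball x (s x)) (%w. \<bar>W n w\<bar>)"
   "(LINT w:ball x (s x)|lborel. \<bar>W n w\<bar>) <= ballm (2 * s x) * (3 * \<eta> * real n)" if x: "x \<in> X" for x
  proof -
   have sx: "s x > 0" "s x <= 1" "cball x (4 * s x) <= \<Omega>" using s x X(1) by blast+
   have sx4: "cmod x <= \<rho>" using x X(1) by (auto simp: K_def)
   note sx = sx sx4
   obtain b where b: "b \<in> ball x (s x)" "exp (- \<eta> * real n) * cmod (p n b) <= cmod (f n b)" using elim(1) x by blast
   have subb: "ball b (3 * s x) <= cball x (4 * s x)"
   proof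
    fix w assume "w \<in> ball b (3 * s x)"
    then show "w \<in> cball x (4 * s x)" using b(1) dist_triangle[of x w b] by simp
   qed
   have subP: "cball x (4 * s x) <= ball 0 P"
   proof
    fix w assume "w \<in> cball x (4 * s x)"
    then have "cmod (w - x) <= 4" using sx by (simp add: dist_norm norm_minus_commute)
    then show "w \<in> ball 0 P" using norm_triangle_sub[of w x] sx by (simp add: P_def)
   qed
   define D where "D w = f n w / p n w" for w
   define U where "U w = ln (cmod (D w))" for w
   have U_borel: "U \<in> borel_measurable borel" unfolding U_def D_def using f_borel p_borel by measurable
   have D_hol: "D holomorphic_on ball b (3 * s x)"
    unfolding D_def using subb subP sx by (intro quotient_holomorphic[OF elim(3)]) auto
   have bO: "b \<in> \<Omega>" using b(1) sx by auto
   have pb: "p n b ~= 0" by (rule p_nz[OF bO])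
   have Db: "exp (- \<eta> * real n) <= cmod (D b)" using b(2) pb by (simp add: D_def norm_divide le_divide_eq)
   then have Db0: "D b ~= 0" by (metis exp_gt_zero norm_zero not_le)
   note sub = ln_norm_submean[OF D_hol _ _ Db0 U_borel, of "2 * s x"]
   have iU: "set_integrable lborel (ball b (2 * s x)) U" using sub sx by (auto simp: U_def)
   have "ballm (2 * s x) * (- (\<eta> * real n)) <= ballm (2 * s x) * ln (cmod (D b))"
   proof (rule mult_left_mono[OF _ ballm_nonneg])
    show "- (\<eta> * real n) <= ln (cmod (D b))" using Db Db0 by (subst ln_ge_iff) auto
   qed
   also have "... <= (LINT w:ball b (2 * s x)|lborel. U w)" using sub sx by (auto simp: U_def)
   finally have lowU: "- (ballm (2 * s x) * (\<eta> * real n)) <= (LINT w:ball b (2 * s x)|lborel. U w)" by simp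
   have upU: "U w <= \<eta> * real n" if w: "w \<in> ball b (2 * s x)" for w
   proof (cases "D w = 0")
    case True
    then show ?thesis using \<eta> by (simp add: U_def)
   next
    case False
    have "w \<in> ball b (3 * s x)" using w sx by auto
    then have w4: "w \<in> cball x (4 * s x)" using subb by blast
    then have "p n w ~= 0" using sx p_nz by blast
    moreover have "cmod (f n w) <= exp (\<eta> * real n) * cmod (p n w)" using elim(1) x w4 by blast
    ultimately have "cmod (D w) <= exp (\<eta> * real n)" by (simp add: D_def norm_divide divide_le_eq)
    then have "ln (cmod (D w)) <= ln (exp (\<eta> * real n))" using False by (subst ln_le_cancel_iff) auto
    then show ?thesis by (simp add: U_def)
   qed
   have absU: "(LINT w:ball b (2 * s x)|lborel. \<bar>U w\<bar>) <= ballm (2 * s x) * (2 * (\<eta> * real n) + \<eta> * real n)"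
    by (rule abs_mean_le[OF iU upU _ lowU]) (use \<eta> in auto)
   have subx: "ball x (s x) <= ball b (2 * s x)"
   proof
    fix w assume "w \<in> ball x (s x)"
    then show "w \<in> ball b (2 * s x)" using b(1) dist_triangle[of b w x] by (simp add: dist_commute)
   qed
   have iUx: "set_integrable lborel (ball x (s x)) (%w. \<bar>U w\<bar>)"
    by (rule set_integrable_subset[OF set_integrable_abs[OF iU] _ subx]) simp
   \<comment> \<open>At a zero of f the convention ln 0 = 0 makes U and W differ, so the equality is
     claimed off a finite set.\<close>
   have UW: "AE w in lborel. w \<in> ball x (s x) --> \<bar>U w\<bar> = \<bar>W n w\<bar>"
   proof -
    have "finite {w \<in> cball b (2 * s x). D w = 0}"
    proof (cases "D constant_on ball b (3 * s x)")
     case True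
     moreover have "b \<in> ball b (3 * s x)" "cball b (2 * s x) <= ball b (3 * s x)" using sx by auto
     ultimately have "D w = D b" if "w \<in> cball b (2 * s x)" for w
      using that unfolding constant_on_def by (metis subsetD)
     then have "{w \<in> cball b (2 * s x). D w = 0} = {}" using Db0 by auto
     then show ?thesis by (simp only: finite.emptyI)
    next
     case False
     show ?thesis by (rule holomorphic_compact_finite_zeros[OF D_hol _ _ _ _ False]) (use sx in auto)
    qed
    from AE_notin_finite[OF this] show ?thesis
    proof eventually_elim
     case (elim w)
     show ?case
     proof
      assume w: "w \<in> ball x (s x)"
      then have w2: "w \<in> cball b (2 * s x)" using subx by auto
      then have "D w ~= 0" using elim by simp
      then have "f n w ~= 0" "p n w ~= 0" by (auto simp: D_def)
      then show "\<bar>U w\<bar> = \<bar>W n w\<bar>" by (simp add: U_def D_def W_def norm_divide ln_div)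
     qed
    qed
   qed
   have Wa: "(%w. \<bar>W n w\<bar>) \<in> borel_measurable borel" "(%w. \<bar>U w\<bar>) \<in> borel_measurable borel" using W_borel U_borel by measurable
   have "set_integrable lborel (ball x (s x)) (%w. \<bar>U w\<bar>) \<longleftrightarrow> set_integrable lborel (ball x (s x)) (%w. \<bar>W n w\<bar>)"
    by (rule set_integrable_cong_AE) (use Wa UW in auto)
   with iUx show iW: "set_integrable lborel (ball x (s x)) (%w. \<bar>W n w\<bar>)" by simp
   have "(LINT w:ball x (s x)|lborel. \<bar>W n w\<bar>) = (LINT w:ball x (s x)|lborel. \<bar>U w\<bar>)"
    by (rule set_lebesgue_integral_cong_AE) (use Wa UW in \<open>auto elim!: eventually_mono\<close>)
   also have "... <= (LINT w:ball b (2 * s x)|lborel. \<bar>U w\<bar>)"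
    by (rule set_integral_mono_subset[OF set_integrable_abs[OF iU]]) (use subx in auto)
   finally show "(LINT w:ball x (s x)|lborel. \<bar>W n w\<bar>) <= ballm (2 * s x) * (3 * \<eta> * real n)" using absU by (simp add: algebra_simps)
  qed
  have bad: "set_integrable lborel (ball (c j) (r j)) (%w. \<bar>W n w\<bar>)"
   "(LINT w:ball (c j) (r j)|lborel. \<bar>W n w\<bar>) <= C1 * ((r j)\<^sup>2 * (1 + L j)) * real n" if j: "j \<in> J" for j
  proof -
   have rj: "0 < r j" "r j <= 1" "0 <= L j" "B j <= \<Omega>" "B j <= ball (c j) (r j)" "cmod (c j) <= \<rho>" using Jp[OF j] by auto
   obtain b where b: "b \<in> B j" "exp (- 1 * real n) * cmod (p n b) <= cmod (f n b)" using elim(2) j by blast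
   have pb: "exp (- L j * real n) <= cmod (p n b)" using Jp[OF j] b(1) by auto
   have "exp (- (1 + L j) * real n) = exp (- 1 * real n) * exp (- L j * real n)" by (simp add: exp_add[symmetric] algebra_simps)
   also have "... <= exp (- 1 * real n) * cmod (p n b)" by (rule mult_left_mono[OF pb]) simp
   finally have fb: "exp (- (1 + L j) * real n) <= cmod (f n b)" using b(2) by simp
   have fb0: "f n b ~= 0" "p n b ~= 0" using fb pb by (metis exp_gt_zero norm_zero not_le)+
   have bc: "b \<in> ball (c j) (r j)" using b rj by blast
   have subP: "ball b (3 * r j) <= ball 0 P"
   proof
    fix w assume "w \<in> ball b (3 * r j)"
    then have "cmod (w - b) <= 3" "cmod (b - c j) <= 1" using rj bc by (auto simp: dist_norm norm_minus_commute)
    then show "w \<in> ball 0 P" using norm_triangle_sub[of w b] norm_triangle_sub[of b "c j"] rj by (simp add: P_def)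
   qed
   have main: "set_integrable lborel (ball b (2 * r j)) (%w. ln (cmod (h w)))"
    "(LINT w:ball b (2 * r j)|lborel. \<bar>ln (cmod (h w))\<bar>) <= ballm (2 * r j) * (2 * (C * real n) + (1 + L j) * real n)"
    if h: "h holomorphic_on ball b (3 * r j)" "h \<in> borel_measurable borel" "exp (- (1 + L j) * real n) <= cmod (h b)"
     "!!w. w \<in> ball 0 P ==> cmod (h w) <= exp (C * real n)" for h
   proof -
    have hb0: "h b ~= 0" using h(3) by (metis exp_gt_zero norm_zero not_le)
    have hbor: "(%w. ln (cmod (h w))) \<in> borel_measurable borel" using h(2) by measurable
    note sub = ln_norm_submean[OF h(1) _ _ hb0 hbor refl, of "2 * r j"]
    show iH: "set_integrable lborel (ball b (2 * r j)) (%w. ln (cmod (h w)))" using sub rj by simp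
    have "ballm (2 * r j) * (- ((1 + L j) * real n)) <= ballm (2 * r j) * ln (cmod (h b))"
    proof (rule mult_left_mono[OF _ ballm_nonneg])
     have "ln (exp (- (1 + L j) * real n)) <= ln (cmod (h b))" using h(3) hb0 by (subst ln_le_cancel_iff) auto
     then show "- ((1 + L j) * real n) <= ln (cmod (h b))" by (simp add: algebra_simps)
    qed
    also have "... <= (LINT w:ball b (2 * r j)|lborel. ln (cmod (h w)))" using sub rj by simp
    finally have low: "- (ballm (2 * r j) * ((1 + L j) * real n)) <= (LINT w:ball b (2 * r j)|lborel. ln (cmod (h w)))" by simp
    have up: "ln (cmod (h w)) <= C * real n" if "w \<in> ball b (2 * r j)" for w
    proof (cases "h w = 0")
     case False
     have "w \<in> ball b (3 * r j)" using that rj by auto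
     then have "cmod (h w) <= exp (C * real n)" using h(4) subP by blast
     then have "ln (cmod (h w)) <= ln (exp (C * real n))" using False by (subst ln_le_cancel_iff) auto
     then show ?thesis by simp
    qed (use C in simp)
    show "(LINT w:ball b (2 * r j)|lborel. \<bar>ln (cmod (h w))\<bar>) <= ballm (2 * r j) * (2 * (C * real n) + (1 + L j) * real n)"
     by (rule abs_mean_le[OF iH up _ low]) (use C in auto)
   qed
   have fh: "f n holomorphic_on ball b (3 * r j)" by (rule holomorphic_on_subset[OF elim(3) subP])
   have "exp (- (1 + L j) * real n) <= exp (- L j * real n)" by (rule exp_decay_mono) simp
   then have pb': "exp (- (1 + L j) * real n) <= cmod (p n b)" using pb by (rule order.trans)
   note mf = main[OF fh f_borel fb] and mp = main[OF p_hol p_borel pb']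
   have iF: "set_integrable lborel (ball b (2 * r j)) (%w. ln (cmod (f n w)))"
    and iP: "set_integrable lborel (ball b (2 * r j)) (%w. ln (cmod (p n w)))" using mf(1) mp(1) elim(4) by auto
   have iW2: "set_integrable lborel (ball b (2 * r j)) (%w. \<bar>W n w\<bar>)"
    unfolding W_def by (intro set_integrable_abs set_integral_diff(1) iF iP)
   have subc: "ball (c j) (r j) <= ball b (2 * r j)"
   proof
    fix w assume "w \<in> ball (c j) (r j)"
    then show "w \<in> ball b (2 * r j)" using bc dist_triangle[of b w "c j"] by (simp add: dist_commute)
   qed
   show "set_integrable lborel (ball (c j) (r j)) (%w. \<bar>W n w\<bar>)"
    by (rule set_integrable_subset[OF iW2 _ subc]) simp
   have "(LINT w:ball (c j) (r j)|lborel. \<bar>W n w\<bar>) <= (LINT w:ball b (2 * r j)|lborel. \<bar>W n w\<bar>)"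
    by (rule set_integral_mono_subset[OF iW2]) (use subc in auto)
   also have "... <= (LINT w:ball b (2 * r j)|lborel. \<bar>ln (cmod (f n w))\<bar> + \<bar>ln (cmod (p n w))\<bar>)"
    by (rule set_integral_mono[OF iW2]) (auto intro!: set_integral_add(1) set_integrable_abs iF iP simp: W_def)
   also have "... = (LINT w:ball b (2 * r j)|lborel. \<bar>ln (cmod (f n w))\<bar>) + (LINT w:ball b (2 * r j)|lborel. \<bar>ln (cmod (p n w))\<bar>)"
    by (intro set_integral_add(2) set_integrable_abs iF iP)
   also have "... <= 2 * (ballm (2 * r j) * (2 * (C * real n) + (1 + L j) * real n))"
    using mf(2) mp(2) elim(4) by fastforce
   also have "... = pi * (4 * (r j)\<^sup>2) * (4 * C + 2 * (1 + L j)) * real n"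
    using rj by (simp add: ballm_eq power_mult_distrib algebra_simps)
   also have "... <= pi * (4 * (r j)\<^sup>2) * ((4 * C + 2) * (1 + L j)) * real n"
   proof (intro mult_right_mono mult_left_mono)
    show "4 * C + 2 * (1 + L j) <= (4 * C + 2) * (1 + L j)" using C rj by (simp add: algebra_simps)
   qed auto
   finally show "(LINT w:ball (c j) (r j)|lborel. \<bar>W n w\<bar>) <= C1 * ((r j)\<^sup>2 * (1 + L j)) * real n"
    by (simp add: C1_def algebra_simps)
  qed
  define I where "I = Inl ` X \<union> Inr ` J"
  define T where "T i = (case i of Inl x => ball x (s x) | Inr j => ball (c j) (r j))" for i
  have I: "finite I" using X J by (simp add: I_def)
  have cov: "ball 0 \<rho> <= (\<Union>i\<in>I. T i)"
  proof
   fix w :: complex assume "w \<in> ball 0 \<rho>"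
   then have "w \<in> K | w \<in> (\<Union>j\<in>J. ball (c j) (r j))" by (auto simp: K_def)
   then show "w \<in> (\<Union>i\<in>I. T i)" using X(3) by (force simp: I_def T_def)
  qed
  have iT: "set_integrable lborel (T i) (%w. \<bar>W n w\<bar>)" if "i \<in> I" for i
   using that good(1) bad(1) by (auto simp: I_def T_def)
  have Wa: "(%w. \<bar>W n w\<bar>) \<in> borel_measurable borel" using W_borel by measurable
  note cover = set_integral_cover[OF I cov _ Wa _ iT]
  have iabs: "set_integrable lborel (ball 0 \<rho>) (%w. \<bar>W n w\<bar>)" using cover(1) by simp
  have "set_integrable lborel (ball 0 \<rho>) (W n)"
   by (subst set_integrable_abs_iff'[symmetric]) (use W_borel iabs in auto)
  moreover have "(LINT w:ball 0 \<rho>|lborel. \<bar>W n w\<bar>) <= e * real n"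
  proof -
   have "(LINT w:ball 0 \<rho>|lborel. \<bar>W n w\<bar>) <= (\<Sum>i\<in>I. LINT w:T i|lborel. \<bar>W n w\<bar>)" using cover(2) by simp
   also have "... = (\<Sum>x\<in>X. LINT w:ball x (s x)|lborel. \<bar>W n w\<bar>) + (\<Sum>j\<in>J. LINT w:ball (c j) (r j)|lborel. \<bar>W n w\<bar>)"
    unfolding I_def using X J by (subst sum.union_disjoint) (auto simp: sum.reindex T_def)
   also have "... <= (\<Sum>x\<in>X. ballm (2 * s x) * (3 * \<eta> * real n)) + (\<Sum>j\<in>J. C1 * ((r j)\<^sup>2 * (1 + L j)) * real n)"
    by (intro add_mono sum_mono good(2) bad(2))
   also have "... = S * (3 * \<eta> * real n) + C1 * (\<Sum>j\<in>J. (r j)\<^sup>2 * (1 + L j)) * real n"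
    by (simp add: S_def sum_distrib_left sum_distrib_right)
   also have "... <= e / 2 * real n + C1 * (e / (2 * C1)) * real n"
   proof (intro add_mono mult_right_mono mult_left_mono Jsum)
    have "S * (3 * \<eta>) <= e / 2"
    proof -
     have "S * (3 * \<eta>) = (3 * S) / (3 * S + 1) * (e / 2)" using S0 by (simp add: \<eta>_def)
     also have "... <= 1 * (e / 2)" using S0 e by (intro mult_right_mono) auto
     finally show ?thesis by simp
    qed
    then show "S * (3 * \<eta> * real n) <= e / 2 * real n" by (metis mult.assoc mult_right_mono of_nat_0_le_iff)
   qed (use C1 in auto)
   also have "... = e * real n" using C1 by (simp add: field_simps)
   finally show ?thesis .
  qed
  ultimately show ?case by (simp add: W_def[abs_def])
 qed
qed

end

subsection \<open>Convergence of zero counting measures\<close>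

lemma max_ln_integrable0:
 assumes "d >= 0" "r > 0"
 shows "set_integrable lborel (ball 0 r) (%z. ln (max (cmod z) d))"
proof (cases "d = 0")
 case True
 then show ?thesis using ln_norm_ball(1)[OF assms(2), of 0 0] by simp
qed (use assms max_ln_integrable in simp)

lemma logball_mono:
 assumes "0 <= d" "d <= d'" "r > 0"
 shows "logball r d <= logball r d'"
 unfolding logball_def set_lebesgue_integral_def
proof (rule integral_mono_AE)
 show "integrable lborel (%z. indicat_real (ball 0 r) z *\<^sub>R ln (max (cmod z) d))"
  "integrable lborel (%z. indicat_real (ball 0 r) z *\<^sub>R ln (max (cmod z) d'))"
  using max_ln_integrable0[of d r] max_ln_integrable0[of d' r] assms unfolding set_integrable_def by auto
 show "AE z in lborel. indicat_real (ball 0 r) z *\<^sub>R ln (max (cmod z) d) <= indicat_real (ball 0 r) z *\<^sub>R ln (max (cmod z) d')"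
  using AE_norm_neq[of 0]
 proof eventually_elim
  case (elim z)
  then have "max (cmod z) d > 0" by (simp add: less_max_iff_disj)
  moreover have "max (cmod z) d <= max (cmod z) d'" using assms by simp
  ultimately have "ln (max (cmod z) d) <= ln (max (cmod z) d')" by (subst ln_le_cancel_iff) auto
  then show ?case by (simp add: indicator_def)
 qed
qed

lemma logball_outside:
 assumes "d >= r" "r > 0"
 shows "logball r d = ballm r * ln d"
proof -
 have "logball r d = (LINT z:ball (0::complex) r|lborel. ln d)"
  unfolding logball_def by (rule set_lebesgue_integral_cong) (use assms in \<open>auto simp: max_def\<close>)
 then show ?thesis by (simp add: set_integral_ball_const)
qed

text \<open>The mean over the annulus between radii 2 \<epsilon> and 3 \<epsilon> minus the mean
  over the disc of radius \<epsilon>, applied to the logarithm with a pole at distance d from the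
  centre. This functional, \<open>ann_mean\<close>, kills harmonic functions and sees only nearby
  poles, so it plays the role of a smeared Laplacian.\<close>

definition tker :: "real => real => real" where
 "tker \<epsilon> d = (logball (3 * \<epsilon>) d - logball (2 * \<epsilon>) d) / (ballm (3 * \<epsilon>) - ballm (2 * \<epsilon>)) - logball \<epsilon> d / ballm \<epsilon>"

definition ann_mean :: "real => complex => (complex => real) => real" where
 "ann_mean \<epsilon> b u = ((LINT w:ball b (3 * \<epsilon>)|lborel. u w) - (LINT w:ball b (2 * \<epsilon>)|lborel. u w)) / (ballm (3 * \<epsilon>) - ballm (2 * \<epsilon>))
  - (LINT w:ball b \<epsilon>|lborel. u w) / ballm \<epsilon>"

context
 fixes \<epsilon> :: real
 assumes \<epsilon>: "\<epsilon> > 0"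
begin

lemma ballm_diff: "ballm (3 * \<epsilon>) - ballm (2 * \<epsilon>) = 5 * pi * \<epsilon>\<^sup>2" "ballm \<epsilon> = pi * \<epsilon>\<^sup>2"
 using \<epsilon> by (auto simp: ballm_eq power_mult_distrib)

lemma ballm_diff_pos: "ballm (3 * \<epsilon>) - ballm (2 * \<epsilon>) > 0" "ballm \<epsilon> > 0"
 unfolding ballm_diff using \<epsilon> by auto

lemma tker_outside:
 assumes "d >= 3 * \<epsilon>" shows "tker \<epsilon> d = 0"
proof -
 have "logball (3 * \<epsilon>) d = ballm (3 * \<epsilon>) * ln d" "logball (2 * \<epsilon>) d = ballm (2 * \<epsilon>) * ln d" "logball \<epsilon> d = ballm \<epsilon> * ln d"
  using assms \<epsilon> by (auto intro!: logball_outside)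
 then show ?thesis unfolding tker_def using ballm_diff_pos by (simp add: left_diff_distrib[symmetric] del: times_divide_eq_left)
qed

text \<open>ln max(|z|, d) increases with |z|, so the annulus mean is at least its value at radius 2
  \<epsilon> and the disc mean at most its value at radius \<epsilon>.\<close>

lemma tker_ge:
 assumes d: "d >= 0"
 shows "tker \<epsilon> d >= ln (max (2 * \<epsilon>) d) - ln (max \<epsilon> d)"
proof -
 let ?g = "%z::complex. ln (max (cmod z) d)"
 let ?a = "ln (max (2 * \<epsilon>) d)"
 have i3: "set_integrable lborel (ball 0 (3 * \<epsilon>)) ?g" and i2: "set_integrable lborel (ball 0 (2 * \<epsilon>)) ?g"
  and i1: "set_integrable lborel (ball 0 \<epsilon>) ?g"
  using max_ln_integrable0 d \<epsilon> by auto
 have c: "set_integrable lborel (ball (0::complex) r) (%z. a)" for r a :: real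
  by (rule set_integrable_ball_bounded) auto
 \<comment> \<open>After subtraction of \<open>?a\<close> the integrand is nonnegative on the
   annulus, so enlarging the disc cannot decrease the integral.\<close>
 have "(LINT z:ball 0 (2 * \<epsilon>)|lborel. ?g z - ?a) <= (LINT z:ball 0 (3 * \<epsilon>)|lborel. ?g z - ?a)"
  unfolding set_lebesgue_integral_def
 proof (rule integral_mono)
  show "integrable lborel (%z. indicat_real (ball 0 (2 * \<epsilon>)) z *\<^sub>R (?g z - ?a))"
   "integrable lborel (%z. indicat_real (ball 0 (3 * \<epsilon>)) z *\<^sub>R (?g z - ?a))"
   using set_integral_diff(1)[OF i2 c] set_integral_diff(1)[OF i3 c] unfolding set_integrable_def by auto
  fix z :: complex
  show "indicat_real (ball 0 (2 * \<epsilon>)) z *\<^sub>R (?g z - ?a) <= indicat_real (ball 0 (3 * \<epsilon>)) z *\<^sub>R (?g z - ?a)"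
  proof (cases "z \<in> ball 0 (2 * \<epsilon>)")
   case True
   then show ?thesis using \<epsilon> by (auto simp: indicator_def)
  next
   case False
   then have "max (2 * \<epsilon>) d <= max (cmod z) d" by auto
   then have "?a <= ?g z" using \<epsilon> by (subst ln_le_cancel_iff) auto
   then show ?thesis using False by (auto simp: indicator_def)
  qed
 qed
 then have 1: "(ballm (3 * \<epsilon>) - ballm (2 * \<epsilon>)) * ?a <= logball (3 * \<epsilon>) d - logball (2 * \<epsilon>) d"
  unfolding set_integral_diff(2)[OF i2 c] set_integral_diff(2)[OF i3 c] set_integral_ball_const logball_def
  by (simp add: algebra_simps)
 have "logball \<epsilon> d <= logball \<epsilon> (max \<epsilon> d)" using d \<epsilon> by (intro logball_mono) auto
 also have "... = ballm \<epsilon> * ln (max \<epsilon> d)" using \<epsilon> by (intro logball_outside) auto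
 finally have 2: "logball \<epsilon> d / ballm \<epsilon> <= ln (max \<epsilon> d)" using ballm_diff_pos by (simp add: divide_le_eq mult.commute)
 have "?a <= (logball (3 * \<epsilon>) d - logball (2 * \<epsilon>) d) / (ballm (3 * \<epsilon>) - ballm (2 * \<epsilon>))"
  using 1 ballm_diff_pos(1) by (subst pos_le_divide_eq) (auto simp: mult.commute)
 with 2 show ?thesis unfolding tker_def by linarith
qed

lemma tker_nonneg: "d >= 0 ==> tker \<epsilon> d >= 0"
proof -
 assume d: "d >= 0"
 have "ln (max \<epsilon> d) <= ln (max (2 * \<epsilon>) d)" using \<epsilon> by (subst ln_le_cancel_iff) auto
 then show ?thesis using tker_ge[OF d] by linarith
qed

lemma tker_bounded: "\<exists>G. \<forall>d\<ge>0. tker \<epsilon> d <= G"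
proof -
 define G where "G = (logball (3 * \<epsilon>) (3 * \<epsilon>) - logball (2 * \<epsilon>) 0) / (ballm (3 * \<epsilon>) - ballm (2 * \<epsilon>)) - logball \<epsilon> 0 / ballm \<epsilon>"
 have "tker \<epsilon> d <= max 0 G" if "d >= 0" for d
 proof (cases "d >= 3 * \<epsilon>")
  case False
  then have "logball (3 * \<epsilon>) d <= logball (3 * \<epsilon>) (3 * \<epsilon>)" "logball (2 * \<epsilon>) 0 <= logball (2 * \<epsilon>) d" "logball \<epsilon> 0 <= logball \<epsilon> d"
   using that \<epsilon> by (auto intro!: logball_mono)
  then have "tker \<epsilon> d <= G" unfolding tker_def G_def using ballm_diff_pos by (intro diff_mono divide_right_mono) auto
  then show ?thesis by simp
 qed (simp add: tker_outside)
 then show ?thesis by blast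
qed

lemma tker_borel: "(%b. tker \<epsilon> (cmod (s - b))) \<in> borel_measurable borel"
proof -
 \<comment> \<open>Measurability comes from monotonicity in d; \<open>max 0 d\<close> extends the
   monotone function to the whole line.\<close>
 have m: "(%d. logball r (max 0 d)) \<in> borel_measurable borel" if "r > 0" for r
  using that by (intro borel_measurable_mono monoI logball_mono) auto
 then have "(%d. tker \<epsilon> (max 0 d)) \<in> borel_measurable borel" unfolding tker_def
  using \<epsilon> by (intro borel_measurable_diff borel_measurable_divide borel_measurable_const m) auto
 from measurable_compose[OF _ this, of "%b. cmod (s - b)" borel]
 show ?thesis by simp
qed

text \<open>The harmonic part contributes Re (k b) to both means and cancels; each pole leaves one
  value of the kernel.\<close>

lemma ann_mean_log_potential:
 fixes s :: "'i => complex" and c :: "'i => real"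
 assumes I: "finite I" and k: "k holomorphic_on ball b R" and R: "3 * \<epsilon> < R"
  and eq: "AE z in lborel. z \<in> ball b (3 * \<epsilon>) --> u z = (\<Sum>i\<in>I. c i * ln (cmod (z - s i))) + Re (k z)"
  and u: "u \<in> borel_measurable borel"
 shows "set_integrable lborel (ball b (3 * \<epsilon>)) u" "ann_mean \<epsilon> b u = (\<Sum>i\<in>I. c i * tker \<epsilon> (cmod (s i - b)))"
proof -
 have eq': "AE z in lborel. z \<in> ball b r --> u z = (\<Sum>i\<in>I. c i * ln (cmod (z - s i))) + Re (k z)" if "r <= 3 * \<epsilon>" for r
  using eq by eventually_elim (use that in auto)
 have v: "(LINT z:ball b r|lborel. u z) = (\<Sum>i\<in>I. c i * logball r (cmod (s i - b))) + ballm r * Re (k b)"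
  if "r <= 3 * \<epsilon>" "r > 0" for r
  by (rule log_potential_ball(2)[OF I k _ _ eq' u]) (use that R in auto)
 show "set_integrable lborel (ball b (3 * \<epsilon>)) u"
  by (rule log_potential_ball(1)[OF I k _ R eq u]) (use \<epsilon> in auto)
 let ?B = "ballm (3 * \<epsilon>) - ballm (2 * \<epsilon>)"
 let ?S = "%r. \<Sum>i\<in>I. c i * logball r (cmod (s i - b))"
 have "ann_mean \<epsilon> b u = ((?S (3 * \<epsilon>) - ?S (2 * \<epsilon>)) + ?B * Re (k b)) / ?B - (?S \<epsilon> + ballm \<epsilon> * Re (k b)) / ballm \<epsilon>"
  unfolding ann_mean_def using \<epsilon> by (simp add: v algebra_simps)
 also have "... = (?S (3 * \<epsilon>) - ?S (2 * \<epsilon>)) / ?B - ?S \<epsilon> / ballm \<epsilon>"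
  using ballm_diff_pos by (simp add: add_divide_distrib)
 also have "... = (\<Sum>i\<in>I. c i * tker \<epsilon> (cmod (s i - b)))"
  unfolding tker_def by (simp add: sum_subtractf[symmetric] sum_divide_distrib right_diff_distrib)
 finally show "ann_mean \<epsilon> b u = (\<Sum>i\<in>I. c i * tker \<epsilon> (cmod (s i - b)))" .
qed

lemma ann_mean_diff:
 assumes "set_integrable lborel (ball b (3 * \<epsilon>)) F" "set_integrable lborel (ball b (3 * \<epsilon>)) H"
 shows "ann_mean \<epsilon> b F - ann_mean \<epsilon> b H = ann_mean \<epsilon> b (%w. F w - H w)"
proof -
 have "set_integrable lborel (ball b r) F" "set_integrable lborel (ball b r) H" if "r <= 3 * \<epsilon>" for r
  using assms by (auto elim!: set_integrable_subset intro!: subset_ball that)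
 then have v: "(LINT w:ball b r|lborel. F w - H w) = (LINT w:ball b r|lborel. F w) - (LINT w:ball b r|lborel. H w)" if "r <= 3 * \<epsilon>" for r
  using that by (intro set_integral_diff(2)) auto
 show ?thesis unfolding ann_mean_def using \<epsilon> by (simp add: v diff_divide_distrib)
qed

lemma ann_mean_bound:
 assumes W: "set_integrable lborel (ball 0 \<rho>) W" and sub: "ball b (3 * \<epsilon>) <= ball 0 \<rho>"
 shows "\<bar>ann_mean \<epsilon> b W\<bar> <= (2 / (5 * pi * \<epsilon>\<^sup>2) + 1 / (pi * \<epsilon>\<^sup>2)) * (LINT w:ball 0 \<rho>|lborel. \<bar>W w\<bar>)"
proof -
 let ?T = "LINT w:ball 0 \<rho>|lborel. \<bar>W w\<bar>"
 have bd: "\<bar>LINT w:ball b r|lborel. W w\<bar> <= ?T" if "r <= 3 * \<epsilon>" for r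
 proof -
  have sr: "ball b r <= ball 0 \<rho>" using sub that by (meson order_trans subset_ball)
  have i: "set_integrable lborel (ball b r) W" by (rule set_integrable_subset[OF W _ sr]) simp
  have "\<bar>LINT w:ball b r|lborel. W w\<bar> <= (LINT w:ball b r|lborel. \<bar>W w\<bar>)"
   using set_integral_norm_bound[OF i] by simp
  also have "... <= ?T" by (rule set_integral_mono_subset[OF set_integrable_abs[OF W]]) (use sr in auto)
  finally show ?thesis .
 qed
 have "\<bar>ann_mean \<epsilon> b W\<bar> <= \<bar>((LINT w:ball b (3 * \<epsilon>)|lborel. W w) - (LINT w:ball b (2 * \<epsilon>)|lborel. W w)) / (5 * pi * \<epsilon>\<^sup>2)\<bar>
  + \<bar>(LINT w:ball b \<epsilon>|lborel. W w) / (pi * \<epsilon>\<^sup>2)\<bar>"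
  unfolding ann_mean_def ballm_diff by (rule abs_triangle_ineq4)
 also have "... <= (?T + ?T) / (5 * pi * \<epsilon>\<^sup>2) + ?T / (pi * \<epsilon>\<^sup>2)"
  unfolding abs_divide using bd[of "3 * \<epsilon>"] bd[of "2 * \<epsilon>"] bd[of \<epsilon>] \<epsilon>
  by (intro add_mono frac_le) (auto intro!: order.trans[OF abs_triangle_ineq4] add_mono)
 also have "... = (2 / (5 * pi * \<epsilon>\<^sup>2) + 1 / (pi * \<epsilon>\<^sup>2)) * ?T" by (simp add: algebra_simps)
 finally show ?thesis .
qed

definition tmass :: real where "tmass = (\<integral>b. tker \<epsilon> (cmod b) \<partial>lborel)"

lemma bounded_support_integrable:
 fixes h :: "complex => real"
 assumes "h \<in> borel_measurable borel" "!!b. \<bar>h b\<bar> <= D" "!!b. b \<notin> ball c r ==> h b = 0"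
 shows "integrable lborel h"
proof -
 have "set_integrable lborel (ball c r) h" by (rule set_integrable_ball_bounded) (use assms in auto)
 moreover have "(%b. indicat_real (ball c r) b *\<^sub>R h b) = h" using assms(3) by (auto simp: fun_eq_iff indicator_def)
 ultimately show ?thesis unfolding set_integrable_def by (simp only:)
qed

lemma tker_integrable: "integrable lborel (%b. tker \<epsilon> (cmod (s - b)))"
proof -
 obtain G where G: "!!d. d >= 0 ==> tker \<epsilon> d <= G" using tker_bounded by blast
 show ?thesis
 proof (rule bounded_support_integrable[OF tker_borel])
  show "\<bar>tker \<epsilon> (cmod (s - b))\<bar> <= G" for b
   using G[of "cmod (s - b)"] tker_nonneg[of "cmod (s - b)"] by simp
  show "tker \<epsilon> (cmod (s - b)) = 0" if "b \<notin> ball s (3 * \<epsilon>)" for b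
   using that by (intro tker_outside) (simp add: dist_norm)
 qed
qed

lemma tmass_shift: "(\<integral>b. tker \<epsilon> (cmod (s - b)) \<partial>lborel) = tmass"
proof -
 have "(\<integral>b. tker \<epsilon> (cmod (s - b)) \<partial>lborel) = (\<integral>b. tker \<epsilon> (cmod (s - b)) \<partial>distr lborel borel ((+) s))"
  by (simp add: lborel_distr_plus)
 also have "... = (\<integral>b. tker \<epsilon> (cmod (s - (s + b))) \<partial>lborel)"
  by (rule integral_distr) (use tker_borel in auto)
 finally show ?thesis by (simp add: tmass_def)
qed

lemma tmass_pos: "tmass > 0"
proof -
 have "0 < ballm \<epsilon> * ln 2" using ballm_diff_pos by simp
 also have "ballm \<epsilon> * ln 2 = (LINT b:ball (0::complex) \<epsilon>|lborel. ln 2)" by (simp add: set_integral_ball_const)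
 also have "... <= tmass"
  unfolding tmass_def set_lebesgue_integral_def
 proof (rule integral_mono)
  show "integrable lborel (%b::complex. indicat_real (ball 0 \<epsilon>) b *\<^sub>R ln 2)"
   using set_integrable_ball_bounded[of "%b. ln 2" 0 \<epsilon> "ln 2"] unfolding set_integrable_def by simp
  show "integrable lborel (%b. tker \<epsilon> (cmod b))" using tker_integrable[of 0] by simp
  fix b :: complex
  show "indicat_real (ball 0 \<epsilon>) b *\<^sub>R ln 2 <= tker \<epsilon> (cmod b)"
  proof (cases "b \<in> ball 0 \<epsilon>")
   case True
   then have "ln (max (2 * \<epsilon>) (cmod b)) - ln (max \<epsilon> (cmod b)) = ln 2"
    using \<epsilon> by (simp add: max_def ln_mult)
   then show ?thesis using tker_ge[of "cmod b"] True by simp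
  qed (use tker_nonneg in simp)
 qed
 finally show ?thesis .
qed

text \<open>Convolution with the kernel. Divided by \<open>tmass\<close> it is an approximate
  identity as \<epsilon> tends to 0.\<close>

definition smear :: "(complex => real) => complex => real" where
 "smear \<psi> s = (\<integral>b. \<psi> b * tker \<epsilon> (cmod (s - b)) \<partial>lborel)"

lemma smear_integrable:
 assumes "\<psi> \<in> borel_measurable borel" "!!b. \<bar>\<psi> b\<bar> <= D"
 shows "integrable lborel (%b. \<psi> b * tker \<epsilon> (cmod (s - b)))"
proof (rule Bochner_Integration.integrable_bound[OF integrable_mult_right[OF tker_integrable, of D s]])
 show "(%b. \<psi> b * tker \<epsilon> (cmod (s - b))) \<in> borel_measurable lborel" using assms(1) tker_borel by measurable
 show "AE b in lborel. norm (\<psi> b * tker \<epsilon> (cmod (s - b))) <= norm (D * tker \<epsilon> (cmod (s - b)))"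
 proof (rule AE_I2)
  fix b
  have "\<bar>\<psi> b\<bar> <= \<bar>D\<bar>" using assms(2)[of b] by linarith
  then show "norm (\<psi> b * tker \<epsilon> (cmod (s - b))) <= norm (D * tker \<epsilon> (cmod (s - b)))"
   by (simp add: abs_mult mult_right_mono)
 qed
qed

lemma smear_close:
 assumes \<psi>: "\<psi> \<in> borel_measurable borel" "!!b. \<bar>\<psi> b\<bar> <= D" and close: "!!b. dist s b < 3 * \<epsilon> ==> \<bar>\<psi> b - \<psi> s\<bar> <= \<omega>"
 shows "\<bar>smear \<psi> s - tmass * \<psi> s\<bar> <= \<omega> * tmass"
proof -
 have "smear \<psi> s - tmass * \<psi> s = (\<integral>b. \<psi> b * tker \<epsilon> (cmod (s - b)) - \<psi> s * tker \<epsilon> (cmod (s - b)) \<partial>lborel)"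
  unfolding smear_def using smear_integrable[OF \<psi>] tker_integrable[of s]
  by (subst Bochner_Integration.integral_diff) (auto simp: tmass_shift mult.commute)
 also have "\<bar>...\<bar> <= (\<integral>b. \<omega> * tker \<epsilon> (cmod (s - b)) \<partial>lborel)"
 proof (rule order.trans[OF integral_abs_bound integral_mono])
  show "integrable lborel (%b. \<bar>\<psi> b * tker \<epsilon> (cmod (s - b)) - \<psi> s * tker \<epsilon> (cmod (s - b))\<bar>)"
   using smear_integrable[OF \<psi>] tker_integrable[of s] by auto
  show "integrable lborel (%b. \<omega> * tker \<epsilon> (cmod (s - b)))" using tker_integrable[of s] by simp
  fix b
  show "\<bar>\<psi> b * tker \<epsilon> (cmod (s - b)) - \<psi> s * tker \<epsilon> (cmod (s - b))\<bar> <= \<omega> * tker \<epsilon> (cmod (s - b))"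
  proof (cases "dist s b < 3 * \<epsilon>")
   case True
   have "\<bar>\<psi> b * tker \<epsilon> (cmod (s - b)) - \<psi> s * tker \<epsilon> (cmod (s - b))\<bar> = \<bar>\<psi> b - \<psi> s\<bar> * tker \<epsilon> (cmod (s - b))"
    using tker_nonneg[of "cmod (s - b)"] by (simp add: left_diff_distrib[symmetric] abs_mult)
   also have "... <= \<omega> * tker \<epsilon> (cmod (s - b))" using close[OF True] tker_nonneg by (intro mult_right_mono) auto
   finally show ?thesis .
  next
   case False
   then have "tker \<epsilon> (cmod (s - b)) = 0" by (intro tker_outside) (simp add: dist_norm)
   then show ?thesis by simp
  qed
 qed
 also have "... = \<omega> * tmass" by (simp add: tmass_shift)
 finally show ?thesis .
qed

lemma smear_zero:
 assumes "!!b. b \<notin> ball 0 \<rho> ==> \<psi> b = 0" "cmod s >= \<rho> + 3 * \<epsilon>"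
 shows "smear \<psi> s = 0"
proof -
 have "\<psi> b * tker \<epsilon> (cmod (s - b)) = 0" for b
 proof (cases "b \<in> ball 0 \<rho>")
  case True
  then have "cmod (s - b) >= 3 * \<epsilon>" using assms(2) norm_triangle_ineq2[of s b] by simp
  then show ?thesis using tker_outside by simp
 qed (use assms(1) in simp)
 then show ?thesis unfolding smear_def by (simp only: Bochner_Integration.integral_zero)
qed

end

locale zero_pair = potential_pair f p \<Omega> for f p \<Omega> +
 fixes I :: "nat => (nat \<times> nat) set" and t :: "nat => nat \<times> nat => complex" and m :: nat
 assumes I_fin: "finite (I n)" and t_nz: "i \<in> I n ==> t n i ~= 0"
  and p_prod: "p n w = (\<Prod>i\<in>I n. 1 - w / t n i)" and I_card: "card (I n) <= m * n"
begin

definition Zf :: "real => nat => complex set" where "Zf \<rho> n = {s \<in> ball 0 \<rho>. f n s = 0}"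

definition mult :: "nat => complex => real" where "mult n s = real (nat (zorder (f n) s))"

text \<open>\<open>ann_mean\<close> sends ln |f n| and ln |p n| to the two sums, and their
  difference is at most a constant times the L1 distance, uniformly in the centre b. The radius is
  enlarged by 3 \<epsilon> + 1 so that every disc involved has some room.\<close>

lemma kernel_diff:
 assumes \<epsilon>: "\<epsilon> > 0" and \<rho>: "\<rho> > 0" and e: "e > 0"
 shows "\<forall>\<^sub>F n in sequentially. finite (Zf (\<rho> + 3 * \<epsilon> + 1) n) & (\<forall>b\<in>ball 0 \<rho>.
  \<bar>(\<Sum>s\<in>Zf (\<rho> + 3 * \<epsilon> + 1) n. mult n s * tker \<epsilon> (cmod (s - b))) - (\<Sum>i\<in>I n. tker \<epsilon> (cmod (t n i - b)))\<bar> <= e * real n)"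
proof -
 define \<rho>' where "\<rho>' = \<rho> + 3 * \<epsilon> + 1"
 define K where "K = 2 / (5 * pi * \<epsilon>\<^sup>2) + 1 / (pi * \<epsilon>\<^sup>2)"
 have K: "K > 0" using \<epsilon> by (auto simp: K_def intro!: add_pos_pos divide_pos_pos)
 have \<rho>': "\<rho>' > 0" using \<rho> \<epsilon> by (simp add: \<rho>'_def)
 have "e / K > 0" using e K by simp
 from L1_convergence[OF \<rho>' this] f_hol[of "\<rho>' + 1"]
 show ?thesis
  unfolding \<rho>'_def[symmetric]
 proof eventually_elim
  case (elim n)
  let ?F = "%w. ln (cmod (f n w))" and ?H = "%w. ln (cmod (p n w))"
  have Fb: "?F \<in> borel_measurable borel" and Hb: "?H \<in> borel_measurable borel" using f_borel p_borel by measurable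
  have nz: "\<exists>w\<in>ball 0 (\<rho>' + 1). f n w ~= 0" using f0[of n] \<rho>' by (intro bexI[of _ 0]) auto
  obtain k where k: "finite (Zf \<rho>' n)" "k holomorphic_on ball 0 \<rho>'"
   "!!w. w \<in> ball 0 \<rho>' ==> f n w = (\<Prod>s\<in>Zf \<rho>' n. (w - s) ^ nat (zorder (f n) s)) * exp (k w)"
  proof (rule holomorphic_zero_factorization[OF elim(2) nz, of \<rho>', folded Zf_def])
   show "\<rho>' < \<rho>' + 1" by simp
  qed (rule that)
  have "\<bar>(\<Sum>s\<in>Zf \<rho>' n. mult n s * tker \<epsilon> (cmod (s - b))) - (\<Sum>i\<in>I n. tker \<epsilon> (cmod (t n i - b)))\<bar> <= e * real n"
   if b: "b \<in> ball 0 \<rho>" for b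
  proof -
   have sub: "ball b (3 * \<epsilon> + 1) <= ball 0 \<rho>'"
   proof
    fix w assume "w \<in> ball b (3 * \<epsilon> + 1)"
    then have "cmod (w - b) < 3 * \<epsilon> + 1" by (simp add: dist_norm norm_minus_commute)
    then show "w \<in> ball 0 \<rho>'" using norm_triangle_sub[of w b] b by (simp add: \<rho>'_def)
   qed
   have sub3: "ball b (3 * \<epsilon>) <= ball 0 \<rho>'" using sub by (rule order.trans[rotated]) (simp add: subset_ball)
   have aeF: "AE z in lborel. z \<in> ball b (3 * \<epsilon>) --> ?F z = (\<Sum>s\<in>Zf \<rho>' n. mult n s * ln (cmod (z - s))) + Re (k z)"
    using AE_notin_finite[OF k(1)]
   proof eventually_elim
    case (elim z)
    show ?case
    proof
     assume "z \<in> ball b (3 * \<epsilon>)"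
     then have "z \<in> ball 0 \<rho>'" using sub3 by blast
     then show "?F z = (\<Sum>s\<in>Zf \<rho>' n. mult n s * ln (cmod (z - s))) + Re (k z)"
      unfolding mult_def using ln_norm_factorization[of "Zf \<rho>' n" "f n" z "%s. nat (zorder (f n) s)" k, OF k(1) k(3) elim] by simp
    qed
   qed
   have aeH: "AE z in lborel. z \<in> ball b (3 * \<epsilon>) --> ?H z = (\<Sum>i\<in>I n. 1 * ln (cmod (z - t n i))) + Re (complex_of_real (- (\<Sum>i\<in>I n. ln (cmod (t n i)))))"
    using AE_notin_finite[OF finite_imageI[OF I_fin[of n], of "t n"]]
   proof eventually_elim
    case (elim z)
    have zt: "z - t n i ~= 0" if "i \<in> I n" for i using that elim by auto
    have "?H z = (\<Sum>i\<in>I n. ln (cmod (1 - z / t n i)))"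
     unfolding p_prod prod_norm[symmetric]
    proof (rule ln_prod[OF I_fin])
     fix i assume "i \<in> I n"
     then show "cmod (1 - z / t n i) ~= 0" using zt[of i] t_nz[of i n] by (auto simp: field_simps)
    qed
    also have "... = (\<Sum>i\<in>I n. ln (cmod (z - t n i)) - ln (cmod (t n i)))"
    proof (rule sum.cong[OF refl])
     fix i assume i: "i \<in> I n"
     have "1 - z / t n i = - (z - t n i) / t n i" using t_nz[OF i] by (simp add: field_simps)
     then have "cmod (1 - z / t n i) = cmod (z - t n i) / cmod (t n i)" by (metis norm_divide norm_minus_cancel)
     then show "ln (cmod (1 - z / t n i)) = ln (cmod (z - t n i)) - ln (cmod (t n i))"
      using zt[OF i] t_nz[OF i] by (simp add: ln_div)
    qed
    finally show ?case by (simp add: sum_subtractf)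
   qed
   note A = ann_mean_log_potential[OF \<epsilon> k(1) holomorphic_on_subset[OF k(2) sub] _ aeF Fb]
   note A' = ann_mean_log_potential[OF \<epsilon> I_fin holomorphic_on_const _ aeH Hb, of "3 * \<epsilon> + 1"]
   have "(\<Sum>s\<in>Zf \<rho>' n. mult n s * tker \<epsilon> (cmod (s - b))) - (\<Sum>i\<in>I n. tker \<epsilon> (cmod (t n i - b))) = ann_mean \<epsilon> b ?F - ann_mean \<epsilon> b ?H"
    using A(2) A'(2) by simp
   also have "... = ann_mean \<epsilon> b (%w. ?F w - ?H w)" by (rule ann_mean_diff[OF \<epsilon>]) (use A(1) A'(1) in auto)
   also have "\<bar>...\<bar> <= K * (LINT w:ball 0 \<rho>'|lborel. \<bar>?F w - ?H w\<bar>)"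
    unfolding K_def using elim(1) by (intro ann_mean_bound[OF \<epsilon> _ sub3]) auto
   also have "... <= K * (e / K * real n)" using elim(1) K by (intro mult_left_mono) auto
   finally show ?thesis using K by simp
  qed
  then show ?case using k(1) by blast
 qed
qed

lemma smear_diff:
 assumes \<epsilon>: "\<epsilon> > 0" and \<rho>: "\<rho> > 0" and e: "e > 0"
  and \<psi>: "\<psi> \<in> borel_measurable borel" "!!b. \<bar>\<psi> b\<bar> <= D" and \<psi>0: "\<forall>b. b \<notin> ball 0 \<rho> --> \<psi> b = 0"
 shows "\<forall>\<^sub>F n in sequentially. finite (Zf (\<rho> + 3 * \<epsilon> + 1) n) \<and>
  \<bar>(\<Sum>s\<in>Zf (\<rho> + 3 * \<epsilon> + 1) n. mult n s * smear \<epsilon> \<psi> s) - (\<Sum>i\<in>I n. smear \<epsilon> \<psi> (t n i))\<bar> <= e * real n"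
proof -
 define T where "T = (\<integral>b. \<bar>\<psi> b\<bar> \<partial>lborel)"
 have i\<psi>: "integrable lborel \<psi>" by (rule bounded_support_integrable[OF \<epsilon> \<psi>, of 0 \<rho>]) (use \<psi>0 in auto)
 have T: "T >= 0" unfolding T_def by simp
 have "e / (T + 1) > 0" using e T by simp
 from kernel_diff[OF \<epsilon> \<rho> this] show ?thesis
 proof eventually_elim
  case (elim n)
  let ?Z = "Zf (\<rho> + 3 * \<epsilon> + 1) n"
  define \<Phi> where "\<Phi> b = (\<Sum>s\<in>?Z. mult n s * tker \<epsilon> (cmod (s - b))) - (\<Sum>i\<in>I n. tker \<epsilon> (cmod (t n i - b)))" for b
  have si: "integrable lborel (%b. \<psi> b * tker \<epsilon> (cmod (s - b)))" for s by (rule smear_integrable[OF \<epsilon> \<psi>(1,2)])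
  have "(\<Sum>s\<in>?Z. mult n s * smear \<epsilon> \<psi> s) - (\<Sum>i\<in>I n. smear \<epsilon> \<psi> (t n i)) =
   (\<integral>b. (\<Sum>s\<in>?Z. mult n s * (\<psi> b * tker \<epsilon> (cmod (s - b)))) \<partial>lborel) - (\<integral>b. (\<Sum>i\<in>I n. \<psi> b * tker \<epsilon> (cmod (t n i - b))) \<partial>lborel)"
   unfolding smear_def[OF \<epsilon>] using si
   by (subst (1 2) Bochner_Integration.integral_sum) auto
  also have "... = (\<integral>b. (\<Sum>s\<in>?Z. mult n s * (\<psi> b * tker \<epsilon> (cmod (s - b)))) - (\<Sum>i\<in>I n. \<psi> b * tker \<epsilon> (cmod (t n i - b))) \<partial>lborel)"
   using si by (intro Bochner_Integration.integral_diff[symmetric] Bochner_Integration.integrable_sum integrable_mult_right)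
  also have "... = (\<integral>b. \<psi> b * \<Phi> b \<partial>lborel)"
   unfolding \<Phi>_def by (simp add: right_diff_distrib sum_distrib_left mult_ac)
  finally have eq: "(\<Sum>s\<in>?Z. mult n s * smear \<epsilon> \<psi> s) - (\<Sum>i\<in>I n. smear \<epsilon> \<psi> (t n i)) = (\<integral>b. \<psi> b * \<Phi> b \<partial>lborel)" .
  have i2: "integrable lborel (%b. \<psi> b * \<Phi> b)"
  proof -
   have "integrable lborel (%b. (\<Sum>s\<in>?Z. mult n s * (\<psi> b * tker \<epsilon> (cmod (s - b)))) - (\<Sum>i\<in>I n. \<psi> b * tker \<epsilon> (cmod (t n i - b))))"
    using si by (intro Bochner_Integration.integrable_diff Bochner_Integration.integrable_sum integrable_mult_right)
   then show ?thesis unfolding \<Phi>_def by (simp add: right_diff_distrib sum_distrib_left mult_ac)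
  qed
  have "\<bar>\<integral>b. \<psi> b * \<Phi> b \<partial>lborel\<bar> <= (\<integral>b. \<bar>\<psi> b\<bar> * (e / (T + 1) * real n) \<partial>lborel)"
  proof (rule order.trans[OF integral_abs_bound integral_mono])
   show "integrable lborel (%b. \<bar>\<psi> b * \<Phi> b\<bar>)" using i2 by simp
   show "integrable lborel (%b. \<bar>\<psi> b\<bar> * (e / (T + 1) * real n))" using i\<psi> by simp
   fix b
   show "\<bar>\<psi> b * \<Phi> b\<bar> <= \<bar>\<psi> b\<bar> * (e / (T + 1) * real n)"
   proof (cases "b \<in> ball 0 \<rho>")
    case True
    then have "\<bar>\<Phi> b\<bar> <= e / (T + 1) * real n" using elim unfolding \<Phi>_def by blast
    then show ?thesis unfolding abs_mult by (rule mult_left_mono) simp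
   qed (use \<psi>0 in simp)
  qed
  also have "... = T / (T + 1) * (e * real n)" by (simp add: T_def)
  also have "... <= 1 * (e * real n)" using T e by (intro mult_right_mono) auto
  finally show ?case using elim eq by simp
 qed
qed

lemma mult_nonneg: "mult n s >= 0" by (simp add: mult_def)

lemma Zf_mono: "\<rho> <= \<rho>' ==> Zf \<rho> n <= Zf \<rho>' n" by (auto simp: Zf_def)

text \<open>Test with the smeared indicator of a larger disc: each zero within \<rho> contributes
  the full \<open>tmass\<close>, and the at most m n roots of p contribute no more than that each.
  For \<epsilon> = 1 the kernel reaches to distance 3, hence the radius \<rho> + 3.\<close>

lemma zero_count:
 assumes \<rho>: "\<rho> > 0"
 shows "\<exists>C\<ge>0. \<forall>\<^sub>F n in sequentially. finite (Zf \<rho> n) & (\<Sum>s\<in>Zf \<rho> n. mult n s) <= C * real n"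
proof -
 let ?\<psi> = "%b. indicat_real (ball 0 (\<rho> + 3)) b"
 have \<psi>: "?\<psi> \<in> borel_measurable borel" "!!b. \<bar>?\<psi> b\<bar> <= 1" "!!b. b \<notin> ball 0 (\<rho> + 3) ==> ?\<psi> b = 0"
  by (rule borel_measurable_indicator) (auto simp: indicator_def)
 define \<gamma> where "\<gamma> = tmass 1"
 have \<gamma>: "\<gamma> > 0" unfolding \<gamma>_def by (rule tmass_pos) simp
 have sm_le: "smear 1 ?\<psi> s <= \<gamma>" "smear 1 ?\<psi> s >= 0" for s
 proof -
  have "smear 1 ?\<psi> s <= (\<integral>b. tker 1 (cmod (s - b)) \<partial>lborel)"
   unfolding smear_def[OF zero_less_one]
   by (rule integral_mono[OF smear_integrable[OF zero_less_one \<psi>(1,2)] tker_integrable[OF zero_less_one]])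
    (use tker_nonneg[OF zero_less_one] in \<open>auto simp: indicator_def\<close>)
  then show "smear 1 ?\<psi> s <= \<gamma>" unfolding \<gamma>_def by (simp add: tmass_shift)
  show "smear 1 ?\<psi> s >= 0" unfolding smear_def[OF zero_less_one]
   by (rule integral_nonneg_AE) (use tker_nonneg[OF zero_less_one] in auto)
 qed
 have sm_eq: "smear 1 ?\<psi> s = \<gamma>" if "s \<in> ball 0 \<rho>" for s
 proof -
  have "?\<psi> b * tker 1 (cmod (s - b)) = tker 1 (cmod (s - b))" for b
  proof (cases "b \<in> ball 0 (\<rho> + 3)")
   case False
   then have "cmod (s - b) >= 3" using that norm_triangle_ineq2[of b s] by (simp add: norm_minus_commute)
   then show ?thesis using tker_outside[of 1 "cmod (s - b)"] by simp
  qed simp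
  then have "smear 1 ?\<psi> s = (\<integral>b. tker 1 (cmod (s - b)) \<partial>lborel)" unfolding smear_def[OF zero_less_one] by (simp only:)
  then show ?thesis unfolding \<gamma>_def by (simp add: tmass_shift)
 qed
 have \<rho>3: "\<rho> + 3 > 0" using \<rho> by simp
 from \<psi>(3) have "\<forall>b. b \<notin> ball 0 (\<rho> + 3) --> ?\<psi> b = 0" by blast
 from smear_diff[OF zero_less_one \<rho>3 zero_less_one \<psi>(1,2) this]
 have "\<forall>\<^sub>F n in sequentially. finite (Zf \<rho> n) & (\<Sum>s\<in>Zf \<rho> n. mult n s) <= (real m + 1 / \<gamma>) * real n"
 proof eventually_elim
  case (elim n)
  let ?Z = "Zf (\<rho> + 3 + 3 * 1 + 1) n"
  have sub: "Zf \<rho> n <= ?Z" by (rule Zf_mono) simp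
  have "\<gamma> * (\<Sum>s\<in>Zf \<rho> n. mult n s) = (\<Sum>s\<in>Zf \<rho> n. mult n s * smear 1 ?\<psi> s)"
   unfolding sum_distrib_left by (rule sum.cong) (auto simp: sm_eq Zf_def)
  also have "... <= (\<Sum>s\<in>?Z. mult n s * smear 1 ?\<psi> s)"
   using elim sub sm_le(2) mult_nonneg by (intro sum_mono2) auto
  also have "... <= (\<Sum>i\<in>I n. smear 1 ?\<psi> (t n i)) + real n" using elim by linarith
  also have "... <= (\<Sum>i\<in>I n. \<gamma>) + real n" by (intro add_right_mono sum_mono sm_le)
  also have "... = real (card (I n)) * \<gamma> + real n" by simp
  also have "... <= real (m * n) * \<gamma> + real n" using I_card[of n] \<gamma> by (intro add_right_mono mult_right_mono) (auto simp del: of_nat_mult)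
  finally have "(\<Sum>s\<in>Zf \<rho> n. mult n s) <= (real m + 1 / \<gamma>) * real n" using \<gamma> by (simp add: field_simps)
  then show ?case using elim sub finite_subset by blast
 qed
 moreover have "real m + 1 / \<gamma> >= 0" using \<gamma> by simp
 ultimately show ?thesis by blast
qed

text \<open>Replacing \<psi> by its smeared version costs a small amount per zero, and by
  \<open>zero_count\<close> there are only O(n) zeros; the smeared sums are compared by
  \<open>smear_diff\<close>.\<close>

theorem zero_sums_compare:
 fixes \<psi> :: "complex => real"
 assumes \<rho>: "\<rho> > 0" and \<psi>: "continuous_on UNIV \<psi>" "!!b. b \<notin> ball 0 \<rho> ==> \<psi> b = 0" and e: "e > 0"
 shows "\<forall>\<^sub>F n in sequentially. \<bar>(\<Sum>s\<in>Zf \<rho> n. mult n s * \<psi> s) - (\<Sum>i\<in>I n. \<psi> (t n i))\<bar> <= e * real n"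
proof -
 have \<psi>b: "\<psi> \<in> borel_measurable borel" using \<psi>(1) by (rule borel_measurable_continuous_onI)
 have "compact (\<psi> ` cball 0 \<rho>)" by (intro compact_continuous_image continuous_on_subset[OF \<psi>(1)]) auto
 then obtain D where D: "!!b. b \<in> cball 0 \<rho> ==> \<bar>\<psi> b\<bar> <= D" using compact_imp_bounded bounded_real by (metis imageI)
 have D0: "D >= 0" using D[of 0] \<rho> by force
 have \<psi>D: "\<bar>\<psi> b\<bar> <= D" for b
  using D[of b] \<psi>(2)[of b] D0 by (cases "b \<in> ball 0 \<rho>") auto
 obtain C where C: "C >= 0" and evC: "\<forall>\<^sub>F n in sequentially. finite (Zf (\<rho> + 10) n) & (\<Sum>s\<in>Zf (\<rho> + 10) n. mult n s) <= C * real n"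
  using zero_count[of "\<rho> + 10"] \<rho> by auto
 \<comment> \<open>The smearing errors of C n zeros and m n roots, divided by \<open>tmass\<close>,
   then amount to at most e n/4.\<close>
 define \<omega> where "\<omega> = e / (4 * (C + real m + 1))"
 have \<omega>: "\<omega> > 0" using e C by (simp add: \<omega>_def add_nonneg_pos)
 have "uniformly_continuous_on (cball 0 (\<rho> + 10)) \<psi>"
  by (rule compact_uniformly_continuous[OF continuous_on_subset[OF \<psi>(1)]]) auto
 then obtain \<delta> where \<delta>: "\<delta> > 0" "!!x y. x \<in> cball 0 (\<rho> + 10) ==> y \<in> cball 0 (\<rho> + 10) ==> dist y x < \<delta> ==> \<bar>\<psi> y - \<psi> x\<bar> < \<omega>"
  using \<omega> unfolding uniformly_continuous_on_def dist_real_def by metis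
 define \<epsilon> where "\<epsilon> = min (\<delta> / 4) 1"
 have \<epsilon>: "\<epsilon> > 0" "3 * \<epsilon> < \<delta>" "\<epsilon> <= 1" using \<delta> by (auto simp: \<epsilon>_def min_def)
 define \<gamma> where "\<gamma> = tmass \<epsilon>"
 have \<gamma>: "\<gamma> > 0" unfolding \<gamma>_def by (rule tmass_pos[OF \<epsilon>(1)])
 have close: "\<bar>smear \<epsilon> \<psi> s - \<gamma> * \<psi> s\<bar> <= \<omega> * \<gamma>" for s
 proof (cases "cmod s < \<rho> + 3 * \<epsilon>")
  case True
  show ?thesis
   unfolding \<gamma>_def
  proof (rule smear_close[OF \<epsilon>(1) \<psi>b \<psi>D])
   fix b assume b: "dist s b < 3 * \<epsilon>"
   have "s \<in> cball 0 (\<rho> + 10)" using True \<epsilon> by simp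
   moreover have "b \<in> cball 0 (\<rho> + 10)" using b True \<epsilon> norm_triangle_sub[of b s] by (simp add: dist_norm norm_minus_commute)
   ultimately show "\<bar>\<psi> b - \<psi> s\<bar> <= \<omega>" using \<delta>(2)[of s b] b \<epsilon> by (simp add: dist_commute)
  qed
 next
  case False
  then have "smear \<epsilon> \<psi> s = 0" using smear_zero[OF \<epsilon>(1) \<psi>(2)] by simp
  moreover have "\<psi> s = 0" using False \<epsilon> by (intro \<psi>(2)) simp
  ultimately show ?thesis using \<omega> \<gamma> by simp
 qed
 have "\<gamma> * e / 4 > 0" using \<gamma> e by simp
 moreover have "\<forall>b. b \<notin> ball 0 \<rho> --> \<psi> b = 0" using \<psi>(2) by blast
 ultimately have "\<forall>\<^sub>F n in sequentially. finite (Zf (\<rho> + 3 * \<epsilon> + 1) n) \<and>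
  \<bar>(\<Sum>s\<in>Zf (\<rho> + 3 * \<epsilon> + 1) n. mult n s * smear \<epsilon> \<psi> s) - (\<Sum>i\<in>I n. smear \<epsilon> \<psi> (t n i))\<bar> <= \<gamma> * e / 4 * real n"
  by (rule smear_diff[OF \<epsilon>(1) \<rho> _ \<psi>b \<psi>D])
 from this evC
 show ?thesis
 proof eventually_elim
  case (elim n)
  let ?Z = "Zf (\<rho> + 3 * \<epsilon> + 1) n"
  have fin: "finite ?Z" using elim by simp
  have subZ: "?Z <= Zf (\<rho> + 10) n" by (rule Zf_mono) (use \<epsilon> in simp)
  have Zsum: "(\<Sum>s\<in>Zf \<rho> n. mult n s * \<psi> s) = (\<Sum>s\<in>?Z. mult n s * \<psi> s)"
   by (rule sum.mono_neutral_left[OF fin Zf_mono]) (use \<epsilon> \<psi>(2) in \<open>auto simp: Zf_def\<close>)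
  have mass: "(\<Sum>s\<in>?Z. mult n s) <= C * real n"
   using elim sum_mono2[of "Zf (\<rho> + 10) n" ?Z "mult n"] subZ mult_nonneg by fastforce
  have 1: "\<bar>(\<Sum>s\<in>?Z. mult n s * smear \<epsilon> \<psi> s) - \<gamma> * (\<Sum>s\<in>?Z. mult n s * \<psi> s)\<bar> <= \<omega> * \<gamma> * (C * real n)"
  proof -
   have "\<bar>(\<Sum>s\<in>?Z. mult n s * smear \<epsilon> \<psi> s) - \<gamma> * (\<Sum>s\<in>?Z. mult n s * \<psi> s)\<bar> = \<bar>\<Sum>s\<in>?Z. mult n s * (smear \<epsilon> \<psi> s - \<gamma> * \<psi> s)\<bar>"
    by (simp add: sum_distrib_left sum_subtractf right_diff_distrib mult_ac)
   also have "... <= (\<Sum>s\<in>?Z. mult n s * (\<omega> * \<gamma>))"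
    by (rule order.trans[OF sum_abs sum_mono]) (auto simp: abs_mult mult_nonneg intro!: mult_left_mono close)
   also have "... = \<omega> * \<gamma> * (\<Sum>s\<in>?Z. mult n s)" by (simp add: sum_distrib_left mult_ac)
   also have "... <= \<omega> * \<gamma> * (C * real n)" using mass \<omega> \<gamma> by (intro mult_left_mono) auto
   finally show ?thesis .
  qed
  have 2: "\<bar>(\<Sum>i\<in>I n. smear \<epsilon> \<psi> (t n i)) - \<gamma> * (\<Sum>i\<in>I n. \<psi> (t n i))\<bar> <= \<omega> * \<gamma> * (real m * real n)"
  proof -
   have "\<bar>(\<Sum>i\<in>I n. smear \<epsilon> \<psi> (t n i)) - \<gamma> * (\<Sum>i\<in>I n. \<psi> (t n i))\<bar> = \<bar>\<Sum>i\<in>I n. smear \<epsilon> \<psi> (t n i) - \<gamma> * \<psi> (t n i)\<bar>"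
    by (simp add: sum_distrib_left sum_subtractf)
   also have "... <= (\<Sum>i\<in>I n. \<omega> * \<gamma>)" by (rule order.trans[OF sum_abs sum_mono]) (rule close)
   also have "... = \<omega> * \<gamma> * real (card (I n))" by simp
   also have "... <= \<omega> * \<gamma> * real (m * n)" using I_card[of n] \<omega> \<gamma> by (intro mult_left_mono) (auto simp del: of_nat_mult)
   finally show ?thesis by simp
  qed
  let ?x = "(\<Sum>s\<in>?Z. mult n s * \<psi> s)" and ?y = "(\<Sum>i\<in>I n. \<psi> (t n i))"
  have "\<gamma> * \<bar>?x - ?y\<bar> = \<bar>\<gamma> * ?x - \<gamma> * ?y\<bar>" using \<gamma> by (simp add: right_diff_distrib[symmetric] abs_mult)
  also have "... <= \<gamma> * e / 4 * real n + \<omega> * \<gamma> * (C * real n) + \<omega> * \<gamma> * (real m * real n)"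
   using 1 2 elim by linarith
  also have "... = \<gamma> * (e / 4 * real n + \<omega> * (C + real m) * real n)" by (simp add: algebra_simps)
  also have "... <= \<gamma> * (e * real n)"
  proof (rule mult_left_mono)
   have "\<omega> * (C + real m) = e / 4 * ((C + real m) / (C + real m + 1))" by (simp add: \<omega>_def)
   also have "... <= e / 4 * 1" using e C by (intro mult_left_mono) auto
   finally have "\<omega> * (C + real m) * real n <= e / 4 * real n" by (intro mult_right_mono) auto
   then have "e / 4 * real n + \<omega> * (C + real m) * real n <= e / 2 * real n" by (simp add: algebra_simps)
   also have "... <= e * real n" using e by (intro mult_right_mono) auto
   finally show "e / 4 * real n + \<omega> * (C + real m) * real n <= e * real n" .
  qed (use \<gamma> in simp)
  finally have "\<bar>?x - ?y\<bar> <= e * real n" using \<gamma> by simp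
  then show ?case unfolding Zsum .
 qed
qed

end

subsection \<open>The ratio of consecutive polynomials\<close>

lemma resolvent_diff:
 fixes Y Y' :: complex
 assumes d: "d > 0" and x: "0 <= x" "x <= C" and Y: "d <= cmod (Y + of_real x)" "d <= cmod (Y' + of_real x)"
 shows "cmod (Y / (Y + of_real x) - Y' / (Y' + of_real x)) <= C / d\<^sup>2 * cmod (Y - Y')"
proof -
 have nz: "Y + of_real x ~= 0" "Y' + of_real x ~= 0" using Y d by auto
 then have "Y / (Y + of_real x) - Y' / (Y' + of_real x) = of_real x * (Y - Y') / ((Y + of_real x) * (Y' + of_real x))"
  by (simp add: divide_simps) (simp add: algebra_simps)
 then have "cmod (Y / (Y + of_real x) - Y' / (Y' + of_real x)) = x * cmod (Y - Y') / (cmod (Y + of_real x) * cmod (Y' + of_real x))"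
  using x by (simp add: norm_divide norm_mult)
 also have "... <= C * cmod (Y - Y') / (d * d)"
  using d x Y by (intro frac_le mult_mono mult_right_mono) auto
 finally show ?thesis by (simp add: power2_eq_square)
qed

text \<open>k * rfun m k Y + 1 is the quotient of \<open>dpoly m (Suc k)\<close> by
  \<open>dpoly m k\<close> at the point k Y.\<close>

definition rfun :: "nat => nat => complex => complex" where
 "rfun m k Y = 1 + of_nat m * Y + of_nat m * (\<Sum>j<k. Y / (Y + of_real (droot m k j / real k))) / of_nat k"

context
 fixes m :: nat and C' :: real
 assumes m: "m >= 1"
 defines "C' \<equiv> 2 ^ (m + 6)"
begin

text \<open>Distance at least d from the segment between -C' and 0, which contains the scaled roots
  of all degrees.\<close>

definition away :: "real => complex set" where
 "away d = {Y. \<forall>s. 0 <= s --> s <= C' --> d <= cmod (Y + of_real s)}"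

lemma C'_pos: "C' > 0" by (simp add: C'_def)

lemma droot_scaled:
 assumes "j < k" shows "0 <= droot m k j / real k" "droot m k j / real k <= C'"
proof -
 have "droot m k j > 0" by (rule droot_pos[OF m assms])
 then show "0 <= droot m k j / real k" by simp
 have "droot m k j <= 2 ^ (m + 6) * real k" using droot_le[OF m assms] by simp
 then show "droot m k j / real k <= C'" using assms by (simp add: C'_def divide_le_eq)
qed

text \<open>A Lipschitz constant independent of k, needed to pass from pointwise to uniform
  estimates.\<close>

lemma rfun_lipschitz:
 assumes d: "d > 0" and k: "k > 0" and Y: "Y \<in> away d" "Y' \<in> away d"
 shows "cmod (rfun m k Y - rfun m k Y') <= real m * (1 + C' / d\<^sup>2) * cmod (Y - Y')"
proof -
 let ?x = "%j. droot m k j / real k"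
 have tm: "cmod (Y / (Y + of_real (?x j)) - Y' / (Y' + of_real (?x j))) <= C' / d\<^sup>2 * cmod (Y - Y')" if "j < k" for j
  using resolvent_diff[OF d droot_scaled[OF that]] droot_scaled[OF that] Y unfolding away_def by blast
 have "rfun m k Y - rfun m k Y' = of_nat m * (Y - Y') + of_nat m * (\<Sum>j<k. Y / (Y + of_real (?x j)) - Y' / (Y' + of_real (?x j))) / of_nat k"
  unfolding rfun_def sum_subtractf by (simp add: right_diff_distrib diff_divide_distrib)
 also have "cmod ... <= cmod (of_nat m * (Y - Y')) + cmod (of_nat m * (\<Sum>j<k. Y / (Y + of_real (?x j)) - Y' / (Y' + of_real (?x j))) / of_nat k)"
  by (rule norm_triangle_ineq)
 also have "... = real m * cmod (Y - Y') + real m * cmod (\<Sum>j<k. Y / (Y + of_real (?x j)) - Y' / (Y' + of_real (?x j))) / real k"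
  by (simp add: norm_mult norm_divide)
 also have "... <= real m * cmod (Y - Y') + real m * (real k * (C' / d\<^sup>2 * cmod (Y - Y'))) / real k"
 proof (intro add_left_mono divide_right_mono mult_left_mono)
  have "cmod (\<Sum>j<k. Y / (Y + of_real (?x j)) - Y' / (Y' + of_real (?x j))) <= (\<Sum>j<k. C' / d\<^sup>2 * cmod (Y - Y'))"
   by (rule sum_norm_le) (use tm in auto)
  then show "cmod (\<Sum>j<k. Y / (Y + of_real (?x j)) - Y' / (Y' + of_real (?x j))) <= real k * (C' / d\<^sup>2 * cmod (Y - Y'))" by simp
 qed auto
 also have "... = real m * (1 + C' / d\<^sup>2) * cmod (Y - Y')" using k by (simp add: algebra_simps)
 finally show ?thesis .
qed

text \<open>Far out the sum over the roots is a small perturbation, so limits have to be examined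
  only on a compact set.\<close>

lemma rfun_large:
 assumes k: "k > 0" and Y: "cmod Y >= C' + 8"
 shows "cmod (rfun m k Y) >= 3"
proof -
 let ?x = "%j. droot m k j / real k"
 let ?S = "\<Sum>j<k. 1 / (Y + of_real (?x j))"
 have Y0: "cmod Y > 0" using Y C'_pos by linarith
 have "cmod (1 / (Y + of_real (?x j))) <= 1 / 8" if "j < k" for j
 proof -
  have "cmod (of_real (?x j)) <= C'" using droot_scaled[OF that] by (simp del: of_real_divide)
  then have "8 <= cmod (Y + of_real (?x j))" using Y norm_diff_ineq[of Y "of_real (?x j)"] by linarith
  then show ?thesis by (simp add: norm_divide divide_simps)
 qed
 then have S: "cmod ?S <= real k * (1 / 8)" using sum_norm_le[of "{..<k}" "%j. 1 / (Y + of_real (?x j))" "%j. 1 / 8"] by simp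
 then have "cmod (?S / of_nat k) <= 1 / 8" using k by (simp add: norm_divide divide_simps)
 then have "7 / 8 <= cmod (1 + ?S / of_nat k)" using norm_diff_ineq[of 1 "?S / of_nat k"] by simp
 moreover have "8 <= cmod (of_nat m * Y)"
 proof -
  have "8 <= 1 * cmod Y" using Y C'_pos by simp
  also have "... <= real m * cmod Y" using m by (intro mult_right_mono) auto
  finally show ?thesis by (simp add: norm_mult)
 qed
 ultimately have "8 * (7 / 8) <= cmod (of_nat m * Y) * cmod (1 + ?S / of_nat k)" by (intro mult_mono) auto
 then have "7 <= cmod (of_nat m * Y * (1 + ?S / of_nat k))" by (simp add: norm_mult)
 moreover have "rfun m k Y = of_nat m * Y * (1 + ?S / of_nat k) + 1"
  unfolding rfun_def by (simp add: sum_distrib_left algebra_simps)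
 ultimately show ?thesis using norm_diff_ineq[of "of_nat m * Y * (1 + ?S / of_nat k)" 1] by simp
qed

text \<open>Weak convergence of the roots gives the limit 1 - A(-Y), whose modulus is at least 1 by
  \<open>A_bound\<close>.\<close>

lemma rfun_tendsto:
 assumes lim: "limit_distribution M m" "weak_conv_m (emp m) M" and Y: "Y \<in> away d" "d > 0"
 shows "\<exists>l. (%l'. rfun m (Suc l') Y) \<longlonglongrightarrow> l & 1 <= cmod l"
proof -
 interpret limit_distribution M m by (rule lim(1))
 \<comment> \<open>Clamping x to the interval from 0 to C' makes the kernel bounded and continuous
   on the line without changing it at the scaled roots.\<close>
 define g where "g x = Y / (Y + of_real (max 0 (min C' x)))" for x :: real
 have den: "d <= cmod (Y + of_real (max 0 (min C' x)))" for x
  using Y C'_pos unfolding away_def by auto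
 have den0: "Y + of_real (max 0 (min C' x)) ~= 0" for x
  using den[of x] Y(2) by (metis norm_zero not_le)
 have cont: "isCont g x" for x
  unfolding g_def using den0 by (intro continuous_intros) auto
 have bd: "cmod (g x) <= cmod Y / d" for x
  unfolding g_def norm_divide using den[of x] Y(2) by (intro divide_left_mono mult_pos_pos) auto
 have wc: "(%n. \<integral>x. g x \<partial>emp m n) \<longlonglongrightarrow> (\<integral>x. g x \<partial>M)"
 proof (rule weak_conv_imp_integral_bdd_continuous_conv[OF _ _ lim(2)])
  show "real_distribution (emp m n)" for n
   using emp_compact_distribution[OF m] by (simp add: compact_distribution_def)
  show "real_distribution M" by (rule real_distribution_axioms)
 qed (use cont bd in auto)
 have emp_eq: "(\<integral>x. g x \<partial>emp m n) = (\<Sum>j<Suc n. Y / (Y + of_real (droot m (Suc n) j / real (Suc n)))) / of_nat (Suc n)" for n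
 proof -
  have "(\<integral>x. g x \<partial>emp m n) = (\<Sum>j<Suc n. g (droot m (Suc n) j / real (Suc n))) /\<^sub>R real (Suc n)"
   by (rule integral_emp) (use cont in \<open>auto intro!: borel_measurable_continuous_onI simp: continuous_on_eq_continuous_at\<close>)
  also have "(\<Sum>j<Suc n. g (droot m (Suc n) j / real (Suc n))) = (\<Sum>j<Suc n. Y / (Y + of_real (droot m (Suc n) j / real (Suc n))))"
  proof (rule sum.cong[OF refl])
   fix j assume "j \<in> {..<Suc n}"
   then have "0 <= droot m (Suc n) j / real (Suc n)" "droot m (Suc n) j / real (Suc n) <= C'" using droot_scaled[of j "Suc n"] by auto
   then show "g (droot m (Suc n) j / real (Suc n)) = Y / (Y + of_real (droot m (Suc n) j / real (Suc n)))"
    unfolding g_def by (simp only: min_absorb2 max_absorb2)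
  qed
  finally show ?thesis by (simp add: scaleR_conv_of_real divide_inverse mult.commute)
 qed
 define l where "l = 1 + of_nat m * Y + of_nat m * (\<integral>x. g x \<partial>M)"
 have "(%n. 1 + of_nat m * Y + of_nat m * (\<integral>x. g x \<partial>emp m n)) \<longlonglongrightarrow> l"
  unfolding l_def by (intro tendsto_intros wc)
 then have tl: "(%n. rfun m (Suc n) Y) \<longlonglongrightarrow> l" unfolding emp_eq rfun_def by (simp only: times_divide_eq_right)
 \<comment> \<open>The sharp edge is at most 8, by (1 + 1/m)^m <= exp 1, and hence below the crude
   bound.\<close>
 have cC: "c_edge m <= C'"
 proof -
  have "(1 + 1 / real m) ^ (m + 1) = (1 + 1 / real m) ^ m * (1 + 1 / real m)" by simp
  also have "... <= 4 * 2"
  proof (rule mult_mono)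
   have "(1 + 1 / real m) ^ m <= exp 1" using exp_ge_one_plus_x_over_n_power_n[of m 1] m by simp
   also have "... <= 4" using exp_le by linarith
   finally show "(1 + 1 / real m) ^ m <= 4" .
  qed (use m in \<open>auto simp: field_simps\<close>)
  also have "... <= C'"
  proof -
   have "8 * 1 <= (2::real) ^ 6 * 2 ^ m" by (intro mult_mono) auto
   then show ?thesis unfolding C'_def power_add by (simp only: mult.commute)
  qed
  finally show ?thesis unfolding c_edge_def using m by (simp add: field_simps)
 qed
 have notin: "- Y \<notin> of_real ` {0..c_edge m}"
 proof
  assume "- Y \<in> of_real ` {0..c_edge m}"
  then obtain s where s: "0 <= s" "s <= c_edge m" "- Y = of_real s" by auto
  then have "d <= cmod (Y + of_real s)" using Y cC unfolding away_def by auto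
  moreover have "Y + of_real s = 0" unfolding s(3)[symmetric] by simp
  ultimately show False using Y(2) by simp
 qed
 have gM: "(\<integral>x. g x \<partial>M) = - Y * ct (- Y)"
 proof -
  have "(\<integral>x. g x \<partial>M) = (\<integral>x. - Y * (1 / (- Y - of_real x)) \<partial>M)"
  proof (rule integral_cong_AE)
   have "g \<in> borel_measurable borel" using cont by (intro borel_measurable_continuous_onI) (auto simp: continuous_on_eq_continuous_at)
   then show "g \<in> borel_measurable M" by simp
   show "AE x in M. g x = - Y * (1 / (- Y - of_real x))"
    using supp
   proof eventually_elim
    case (elim x)
    then have "max 0 (min C' x) = x" using cC by auto
    then have 1: "g x = Y / (Y + of_real x)" unfolding g_def by (simp only:)
    have 2: "- Y - of_real x = - (Y + of_real x)" by simp
    show ?case unfolding 1 2 by (simp del: minus_add_distrib)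
   qed
  qed auto
  then show ?thesis unfolding ct_def by (simp only: integral_mult_right_zero)
 qed
 have "l = 1 - A (- Y)" unfolding l_def gM A_def by (simp add: algebra_simps)
 then have "1 <= cmod l" using A_bound[OF notin] by (simp add: norm_minus_commute)
 with tl show ?thesis by blast
qed

text \<open>Pointwise limits at finitely many centres, \<open>rfun_lipschitz\<close> between them,
  and \<open>rfun_large\<close> far out.\<close>

lemma rfun_uniform:
 assumes d: "d > 0" and \<eta>: "\<eta> > 0"
 shows "\<forall>\<^sub>F k in sequentially. \<forall>Y\<in>away d. 1 - \<eta> <= cmod (rfun m k Y)"
proof -
 obtain M where M: "limit_distribution M m" "weak_conv_m (emp m) M" using limit_distribution_exists[OF m] by blast
 define L where "L = real m * (1 + C' / d\<^sup>2)"
 have L: "L > 0" unfolding L_def using m C'_pos d by (intro mult_pos_pos add_pos_nonneg) auto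
 define K where "K = away d \<inter> cball 0 (C' + 8)"
 have "closed (away d)"
  unfolding away_def by (intro closed_Collect_all closed_Collect_imp closed_Collect_le open_Collect_const continuous_intros)
 then have K: "compact K" unfolding K_def using compact_cball closed_Int_compact by blast
 obtain X where X: "X <= K" "finite X" "K <= (\<Union>x\<in>X. ball x (\<eta> / (2 * L)))"
 proof (rule compactE_image[OF K, of K "%x. ball x (\<eta> / (2 * L))"])
  show "K <= (\<Union>x\<in>K. ball x (\<eta> / (2 * L)))" using \<eta> L by force
 qed auto
 have "\<forall>\<^sub>F l in sequentially. \<forall>x\<in>X. 1 - \<eta> / 2 <= cmod (rfun m (Suc l) x)"
 proof (rule eventually_ball_finite[OF X(2)], rule ballI)
  fix x assume "x \<in> X"
  then have "x \<in> away d" using X by (auto simp: K_def)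
  then obtain l where l: "(%l'. rfun m (Suc l') x) \<longlonglongrightarrow> l" "1 <= cmod l" using rfun_tendsto[OF M _ d] by blast
  have "1 - \<eta> / 2 < cmod l" using l \<eta> by linarith
  from order_tendstoD(1)[OF tendsto_norm[OF l(1)] this]
  show "\<forall>\<^sub>F l in sequentially. 1 - \<eta> / 2 <= cmod (rfun m (Suc l) x)" by eventually_elim simp
 qed
 then have "\<forall>\<^sub>F l in sequentially. \<forall>Y\<in>away d. 1 - \<eta> <= cmod (rfun m (Suc l) Y)"
 proof eventually_elim
  case (elim l)
  show ?case
  proof
   fix Y assume Y: "Y \<in> away d"
   show "1 - \<eta> <= cmod (rfun m (Suc l) Y)"
   proof (cases "cmod Y >= C' + 8")
    case True
    then show ?thesis using rfun_large[of "Suc l" Y] \<eta> by simp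
   next
    case False
    then have "Y \<in> K" using Y by (simp add: K_def)
    then obtain x where x: "x \<in> X" "dist x Y < \<eta> / (2 * L)" using X by auto
    then have xa: "x \<in> away d" using X by (auto simp: K_def)
    have "cmod (rfun m (Suc l) x - rfun m (Suc l) Y) <= L * cmod (x - Y)"
     unfolding L_def by (rule rfun_lipschitz[OF d _ xa Y]) simp
    also have "... <= L * (\<eta> / (2 * L))" using x L by (intro mult_left_mono) (auto simp: dist_norm)
    also have "... = \<eta> / 2" using L by simp
    finally have "cmod (rfun m (Suc l) x) - cmod (rfun m (Suc l) Y) <= \<eta> / 2"
     using norm_triangle_ineq2 order.trans by blast
    moreover have "1 - \<eta> / 2 <= cmod (rfun m (Suc l) x)" using elim x by blast
    ultimately show ?thesis by linarith
   qed
  qed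
 qed
 then show ?thesis by (subst (asm) eventually_sequentially_Suc)
qed

text \<open>Dilation by t >= 1 does not bring a point closer to the segment, because s/t still lies
  between 0 and C'. With t = n/k this makes the ratio estimate uniform over k < n.\<close>

lemma compact_away:
 assumes K: "compact K" "K \<inter> of_real ` {- C'..0} = {}"
 obtains d where "d > 0" "!!Y t. Y \<in> K ==> t >= 1 ==> of_real t * Y \<in> away d"
proof -
 have "closed (complex_of_real ` {- C'..0})"
  by (intro compact_imp_closed compact_continuous_image continuous_intros) auto
 from separate_compact_closed[OF K(1) this K(2)]
 obtain d where d: "d > 0" "!!x y. x \<in> K ==> y \<in> complex_of_real ` {- C'..0} ==> d <= dist x y" by blast
 show ?thesis
 proof (rule that[OF d(1)])
  fix Y and t :: real assume Y: "Y \<in> K" and t: "t >= 1"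
  show "of_real t * Y \<in> away d"
   unfolding away_def
  proof (intro CollectI allI impI)
   fix s assume s: "0 <= s" "s <= C'"
   have "s / t <= s" using s t by (simp add: divide_le_eq mult_le_cancel_left1)
   then have "d <= dist Y (of_real (- (s / t)))" using s t by (intro d(2) Y imageI) auto
   also have "... = cmod (Y + of_real (s / t))" by (simp add: dist_norm)
   also have "... <= t * cmod (Y + of_real (s / t))" using t by (simp add: mult_le_cancel_right1)
   also have "... = cmod (of_real t * (Y + of_real (s / t)))" using t by (simp add: norm_mult)
   also have "of_real t * (Y + of_real (s / t)) = of_real t * Y + of_real s" using t by (simp add: algebra_simps)
   finally show "d <= cmod (of_real t * Y + of_real s)" .
  qed
 qed
qed

text \<open>The quotient at n Y is read as the quotient at k times (n/k) Y. For k >= k0 the uniform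
  estimate applies; for 0 < k < k0 the point (n/k) Y is so far out that \<open>rfun_large\<close>
  applies; k = 0 is computed directly.\<close>

theorem dpoly_ratio_lower:
 assumes K: "compact K" "K \<inter> of_real ` {- C'..0} = {}" and \<eta>: "\<eta> > 0"
 shows "\<forall>\<^sub>F n in sequentially. \<forall>Y\<in>K. \<forall>k<n.
  (1 - \<eta>) * real (Suc k) * cmod (poly (dpoly m k) (of_nat n * Y)) <= cmod (poly (dpoly m (Suc k)) (of_nat n * Y))"
proof -
 obtain d where d: "d > 0" "!!Y t. Y \<in> K ==> t >= 1 ==> of_real t * Y \<in> away d" using compact_away[OF K] by blast
 have dY: "d <= cmod Y" if "Y \<in> K" for Y
  using d(2)[OF that, of 1] C'_pos unfolding away_def by (auto dest!: spec[of _ 0])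
 have "\<eta> / 2 > 0" using \<eta> by simp
 from rfun_uniform[OF d(1) this] obtain k1 where k1: "!!k Y. k >= k1 ==> Y \<in> away d ==> 1 - \<eta> / 2 <= cmod (rfun m k Y)"
  unfolding eventually_sequentially by blast
 \<comment> \<open>The bound 4/\<eta> absorbs the summand 1 and the step from k to k + 1: k (1 -
   \<eta>/2) - 1 >= (1 - \<eta>)(k + 1) once k \<eta> >= 4.\<close>
 define k0 where "k0 = max (Suc k1) (nat \<lceil>4 / \<eta>\<rceil>)"
 have k0: "k0 >= k1" "k0 >= 1" "real k0 >= 4 / \<eta>" unfolding k0_def by (auto simp: max_def) linarith+
 \<comment> \<open>Makes |n Y| at least k0 (C' + 8), so that (n/k) Y has modulus at least C' + 8 for
   every k below k0.\<close>
 define n0 where "n0 = nat \<lceil>real k0 * (C' + 8) / d\<rceil>"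
 show ?thesis
  unfolding eventually_sequentially
 proof (intro exI[of _ n0] allI impI ballI)
  fix n Y k assume n: "n >= n0" and Y: "Y \<in> K" and kn: "k < n"
  define y where "y = of_nat n * Y"
  have "real k0 * (C' + 8) / d <= real n" using n unfolding n0_def by linarith
  then have nd: "real k0 * (C' + 8) <= real n * d" using d(1) by (simp add: divide_le_eq)
  also have "... <= cmod y" unfolding y_def norm_mult using dY[OF Y] by (simp add: mult_left_mono)
  finally have ybig: "real k0 * (C' + 8) <= cmod y" .
  have nz: "y + of_real (droot m k j) ~= 0" if j: "j < k" for j
  proof
   assume 0: "y + of_real (droot m k j) = 0"
   have n0: "real n > 0" using kn by simp
   have "droot m k j <= C' * real k" using droot_scaled(2)[OF j] j by (simp add: divide_le_eq)
   also have "... <= C' * real n" using kn C'_pos by (intro mult_left_mono) auto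
   finally have "droot m k j / real n <= C'" using n0 by (simp add: divide_le_eq)
   moreover have "0 <= droot m k j / real n" using droot_pos[OF m j] by simp
   ultimately have "d <= cmod (Y + of_real (droot m k j / real n))" using d(2)[OF Y, of 1] unfolding away_def by auto
   also have "Y + of_real (droot m k j / real n) = (y + of_real (droot m k j)) / of_nat n" using n0 by (simp add: y_def field_simps)
   finally show False using 0 d(1) by simp
  qed
  have step: "poly (dpoly m (Suc k)) y = (of_nat (Suc k) + of_nat m * y * (1 + (\<Sum>j<k. 1 / (y + of_real (droot m k j))))) * poly (dpoly m k) y"
   by (rule dpoly_ratio[OF m]) (use nz in auto)
  have main: "(1 - \<eta>) * real (Suc k) <= cmod (of_nat (Suc k) + of_nat m * y * (1 + (\<Sum>j<k. 1 / (y + of_real (droot m k j)))))"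
  proof (cases "k = 0")
   case True
   have "1 * (C' + 8) <= real k0 * (C' + 8)" using k0 C'_pos by (intro mult_right_mono) auto
   then have "C' + 8 <= 1 * cmod y" using ybig by simp
   also have "... <= real m * cmod y" using m by (intro mult_right_mono) auto
   finally have "2 <= cmod (of_nat m * y)" using C'_pos by (simp add: norm_mult)
   then have "1 <= cmod (1 + of_nat m * y)" using norm_diff_ineq[of "of_nat m * y" 1] by (simp add: add.commute)
   then show ?thesis using True \<eta> by simp
  next
   case False
   define Yk where "Yk = y / of_nat k"
   have Yk: "Yk = of_real (real n / real k) * Y" by (simp add: Yk_def y_def)
   have Ya: "Yk \<in> away d" unfolding Yk by (rule d(2)[OF Y]) (use kn False in simp)
   have "of_nat (Suc k) + of_nat m * y * (1 + (\<Sum>j<k. 1 / (y + of_real (droot m k j)))) = of_nat k * rfun m k Yk + 1"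
   proof -
    have "y / (y + of_real (droot m k j)) = Yk / (Yk + of_real (droot m k j / real k))" for j
    proof -
     have "Yk + of_real (droot m k j / real k) = (y + of_real (droot m k j)) / of_nat k" by (simp add: Yk_def add_divide_distrib)
     then show ?thesis using False by (simp add: Yk_def)
    qed
    then have "(\<Sum>j<k. Yk / (Yk + of_real (droot m k j / real k))) = y * (\<Sum>j<k. 1 / (y + of_real (droot m k j)))"
     by (simp add: sum_distrib_left)
    then have "rfun m k Yk = 1 + of_nat m * Yk + of_nat m * (y * (\<Sum>j<k. 1 / (y + of_real (droot m k j)))) / of_nat k"
     unfolding rfun_def by simp
    moreover have "of_nat k * Yk = y" using False by (simp add: Yk_def)
    ultimately show ?thesis using False by (simp add: algebra_simps)
   qed
   moreover have "(1 - \<eta>) * real (Suc k) <= real k * cmod (rfun m k Yk) - 1"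
   proof (cases "k >= k0")
    case True
    then have "1 - \<eta> / 2 <= cmod (rfun m k Yk)" using k1[of k Yk] k0 Ya by simp
    then have "real k * (1 - \<eta> / 2) <= real k * cmod (rfun m k Yk)" by (rule mult_left_mono) simp
    moreover have "4 <= real k * \<eta>" using True k0 \<eta> by (simp add: divide_le_eq) (metis mult_right_mono less_imp_le of_nat_le_iff order.trans)
    ultimately show ?thesis using \<eta> by (simp add: algebra_simps)
   next
    case False
    have "real k * (C' + 8) <= real k0 * (C' + 8)" using False C'_pos by (intro mult_right_mono) auto
    then have "C' + 8 <= cmod Yk" using ybig \<open>k ~= 0\<close> by (simp add: Yk_def norm_divide le_divide_eq mult.commute)
    then have "3 <= cmod (rfun m k Yk)" using \<open>k ~= 0\<close> by (intro rfun_large) auto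
    then have "real k * 3 <= real k * cmod (rfun m k Yk)" by (rule mult_left_mono) simp
    moreover have "(1 - \<eta>) * real (Suc k) <= 1 * real (Suc k)" using \<eta> by (intro mult_right_mono) auto
    moreover have "1 * real (Suc k) <= real k * 3 - 1" using \<open>k ~= 0\<close> by simp
    ultimately show ?thesis by linarith
   qed
   moreover have "real k * cmod (rfun m k Yk) - 1 <= cmod (of_nat k * rfun m k Yk + 1)"
    using norm_diff_ineq[of "of_nat k * rfun m k Yk" 1] by (simp add: norm_mult)
   ultimately show ?thesis by (metis order.trans)
  qed
  show "(1 - \<eta>) * real (Suc k) * cmod (poly (dpoly m k) (of_nat n * Y)) <= cmod (poly (dpoly m (Suc k)) (of_nat n * Y))"
   using mult_right_mono[OF main, of "cmod (poly (dpoly m k) y)"] step unfolding y_def[symmetric] by (simp add: norm_mult)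
 qed
qed

end

subsection \<open>Derivatives near an essential singularity\<close>

lemma DERIV_pole:
 fixes c z :: complex
 assumes "z ~= 0"
 shows "((%z. c / z ^ n) has_field_derivative - (of_nat n * c / z ^ (n + 1))) (at z)"
proof (cases n)
 case (Suc k)
 have "((%z. z ^ n) has_field_derivative of_nat n * z ^ k) (at z)"
  using DERIV_power[OF DERIV_ident, where n = n and x = z] Suc by simp
 from DERIV_divide[OF DERIV_const this, of c]
 have "((%z. c / z ^ n) has_field_derivative (0 * z ^ n - c * (of_nat n * z ^ k)) / (z ^ n * z ^ n)) (at z)"
  using assms by simp
 also have "(0 * z ^ n - c * (of_nat n * z ^ k)) / (z ^ n * z ^ n) = - (of_nat n * c / z ^ (n + 1))"
  using assms unfolding Suc by (simp add: field_simps)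
 finally show ?thesis .
qed simp

text \<open>The origin of the recursion of \<open>dpoly\<close>: differentiating E q/z^n produces n
  + 1 from the power z^(-n-1), m y from the exponential, and m y q' from the chain rule.\<close>

lemma deriv_exp_pole:
 fixes l z :: complex
 assumes "z ~= 0"
 shows "(deriv ^^ n) (%z. exp (l / z ^ m) / z) z = (- 1) ^ n * (exp (l / z ^ m) / z) * poly (dpoly m n) (l / z ^ m) / z ^ n"
 using assms
proof (induction n arbitrary: z)
 case 0
 then show ?case by simp
next
 case (Suc n)
 define y where "y = l / z ^ m"
 define E where "E = exp y / z"
 have dy: "((%z. l / z ^ m) has_field_derivative - of_nat m * y / z) (at z)"
  using DERIV_pole[OF Suc.prems, of l m] by (simp add: y_def mult.commute)
 have dE: "((%z. exp (l / z ^ m) / z) has_field_derivative - (of_nat m * y + 1) * E / z) (at z)"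
  using Suc.prems unfolding E_def
  by (auto intro!: derivative_eq_intros dy[THEN DERIV_cong] simp: y_def field_simps)
 have dq: "((%z. poly (dpoly m n) (l / z ^ m)) has_field_derivative poly (pderiv (dpoly m n)) y * (- of_nat m * y / z)) (at z)"
  using DERIV_chain2[OF poly_DERIV dy] by (simp add: y_def)
 have dz: "((%z. 1 / z ^ n) has_field_derivative - of_nat n / z ^ (n + 1)) (at z)"
  using DERIV_pole[OF Suc.prems, of 1 n] by simp
 have "((%z. (- 1) ^ n * ((exp (l / z ^ m) / z) * (poly (dpoly m n) (l / z ^ m) * (1 / z ^ n)))) has_field_derivative
  (- 1) ^ n * ((- (of_nat m * y + 1) * E / z) * (poly (dpoly m n) y * (1 / z ^ n)) +
   ((poly (pderiv (dpoly m n)) y * (- of_nat m * y / z)) * (1 / z ^ n) + (- of_nat n / z ^ (n + 1)) * poly (dpoly m n) y) * E)) (at z)"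
  using DERIV_cmult[OF DERIV_mult[OF dE DERIV_mult[OF dq dz]]] unfolding y_def E_def .
 also have "(- 1) ^ n * ((- (of_nat m * y + 1) * E / z) * (poly (dpoly m n) y * (1 / z ^ n)) +
   ((poly (pderiv (dpoly m n)) y * (- of_nat m * y / z)) * (1 / z ^ n) + (- of_nat n / z ^ (n + 1)) * poly (dpoly m n) y) * E) =
  (- 1) ^ Suc n * E * poly (dpoly m (Suc n)) y / z ^ Suc n"
  unfolding poly_dpoly_Suc using Suc.prems by (simp add: field_simps)
 finally have "((%z. (- 1) ^ n * ((exp (l / z ^ m) / z) * (poly (dpoly m n) (l / z ^ m) * (1 / z ^ n)))) has_field_derivative
  (- 1) ^ Suc n * E * poly (dpoly m (Suc n)) y / z ^ Suc n) (at z)" .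
 then have "((deriv ^^ n) (%z. exp (l / z ^ m) / z) has_field_derivative (- 1) ^ Suc n * E * poly (dpoly m (Suc n)) y / z ^ Suc n) (at z)"
  by (rule has_field_derivative_transform_within_open[of _ _ _ "- {0}"]) (use Suc in auto)
 from DERIV_imp_deriv[OF this] show ?case by (simp add: E_def y_def)
qed

locale essential_function =
 fixes m :: nat and \<alpha> :: int and lam :: "nat => complex" and \<phi> :: "complex => complex" and r :: real and U :: "complex set"
 assumes m: "m >= 1" and lam: "lam m ~= 0" and r: "r > 0" and U: "open U" "cball 0 r <= U"
  and \<phi>: "\<phi> holomorphic_on U" "!!z. z \<in> U ==> \<phi> z ~= 0"
begin

definition G :: "complex => complex" where
 "G z = z powi \<alpha> * exp (\<Sum>s = 1..m. lam s / z ^ s) * \<phi> z"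

text \<open>The model factor including 1/z, which is why the cofactor \<open>H\<close> carries the
  exponent \<alpha> + 1. The exponent in \<open>H\<close> has only poles of order below m, so
  \<open>H\<close> varies subexponentially on the scale n^(-1/m).\<close>

definition E :: "complex => complex" where "E z = exp (lam m / z ^ m) / z"

definition H :: "complex => complex" where
 "H z = z powi (\<alpha> + 1) * exp (\<Sum>s = 1..<m. lam s / z ^ s) * \<phi> z"

text \<open>z^(m+1) times the logarithmic derivative of \<open>G\<close>, with all negative powers
  cleared, hence holomorphic at 0.\<close>

definition b :: "complex => complex" where
 "b z = of_int \<alpha> * z ^ m - (\<Sum>s = 1..m. of_nat s * lam s * z ^ (m - s)) + z ^ (m + 1) * (deriv \<phi> z / \<phi> z)"

text \<open>The holomorphic numerator of the n-th derivative of \<open>G\<close>: off 0 the zeros of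
  the derivative are the zeros of \<open>Qp n\<close>.\<close>

primrec Qp :: "nat => complex => complex" where
 "Qp 0 = (%z. 1)"
| "Qp (Suc n) = (%z. z ^ (m + 1) * deriv (Qp n) z + (b z - of_nat (n * (m + 1)) * z ^ m) * Qp n z)"

lemma ball_U: "ball 0 r <= U" using U by auto

lemma b_holomorphic: "b holomorphic_on ball 0 r"
proof -
 have "\<phi> holomorphic_on ball 0 r" using \<phi>(1) ball_U by (rule holomorphic_on_subset)
 moreover have "\<phi> z ~= 0" if "z \<in> ball 0 r" for z using that ball_U \<phi>(2) by blast
 ultimately show ?thesis unfolding b_def by (intro holomorphic_intros) auto
qed

lemma Qp_holomorphic: "Qp n holomorphic_on ball 0 r"
 by (induction n) (auto intro!: holomorphic_intros b_holomorphic)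

lemma b_0: "b 0 = - of_nat m * lam m"
proof -
 have "(\<Sum>s = 1..m. of_nat s * lam s * 0 ^ (m - s)) = (\<Sum>s \<in> {m}. of_nat s * lam s * 0 ^ (m - s))"
  by (rule sum.mono_neutral_right) (use m in \<open>auto simp: power_0_left\<close>)
 then show ?thesis unfolding b_def using m by simp
qed

text \<open>All terms with a positive power of z drop out. The value is nonzero, so
  \<open>Qp n\<close> can be normalised to 1 at the origin.\<close>

lemma Qp_0: "Qp n 0 = (- of_nat m * lam m) ^ n"
 using m by (induction n) (auto simp: b_0 power_0_left)

lemma G_nz: "z \<in> U ==> z ~= 0 ==> G z ~= 0"
 unfolding G_def using \<phi>(2) by simp

lemma G_eq: "z ~= 0 ==> G z = H z * E z"
proof -
 assume z: "z ~= 0"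
 have "(\<Sum>s = 1..m. lam s / z ^ s) = (\<Sum>s = 1..<m. lam s / z ^ s) + lam m / z ^ m"
 proof -
  have "{1..m} = insert m {1..<m}" using m by auto
  then show ?thesis by simp
 qed
 moreover have "z powi (\<alpha> + 1) = z powi \<alpha> * z" using z by (simp add: power_int_add)
 ultimately show ?thesis unfolding G_def H_def E_def using z by (simp add: exp_add)
qed

lemma G_deriv:
 assumes z: "z \<in> U" "z ~= 0"
 shows "(G has_field_derivative G z * b z / z ^ (m + 1)) (at z)"
proof -
 have d1: "((%z. z powi \<alpha>) has_field_derivative z powi \<alpha> * (of_int \<alpha> / z)) (at z)"
  using DERIV_power_int[OF DERIV_ident, of \<alpha> z] z(2) by (simp add: power_int_diff mult_ac)
 have ds: "((%z. lam s / z ^ s) has_field_derivative - (of_nat s * lam s / z ^ (s + 1))) (at z)" for s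
  by (rule DERIV_pole[OF z(2)])
 have d2: "((%z. exp (\<Sum>s = 1..m. lam s / z ^ s)) has_field_derivative
  exp (\<Sum>s = 1..m. lam s / z ^ s) * (\<Sum>s = 1..m. - (of_nat s * lam s / z ^ (s + 1)))) (at z)"
  by (intro DERIV_chain2[OF DERIV_exp] DERIV_sum ds)
 have d3: "(\<phi> has_field_derivative deriv \<phi> z) (at z)"
  using holomorphic_derivI[OF \<phi>(1) U(1) z(1)] .
 have "(G has_field_derivative z powi \<alpha> * (of_int \<alpha> / z) * (exp (\<Sum>s = 1..m. lam s / z ^ s) * \<phi> z) +
  (exp (\<Sum>s = 1..m. lam s / z ^ s) * (\<Sum>s = 1..m. - (of_nat s * lam s / z ^ (s + 1))) * \<phi> z + deriv \<phi> z * exp (\<Sum>s = 1..m. lam s / z ^ s)) * z powi \<alpha>) (at z)"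
  using DERIV_mult[OF d1 DERIV_mult[OF d2 d3]] unfolding G_def[abs_def] by (simp add: mult.assoc)
 also have "z powi \<alpha> * (of_int \<alpha> / z) * (exp (\<Sum>s = 1..m. lam s / z ^ s) * \<phi> z) +
  (exp (\<Sum>s = 1..m. lam s / z ^ s) * (\<Sum>s = 1..m. - (of_nat s * lam s / z ^ (s + 1))) * \<phi> z + deriv \<phi> z * exp (\<Sum>s = 1..m. lam s / z ^ s)) * z powi \<alpha>
  = G z * (of_int \<alpha> / z + (\<Sum>s = 1..m. - (of_nat s * lam s / z ^ (s + 1))) + deriv \<phi> z / \<phi> z)"
  unfolding G_def using \<phi>(2)[OF z(1)] by (simp add: field_simps)
 also have "of_int \<alpha> / z + (\<Sum>s = 1..m. - (of_nat s * lam s / z ^ (s + 1))) + deriv \<phi> z / \<phi> z = b z / z ^ (m + 1)"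
 proof -
  have "of_nat s * lam s * z ^ (m - s) / z ^ (m + 1) = of_nat s * lam s / z ^ (s + 1)" if "s \<in> {1..m}" for s
  proof -
   have "z ^ (m + 1) = z ^ (m - s) * z ^ (s + 1)" using that by (simp flip: power_add)
   then show ?thesis using z(2) by simp
  qed
  then have "(\<Sum>s = 1..m. of_nat s * lam s * z ^ (m - s)) / z ^ (m + 1) = (\<Sum>s = 1..m. of_nat s * lam s / z ^ (s + 1))"
   unfolding sum_divide_distrib by (intro sum.cong) auto
  then have "b z / z ^ (m + 1) = of_int \<alpha> * z ^ m / z ^ (m + 1) - (\<Sum>s = 1..m. of_nat s * lam s / z ^ (s + 1)) + deriv \<phi> z / \<phi> z"
   unfolding b_def using z(2) by (simp only: add_divide_distrib diff_divide_distrib) simp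
  moreover have "of_int \<alpha> * z ^ m / z ^ (m + 1) = of_int \<alpha> / z" using z(2) by simp
  ultimately show ?thesis by (simp add: sum_negf)
 qed
 finally show ?thesis by simp
qed

lemma higher_deriv_G:
 assumes "z \<in> ball 0 r - {0}"
 shows "(deriv ^^ n) G z = G z * Qp n z / z ^ (n * (m + 1))"
 using assms
proof (induction n arbitrary: z)
 case (Suc n)
 let ?N = "n * (m + 1)"
 have z: "z ~= 0" "z \<in> U" "z \<in> ball 0 r" using Suc.prems ball_U by auto
 have dQ: "(Qp n has_field_derivative deriv (Qp n) z) (at z)"
  by (rule holomorphic_derivI[OF Qp_holomorphic open_ball z(3)])
 have dz: "((%z. 1 / z ^ ?N) has_field_derivative - of_nat ?N / z ^ (?N + 1)) (at z)"
  using DERIV_pole[OF z(1), of 1 ?N] by (simp del: of_nat_mult of_nat_add)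
 have "((%z. G z * (Qp n z * (1 / z ^ ?N))) has_field_derivative
  (G z * b z / z ^ (m + 1)) * (Qp n z * (1 / z ^ ?N)) + (deriv (Qp n) z * (1 / z ^ ?N) + (- of_nat ?N / z ^ (?N + 1)) * Qp n z) * G z) (at z)"
  by (rule DERIV_mult[OF G_deriv[OF z(2,1)] DERIV_mult[OF dQ dz]])
 also have "(G z * b z / z ^ (m + 1)) * (Qp n z * (1 / z ^ ?N)) + (deriv (Qp n) z * (1 / z ^ ?N) + (- of_nat ?N / z ^ (?N + 1)) * Qp n z) * G z
  = G z * Qp (Suc n) z / z ^ (?N + (m + 1))"
 proof -
  define X where "X = z ^ ?N" define Y where "Y = z ^ m" define c where "c = (of_nat ?N :: complex)"
  have "X ~= 0" "Y ~= 0" using z by (auto simp: X_def Y_def)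
  then have "(G z * b z / (Y * z)) * (Qp n z * (1 / X)) + (deriv (Qp n) z * (1 / X) + (- c / (X * z)) * Qp n z) * G z
   = G z * (Y * z * deriv (Qp n) z + (b z - c * Y) * Qp n z) / (X * (Y * z))"
   using z(1) by (simp add: field_simps)
  then show ?thesis unfolding X_def Y_def c_def by (simp add: power_add mult.commute del: of_nat_mult of_nat_add)
 qed
 also have "?N + (m + 1) = Suc n * (m + 1)" by simp
 finally have "((%z. G z * (Qp n z * (1 / z ^ ?N))) has_field_derivative G z * Qp (Suc n) z / z ^ (Suc n * (m + 1))) (at z)" .
 then have "((deriv ^^ n) G has_field_derivative G z * Qp (Suc n) z / z ^ (Suc n * (m + 1))) (at z)"
  by (rule has_field_derivative_transform_within_open[of _ _ _ "ball 0 r - {0}"]) (use Suc in auto)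
 from DERIV_imp_deriv[OF this] show ?case by simp
qed simp

lemma H_holomorphic: "H holomorphic_on U - {0}"
 unfolding H_def by (intro holomorphic_intros holomorphic_on_subset[OF \<phi>(1)]) auto

lemma E_holomorphic: "E holomorphic_on - {0}"
 unfolding E_def by (intro holomorphic_intros) auto

text \<open>Leibniz for G = H E: the derivatives of \<open>E\<close> are known exactly, those of
  \<open>H\<close> are bounded by Cauchy's inequality on the disc of radius \<delta> |z|. The
  binomial coefficient times k! becomes n!/(n-k)!, and the powers of |z| cancel.\<close>

lemma leibniz_bound:
 assumes z: "z ~= 0" and \<delta>: "0 < \<delta>" "\<delta> < 1" and sub: "cball z (\<delta> * cmod z) <= U"
  and M: "!!z'. cmod (z' - z) <= \<delta> * cmod z ==> cmod (H z') <= M * cmod (H z)"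
 shows "cmod (z ^ n * (deriv ^^ n) G z) \<le>
  cmod (G z) * (M * (\<Sum>k\<le>n. fact n / fact (n - k) * cmod (poly (dpoly m (n - k)) (lam m / z ^ m)) / \<delta> ^ k))"
proof -
 let ?q = "%k. cmod (poly (dpoly m (n - k)) (lam m / z ^ m))"
 have r0: "\<delta> * cmod z > 0" using z \<delta> by simp
 have zU: "z \<in> U" using sub r0 by auto
 have n0: "0 \<notin> cball z (\<delta> * cmod z)" using z \<delta> by (simp add: dist_norm mult_le_cancel_right2)
 have Hc: "H holomorphic_on cball z (\<delta> * cmod z)"
  by (rule holomorphic_on_subset[OF H_holomorphic]) (use sub n0 in auto)
 have cH: "cmod ((deriv ^^ k) H z) <= fact k * (M * cmod (H z)) / (\<delta> * cmod z) ^ k" for k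
  by (rule Cauchy_inequality[OF holomorphic_on_subset[OF Hc ball_subset_cball] holomorphic_on_imp_continuous_on[OF Hc] r0])
   (use M in \<open>auto simp: norm_minus_commute\<close>)
 have cE: "cmod ((deriv ^^ k) E z) = cmod (E z) * cmod (poly (dpoly m k) (lam m / z ^ m)) / cmod z ^ k" for k
  unfolding E_def[abs_def] deriv_exp_pole[OF z] by (simp add: norm_mult norm_divide norm_power)
 have "(deriv ^^ n) G z = (deriv ^^ n) (%w. H w * E w) z"
 proof (rule higher_deriv_transform_within_open)
  show "open (U - {0})" "z \<in> U - {0}" using U(1) zU z by auto
  show "(%w. H w * E w) holomorphic_on U - {0}"
   by (intro holomorphic_intros H_holomorphic holomorphic_on_subset[OF E_holomorphic]) auto
  then show "G holomorphic_on U - {0}" by (rule holomorphic_transform) (simp add: G_eq)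
 qed (auto simp: G_eq)
 also have "... = (\<Sum>k = 0..n. of_nat (n choose k) * (deriv ^^ k) H z * (deriv ^^ (n - k)) E z)"
  by (rule higher_deriv_mult[OF H_holomorphic holomorphic_on_subset[OF E_holomorphic]]) (use U(1) zU z in auto)
 finally have "cmod (z ^ n * (deriv ^^ n) G z) = cmod z ^ n * cmod (\<Sum>k\<le>n. of_nat (n choose k) * (deriv ^^ k) H z * (deriv ^^ (n - k)) E z)"
  by (simp add: norm_mult norm_power atLeast0AtMost)
 also have "... <= cmod z ^ n * (\<Sum>k\<le>n. real (n choose k) * (fact k * (M * cmod (H z)) / (\<delta> * cmod z) ^ k) * (cmod (E z) * ?q k / cmod z ^ (n - k)))"
 proof (intro mult_left_mono sum_norm_le)
  fix k assume "k \<in> {..n}"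
  have "cmod (of_nat (n choose k) * (deriv ^^ k) H z * (deriv ^^ (n - k)) E z) = real (n choose k) * cmod ((deriv ^^ k) H z) * (cmod (E z) * ?q k / cmod z ^ (n - k))"
   by (simp add: norm_mult cE)
  also have "... <= real (n choose k) * (fact k * (M * cmod (H z)) / (\<delta> * cmod z) ^ k) * (cmod (E z) * ?q k / cmod z ^ (n - k))"
   by (intro mult_right_mono mult_left_mono cH) auto
  finally show "cmod (of_nat (n choose k) * (deriv ^^ k) H z * (deriv ^^ (n - k)) E z) \<le>
   real (n choose k) * (fact k * (M * cmod (H z)) / (\<delta> * cmod z) ^ k) * (cmod (E z) * ?q k / cmod z ^ (n - k))" .
 qed simp
 also have "... = (\<Sum>k\<le>n. cmod (G z) * (M * (fact n / fact (n - k) * ?q k / \<delta> ^ k)))"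
  unfolding sum_distrib_left
 proof (rule sum.cong[OF refl])
  fix k assume "k \<in> {..n}"
  then have k: "k <= n" by simp
  have zn: "cmod z ^ n = cmod z ^ k * cmod z ^ (n - k)" using k by (simp flip: power_add)
  have bin: "real (n choose k) = fact n / (fact k * fact (n - k))" by (rule binomial_fact[OF k])
  show "cmod z ^ n * (real (n choose k) * (fact k * (M * cmod (H z)) / (\<delta> * cmod z) ^ k) * (cmod (E z) * ?q k / cmod z ^ (n - k))) =
   cmod (G z) * (M * (fact n / fact (n - k) * ?q k / \<delta> ^ k))"
   unfolding zn bin G_eq[OF z] using z \<delta> by (simp add: power_mult_distrib norm_mult field_simps)
 qed
 finally show ?thesis by (simp add: sum_distrib_left)
qed

definition sc :: "nat => real" where "sc n = real n powr (1 / real m)"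

lemma sc_pow: "n > 0 ==> sc n ^ m = real n"
 unfolding sc_def using m by (simp add: powr_realpow[symmetric] powr_powr)

lemma sc_pos: "n > 0 ==> sc n > 0" by (simp add: sc_def)

lemma sc_at_top: "filterlim sc at_top sequentially"
 unfolding sc_def using m by real_asymp

lemma sc_pow_small: "s < m ==> (%n. sc n ^ s / real n) \<longlonglongrightarrow> 0"
proof -
 assume s: "s < m"
 have "((%n. real n powr (real s / real m - 1)) \<longlongrightarrow> 0) sequentially"
  by (rule tendsto_neg_powr[OF _ filterlim_real_sequentially]) (use s in \<open>simp add: field_simps\<close>)
 moreover have "\<forall>\<^sub>F n in sequentially. real n powr (real s / real m - 1) = sc n ^ s / real n"
  using eventually_gt_at_top[of 0]
 proof eventually_elim
  case (elim n)
  then have "sc n ^ s = real n powr (real s / real m)" using m by (simp add: sc_def powr_realpow[symmetric] powr_powr)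
  then show ?case using elim by (simp add: powr_diff)
 qed
 ultimately show ?thesis by (rule Lim_transform_eventually)
qed

text \<open>For |z| of order n^(-1/m) the exponent left in \<open>H\<close> is at most of order
  n^((m-1)/m), hence o(n); the power of z and \<phi> change by bounded factors. The condition 2 R <
  r sc n keeps the whole disc inside the domain.\<close>

lemma H_ratio:
 assumes \<kappa>: "\<kappa> > 0" "\<kappa> <= R" and \<delta>: "0 < \<delta>" "\<delta> < 1" and \<eta>: "\<eta> > 0"
 shows "\<forall>\<^sub>F n in sequentially. n > 0 & 2 * R < r * sc n & (\<forall>w. \<kappa> <= cmod w --> cmod w <= R -->
  (\<forall>z'. cmod (z' - w / of_real (sc n)) <= \<delta> * cmod (w / of_real (sc n)) --> cmod (H z') <= exp (\<eta> * real n) * cmod (H (w / of_real (sc n)))))"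
proof -
 \<comment> \<open>On the disc |z'|/|z| stays between 1 - \<delta> and 2, so the power of z changes
   at most by the factor B.\<close>
 have "compact ((%u. u powi (\<alpha> + 1)) ` {1 - \<delta>..2::real})"
  by (intro compact_continuous_image continuous_intros) (use \<delta> in auto)
 then obtain B where B: "!!u::real. 1 - \<delta> <= u ==> u <= 2 ==> u powi (\<alpha> + 1) <= B"
  using compact_imp_bounded[THEN bounded_imp_bdd_above] unfolding bdd_above_def by (metis atLeastAtMost_iff imageI)
 have cont: "continuous_on (cball 0 r) \<phi>" using \<phi>(1) U(2) holomorphic_on_imp_continuous_on continuous_on_subset by blast
 have "compact ((%z. cmod (\<phi> z)) ` cball 0 r)" by (intro compact_continuous_image continuous_intros cont) auto
 then obtain u where u: "!!z. z \<in> cball 0 r ==> cmod (\<phi> z) <= u"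
  using compact_imp_bounded[THEN bounded_imp_bdd_above] unfolding bdd_above_def by (metis imageI)
 have "compact ((%z. 1 / cmod (\<phi> z)) ` cball 0 r)"
  by (intro compact_continuous_image continuous_intros cont) (use \<phi>(2) U(2) in auto)
 then obtain v where v: "!!z. z \<in> cball 0 r ==> 1 / cmod (\<phi> z) <= v"
  using compact_imp_bounded[THEN bounded_imp_bdd_above] unfolding bdd_above_def by (metis imageI)
 have pos: "B > 0" "u > 0" "v > 0"
 proof -
  show "B > 0" using B[of 1] \<delta> by simp
  have "\<phi> 0 ~= 0" using \<phi>(2)[of 0] subsetD[OF U(2), of 0] r by auto
  then show "u > 0" "v > 0" using u[of 0] v[of 0] r by (auto simp: zero_less_norm_iff intro: less_le_trans[of 0 "cmod (\<phi> 0)"] less_le_trans[of 0 "1 / cmod (\<phi> 0)"])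
 qed
 \<comment> \<open>A lower bound for sc n |z'| on the disc; with it \<open>T n\<close> bounds the
   lower-order exponent.\<close>
 define c where "c = (1 - \<delta>) * \<kappa>"
 have c: "c > 0" using \<kappa> \<delta> by (simp add: c_def)
 define T where "T n = (\<Sum>s = 1..<m. cmod (lam s) * (sc n / c) ^ s)" for n
 have "(%n. \<Sum>s = 1..<m. cmod (lam s) / c ^ s * (sc n ^ s / real n)) \<longlonglongrightarrow> (\<Sum>s = 1..<m. cmod (lam s) / c ^ s * 0)"
  by (intro tendsto_intros sc_pow_small) auto
 also have "(%n. \<Sum>s = 1..<m. cmod (lam s) / c ^ s * (sc n ^ s / real n)) = (%n. T n / real n)"
  unfolding T_def by (simp add: sum_divide_distrib power_divide)
 finally have "(%n. T n / real n) \<longlonglongrightarrow> 0" by simp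
 then have evT: "\<forall>\<^sub>F n in sequentially. T n / real n < \<eta> / 4" by (rule order_tendstoD) (use \<eta> in simp)
 have evS: "\<forall>\<^sub>F n in sequentially. 2 * R / r < sc n" using sc_at_top by (simp add: filterlim_at_top_dense)
 have evE: "\<forall>\<^sub>F n in sequentially. B * u * v <= exp (\<eta> / 2 * real n)"
 proof -
  have "filterlim (%n. exp (\<eta> / 2 * real n)) at_top sequentially"
   using \<eta> by real_asymp
  then show ?thesis by (simp add: filterlim_at_top)
 qed
 show ?thesis
  using evT evS evE eventually_gt_at_top[of 0]
 proof eventually_elim
  case (elim n)
  have n: "n > 0" using elim by simp
  note sp = sc_pos[OF n]
  have R: "2 * R < r * sc n" using elim(2) r by (simp add: divide_less_eq mult.commute)
  have Tn: "T n <= \<eta> / 4 * real n" using elim(1) n by (simp add: divide_less_eq)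
  have main: "cmod (H z') <= exp (\<eta> * real n) * cmod (H (w / of_real (sc n)))"
   if w: "\<kappa> <= cmod w" "cmod w <= R" and z': "cmod (z' - w / of_real (sc n)) <= \<delta> * cmod (w / of_real (sc n))" for w z'
  proof -
   define z where "z = w / of_real (sc n)"
   have cz: "cmod z = cmod w / sc n" using sp by (simp add: z_def norm_divide)
   have z0: "cmod z > 0" unfolding cz using less_le_trans[OF \<kappa>(1) w(1)] sp by (rule divide_pos_pos)
   have z'b: "(1 - \<delta>) * cmod z <= cmod z'" "cmod z' <= 2 * cmod z"
   proof -
    have "cmod z - cmod z' <= \<delta> * cmod z" using z' norm_triangle_ineq2[of z z'] by (simp add: z_def norm_minus_commute)
    then show "(1 - \<delta>) * cmod z <= cmod z'" by (simp add: algebra_simps)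
    have "cmod z' - cmod z <= \<delta> * cmod z" using z' norm_triangle_ineq2[of z' z] by (simp add: z_def)
    moreover have "\<delta> * cmod z <= cmod z" using \<delta> z0 by (simp add: mult_le_cancel_right2)
    ultimately show "cmod z' <= 2 * cmod z" by simp
   qed
   have "cmod z * 2 < r" unfolding cz using w R sp by (simp add: divide_less_eq mult.commute)
   then have "cmod z <= r" "cmod z' <= r" using z'b(2) z0 by linarith+
   then have in_ball: "z \<in> cball 0 r" "z' \<in> cball 0 r" by auto
   have czl: "c / sc n <= (1 - \<delta>) * cmod z" unfolding cz c_def using w \<delta> sp by (simp add: divide_right_mono mult_left_mono)
   have S: "cmod (\<Sum>s = 1..<m. lam s / x ^ s) <= T n" if x: "(1 - \<delta>) * cmod z <= cmod x" for x
    unfolding T_def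
   proof (rule sum_norm_le)
    fix s
    have cx: "c / sc n <= cmod x" using czl x by simp
    have cs: "c / sc n > 0" using c sp by simp
    have "cmod (lam s / x ^ s) = cmod (lam s) / cmod x ^ s" by (simp add: norm_divide norm_power)
    also have "... <= cmod (lam s) / (c / sc n) ^ s"
     using cx cs by (intro divide_left_mono power_mono mult_pos_pos zero_less_power) auto
    also have "... = cmod (lam s) * (sc n / c) ^ s" by (simp add: power_divide)
    finally show "cmod (lam s / x ^ s) <= cmod (lam s) * (sc n / c) ^ s" .
   qed
   have zz: "(1 - \<delta>) * cmod z <= cmod z" using \<delta> z0 by (simp add: mult_le_cancel_right2)
   let ?S = "%x. \<Sum>s = 1..<m. lam s / x ^ s"
   have e1: "cmod (exp (?S z')) <= exp (T n)" using S[OF z'b(1)] complex_Re_le_cmod[of "?S z'"] by (simp add: norm_exp_eq_Re)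
   have e2: "exp (- T n) <= cmod (exp (?S z))" using S[OF zz] abs_Re_le_cmod[of "?S z"] by (simp add: norm_exp_eq_Re)
   define X where "X = cmod z powi (\<alpha> + 1)"
   have X: "X > 0" using z0 by (simp add: X_def)
   have p: "cmod z' powi (\<alpha> + 1) <= B * X"
   proof -
    have "(cmod z' / cmod z) powi (\<alpha> + 1) <= B" using z'b z0 by (intro B) (auto simp: divide_simps)
    then show ?thesis unfolding X_def power_int_divide_distrib using z0 by (simp add: divide_le_eq)
   qed
   have pz': "cmod (\<phi> z') <= u" by (rule u[OF in_ball(2)])
   have pz: "1 / v <= cmod (\<phi> z)"
   proof -
    have "\<phi> z ~= 0" using \<phi>(2) U(2) in_ball by blast
    then show ?thesis using v[OF in_ball(1)] pos by (simp add: divide_simps mult.commute)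
   qed
   have "cmod (H z') = cmod z' powi (\<alpha> + 1) * cmod (exp (?S z')) * cmod (\<phi> z')"
    by (simp add: H_def norm_mult norm_power_int)
   also have "... <= (B * X) * exp (T n) * u"
    using pos X by (intro mult_mono p e1 pz' mult_nonneg_nonneg) auto
   also have "... = B * u * v * exp (2 * T n) * (X * exp (- T n) * (1 / v))"
    using pos by (simp add: exp_minus exp_add[symmetric] field_simps flip: exp_add)
   also have "... <= exp (\<eta> / 2 * real n) * exp (2 * T n) * (X * exp (- T n) * (1 / v))"
    using elim(3) X pos by (intro mult_right_mono) auto
   also have "... <= exp (\<eta> / 2 * real n) * exp (\<eta> / 2 * real n) * (X * exp (- T n) * (1 / v))"
    using Tn X pos by (intro mult_right_mono mult_left_mono) auto
   also have "... <= exp (\<eta> / 2 * real n) * exp (\<eta> / 2 * real n) * (X * cmod (exp (?S z)) * cmod (\<phi> z))"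
    using X pos by (intro mult_left_mono mult_mono e2 pz mult_nonneg_nonneg) auto
   also have "X * cmod (exp (?S z)) * cmod (\<phi> z) = cmod (H z)" by (simp add: H_def X_def norm_mult norm_power_int)
   also have "exp (\<eta> / 2 * real n) * exp (\<eta> / 2 * real n) = exp (\<eta> * real n)" by (simp add: mult_exp_exp field_simps)
   finally show ?thesis unfolding z_def .
  qed
  show ?case using n R main by blast
 qed
qed

end

subsection \<open>The rescaled zeros\<close>

definition unity_root :: "nat => nat => complex" where
 "unity_root n \<nu> = exp (2 * of_real pi * \<i> * of_nat \<nu> / of_nat n)"

lemma norm_unity_root [simp]: "cmod (unity_root n \<nu>) = 1"
proof -
 have "2 * of_real pi * \<i> * of_nat \<nu> / of_nat n = \<i> * of_real (2 * pi * real \<nu> / real n)" by simp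
 then show ?thesis unfolding unity_root_def by (metis norm_exp_i_times)
qed

lemma unity_root_nz [simp]: "unity_root n \<nu> ~= 0" by (simp add: unity_root_def)

lemma roots_unity_bij:
 assumes "n >= 1" shows "bij_betw (unity_root n) {..<n} {z. z ^ n = 1}"
proof -
 have "{exp (2 * of_real pi * \<i> * of_nat j / of_nat n) |j. j < n} = {z::complex. z ^ n = 1}"
  using complex_roots_unity[OF assms] by auto
 then show ?thesis using bij_betw_roots_unity[of n] unfolding unity_root_def[abs_def] by simp
qed

lemma unity_root_pow: "n >= 1 ==> \<nu> < n ==> unity_root n \<nu> ^ n = 1"
 using roots_unity_bij[of n] by (auto simp: bij_betw_def)

text \<open>The factorisation of x^n - 1, divided by its value at x = 0.\<close>

lemma prod_roots_unity:
 assumes n: "n >= 1"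
 shows "(\<Prod>\<nu><n. 1 - x / unity_root n \<nu>) = 1 - x ^ n"
proof -
 let ?A = "{z::complex. z ^ n = 1}" and ?P = "monom (1::complex) n - 1"
 have card: "card ?A = n" using bij_betw_same_card[OF roots_unity_bij[OF n]] by simp
 have fin: "finite ?A" using bij_betw_finite[OF roots_unity_bij[OF n]] by simp
 have co: "coeff ?P n = 1" using n by simp
 have "?P = smult (coeff ?P (card ?A)) (\<Prod>a\<in>?A. [:- a, 1:])"
 proof (rule poly_eq_prod_roots[OF fin])
  show "degree ?P <= card ?A" unfolding card by (intro degree_diff_le degree_monom_le) auto
 qed (auto simp: poly_monom)
 then have "?P = (\<Prod>a\<in>?A. [:- a, 1:])" unfolding card co by simp
 then have "poly ?P x = (\<Prod>a\<in>?A. x - a)" for x by (simp add: poly_prod)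
 then have eq: "x ^ n - 1 = (\<Prod>\<nu><n. x - unity_root n \<nu>)" for x
  unfolding prod.reindex_bij_betw[OF roots_unity_bij[OF n], symmetric] by (simp add: poly_monom)
 have "(\<Prod>\<nu><n. 1 - x / unity_root n \<nu>) = (\<Prod>\<nu><n. (x - unity_root n \<nu>) / (0 - unity_root n \<nu>))"
  by (rule prod.cong) (auto simp: field_simps)
 also have "... = (x ^ n - 1) / (0 ^ n - 1)" unfolding prod_dividef eq[symmetric] ..
 also have "... = 1 - x ^ n" using n by (simp add: power_0_left)
 finally show ?thesis .
qed

section \<open>The normalised derivative, the normalised model polynomial, and their
  comparison\<close>

context essential_function
begin

definition Cb :: real where "Cb = 2 ^ (m + 6)"

text \<open>Equals -1/Y for Y = lam m / w^m. It is a polynomial in w, and a root Y = -x corresponds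
  to \<tau> w = 1/x.\<close>

definition \<tau> :: "complex => complex" where "\<tau> w = - (w ^ m) / lam m"

text \<open>The complement of the arms. The crude bound Cb is used in place of the sharp edge so
  that the zeros of every \<open>p n\<close> lie on the arms, for each n and not just in the
  limit.\<close>

definition \<Omega> :: "complex set" where "\<Omega> = {w. \<not> (Im (\<tau> w) = 0 & 1 / Cb <= Re (\<tau> w))}"

text \<open>\<open>Qp n\<close> on the scale w = sc n * z, divided by its value at 0. The
  conventions for n = 0 and outside the disc make it Borel with value 1 at 0 for every n.\<close>

definition f :: "nat => complex => complex" where
 "f n w = (if n = 0 then 1 else if cmod w < r * sc n then Qp n (w / of_real (sc n)) / (- of_nat m * lam m) ^ n else 0)"

definition p :: "nat => complex => complex" where
 "p n w = (\<Prod>j<n. 1 - of_real (droot m n j / real n) * \<tau> w)"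

lemma Cb_pos: "Cb > 0" by (simp add: Cb_def)

lemma droot_quot:
 assumes "j < n" shows "0 < droot m n j / real n" "droot m n j / real n <= Cb"
proof -
 have "droot m n j > 0" by (rule droot_pos[OF m assms])
 then show "0 < droot m n j / real n" using assms by simp
 have "droot m n j <= 2 ^ (m + 6) * real n" using droot_le[OF m assms] by simp
 then show "droot m n j / real n <= Cb" using assms by (simp add: Cb_def divide_le_eq)
qed

lemma \<tau>_continuous: "continuous_on S \<tau>" unfolding \<tau>_def using lam by (intro continuous_intros) auto

lemma \<tau>_0: "\<tau> 0 = 0" using m by (simp add: \<tau>_def power_0_left)

lemma \<tau>_scale: "\<tau> (of_real t * w) = of_real (t ^ m) * \<tau> w" by (simp add: \<tau>_def power_mult_distrib)

lemma \<Omega>_open: "open \<Omega>"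
proof -
 have "closed ({w. Im (\<tau> w) = 0} \<inter> {w. 1 / Cb <= Re (\<tau> w)})"
  by (intro closed_Int closed_Collect_eq closed_Collect_le continuous_intros \<tau>_continuous)
 moreover have "\<Omega> = - ({w. Im (\<tau> w) = 0} \<inter> {w. 1 / Cb <= Re (\<tau> w)})" by (auto simp: \<Omega>_def)
 ultimately show ?thesis by (simp only: open_Compl)
qed

lemma \<Omega>_0: "0 \<in> \<Omega>" using Cb_pos by (simp add: \<Omega>_def \<tau>_0)

text \<open>Scaling w towards 0 scales \<tau> by a factor in [0, 1], so \<Omega> is star-shaped
  about 0.\<close>

lemma \<Omega>_connected: "connected \<Omega>"
proof (rule starlike_imp_connected)
 show "starlike \<Omega>"
  unfolding starlike_def
 proof (intro bexI[OF _ \<Omega>_0] ballI subsetI)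
  fix w z assume w: "w \<in> \<Omega>" and "z \<in> closed_segment 0 w"
  then obtain t where t: "0 <= t" "t <= 1" "z = of_real t * w"
   by (auto simp: closed_segment_def scaleR_conv_of_real)
  show "z \<in> \<Omega>"
  proof (rule ccontr)
   assume "z \<notin> \<Omega>"
   then have "Im (\<tau> z) = 0" "1 / Cb <= Re (\<tau> z)" by (auto simp: \<Omega>_def)
   then have I: "t ^ m * Im (\<tau> w) = 0" and Re: "1 / Cb <= t ^ m * Re (\<tau> w)" unfolding t(3) \<tau>_scale by auto
   have "1 / Cb > 0" using Cb_pos by simp
   then have pos: "0 < t ^ m * Re (\<tau> w)" using Re by linarith
   then have "t ^ m > 0" "Re (\<tau> w) > 0" using t(1) by (auto simp: zero_less_mult_iff not_less zero_le_power)
   moreover have "t ^ m <= 1" using t by (simp add: power_le_one)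
   ultimately have "t ^ m * Re (\<tau> w) <= 1 * Re (\<tau> w)" by (intro mult_right_mono) auto
   moreover have "Im (\<tau> w) = 0" using I \<open>t ^ m > 0\<close> by (metis less_irrefl mult_eq_0_iff)
   ultimately show False using w Re by (auto simp: \<Omega>_def)
  qed
 qed
qed

lemma p_nz: assumes w: "w \<in> \<Omega>" shows "p n w ~= 0"
proof
 assume "p n w = 0"
 then obtain j where j: "j < n" "1 - of_real (droot m n j / real n) * \<tau> w = 0" by (auto simp: p_def)
 define \<xi> where "\<xi> = droot m n j / real n"
 have \<xi>: "0 < \<xi>" "\<xi> <= Cb" unfolding \<xi>_def using droot_quot[OF j(1)] by auto
 have "of_real \<xi> * \<tau> w = 1" using j(2) unfolding \<xi>_def by simp
 then have "\<tau> w = of_real (1 / \<xi>)" using \<xi> by (simp add: field_simps)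
 moreover have "1 / Cb <= 1 / \<xi>" using \<xi> by (intro divide_left_mono mult_pos_pos) auto
 ultimately have "Im (\<tau> w) = 0 & 1 / Cb <= Re (\<tau> w)" by simp
 then show False using w by (simp add: \<Omega>_def)
qed

lemma p_holomorphic: "p n holomorphic_on S"
 unfolding p_def[abs_def] \<tau>_def using lam by (intro holomorphic_intros) auto

lemma p_0: "p n 0 = 1" by (simp add: p_def \<tau>_0)

lemma f_0: "f n 0 = 1"
proof (cases "n = 0")
 case False
 then have "r * sc n > 0" using r sc_pos by simp
 then show ?thesis using m lam by (simp add: f_def Qp_0)
qed (simp add: f_def)

lemma f_holomorphic: assumes "n > 0" shows "f n holomorphic_on ball 0 (r * sc n)"
proof -
 have s: "sc n > 0" using sc_pos assms by simp
 have 1: "(%w. w / complex_of_real (sc n)) holomorphic_on ball 0 (r * sc n)"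
  by (intro holomorphic_intros) (use s in auto)
 have 2: "(%w. w / complex_of_real (sc n)) ` ball 0 (r * sc n) <= ball 0 r"
  using s by (auto simp: norm_divide divide_less_eq)
 have "(%w. Qp n (w / of_real (sc n))) holomorphic_on ball 0 (r * sc n)"
  using holomorphic_on_compose[OF 1 holomorphic_on_subset[OF Qp_holomorphic 2]] by (simp add: o_def)
 then have "(%w. Qp n (w / of_real (sc n)) / (- of_nat m * lam m) ^ n) holomorphic_on ball 0 (r * sc n)"
  by (intro holomorphic_intros) (use m lam in auto)
 then show ?thesis by (rule holomorphic_transform) (use assms in \<open>auto simp: f_def\<close>)
qed

lemma f_borel: "f n \<in> borel_measurable borel"
proof (cases "n = 0")
 case True
 then have "f n = (%w. 1)" by (auto simp: f_def)
 then show ?thesis by simp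
next
 case False
 have "continuous_on (ball 0 (r * sc n)) (f n)"
  using f_holomorphic False by (intro holomorphic_on_imp_continuous_on) auto
 then have "(%w. indicator (ball 0 (r * sc n)) w *\<^sub>R f n w) \<in> borel_measurable borel"
  by (intro borel_measurable_continuous_on_indicator) auto
 also have "(%w. indicator (ball 0 (r * sc n)) w *\<^sub>R f n w) = f n"
  using False by (auto simp: f_def fun_eq_iff indicator_def)
 finally show ?thesis .
qed

lemma f_eventually: "\<forall>\<^sub>F n in sequentially. n > 0 & \<rho> < r * sc n"
proof -
 have "\<forall>\<^sub>F n in sequentially. \<rho> / r < sc n" using sc_at_top by (simp add: filterlim_at_top_dense)
 then show ?thesis using eventually_gt_at_top[of 0]
  by eventually_elim (use r in \<open>auto simp: divide_less_eq mult.commute\<close>)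
qed

lemma f_hol: "\<forall>\<^sub>F n in sequentially. f n holomorphic_on ball 0 \<rho>"
 using f_eventually[of \<rho>]
proof eventually_elim
 case (elim n)
 then have "ball 0 \<rho> <= ball (0::complex) (r * sc n)" by (intro subset_ball) auto
 then show ?case using f_holomorphic elim holomorphic_on_subset by blast
qed

definition Yv :: "complex => complex" where "Yv w = lam m / w ^ m"

text \<open>\<open>p n\<close> is the polynomial with its leading power taken out. The same power
  appears in \<open>f_norm\<close> and cancels when f and p are compared.\<close>

lemma p_dpoly:
 assumes "w ~= 0" "n > 0"
 shows "poly (dpoly m n) (of_nat n * Yv w) = (of_nat m * (of_nat n * Yv w)) ^ n * p n w"
proof -
 have Y: "Yv w ~= 0" using assms lam by (simp add: Yv_def)
 have "of_nat n * Yv w + of_real (droot m n j) = of_nat n * Yv w * (1 - of_real (droot m n j / real n) * \<tau> w)" for j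
  using assms lam by (simp add: \<tau>_def Yv_def field_simps)
 then have "poly (dpoly m n) (of_nat n * Yv w) = of_nat m ^ n * (\<Prod>j<n. of_nat n * Yv w * (1 - of_real (droot m n j / real n) * \<tau> w))"
  unfolding poly_dpoly_complex[OF m] by simp
 also have "... = of_nat m ^ n * ((of_nat n * Yv w) ^ n * p n w)" unfolding p_def by (simp only: prod.distrib prod_constant card_lessThan power_mult_distrib mult.assoc)
 finally show ?thesis by (simp only: power_mult_distrib[of "of_nat m"] mult.assoc)
qed

lemma f_norm:
 assumes w: "w ~= 0" "cmod w < r * sc n" and n: "n > 0"
 defines "z \<equiv> w / of_real (sc n)"
 shows "cmod (f n w) * cmod (of_nat m * (of_nat n * Yv w)) ^ n * cmod (G z) = cmod (z ^ n * (deriv ^^ n) G z)"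
proof -
 have s: "sc n > 0" using sc_pos n by simp
 have z: "z ~= 0" "z \<in> ball 0 r" using w s by (auto simp: z_def norm_divide divide_less_eq)
 have zm: "of_nat n * Yv w = lam m / z ^ m"
 proof -
  have "of_real (sc n) ^ m = complex_of_nat n" using sc_pow[OF n] by (metis of_real_of_nat_eq of_real_power)
  then show ?thesis by (simp add: z_def Yv_def power_divide)
 qed
 have "cmod (f n w) * cmod (of_nat m * (of_nat n * Yv w)) ^ n = cmod (Qp n z) / cmod (- of_nat m * lam m) ^ n * (cmod (- of_nat m * lam m) ^ n / cmod (z ^ m) ^ n)"
 proof -
  have 1: "f n w = Qp n z / (- of_nat m * lam m) ^ n" using w n by (simp add: f_def z_def)
  have 2: "cmod (of_nat m * (lam m / z ^ m)) = cmod (- of_nat m * lam m) / cmod (z ^ m)" by (simp add: norm_mult norm_divide)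
  show ?thesis unfolding zm 1 2 by (simp only: norm_divide norm_power power_divide)
 qed
 also have "... = cmod (Qp n z) / cmod z ^ (m * n)" using m lam by (simp add: norm_mult norm_power power_mult)
 finally have 1: "cmod (f n w) * cmod (of_nat m * (of_nat n * Yv w)) ^ n = cmod (Qp n z) / cmod z ^ (m * n)" .
 have "z \<in> ball 0 r - {0}" using z by simp
 from higher_deriv_G[OF this, of n]
 have "cmod (z ^ n * (deriv ^^ n) G z) = cmod z ^ n * (cmod (G z) * cmod (Qp n z) / cmod z ^ (n * (m + 1)))"
  by (simp add: norm_mult norm_divide norm_power)
 also have "n * (m + 1) = n + m * n" by simp
 also have "cmod z ^ n * (cmod (G z) * cmod (Qp n z) / cmod z ^ (n + m * n)) = cmod (Qp n z) / cmod z ^ (m * n) * cmod (G z)"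
  using z by (simp add: power_add)
 finally show ?thesis unfolding 1 by simp
qed

lemma f_leibniz:
 assumes \<kappa>: "\<kappa> > 0" "\<kappa> <= R" and \<delta>: "0 < \<delta>" "\<delta> < 1" and \<eta>: "\<eta> > 0"
 shows "\<forall>\<^sub>F n in sequentially. n > 0 & R < r * sc n & (\<forall>w. \<kappa> <= cmod w --> cmod w <= R -->
  cmod (f n w) * cmod (of_nat m * (of_nat n * Yv w)) ^ n \<le>
   exp (\<eta> * real n) * (\<Sum>k\<le>n. fact n / fact (n - k) * cmod (poly (dpoly m (n - k)) (of_nat n * Yv w)) / \<delta> ^ k))"
 using H_ratio[OF \<kappa> \<delta> \<eta>]
proof eventually_elim
 case (elim n)
 then have n: "n > 0" and s2: "2 * R < r * sc n" by auto
 have s: "sc n > 0" using sc_pos n by simp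
 have R: "R > 0" using \<kappa> by simp
 show ?case
 proof (intro conjI n allI impI)
  show "R < r * sc n" using s2 R by linarith
  fix w assume w: "\<kappa> <= cmod w" "cmod w <= R"
  define z where "z = w / of_real (sc n)"
  have w0: "w ~= 0" using w \<kappa> by auto
  have z0: "z ~= 0" using w0 s by (simp add: z_def)
  have zr: "2 * cmod z < r" using w(2) s2 s by (simp add: z_def norm_divide divide_less_eq)
  have sub: "cball z (\<delta> * cmod z) <= U"
  proof
   fix x assume "x \<in> cball z (\<delta> * cmod z)"
   then have "cmod (x - z) <= \<delta> * cmod z" by (simp add: dist_norm norm_minus_commute)
   also have "... <= 1 * cmod z" using \<delta> by (intro mult_right_mono) auto
   finally have "cmod x <= 2 * cmod z" using norm_triangle_sub[of x z] by simp
   then show "x \<in> U" using zr U(2) by auto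
  qed
  have zU: "z \<in> U" using sub \<delta> by (meson centre_in_cball mult_nonneg_nonneg less_imp_le norm_ge_zero subsetD)
  have zm: "lam m / z ^ m = of_nat n * Yv w"
  proof -
   have "of_real (sc n) ^ m = complex_of_nat n" using sc_pow[OF n] by (metis of_real_of_nat_eq of_real_power)
   then show ?thesis by (simp add: z_def Yv_def power_divide)
  qed
  have "cmod (f n w) * cmod (of_nat m * (of_nat n * Yv w)) ^ n * cmod (G z) = cmod (z ^ n * (deriv ^^ n) G z)"
   unfolding z_def by (rule f_norm[OF w0 _ n]) (use w s2 R in auto)
  also have "... <= cmod (G z) * (exp (\<eta> * real n) * (\<Sum>k\<le>n. fact n / fact (n - k) * cmod (poly (dpoly m (n - k)) (lam m / z ^ m)) / \<delta> ^ k))"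
   by (rule leibniz_bound[OF z0 \<delta> sub]) (use elim w in \<open>auto simp: z_def\<close>)
  finally show "cmod (f n w) * cmod (of_nat m * (of_nat n * Yv w)) ^ n \<le>
   exp (\<eta> * real n) * (\<Sum>k\<le>n. fact n / fact (n - k) * cmod (poly (dpoly m (n - k)) (of_nat n * Yv w)) / \<delta> ^ k)"
   using G_nz[OF zU z0] unfolding zm by (simp add: mult.commute)
 qed
qed

lemma Suc_le_exp: "\<eta> > 0 ==> \<forall>\<^sub>F n in sequentially. real n + 1 <= exp (\<eta> * real n)"
 by real_asymp

lemma Yv_nz: "w ~= 0 ==> Yv w ~= 0" using lam by (simp add: Yv_def)

lemma Yv_avoids:
 assumes "w \<in> \<Omega>" "w ~= 0" shows "Yv w \<notin> of_real ` {- Cb..0}"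
proof
 assume "Yv w \<in> of_real ` {- Cb..0}"
 then obtain s where s: "- Cb <= s" "s <= 0" "Yv w = of_real s" by auto
 then have s0: "s < 0" using Yv_nz[OF assms(2)] by (cases "s = 0") auto
 have "\<tau> w = - 1 / Yv w" using assms(2) lam by (simp add: \<tau>_def Yv_def)
 then have "\<tau> w = of_real (- 1 / s)" unfolding s(3) by simp
 moreover have "1 / Cb <= - 1 / s" using s s0 Cb_pos by (simp add: field_simps)
 ultimately show False using assms(1) by (simp add: \<Omega>_def)
qed

text \<open>By \<open>dpoly_ratio_lower\<close> no term of the Leibniz sum exceeds the term k = 0 by
  more than a factor exp(\<eta> n/2), although there are n + 1 terms and the polynomials have
  complex arguments.\<close>

lemma upper_away:
 assumes K: "compact K" "K <= \<Omega>" "0 \<notin> K" and \<eta>: "\<eta> > 0"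
 shows "\<forall>\<^sub>F n in sequentially. \<forall>w\<in>K. cmod (f n w) <= exp (\<eta> * real n) * cmod (p n w)"
proof -
 obtain \<kappa> where \<kappa>: "\<kappa> > 0" "!!w. w \<in> K ==> \<kappa> <= cmod w"
  using separate_point_closed[OF compact_imp_closed[OF K(1)] K(3)] by auto
 obtain R0 where R0: "!!w. w \<in> K ==> cmod w <= R0" using compact_imp_bounded[OF K(1)] unfolding bounded_iff by blast
 define R where "R = max \<kappa> R0"
 have R: "\<kappa> <= R" "!!w. w \<in> K ==> cmod w <= R" using R0 by (auto simp: R_def intro: max.coboundedI2)
 \<comment> \<open>\<open>a\<close> is both the relative radius \<delta> in Cauchy's inequality and
   the loss in the ratio estimate, so a term costs at most a^(-2k) <= exp(\<eta> n/2). The variation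
   of \<open>H\<close> and the n + 1 terms cost exp(\<eta> n/4) each.\<close>
 define a where "a = exp (- \<eta> / 4)"
 have a: "0 < a" "a < 1" using \<eta> by (auto simp: a_def)
 have "compact (Yv ` K)" unfolding Yv_def
  by (intro compact_continuous_image continuous_intros K) (use K(3) in auto)
 moreover have "Yv ` K \<inter> of_real ` {- (2 ^ (m + 6))..0} = {}" using Yv_avoids K unfolding Cb_def by blast
 ultimately have ratio: "\<forall>\<^sub>F n in sequentially. \<forall>Y\<in>Yv ` K. \<forall>k<n.
  (1 - (1 - a)) * real (Suc k) * cmod (poly (dpoly m k) (of_nat n * Y)) <= cmod (poly (dpoly m (Suc k)) (of_nat n * Y))"
  by (rule dpoly_ratio_lower[OF m]) (use a in simp)
 have \<eta>4: "\<eta> / 4 > 0" using \<eta> by simp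
 show ?thesis
  using ratio f_leibniz[OF \<kappa>(1) R(1) a \<eta>4] Suc_le_exp[OF \<eta>4]
 proof eventually_elim
  case (elim n)
  have n: "n > 0" using elim(2) by simp
  show ?case
  proof
   fix w assume w: "w \<in> K"
   then have w0: "w ~= 0" using K(3) by auto
   let ?q = "%k. cmod (poly (dpoly m k) (of_nat n * Yv w))"
   define X where "X = cmod (of_nat m * (of_nat n * Yv w)) ^ n"
   have X: "X > 0" unfolding X_def using m n Yv_nz[OF w0] by simp
   \<comment> \<open>The ratio estimate iterated k times downwards from n.\<close>
   have q: "a ^ k * (fact n / fact (n - k) * ?q (n - k)) <= ?q n" if "k <= n" for k
    using that
   proof (induction k)
    case (Suc k)
    have "n - k = Suc (n - Suc k)" using Suc.prems by simp
    then have "a * real (n - k) * ?q (n - Suc k) <= ?q (n - k)"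
     using elim(1)[rule_format, of "Yv w" "n - Suc k"] w Suc.prems by simp
    then have "(a ^ k * (fact n / fact (n - k))) * (a * real (n - k) * ?q (n - Suc k)) <= (a ^ k * (fact n / fact (n - k))) * ?q (n - k)"
     using a by (intro mult_left_mono) auto
    also have "... <= ?q n" using Suc by (simp add: mult.assoc)
    finally have "(a ^ k * (fact n / fact (n - k))) * (a * real (n - k) * ?q (n - Suc k)) <= ?q n" .
    moreover have "(fact (n - k) :: real) = real (n - k) * fact (n - Suc k)"
     unfolding \<open>n - k = Suc (n - Suc k)\<close> fact_Suc by simp
    moreover have "real (n - k) > 0" using Suc.prems by simp
    ultimately show ?case by (simp add: field_simps del: of_nat_diff)
   qed simp
   have tm: "fact n / fact (n - k) * ?q (n - k) / a ^ k <= exp (\<eta> / 2 * real n) * ?q n" if k: "k \<in> {..n}" for k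
   proof -
    have "fact n / fact (n - k) * ?q (n - k) / a ^ k <= ?q n / (a ^ k * a ^ k)"
     using q[of k] k a by (simp add: field_simps)
    also have "... = exp (\<eta> / 2 * real k) * ?q n"
    proof -
     have "a ^ k * a ^ k = exp (- (\<eta> / 2 * real k))" unfolding a_def by (simp add: exp_of_nat_mult[symmetric] mult_exp_exp)
     then show ?thesis unfolding exp_minus by (simp only: divide_inverse inverse_inverse_eq mult.commute)
    qed
    also have "... <= exp (\<eta> / 2 * real n) * ?q n" using k \<eta> by (intro mult_right_mono) auto
    finally show ?thesis .
   qed
   have "cmod (f n w) * X <= exp (\<eta> / 4 * real n) * (\<Sum>k\<le>n. fact n / fact (n - k) * ?q (n - k) / a ^ k)"
    unfolding X_def using elim(2) \<kappa>(2)[OF w] R(2)[OF w] by blast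
   also have "... <= exp (\<eta> / 4 * real n) * (\<Sum>k\<le>n. exp (\<eta> / 2 * real n) * ?q n)"
    by (intro mult_left_mono sum_mono tm) auto
   also have "... = exp (\<eta> / 4 * real n) * (exp (\<eta> / 2 * real n) * ?q n * (real n + 1))" by simp
   also have "... <= exp (\<eta> / 4 * real n) * (exp (\<eta> / 2 * real n) * ?q n * exp (\<eta> / 4 * real n))"
    using elim(3) by (intro mult_left_mono) auto
   also have "... = exp (\<eta> * real n) * ?q n" by (simp add: field_simps mult_exp_exp)
   also have "?q n = X * cmod (p n w)" unfolding p_dpoly[OF w0 n] X_def by (simp add: norm_mult norm_power)
   finally have "cmod (f n w) * X <= (exp (\<eta> * real n) * cmod (p n w)) * X" by (simp add: mult_ac)
   then show "cmod (f n w) <= exp (\<eta> * real n) * cmod (p n w)" using X by simp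
  qed
 qed
qed

lemma upper:
 assumes K: "compact K" "K <= \<Omega>" and \<eta>: "\<eta> > 0"
 shows "\<forall>\<^sub>F n in sequentially. \<forall>w\<in>K. cmod (f n w) <= exp (\<eta> * real n) * cmod (p n w)"
proof -
 obtain e where e: "e > 0" "cball 0 e <= \<Omega>" using \<Omega>_open \<Omega>_0 open_contains_cball by blast
 define K' where "K' = (K - ball 0 e) \<union> sphere 0 e"
 have "compact K'" "K' <= \<Omega>" "0 \<notin> K'" using K e by (auto simp: K'_def intro!: compact_Un compact_diff)
 from upper_away[OF this \<eta>] f_eventually[of e]
 show ?thesis
 proof eventually_elim
  case (elim n)
  have D: "(%w. f n w / p n w) holomorphic_on cball 0 e"
  proof (intro holomorphic_on_divide p_holomorphic holomorphic_on_subset[OF f_holomorphic])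
   show "cball 0 e <= ball 0 (r * sc n)" using elim(2) by auto
  qed (use elim e p_nz in auto)
  show ?case
  proof
   fix w assume w: "w \<in> K"
   show "cmod (f n w) <= exp (\<eta> * real n) * cmod (p n w)"
   proof (cases "w \<in> ball 0 e")
    case True
    have "cmod (f n w / p n w) <= exp (\<eta> * real n)"
    proof (rule maximum_modulus_frontier[of "%w. f n w / p n w" "cball 0 e"])
     show "(%w. f n w / p n w) holomorphic_on interior (cball 0 e)"
      by (rule holomorphic_on_subset[OF D]) (simp add: interior_subset)
     show "continuous_on (closure (cball 0 e)) (%w. f n w / p n w)" using holomorphic_on_imp_continuous_on[OF D] by simp
     fix z assume "z \<in> frontier (cball (0::complex) e)"
     then have "z \<in> sphere 0 e" using frontier_cball by blast
     then have "z \<in> K'" "z \<in> \<Omega>" using e by (auto simp: K'_def)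
     then show "cmod (f n z / p n z) <= exp (\<eta> * real n)" using elim(1) p_nz[of z n] by (auto simp: norm_divide divide_le_eq)
    qed (use True in auto)
    then show ?thesis using p_nz[of w n] w K(2) by (auto simp: norm_divide divide_le_eq)
   next
    case False
    then show ?thesis using elim(1) w by (simp add: K'_def)
   qed
  qed
 qed
qed

lemma norm_p_le:
 assumes "cmod w <= \<rho>" shows "cmod (p n w) <= (1 + Cb * \<rho> ^ m / cmod (lam m)) ^ n"
proof -
 have \<tau>: "cmod (\<tau> w) <= \<rho> ^ m / cmod (lam m)"
  using assms by (simp add: \<tau>_def norm_divide norm_power divide_right_mono power_mono)
 have "cmod (p n w) <= (\<Prod>j<n. 1 + Cb * \<rho> ^ m / cmod (lam m))"
  unfolding p_def prod_norm[symmetric]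
 proof (rule prod_mono, intro conjI norm_ge_zero)
  fix j assume "j \<in> {..<n}"
  then have x: "0 < droot m n j / real n" "droot m n j / real n <= Cb" using droot_quot by auto
  have "cmod (1 - of_real (droot m n j / real n) * \<tau> w) <= 1 + cmod (of_real (droot m n j / real n) * \<tau> w)"
   using norm_triangle_ineq4[of 1 "of_real (droot m n j / real n) * \<tau> w"] by simp
  also have "cmod (of_real (droot m n j / real n) * \<tau> w) = droot m n j / real n * cmod (\<tau> w)"
   unfolding norm_mult norm_of_real using x by (simp only: abs_of_pos)
  also have "droot m n j / real n * cmod (\<tau> w) <= Cb * (\<rho> ^ m / cmod (lam m))"
   using x \<tau> Cb_pos by (intro mult_mono) auto
  finally show "cmod (1 - of_real (droot m n j / real n) * \<tau> w) <= 1 + Cb * \<rho> ^ m / cmod (lam m)" by simp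
 qed
 then show ?thesis by simp
qed

text \<open>No distance from the arms is available here. On the circle |w| = R the polynomials are
  replaced by their values at |n Y|, where \<open>dpoly_Suc_ge\<close> orders the Leibniz terms; the
  maximum principle covers the inside.\<close>

lemma crude: "\<exists>C\<ge>0. \<forall>\<^sub>F n in sequentially. \<forall>w\<in>ball 0 \<rho>. cmod (f n w) <= exp (C * real n) & cmod (p n w) <= exp (C * real n)"
proof -
 define R where "R = max \<rho> 1"
 have R: "R > 0" "\<rho> <= R" by (auto simp: R_def)
 define B where "B = 1 + Cb * R ^ m / cmod (lam m)"
 have B1: "B >= 1" unfolding B_def using Cb_pos R by simp
 \<comment> \<open>One unit each for the variation of \<open>H\<close>, for 2^n from \<delta> = 1/2,
   and for the n + 1 terms; ln B accounts for the polynomial.\<close>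
 define C where "C = 3 + ln B"
 have C: "C >= 0" using B1 by (simp add: C_def)
 have Bn: "B ^ n = exp (ln B * real n)" for n using B1 by (simp add: exp_of_nat2_mult)
 have h: "(0::real) < 1 / 2" "1 / 2 < (1::real)" "(0::real) < 1" by auto
 have "\<forall>\<^sub>F n in sequentially. \<forall>w\<in>ball 0 \<rho>. cmod (f n w) <= exp (C * real n) & cmod (p n w) <= exp (C * real n)"
  using f_leibniz[OF R(1) order.refl h] Suc_le_exp[OF h(3)]
 proof eventually_elim
  case (elim n)
  have n: "n > 0" "R < r * sc n" using elim(1) by auto
  have BC: "B ^ n <= exp (C * real n)" unfolding Bn C_def by (simp add: algebra_simps)
  have sph: "cmod (f n w) <= exp (C * real n)" if w: "cmod w = R" for w
  proof -
   have w0: "w ~= 0" using w R by auto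
   let ?q = "%k. cmod (poly (dpoly m k) (of_nat n * Yv w))"
   define y where "y = cmod (of_nat n * Yv w)"
   have y: "y > 0" unfolding y_def using Yv_nz[OF w0] n by simp
   have q: "fact n / fact (n - k) * poly (dpoly m (n - k)) y <= poly (dpoly m n) y" if "k <= n" for k
    using that
   proof (induction k)
    case (Suc k)
    have nk: "n - k = Suc (n - Suc k)" using Suc.prems by simp
    have "real (n - k) * poly (dpoly m (n - Suc k)) y <= poly (dpoly m (n - k)) y"
     unfolding nk by (rule dpoly_Suc_ge[OF m]) (use y in simp)
    then have "fact n / fact (n - k) * (real (n - k) * poly (dpoly m (n - Suc k)) y) <= fact n / fact (n - k) * poly (dpoly m (n - k)) y"
     by (intro mult_left_mono) auto
    also have "... <= poly (dpoly m n) y" using Suc by simp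
    finally have "fact n / fact (n - k) * (real (n - k) * poly (dpoly m (n - Suc k)) y) <= poly (dpoly m n) y" .
    moreover have "(fact (n - k) :: real) = real (n - k) * fact (n - Suc k)" unfolding nk fact_Suc by simp
    moreover have "real (n - k) > 0" using Suc.prems by simp
    ultimately show ?case by (simp add: field_simps del: of_nat_diff)
   qed simp
   have tm: "fact n / fact (n - k) * ?q (n - k) / (1 / 2) ^ k <= 2 ^ n * poly (dpoly m n) y" if k: "k \<in> {..n}" for k
   proof -
    have "fact n / fact (n - k) * ?q (n - k) <= fact n / fact (n - k) * poly (dpoly m (n - k)) y"
     unfolding y_def by (intro mult_left_mono norm_dpoly_le[OF m]) auto
    also have "... <= poly (dpoly m n) y" using q k by simp
    finally have le: "fact n / fact (n - k) * ?q (n - k) <= poly (dpoly m n) y" .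
    moreover have "0 <= fact n / fact (n - k) * ?q (n - k)" by simp
    ultimately have "0 <= poly (dpoly m n) y" by linarith
    then have "fact n / fact (n - k) * ?q (n - k) * 2 ^ k <= poly (dpoly m n) y * 2 ^ n"
     using k by (intro mult_mono[OF le] power_increasing) auto
    then show ?thesis by (simp add: power_one_over field_simps)
   qed
   define X where "X = cmod (of_nat m * (of_nat n * Yv w)) ^ n"
   have X: "X > 0" unfolding X_def using m n Yv_nz[OF w0] by simp
   have qn: "poly (dpoly m n) y <= X * B ^ n"
   proof -
    have "y + droot m n j <= y * B" if "j < n" for j
    proof -
     have "droot m n j = droot m n j / real n * real n" using n by simp
     also have "... <= Cb * real n" using droot_quot(2)[OF that] by (intro mult_right_mono) auto
     also have "... = y * (Cb * R ^ m / cmod (lam m))"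
      unfolding y_def Yv_def using lam w R n by (simp add: norm_mult norm_divide norm_power)
     finally show ?thesis by (simp add: B_def algebra_simps)
    qed
    then have "(\<Prod>j<n. y + droot m n j) <= (\<Prod>j<n. y * B)"
     using y droot_pos[OF m, THEN less_imp_le] by (intro prod_mono) (auto intro!: add_nonneg_nonneg)
    then have "real m ^ n * (\<Prod>j<n. y + droot m n j) <= real m ^ n * (y * B) ^ n" by (intro mult_left_mono) auto
    also have "... = X * B ^ n" unfolding X_def norm_mult[of "of_nat m"] y_def[symmetric] by (simp add: power_mult_distrib)
    finally show ?thesis unfolding poly_dpoly_real[OF m] .
   qed
   have "cmod (f n w) * X <= exp (1 * real n) * (\<Sum>k\<le>n. fact n / fact (n - k) * ?q (n - k) / (1 / 2) ^ k)"
    unfolding X_def using elim(1) w by blast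
   also have "... <= exp (1 * real n) * (\<Sum>k\<le>n. 2 ^ n * poly (dpoly m n) y)"
    by (intro mult_left_mono sum_mono tm) auto
   also have "... = exp (1 * real n) * 2 ^ n * (real n + 1) * poly (dpoly m n) y" by simp
   also have "... <= exp (1 * real n) * exp (1 * real n) * exp (1 * real n) * (X * B ^ n)"
   proof (intro mult_mono qn)
    have "(2::real) <= exp 1" using exp_ge_add_one_self[of 1] by simp
    then have "2 ^ n <= exp (1::real) ^ n" by (rule power_mono) simp
    then show "(2::real) ^ n <= exp (1 * real n)" by (simp add: exp_of_nat_mult[symmetric])
    show "0 <= poly (dpoly m n) y" using norm_dpoly_le[OF m, of n "of_nat n * Yv w"] norm_ge_zero unfolding y_def by (rule order.trans[rotated])
   qed (use elim(2) in auto)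
   also have "... = exp (C * real n) * X" unfolding Bn C_def by (simp add: mult_exp_exp algebra_simps)
   finally show ?thesis using X by simp
  qed
  have fc: "f n holomorphic_on cball 0 R"
   by (rule holomorphic_on_subset[OF f_holomorphic]) (use n in auto)
  have ins: "cmod (f n w) <= exp (C * real n)" if "w \<in> cball 0 R" for w
  proof (rule maximum_modulus_frontier[of "f n" "cball 0 R"])
   show "f n holomorphic_on interior (cball 0 R)" by (rule holomorphic_on_subset[OF fc]) (simp add: interior_subset)
   show "continuous_on (closure (cball 0 R)) (f n)" using holomorphic_on_imp_continuous_on[OF fc] by simp
   fix z assume "z \<in> frontier (cball (0::complex) R)"
   then have "z \<in> sphere 0 R" using frontier_cball by blast
   then show "cmod (f n z) <= exp (C * real n)" by (intro sph) simp
  qed (use that in auto)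
  show ?case
  proof (intro ballI conjI)
   fix w :: complex assume "w \<in> ball 0 \<rho>"
   then have w: "cmod w <= R" using R by simp
   then show "cmod (f n w) <= exp (C * real n)" by (intro ins) simp
   show "cmod (p n w) <= exp (C * real n)" using norm_p_le[OF w, of n] BC unfolding B_def by linarith
  qed
 qed
 then show ?thesis using C by blast
qed

end

section \<open>Covering the arms by discs of small total weight\<close>

lemma exists_complex_root:
 fixes z :: complex
 assumes "n >= 1" obtains w where "w ^ n = z"
proof (cases "z = 0")
 case True
 then show ?thesis using that[of 0] assms by (simp add: power_0_left)
next
 case False
 have "exp (Ln z / of_nat n) ^ n = exp (of_nat n * (Ln z / of_nat n))" by (rule exp_of_nat_mult[symmetric])
 also have "... = z" using assms False by simp
 finally show ?thesis by (rule that)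
qed

lemma norm_cis_minus_1: "cmod (cis t - 1) <= \<bar>t\<bar>"
 using iexp_approx1[of t 0] by (simp add: cis_conv_exp)

lemma sin_ge_half: "0 <= x ==> x <= 1 ==> x / 2 <= sin (x::real)"
proof -
 assume x: "0 <= x" "x <= 1"
 have "\<bar>sin x - (\<Sum>m<3. sin_coeff m * x ^ m)\<bar> <= inverse (fact 3) * \<bar>x\<bar> ^ 3" by (rule Maclaurin_sin_bound)
 then have "\<bar>sin x - x\<bar> <= 1 / 6 * x ^ 3" using x by (simp add: eval_nat_numeral sin_coeff_def)
 moreover have "x ^ 3 <= x" using x power_decreasing[of 1 3 x] by simp
 ultimately show ?thesis by linarith
qed

text \<open>|Im \<tau>|/|\<tau>| is the distance of 1 from the real line through 0 and \<tau>.
  Multiplying by the conjugate of \<tau> makes the \<xi>-term real, so it drops out of the imaginary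
  part.\<close>

lemma norm_one_minus_ge:
 assumes "\<bar>Im \<tau>\<bar> >= s * cmod \<tau>" "\<tau> ~= 0" shows "s <= cmod (1 - of_real \<xi> * \<tau>)"
proof -
 have "(1 - of_real \<xi> * \<tau>) * cnj \<tau> = cnj \<tau> - of_real (\<xi> * (cmod \<tau>)\<^sup>2)"
  using complex_norm_square[of \<tau>] by (simp add: algebra_simps)
 then have "Im ((1 - of_real \<xi> * \<tau>) * cnj \<tau>) = - Im \<tau>" by simp
 then have "\<bar>Im \<tau>\<bar> <= cmod ((1 - of_real \<xi> * \<tau>) * cnj \<tau>)" by (metis abs_Im_le_cmod abs_minus_cancel)
 then have "s * cmod \<tau> <= cmod (1 - of_real \<xi> * \<tau>) * cmod \<tau>" using assms(1) by (simp add: norm_mult)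
 then show ?thesis using assms(2) by simp
qed

context essential_function
begin

text \<open>Where \<tau> makes an angle of order 1/N with the real axis, every factor of
  \<open>p n\<close> is at least 1/(4 N), whatever the root.\<close>

lemma p_lower:
 assumes N: "N > 0" and w: "cmod (\<tau> w) < 4 * N * \<bar>Im (\<tau> w)\<bar>"
 shows "exp (- ln (4 * N) * real n) <= cmod (p n w)"
proof -
 have "\<tau> w ~= 0" using w by auto
 moreover have "1 / (4 * N) * cmod (\<tau> w) <= \<bar>Im (\<tau> w)\<bar>" using w N by (simp add: divide_le_eq mult.commute)
 ultimately have L: "1 / (4 * N) <= cmod (1 - of_real \<xi> * \<tau> w)" for \<xi> using norm_one_minus_ge by blast
 have "(\<Prod>j<n. 1 / (4 * N)) <= (\<Prod>j<n. cmod (1 - of_real (droot m n j / real n) * \<tau> w))"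
  by (intro prod_mono conjI L) (use N in simp)
 also have "... = cmod (p n w)" by (simp add: p_def prod_norm)
 finally have "(1 / (4 * N)) ^ n <= cmod (p n w)" by simp
 moreover have "exp (- ln (4 * N) * real n) = (1 / (4 * N)) ^ n"
 proof -
  have "exp (- ln (4 * N) * real n) = exp (- ln (4 * N)) ^ n" by (rule exp_of_nat2_mult)
  then show ?thesis using N by (simp add: exp_minus inverse_eq_divide)
 qed
 ultimately show ?thesis by simp
qed

text \<open>Off \<Omega> the number -w^m / lam m is positive, so w has one of m directions, those of
  the m-th roots of -lam m.\<close>

lemma complement_arms:
 assumes u: "u ^ m = - lam m / of_real (cmod (lam m))" and w: "w \<notin> \<Omega>"
 obtains \<nu> where "\<nu> < m" "w = of_real (cmod w) * (unity_root m \<nu> * u)" "w ~= 0"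
proof -
 have Re: "Im (\<tau> w) = 0" "Re (\<tau> w) > 0" using w Cb_pos less_le_trans[of 0 "1 / Cb" "Re (\<tau> w)"] by (auto simp: \<Omega>_def)
 then have w0: "w ~= 0" using \<tau>_0 by auto
 have \<tau>r: "\<tau> w = of_real (Re (\<tau> w))" using Re(1) by (simp add: complex_eq_iff)
 have "cmod (\<tau> w) = Re (\<tau> w)" using \<tau>r Re(2) by (metis abs_of_pos norm_of_real)
 moreover have "cmod (\<tau> w) = cmod w ^ m / cmod (lam m)" by (simp add: \<tau>_def norm_divide norm_power)
 ultimately have "\<tau> w = of_real (cmod w ^ m / cmod (lam m))" using \<tau>r by simp
 moreover have "w ^ m = - lam m * \<tau> w" using lam by (simp add: \<tau>_def)
 ultimately have "w ^ m = - lam m * of_real (cmod w ^ m / cmod (lam m))" by (simp only:)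
 also have "... = (of_real (cmod w) * u) ^ m" using lam by (simp add: power_mult_distrib u)
 finally have wm: "w ^ m = (of_real (cmod w) * u) ^ m" .
 have u0: "u ~= 0"
 proof
  assume "u = 0"
  then show False using u m lam by (simp add: power_0_left)
 qed
 have "(w / (of_real (cmod w) * u)) ^ m = 1" unfolding power_divide wm using w0 u0 by simp
 then obtain \<nu> where "\<nu> < m" "w / (of_real (cmod w) * u) = unity_root m \<nu>"
  using roots_unity_bij[OF m] unfolding bij_betw_def by (metis (mono_tags, lifting) imageE lessThan_iff mem_Collect_eq)
 then show ?thesis using that[of \<nu>] w0 u0 by (simp add: field_simps)
qed

text \<open>m N discs of radius 2 \<rho>/N along the arms, each with L = ln(4 N), have total weight
  4 m \<rho>^2 (1 + ln(4 N))/N. The logarithmic loss from \<open>p_lower\<close> is beaten by the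
  area.\<close>

lemma thin:
 assumes \<eta>: "\<eta> > 0" and \<rho>: "\<rho> > 0"
 shows "\<exists>(J :: (nat \<times> nat) set) c r L B. finite J \<and>
   (\<forall>j\<in>J. c j \<in> cball 0 \<rho> & 0 < r j & r j <= 1 & 0 <= L j & open (B j) & B j ~= {} & B j <= \<Omega> \<and>
    B j <= ball (c j) (r j) & (\<forall>w\<in>B j. \<forall>n. exp (- L j * real n) <= cmod (p n w))) \<and>
   cball 0 \<rho> - \<Omega> <= (\<Union>j\<in>J. ball (c j) (r j)) & (\<Sum>j\<in>J. (r j)\<^sup>2 * (1 + L j)) <= \<eta>"
proof -
 obtain u where u: "u ^ m = - lam m / of_real (cmod (lam m))" using exists_complex_root[OF m] by blast
 have cu: "cmod u = 1"
 proof -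
  have "cmod u ^ m = 1" using arg_cong[OF u, of cmod] lam by (simp add: norm_power norm_divide)
  then show ?thesis using m power_eq_1_iff[of "cmod u" m] by (metis One_nat_def norm_ge_zero not_one_le_zero power_eq_imp_eq_base power_one zero_less_one le_less_trans not_le gr0I)
 qed
 have "(%N. 4 * real m * \<rho>\<^sup>2 * ((1 + ln (4 * real N)) / real N)) \<longlonglongrightarrow> 4 * real m * \<rho>\<^sup>2 * 0"
  by (intro tendsto_intros) real_asymp
 then have "\<forall>\<^sub>F N in sequentially. 4 * real m * \<rho>\<^sup>2 * ((1 + ln (4 * real N)) / real N) < \<eta>"
  using \<eta> by (intro order_tendstoD) auto
 moreover have "\<forall>\<^sub>F N in sequentially. 2 * \<rho> <= real N"
  using filterlim_real_sequentially by (simp add: filterlim_at_top)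
 moreover have "\<forall>\<^sub>F N in sequentially. N >= (1::nat)" by (rule eventually_ge_at_top)
 ultimately have "\<forall>\<^sub>F N in sequentially. 4 * real m * \<rho>\<^sup>2 * ((1 + ln (4 * real N)) / real N) < \<eta> & 2 * \<rho> <= real N & N >= 1"
  by eventually_elim simp
 then obtain N where N: "4 * real m * \<rho>\<^sup>2 * ((1 + ln (4 * real N)) / real N) < \<eta>" "2 * \<rho> <= real N" "N >= 1"
  unfolding eventually_sequentially by blast
 have Np: "real N > 0" using N by simp
 define J where "J = {1..N} \<times> {..<m}"
 define c where "c j = of_real (real (fst j) / real N * \<rho>) * (unity_root m (snd j) * u)" for j :: "nat \<times> nat"
 define B where "B j = {w \<in> ball (c j) (2 * \<rho> / real N). cmod (\<tau> w) < 4 * real N * \<bar>Im (\<tau> w)\<bar>}" for j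
 have cc: "cmod (c j) = real (fst j) / real N * \<rho>" for j
  unfolding c_def norm_mult norm_of_real using cu \<rho> by simp
 have B\<Omega>: "B j <= \<Omega>" for j
 proof
  fix w assume "w \<in> B j"
  then have "Im (\<tau> w) ~= 0" using norm_ge_zero[of "\<tau> w"] by (auto simp: B_def)
  then show "w \<in> \<Omega>" by (simp add: \<Omega>_def)
 qed
 have Bopen: "open (B j)" for j
 proof -
  have "open ({w. cmod (\<tau> w) < 4 * real N * \<bar>Im (\<tau> w)\<bar>} \<inter> ball (c j) (2 * \<rho> / real N))"
   by (intro open_Int open_Collect_less continuous_intros \<tau>_continuous open_ball)
  also have "{w. cmod (\<tau> w) < 4 * real N * \<bar>Im (\<tau> w)\<bar>} \<inter> ball (c j) (2 * \<rho> / real N) = B j" by (auto simp: B_def)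
  finally show ?thesis .
 qed
 have Bne: "B j ~= {}" if j: "j \<in> J" for j
 proof -
  \<comment> \<open>Turning the centre by 1/(m N) turns \<tau> by 1/N, whose sine is at least 1/(2
    N) and so exceeds 1/(4 N); the point moves by at most \<rho>/N.\<close>
  define t where "t = 1 / (real m * real N)"
  define b where "b = c j * cis t"
  have k: "1 <= fst j" "fst j <= N" "snd j < m" using j by (auto simp: J_def)
  have cj: "0 < cmod (c j)" "cmod (c j) <= \<rho>" unfolding cc using k Np \<rho> by (auto simp: field_simps)
  have t: "0 <= t" "t <= 1 / real N" using m Np by (auto simp: t_def field_simps)
  have "dist (c j) b = cmod (c j) * cmod (cis t - 1)"
   by (simp add: b_def dist_norm norm_minus_commute norm_mult[symmetric] algebra_simps)
  also have "... <= \<rho> * t" using cj norm_cis_minus_1[of t] t \<rho> by (intro mult_mono) auto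
  also have "... <= \<rho> * (1 / real N)" using t \<rho> by (intro mult_left_mono) auto
  also have "... < 2 * \<rho> / real N" using \<rho> Np by (simp add: divide_simps)
  finally have bb: "b \<in> ball (c j) (2 * \<rho> / real N)" by simp
  define X where "X = real (fst j) / real N * \<rho>"
  have X: "X > 0" unfolding X_def using k Np \<rho> by simp
  have cX: "c j = of_real X * (unity_root m (snd j) * u)" unfolding c_def X_def ..
  define T where "T = X ^ m / cmod (lam m)"
  have T: "T > 0" unfolding T_def using X lam by simp
  have "cis t ^ m = cis (1 / real N)" using m Np unfolding Complex.DeMoivre by (simp add: t_def)
  then have "b ^ m = of_real (X ^ m) * (- lam m / of_real (cmod (lam m))) * cis (1 / real N)"
   unfolding b_def cX power_mult_distrib u unity_root_pow[OF m k(3)] by simp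
  then have \<tau>b: "\<tau> b = of_real T * cis (1 / real N)" using lam by (simp add: \<tau>_def T_def)
  have "1 < 4 * real N * sin (1 / real N)"
   using sin_ge_half[of "1 / real N"] N(3) Np by (simp add: field_simps)
  then have "T * 1 < T * (4 * real N * sin (1 / real N))" using T by (rule mult_strict_left_mono)
  moreover have "cmod (\<tau> b) = T" "Im (\<tau> b) = T * sin (1 / real N)" unfolding \<tau>b using T by (auto simp: norm_mult)
  ultimately have "cmod (\<tau> b) < 4 * real N * \<bar>Im (\<tau> b)\<bar>" using abs_ge_self[of "Im (\<tau> b)"] Np
   by (smt (verit) mult.assoc mult.commute mult_left_mono)
  then have "b \<in> B j" using bb by (simp add: B_def)
  then show ?thesis by blast
 qed
 have cover: "cball 0 \<rho> - \<Omega> <= (\<Union>j\<in>J. ball (c j) (2 * \<rho> / real N))"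
 proof
  fix w assume w: "w \<in> cball 0 \<rho> - \<Omega>"
  then obtain \<nu> where \<nu>: "\<nu> < m" "w = of_real (cmod w) * (unity_root m \<nu> * u)" "w ~= 0"
   using complement_arms[OF u] by blast
  \<comment> \<open>Rounding up gives k >= 1, as the index set requires, and puts the centre within
    \<rho>/N of w.\<close>
  define k where "k = nat \<lceil>cmod w * real N / \<rho>\<rceil>"
  have x: "0 < cmod w * real N / \<rho>" "cmod w * real N / \<rho> <= real N" using w \<nu>(3) \<rho> Np by (auto simp: divide_le_eq)
  have k: "k >= 1" "k <= N" "cmod w * real N / \<rho> <= real k" "real k <= cmod w * real N / \<rho> + 1"
   using x unfolding k_def by linarith+
  have "c (k, \<nu>) - w = of_real (real k / real N * \<rho> - cmod w) * (unity_root m \<nu> * u)"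
   using arg_cong[OF \<nu>(2), of "%x. c (k, \<nu>) - x"] by (simp add: c_def algebra_simps)
  then have "cmod (c (k, \<nu>) - w) = cmod (of_real (real k / real N * \<rho> - cmod w) * (unity_root m \<nu> * u))"
   by (rule arg_cong)
  also have "... = \<bar>real k / real N * \<rho> - cmod w\<bar>"
   by (simp only: norm_mult norm_of_real norm_unity_root cu mult_1_left mult_1_right)
  also have "... < 2 * \<rho> / real N"
  proof -
   have "cmod w <= real k / real N * \<rho>" using k(3) \<rho> Np by (simp add: field_simps)
   moreover have "real k / real N * \<rho> <= cmod w + \<rho> / real N" using k(4) \<rho> Np by (simp add: field_simps)
   moreover have "\<rho> / real N < 2 * \<rho> / real N" using \<rho> Np by (simp add: divide_strict_right_mono)
   moreover have "\<bar>X - cmod w\<bar> < q'" if "cmod w <= X" "X <= cmod w + q" "q < q'" for X q q' :: real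
    using that by linarith
   ultimately show ?thesis by blast
  qed
  finally have "w \<in> ball (c (k, \<nu>)) (2 * \<rho> / real N)" by (simp add: dist_norm)
  moreover have "(k, \<nu>) \<in> J" using k \<nu> by (simp add: J_def)
  ultimately show "w \<in> (\<Union>j\<in>J. ball (c j) (2 * \<rho> / real N))" by blast
 qed
 have sum: "(\<Sum>j\<in>J. (2 * \<rho> / real N)\<^sup>2 * (1 + ln (4 * real N))) <= \<eta>"
 proof -
  have "(\<Sum>j\<in>J. (2 * \<rho> / real N)\<^sup>2 * (1 + ln (4 * real N))) = 4 * real m * \<rho>\<^sup>2 * ((1 + ln (4 * real N)) / real N)"
   using Np by (simp add: J_def card_cartesian_product power2_eq_square field_simps)
  then show ?thesis using N(1) by simp
 qed
 have L0: "0 <= ln (4 * real N)" using N(3) by simp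
 have props: "c j \<in> cball 0 \<rho> & 0 < 2 * \<rho> / real N & 2 * \<rho> / real N <= 1 & 0 <= ln (4 * real N) & open (B j) & B j ~= {} & B j <= \<Omega> \<and>
    B j <= ball (c j) (2 * \<rho> / real N) & (\<forall>w\<in>B j. \<forall>n. exp (- ln (4 * real N) * real n) <= cmod (p n w))" if j: "j \<in> J" for j
 proof (intro conjI Bopen B\<Omega> Bne[OF j] L0)
  have "fst j <= N" using j by (auto simp: J_def)
  then show "c j \<in> cball 0 \<rho>" using cc[of j] Np \<rho> by (simp add: divide_le_eq mult.commute mult_right_mono)
  show "B j <= ball (c j) (2 * \<rho> / real N)" by (auto simp: B_def)
  show "\<forall>w\<in>B j. \<forall>n. exp (- ln (4 * real N) * real n) <= cmod (p n w)"
   using p_lower[OF Np] by (auto simp: B_def)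
 qed (use \<rho> Np N(2) in auto)
 show ?thesis
  by (rule exI[of _ J], rule exI[of _ c], rule exI[of _ "%j. 2 * \<rho> / real N"], rule exI[of _ "%j. ln (4 * real N)"], rule exI[of _ B])
   (use props cover sum in \<open>simp add: J_def\<close>)
qed

lemma potential_pair: "potential_pair f p \<Omega>"
 by unfold_locales (use \<Omega>_open \<Omega>_connected \<Omega>_0 f_0 p_0 f_borel p_holomorphic f_hol p_nz crude upper thin in auto)

definition zt :: "complex => nat => nat \<times> nat => complex" where
 "zt \<eta> n i = unity_root m (snd i) * \<eta> * of_real ((droot m n (fst i) / real n) powr (- 1 / real m))"

text \<open>Each factor 1 - x \<tau>(w) equals 1 - (w/s)^m with s^m = -lam m / x and splits over the
  m-th roots of unity, which gives m zeros of \<open>p n\<close> for every root of the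
  polynomial.\<close>

lemma zero_pair:
 assumes \<eta>: "\<eta> ^ m = - lam m"
 shows "zero_pair f p \<Omega> (%n. {..<n} \<times> {..<m}) (zt \<eta>) m"
proof -
 have \<eta>0: "\<eta> ~= 0" using \<eta> lam m by (auto simp: power_0_left)
 have pp: "p n w = (\<Prod>i\<in>{..<n} \<times> {..<m}. 1 - w / zt \<eta> n i)" for n w
 proof -
  have "(\<Prod>\<nu><m. 1 - w / zt \<eta> n (j, \<nu>)) = 1 - of_real (droot m n j / real n) * \<tau> w" if j: "j < n" for j
  proof -
   define x where "x = droot m n j / real n"
   have x: "x > 0" unfolding x_def by (rule droot_quot[OF j])
   define s where "s = \<eta> * of_real (x powr (- 1 / real m))"
   have "(x powr (- 1 / real m)) ^ m = x powr (- 1)" using x m by (simp add: powr_realpow[symmetric] powr_powr)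
   then have "(x powr (- 1 / real m)) ^ m = 1 / x" using x by (simp add: powr_minus_divide)
   then have sm: "s ^ m = - lam m / of_real x" unfolding s_def power_mult_distrib \<eta> by (metis of_real_power of_real_divide of_real_1 times_divide_eq_right mult.right_neutral)
   have "(\<Prod>\<nu><m. 1 - w / zt \<eta> n (j, \<nu>)) = (\<Prod>\<nu><m. 1 - (w / s) / unity_root m \<nu>)"
    by (simp add: zt_def s_def x_def mult_ac)
   also have "... = 1 - (w / s) ^ m" by (rule prod_roots_unity[OF m])
   also have "(w / s) ^ m = of_real x * \<tau> w" unfolding power_divide sm \<tau>_def using lam x by (simp add: field_simps)
   finally show ?thesis unfolding x_def .
  qed
  then have "p n w = (\<Prod>j<n. \<Prod>\<nu><m. 1 - w / zt \<eta> n (j, \<nu>))" unfolding p_def by simp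
  then show ?thesis by (simp add: prod.cartesian_product)
 qed
 interpret potential_pair f p \<Omega> by (rule potential_pair)
 show ?thesis
 proof unfold_locales
  show "zt \<eta> n i ~= 0" if i: "i \<in> {..<n} \<times> {..<m}" for n i
  proof -
   have "droot m n (fst i) / real n > 0" using i by (intro droot_quot) auto
   then have "droot m n (fst i) / real n ~= 0" by (rule less_imp_neq[symmetric])
   then show ?thesis using \<eta>0 by (auto simp: zt_def)
  qed
 qed (auto simp: pp card_cartesian_product)
qed

end

subsection \<open>Measures on the sphere\<close>

lemma topspace_sphere: "topspace riemann_sphere = UNIV"
 by (simp add: UNIV_option_conv)

lemma space_borel_sphere: "space borel_sphere = UNIV"
 unfolding borel_sphere_def topspace_sphere by simp

lemma openin_sets_borel_sphere: "openin riemann_sphere V ==> V \<in> sets borel_sphere"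
 unfolding borel_sphere_def topspace_sphere by (simp add: sets_measure_of)

lemma Some_measurable: "Some \<in> borel \<rightarrow>\<^sub>M borel_sphere"
 unfolding borel_sphere_def topspace_sphere
proof (rule measurable_measure_of)
 fix V :: "complex option set" assume "V \<in> {V. openin riemann_sphere V}"
 then have "openin euclidean {x \<in> topspace euclidean. Some x \<in> V}"
  by (intro openin_continuous_map_preimage[OF continuous_map_Some]) simp
 moreover have "{x \<in> topspace euclidean. Some x \<in> V} = Some -` V \<inter> space borel" by auto
 ultimately show "Some -` V \<inter> space borel \<in> sets borel" by (metis borel_open open_openin)
qed auto

lemma Some_image_sets: "open V ==> Some ` V \<in> sets borel_sphere"
 by (intro openin_sets_borel_sphere) simp

lemma None_sets: "{None} \<in> sets borel_sphere"
proof -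
 have "space borel_sphere - Some ` UNIV \<in> sets borel_sphere" by (intro sets.compl_sets Some_image_sets) simp
 also have "space borel_sphere - Some ` UNIV = {None}" by (auto simp: space_borel_sphere image_iff)
 finally show ?thesis .
qed

lemma the_measurable: "the \<in> borel_measurable borel_sphere"
proof (rule borel_measurableI)
 fix V :: "complex set" assume V: "open V"
 \<comment> \<open>\<open>the None\<close> is an unspecified number, so None may or may not belong
   to the preimage.\<close>
 have "the -` V \<inter> space borel_sphere = Some ` V \<union> (if the None \<in> V then {None} else {})"
  by (auto simp: space_borel_sphere image_iff split: if_splits) (metis option.collapse option.sel)+
 moreover have "Some ` V \<union> (if the None \<in> V then {None} else {}) \<in> sets borel_sphere"
  by (intro sets.Un Some_image_sets V) (use None_sets in auto)
 ultimately show "the -` V \<inter> space borel_sphere \<in> sets borel_sphere" by (simp only:)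
qed

lemma case_measurable:
 fixes h :: "complex => 'b::real_normed_vector"
 assumes "h \<in> borel_measurable borel"
 shows "(%p. if p = None then c else h (the p)) \<in> borel_measurable borel_sphere"
proof (rule measurable_If)
 show "(%p. h (the p)) \<in> borel_measurable borel_sphere" by (rule measurable_compose[OF the_measurable assms])
 have "{p \<in> space borel_sphere. p = None} = {None}" by (auto simp: space_borel_sphere)
 then show "{p \<in> space borel_sphere. p = None} \<in> sets borel_sphere" using None_sets by simp
qed simp

lemma mu_prob:
 assumes "m >= 1"
 shows "prob_space (mu m)" "sets (mu m) = sets (restrict_space borel {0..c_edge m})"
proof -
 obtain M where "limit_distribution M m" using limit_distribution_exists[OF assms] by blast
 then interpret limit_distribution M m .
 show "prob_space (mu m)" unfolding mu_eq by (rule restrict_prob)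
 show "sets (mu m) = sets (restrict_space borel {0..c_edge m})" unfolding mu_eq by (intro restrict_space_sets_cong) auto
qed

lemma root_map_measurable:
 assumes "m >= 1" shows "root_map m \<eta> \<nu> \<in> mu m \<rightarrow>\<^sub>M borel_sphere"
proof -
 have "root_map m \<eta> \<nu> \<in> borel \<rightarrow>\<^sub>M borel_sphere"
  unfolding root_map_def[abs_def]
 proof (rule measurable_If)
  have "(%x. exp (2 * of_real pi * \<i> * of_nat \<nu> / of_nat m) * \<eta> * of_real (x powr (- 1 / real m))) \<in> borel_measurable borel"
   by measurable
  then show "(%x. Some (exp (2 * of_real pi * \<i> * of_nat \<nu> / of_nat m) * \<eta> * of_real (x powr (- 1 / real m)))) \<in> borel \<rightarrow>\<^sub>M borel_sphere"
   by (rule measurable_compose[OF _ Some_measurable])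
 qed (auto simp: space_borel_sphere)
 then have "root_map m \<eta> \<nu> \<in> restrict_space borel {0..c_edge m} \<rightarrow>\<^sub>M borel_sphere" by (rule measurable_restrict_space1)
 then show ?thesis using measurable_cong_sets[OF mu_prob(2)[OF assms] refl] by blast
qed

context
 fixes m :: nat and l :: complex
 assumes m: "m >= 1"
begin

abbreviation prodm where "prodm \<equiv> uniform_count_measure {..<m} \<Otimes>\<^sub>M mu m"
abbreviation some_root where "some_root \<equiv> (SOME \<eta>. \<eta> ^ m = - l)"

lemma pair_root_measurable: "(%(\<nu>, x). root_map m some_root \<nu> x) \<in> prodm \<rightarrow>\<^sub>M borel_sphere"
proof -
 have "(%(\<nu>, x). root_map m some_root \<nu> x) \<in> count_space {..<m} \<Otimes>\<^sub>M mu m \<rightarrow>\<^sub>M borel_sphere"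
  by (rule measurable_pair_measure_countable1) (auto intro: root_map_measurable[OF m])
 then show ?thesis
  using measurable_cong_sets[OF sets_pair_measure_cong[OF sets_uniform_count_measure_count_space refl] refl] by blast
qed

lemma prodm_prob: "prob_space prodm"
proof -
 interpret A: prob_space "uniform_count_measure {..<m}" by (rule prob_space_uniform_count_measure) (use m in \<open>auto simp: lessThan_empty_iff\<close>)
 interpret B: prob_space "mu m" by (rule mu_prob[OF m])
 interpret pair_prob_space "uniform_count_measure {..<m}" "mu m" ..
 show ?thesis by (rule P.prob_space_axioms)
qed

text \<open>The averaged set function is the push-forward of a product with the uniform distribution
  on the m branches. This shows that it really is a measure and gives its integrals by
  Fubini.\<close>

lemma mu_hat_eq: "mu_hat m l = distr prodm borel_sphere (%(\<nu>, x). root_map m some_root \<nu> x)"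
proof -
 let ?D = "distr prodm borel_sphere (%(\<nu>, x). root_map m some_root \<nu> x)"
 interpret B: prob_space "mu m" by (rule mu_prob[OF m])
 have eq: "(\<Sum>\<nu><m. emeasure (distr (mu m) borel_sphere (root_map m some_root \<nu>)) A) / of_nat m = emeasure ?D A"
  if A: "A \<in> sets borel_sphere" for A
 proof -
  let ?X = "(%(\<nu>, x). root_map m some_root \<nu> x) -` A \<inter> space prodm"
  have X: "?X \<in> sets prodm" by (rule measurable_sets[OF pair_root_measurable A])
  have "emeasure ?D A = emeasure prodm ?X" by (rule emeasure_distr[OF pair_root_measurable A])
  also have "... = (\<integral>\<^sup>+\<nu>. emeasure (mu m) (Pair \<nu> -` ?X) \<partial>uniform_count_measure {..<m})"
   by (rule B.emeasure_pair_measure_alt[OF X])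
  also have "... = (\<Sum>\<nu><m. ennreal (1 / real m) * emeasure (mu m) (Pair \<nu> -` ?X))"
   unfolding uniform_count_measure_def by (subst nn_integral_point_measure_finite) auto
  also have "... = (\<Sum>\<nu><m. ennreal (1 / real m) * emeasure (distr (mu m) borel_sphere (root_map m some_root \<nu>)) A)"
  proof (rule sum.cong[OF refl])
   fix \<nu> assume "\<nu> \<in> {..<m}"
   then have "Pair \<nu> -` ?X = root_map m some_root \<nu> -` A \<inter> space (mu m)"
    by (auto simp: space_pair_measure space_uniform_count_measure)
   then show "ennreal (1 / real m) * emeasure (mu m) (Pair \<nu> -` ?X) = ennreal (1 / real m) * emeasure (distr (mu m) borel_sphere (root_map m some_root \<nu>)) A"
    by (simp add: emeasure_distr[OF root_map_measurable[OF m] A])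
  qed
  also have "... = (\<Sum>\<nu><m. emeasure (distr (mu m) borel_sphere (root_map m some_root \<nu>)) A) * ennreal (1 / real m)"
   by (simp add: sum_distrib_left[symmetric] mult.commute)
  also have "ennreal (1 / real m) = inverse (of_nat m)"
   using m by (simp add: inverse_ennreal ennreal_of_nat_eq_real_of_nat inverse_eq_divide)
  finally show ?thesis by (simp add: divide_ennreal_def)
 qed
 have "mu_hat m l = measure_of (space borel_sphere) (sets borel_sphere) (emeasure ?D)"
  unfolding mu_hat_def Let_def
  by (rule measure_of_eq[OF sets.space_closed]) (simp add: eq sets.sigma_sets_eq)
 also have "... = ?D" using measure_of_of_measure[of ?D] by simp
 finally show ?thesis .
qed

lemma mu_hat_prob: "prob_space (mu_hat m l)"
 unfolding mu_hat_eq by (rule prob_space.prob_space_distr[OF prodm_prob pair_root_measurable])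

lemma sets_mu_hat: "sets (mu_hat m l) = sets borel_sphere"
 unfolding mu_hat_eq by simp

lemma integral_mu_hat:
 fixes k :: "complex option => 'b::{banach, second_countable_topology}"
 assumes k: "k \<in> borel_measurable borel_sphere" and B: "!!p. norm (k p) <= B"
 shows "(\<integral>p. k p \<partial>mu_hat m l) = (\<Sum>\<nu><m. \<integral>x. k (root_map m some_root \<nu> x) \<partial>mu m) /\<^sub>R real m"
proof -
 interpret A: prob_space "uniform_count_measure {..<m}" by (rule prob_space_uniform_count_measure) (use m in \<open>auto simp: lessThan_empty_iff\<close>)
 interpret B: prob_space "mu m" by (rule mu_prob[OF m])
 interpret pair_prob_space "uniform_count_measure {..<m}" "mu m" ..
 let ?f = "%z. k ((%(\<nu>, x). root_map m some_root \<nu> x) z)"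
 have int: "integrable prodm ?f"
  by (rule P.integrable_const_bound[of _ B]) (use B measurable_compose[OF pair_root_measurable k] in auto)
 have "(\<integral>p. k p \<partial>mu_hat m l) = (\<integral>z. ?f z \<partial>prodm)"
  unfolding mu_hat_eq by (rule integral_distr[OF pair_root_measurable k])
 also have "... = (\<integral>\<nu>. (\<integral>x. ?f (\<nu>, x) \<partial>mu m) \<partial>uniform_count_measure {..<m})"
  by (rule integral_fst'[OF int, symmetric])
 also have "... = (\<Sum>\<nu><m. (1 / real m) *\<^sub>R (\<integral>x. k (root_map m some_root \<nu> x) \<partial>mu m))"
  unfolding uniform_count_measure_def by (subst lebesgue_integral_point_measure_finite) auto
 finally show ?thesis by (simp add: scaleR_sum_right divide_inverse)
qed

end

subsection \<open>Transfer to the zeros of the derivatives\<close>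

lemma deriv_shift: "deriv (%z. f (a + z)) = (%z. deriv f (a + z))"
proof
 fix z
 have "deriv (%z. f (a + z)) z = deriv ((%z. f (a + z)) \<circ> (%x. z + x)) 0" by (rule deriv_shift_0)
 also have "(%z. f (a + z)) \<circ> (%x. z + x) = f \<circ> (%x. (a + z) + x)" by (auto simp: o_def add.assoc)
 also have "deriv ... 0 = deriv f (a + z)" by (rule deriv_shift_0[symmetric])
 finally show "deriv (%z. f (a + z)) z = deriv f (a + z)" .
qed

lemma higher_deriv_shift: "(deriv ^^ n) (%z. f (a + z)) = (%z. (deriv ^^ n) f (a + z))"
 by (induction n) (auto simp: deriv_shift)

context essential_function
begin

text \<open>The same choice term as in \<open>mu_hat\<close>, so the branches match without an
  appeal to independence of the choice.\<close>

definition rt :: complex where "rt = (SOME \<eta>. \<eta> ^ m = - lam m)"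

lemma rt_pow: "rt ^ m = - lam m"
 unfolding rt_def using exists_complex_root[OF m, of "- lam m"] by (metis (mono_tags, lifting) someI_ex)

lemma rt_nz: "rt ~= 0" using rt_pow lam m by (auto simp: power_0_left)

definition Zs :: "real => nat => complex set" where "Zs R n = {w \<in> ball 0 R. f n w = 0}"

definition mlt :: "nat => complex => real" where "mlt n w = real (nat (zorder (f n) w))"

lemmas zp = zero_pair[OF rt_pow]

lemma zero_sums:
 fixes \<psi> :: "complex => real"
 assumes "R > 0" "continuous_on UNIV \<psi>" "\<forall>b. b \<notin> ball 0 R --> \<psi> b = 0" "e > 0"
 shows "\<forall>\<^sub>F n in sequentially. \<bar>(\<Sum>w\<in>Zs R n. mlt n w * \<psi> w) - (\<Sum>i\<in>{..<n} \<times> {..<m}. \<psi> (zt rt n i))\<bar> <= e * real n"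
 using zero_pair.zero_sums_compare[OF zp assms(1,2) _ assms(4)] assms(3)
 unfolding zero_pair.Zf_def[OF zp] zero_pair.mult_def[OF zp] Zs_def mlt_def by blast

lemma Zs_finite:
 assumes "n > 0" "R < r * sc n"
 shows "finite (Zs R n)" "!!w. w \<in> Zs R n ==> zorder (f n) w > 0"
proof -
 have s: "r * sc n > 0" using r sc_pos assms(1) by simp
 have nz: "\<exists>w\<in>ball 0 (r * sc n). f n w ~= 0" using f_0[of n] s by (intro bexI[of _ 0]) auto
 obtain k where "finite {w \<in> ball 0 R. f n w = 0}" "!!w. w \<in> {w \<in> ball 0 R. f n w = 0} ==> zorder (f n) w > 0"
  using holomorphic_zero_factorization[OF f_holomorphic[OF assms(1)] nz assms(2)] by metis
 then show "finite (Zs R n)" "!!w. w \<in> Zs R n ==> zorder (f n) w > 0" unfolding Zs_def by auto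
qed

lemma Zs_mono: "R <= R' ==> Zs R n <= Zs R' n" by (auto simp: Zs_def)

lemma mlt_nonneg: "mlt n w >= 0" by (simp add: mlt_def)

context
 fixes F :: "complex => complex" and a :: complex and r1 :: real
 assumes F: "\<forall>z. z ~= 0 --> cmod z < r1 --> F (a + z) = G z" and r1: "r1 < r"
begin

lemma ball_r1: "ball 0 r1 <= U"
 by (rule order.trans[OF subset_ball ball_U]) (use r1 in simp)

lemma higher_deriv_F:
 assumes z: "z ~= 0" "cmod z < r1" and n: "n > 0"
 shows "(deriv ^^ n) F (a + z) = G z / z ^ (n * (m + 1)) * (- of_nat m * lam m) ^ n * f n (of_real (sc n) * z)"
proof -
 have s: "sc n > 0" by (rule sc_pos[OF n])
 have S: "open (ball 0 r1 - {0::complex})" "z \<in> ball 0 r1 - {0}" "ball 0 r1 - {0} <= U" using z ball_r1 by auto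
 have Ghol: "G holomorphic_on ball 0 r1 - {0}"
  unfolding holomorphic_on_open[OF S(1)] using G_deriv S(3) by blast
 have Fhol: "(%z. F (a + z)) holomorphic_on ball 0 r1 - {0}"
  by (rule holomorphic_transform[OF Ghol]) (use F in auto)
 have "(deriv ^^ n) F (a + z) = (deriv ^^ n) (%z. F (a + z)) z" by (simp add: higher_deriv_shift)
 also have "... = (deriv ^^ n) G z"
  by (rule higher_deriv_transform_within_open[OF Fhol Ghol S(1,2)]) (use F in auto)
 also have "... = G z * Qp n z / z ^ (n * (m + 1))" by (rule higher_deriv_G) (use z r1 in auto)
 also have "Qp n z = (- of_nat m * lam m) ^ n * f n (of_real (sc n) * z)"
 proof -
  have "cmod (of_real (sc n) * z) < r * sc n" using z r1 s by (simp add: norm_mult mult.commute)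
  then show ?thesis using n s m lam by (simp add: f_def)
 qed
 finally show ?thesis by (simp add: mult_ac)
qed

text \<open>On the punctured disc the n-th derivative of F is a zero-free holomorphic factor times
  \<open>f n\<close> after rescaling, so zeros and orders correspond. The puncture loses nothing
  because f n 0 = 1.\<close>

lemma zeros_transfer:
 assumes n: "n > 0" and \<rho>: "\<rho> <= r1"
 shows "bij_betw (%w. a + w / of_real (sc n)) (Zs (\<rho> * sc n) n) (deriv_zeros F a n \<rho>)"
  and "!!w. w \<in> Zs (\<rho> * sc n) n ==> zorder ((deriv ^^ n) F) (a + w / of_real (sc n)) = zorder (f n) w"
  and "!!w. rescale m a n (a + w / of_real (sc n)) = w"
  and "finite (Zs (\<rho> * sc n) n)"
  and "!!w. w \<in> Zs (\<rho> * sc n) n ==> zorder (f n) w > 0"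
proof -
 have s: "sc n > 0" by (rule sc_pos[OF n])
 \<comment> \<open>The gap between r1 and r makes the rescaled disc relatively compact in the domain
   of \<open>f n\<close>, whence finitely many zeros.\<close>
 have rs: "\<rho> * sc n < r * sc n" using \<rho> r1 s by simp
 show fin: "finite (Zs (\<rho> * sc n) n)" and zpos: "!!w. w \<in> Zs (\<rho> * sc n) n ==> zorder (f n) w > 0"
  using Zs_finite[OF n rs] by auto
 show "!!w. rescale m a n (a + w / of_real (sc n)) = w"
  using s by (simp add: rescale_def sc_def)
 define g where "g z = G z / z ^ (n * (m + 1)) * (- of_nat m * lam m) ^ n" for z
 have gnz: "g z ~= 0" if "z ~= 0" "cmod z < r1" for z
  unfolding g_def using G_nz[of z] that subsetD[OF ball_r1, of z] m lam by auto
 have FD: "(deriv ^^ n) F (a + z) = g z * f n (of_real (sc n) * z)" if "z ~= 0" "cmod z < r1" for z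
  unfolding g_def by (rule higher_deriv_F[OF that n])
 show "bij_betw (%w. a + w / of_real (sc n)) (Zs (\<rho> * sc n) n) (deriv_zeros F a n \<rho>)"
  unfolding bij_betw_def
 proof
  show "inj_on (%w. a + w / of_real (sc n)) (Zs (\<rho> * sc n) n)" using s by (auto simp: inj_on_def)
  show "(%w. a + w / of_real (sc n)) ` Zs (\<rho> * sc n) n = deriv_zeros F a n \<rho>"
  proof (intro equalityI subsetI)
   fix \<zeta> assume "\<zeta> \<in> (%w. a + w / of_real (sc n)) ` Zs (\<rho> * sc n) n"
   then obtain w where w: "w \<in> Zs (\<rho> * sc n) n" "\<zeta> = a + w / of_real (sc n)" by auto
   have fw: "f n w = 0" "cmod w < \<rho> * sc n" using w by (auto simp: Zs_def)
   then have w0: "w ~= 0" using f_0[of n] by auto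
   have cz: "w / of_real (sc n) ~= 0" "cmod (w / of_real (sc n)) < \<rho>" using w0 s fw by (auto simp: norm_divide divide_less_eq)
   have "(deriv ^^ n) F \<zeta> = 0" unfolding w(2) using FD[OF cz(1)] cz(2) \<rho> s fw by simp
   then show "\<zeta> \<in> deriv_zeros F a n \<rho>" using cz unfolding deriv_zeros_def w(2) by simp
  next
   fix \<zeta> assume "\<zeta> \<in> deriv_zeros F a n \<rho>"
   then have z: "(deriv ^^ n) F (a + (\<zeta> - a)) = 0" "\<zeta> - a ~= 0" "cmod (\<zeta> - a) < \<rho>" by (auto simp: deriv_zeros_def)
   have "f n (of_real (sc n) * (\<zeta> - a)) = 0" using FD[OF z(2)] gnz[OF z(2)] z \<rho> by simp
   then have "of_real (sc n) * (\<zeta> - a) \<in> Zs (\<rho> * sc n) n" using z(3) s by (simp add: Zs_def norm_mult mult.commute)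
   moreover have "\<zeta> = a + of_real (sc n) * (\<zeta> - a) / of_real (sc n)" using s by simp
   ultimately show "\<zeta> \<in> (%w. a + w / of_real (sc n)) ` Zs (\<rho> * sc n) n" by blast
  qed
 qed
 fix w0 assume w0Z: "w0 \<in> Zs (\<rho> * sc n) n"
 have w0: "f n w0 = 0" "cmod w0 < \<rho> * sc n" "w0 ~= 0" using w0Z f_0[of n] by (auto simp: Zs_def)
 define k where "k = zorder (f n) w0"
 have k: "k > 0" unfolding k_def by (rule zpos[OF w0Z])
 have "\<exists>w\<in>ball 0 (r * sc n). f n w ~= 0" using f_0[of n] s r by (intro bexI[of _ 0]) auto
 from zorder_exist_zero[OF f_holomorphic[OF n] open_ball connected_ball _ this, of w0]
 obtain e h where e: "e > 0" "h holomorphic_on cball w0 e" "!!w. w \<in> cball w0 e ==> f n w = h w * (w - w0) ^ nat k & h w ~= 0"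
  using w0 rs unfolding k_def by auto
 \<comment> \<open>The inverse rescaling; the local factorisation of \<open>f n\<close> at w0 is
   pulled back along it to the disc around a.\<close>
 define L where "L \<zeta> = of_real (sc n) * (\<zeta> - a)" for \<zeta>
 define S where "S = L -` (ball w0 e \<inter> (ball 0 (\<rho> * sc n) - {0}))"
 have Lc: "L holomorphic_on A" for A unfolding L_def[abs_def] by (intro holomorphic_intros)
 have S: "open S" unfolding S_def
  by (rule open_vimage) (use holomorphic_on_imp_continuous_on[OF Lc] in auto)
 let ?\<zeta> = "a + w0 / of_real (sc n)"
 have L0: "L ?\<zeta> = w0" using s by (simp add: L_def)
 have inS: "?\<zeta> \<in> S" unfolding S_def using L0 e w0 by simp
 have Lz: "\<zeta> - a ~= 0" "cmod (\<zeta> - a) < r1" if "\<zeta> \<in> S" for \<zeta>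
 proof -
  have "L \<zeta> ~= 0" "cmod (L \<zeta>) < \<rho> * sc n" using that by (auto simp: S_def)
  then have "\<zeta> - a ~= 0" "cmod (\<zeta> - a) < \<rho>" using s by (auto simp: L_def norm_mult mult.commute)
  then show "\<zeta> - a ~= 0" "cmod (\<zeta> - a) < r1" using \<rho> by auto
 qed
 have "zorder ((deriv ^^ n) F) ?\<zeta> = k"
 proof (rule zorder_eqI[OF S inS, of "%\<zeta>. g (\<zeta> - a) * h (L \<zeta>) * of_real (sc n) ^ nat k"])
  have "G holomorphic_on ball 0 r1 - {0}"
  proof -
   have o: "open (ball 0 r1 - {0::complex})" by auto
   have "ball 0 r1 - {0} <= U" using ball_r1 by auto
   then show ?thesis unfolding holomorphic_on_open[OF o] using G_deriv by blast
  qed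
  then have g: "g holomorphic_on ball 0 r1 - {0}" unfolding g_def[abs_def] by (intro holomorphic_intros) auto
  have sub1: "(%\<zeta>. \<zeta> - a) ` S <= ball 0 r1 - {0}" using Lz by auto
  have "(%\<zeta>. g (\<zeta> - a)) holomorphic_on S"
   using holomorphic_on_compose[OF _ holomorphic_on_subset[OF g sub1]] by (simp add: o_def holomorphic_intros)
  moreover have sub2: "L ` S <= cball w0 e" by (auto simp: S_def)
  have "(%\<zeta>. h (L \<zeta>)) holomorphic_on S"
   using holomorphic_on_compose[OF Lc holomorphic_on_subset[OF e(2) sub2]] by (simp add: o_def)
  ultimately show "(%\<zeta>. g (\<zeta> - a) * h (L \<zeta>) * of_real (sc n) ^ nat k) holomorphic_on S"
   by (intro holomorphic_intros)
  show "g (?\<zeta> - a) * h (L ?\<zeta>) * of_real (sc n) ^ nat k ~= 0"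
   using gnz[OF Lz[OF inS]] e(1) e(3)[of w0] s unfolding L0 by simp
  fix \<zeta> assume \<zeta>: "\<zeta> \<in> S" "\<zeta> ~= ?\<zeta>"
  have LS: "L \<zeta> \<in> cball w0 e" using \<zeta> by (auto simp: S_def)
  have "(deriv ^^ n) F \<zeta> = (deriv ^^ n) F (a + (\<zeta> - a))" by simp
  also have "... = g (\<zeta> - a) * f n (L \<zeta>)" unfolding L_def by (rule FD[OF Lz[OF \<zeta>(1)]])
  also have "f n (L \<zeta>) = h (L \<zeta>) * (L \<zeta> - w0) ^ nat k" using e(3)[OF LS] by simp
  also have "L \<zeta> - w0 = of_real (sc n) * (\<zeta> - ?\<zeta>)" using s by (simp add: L_def algebra_simps)
  finally show "(deriv ^^ n) F \<zeta> = g (\<zeta> - a) * h (L \<zeta>) * of_real (sc n) ^ nat k * (\<zeta> - ?\<zeta>) powi k"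
   using k by (simp add: power_mult_distrib power_int_def mult_ac)
 qed
 then show "zorder ((deriv ^^ n) F) ?\<zeta> = zorder (f n) w0" unfolding k_def .
qed

lemma deriv_zeros_props:
 assumes n: "n > 0" and \<rho>: "\<rho> <= r1"
 shows "finite (deriv_zeros F a n \<rho>)" "!!\<zeta>. \<zeta> \<in> deriv_zeros F a n \<rho> ==> zorder ((deriv ^^ n) F) \<zeta> > 0"
proof -
 note T = zeros_transfer[OF n \<rho>]
 show "finite (deriv_zeros F a n \<rho>)" using bij_betw_finite[OF T(1)] T(4) by simp
 fix \<zeta> assume "\<zeta> \<in> deriv_zeros F a n \<rho>"
 then obtain w where "w \<in> Zs (\<rho> * sc n) n" "\<zeta> = a + w / of_real (sc n)" using T(1) unfolding bij_betw_def by blast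
 then show "zorder ((deriv ^^ n) F) \<zeta> > 0" using T(2,5) by simp
qed

lemma sum_transfer:
 fixes h :: "complex => complex"
 assumes n: "n > 0" and \<rho>: "\<rho> <= r1"
 shows "(\<Sum>\<zeta>\<in>deriv_zeros F a n \<rho>. of_int (zorder ((deriv ^^ n) F) \<zeta>) * h (rescale m a n \<zeta>)) = (\<Sum>w\<in>Zs (\<rho> * sc n) n. of_real (mlt n w) * h w)"
proof -
 note T = zeros_transfer[OF n \<rho>]
 have "(\<Sum>\<zeta>\<in>deriv_zeros F a n \<rho>. of_int (zorder ((deriv ^^ n) F) \<zeta>) * h (rescale m a n \<zeta>)) =
  (\<Sum>w\<in>Zs (\<rho> * sc n) n. of_int (zorder ((deriv ^^ n) F) (a + w / of_real (sc n))) * h (rescale m a n (a + w / of_real (sc n))))"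
  by (rule sum.reindex_bij_betw[OF T(1), symmetric])
 also have "... = (\<Sum>w\<in>Zs (\<rho> * sc n) n. of_real (mlt n w) * h w)"
 proof (rule sum.cong[OF refl])
  fix w assume w: "w \<in> Zs (\<rho> * sc n) n"
  have "of_int (zorder (f n) w) = complex_of_real (mlt n w)" using T(5)[OF w] by (simp add: mlt_def)
  then show "of_int (zorder ((deriv ^^ n) F) (a + w / of_real (sc n))) * h (rescale m a n (a + w / of_real (sc n))) = of_real (mlt n w) * h w"
   unfolding T(2)[OF w] T(3) by simp
 qed
 finally show ?thesis .
qed

lemma zero_sum_eq:
 assumes "n > 0" "\<rho> <= r1"
 shows "zero_sum m F a h n \<rho> = (\<Sum>w\<in>Zs (\<rho> * sc n) n. of_real (mlt n w) * h w) / of_nat (m * n)"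
 unfolding zero_sum_def sum_transfer[OF assms] by simp

lemma zero_mass_eq:
 assumes "n > 0" "\<rho> <= r1"
 shows "zero_mass m F a n \<rho> = (\<Sum>w\<in>Zs (\<rho> * sc n) n. mlt n w) / real (m * n)"
proof -
 have "complex_of_real (zero_mass m F a n \<rho>) = zero_sum m F a (%_. 1) n \<rho>"
  unfolding zero_mass_def zero_sum_def by simp
 also have "... = complex_of_real ((\<Sum>w\<in>Zs (\<rho> * sc n) n. mlt n w) / real (m * n))"
  unfolding zero_sum_eq[OF assms] by simp
 finally show ?thesis using of_real_eq_iff by blast
qed

lemma zero_measure_integral:
 fixes k :: "complex option => complex"
 assumes n: "n > 0" and \<rho>: "\<rho> <= r1" and k: "k \<in> borel_measurable borel_sphere"
 shows "(\<integral>p. k p \<partial>zero_measure m F a n \<rho>) = zero_sum m F a (%w. k (Some w)) n \<rho>"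
proof -
 let ?Z = "deriv_zeros F a n \<rho>" and ?d = "%\<zeta>. of_int (zorder ((deriv ^^ n) F) \<zeta>) / real (m * n)"
 note P = deriv_zeros_props[OF n \<rho>]
 have m0: "(%\<zeta>. Some (rescale m a n \<zeta>)) \<in> density (count_space ?Z) (%\<zeta>. ennreal (?d \<zeta>)) \<rightarrow>\<^sub>M borel_sphere"
  by (auto simp: space_borel_sphere)
 have "(\<integral>p. k p \<partial>zero_measure m F a n \<rho>) = (\<integral>\<zeta>. k (Some (rescale m a n \<zeta>)) \<partial>density (count_space ?Z) (%\<zeta>. ennreal (?d \<zeta>)))"
  unfolding zero_measure_def by (rule integral_distr[OF m0 k])
 also have "... = (\<integral>\<zeta>. ?d \<zeta> *\<^sub>R k (Some (rescale m a n \<zeta>)) \<partial>count_space ?Z)"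
  by (rule integral_density) (use P in \<open>auto simp: AE_count_space less_imp_le\<close>)
 also have "... = (\<Sum>\<zeta>\<in>?Z. ?d \<zeta> *\<^sub>R k (Some (rescale m a n \<zeta>)))"
  by (rule lebesgue_integral_count_space_finite[OF P(1)])
 also have "... = zero_sum m F a (%w. k (Some w)) n \<rho>"
  unfolding zero_sum_def sum_distrib_left by (rule sum.cong) (auto simp: scaleR_conv_of_real)
 finally show ?thesis .
qed

end

end

subsection \<open>Riemann sums over the rescaled roots\<close>

text \<open>Open neighbourhoods of None are complements of compact sets, so continuity there is
  uniform convergence at infinity. Boundedness and measurability follow by treating the finite
  points and None separately.\<close>

lemma sphere_function:
 fixes f :: "complex option => complex"
 assumes f: "continuous_map riemann_sphere euclidean f"
 shows "continuous_on UNIV (%w. f (Some w))"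
  and "!!e. e > 0 ==> \<exists>R>0. \<forall>w. cmod w >= R --> cmod (f (Some w) - f None) < e"
  and "f \<in> borel_measurable borel_sphere" and "\<exists>B. \<forall>p. cmod (f p) <= B"
proof -
 have "continuous_map euclidean euclidean (f \<circ> Some)" by (rule continuous_map_compose[OF continuous_map_Some f])
 then show cont: "continuous_on UNIV (%w. f (Some w))" by (simp add: o_def)
 show inf: "\<exists>R>0. \<forall>w. cmod w >= R --> cmod (f (Some w) - f None) < e" if e: "e > 0" for e
 proof -
  have "openin riemann_sphere {p \<in> topspace riemann_sphere. f p \<in> ball (f None) e}"
   by (rule openin_continuous_map_preimage[OF f]) simp
  then have op: "openin riemann_sphere {p. f p \<in> ball (f None) e}" unfolding topspace_sphere by simp
  have N: "None \<in> {p. f p \<in> ball (f None) e}" using e by simp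
  from op[unfolded openin_Alexandroff_compactification] obtain C where
   C: "compactin euclidean C" "{p. f p \<in> ball (f None) e} = insert None (Some ` (topspace euclidean - C))"
   using N by auto
  then have "bounded C" by (simp add: compact_imp_bounded)
  then obtain R where R: "R > 0" "!!w. w \<in> C ==> cmod w <= R" unfolding bounded_pos by blast
  have "cmod (f (Some w) - f None) < e" if "cmod w >= R + 1" for w
  proof -
   have "w \<notin> C" using R(2)[of w] that by auto
   then have "Some w \<in> {p. f p \<in> ball (f None) e}" unfolding C(2) by simp
   then show ?thesis by (simp add: dist_norm norm_minus_commute)
  qed
  then show ?thesis using R(1) by (intro exI[of _ "R + 1"]) auto
 qed
 have "(%p. if p = None then f None else f (Some (the p))) \<in> borel_measurable borel_sphere"
  by (rule case_measurable[OF borel_measurable_continuous_onI[OF cont]])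
 also have "(%p. if p = None then f None else f (Some (the p))) = f" by (auto simp: fun_eq_iff)
 finally show "f \<in> borel_measurable borel_sphere" .
 obtain R where R: "!!w. cmod w >= R ==> cmod (f (Some w) - f None) < 1" using inf[of 1] by auto
 have "compact ((%w. f (Some w)) ` cball 0 R)"
  by (intro compact_continuous_image continuous_on_subset[OF cont]) auto
 then have "bounded ((%w. f (Some w)) ` cball 0 R)" by (rule compact_imp_bounded)
 then obtain B where "\<forall>w\<in>cball 0 R. cmod (f (Some w)) <= B" unfolding bounded_iff by auto
 then have B: "!!w. w \<in> cball 0 R ==> cmod (f (Some w)) <= B" by blast
 have "cmod (f p) <= max B (cmod (f None) + 1)" for p
 proof (cases p)
  case (Some w)
  show ?thesis
  proof (cases "cmod w <= R")
   case True
   then show ?thesis using B[of w] Some by (simp add: le_max_iff_disj)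
  next
   case False
   then have "cmod (f (Some w)) <= cmod (f None) + 1" using R[of w] norm_triangle_sub[of "f (Some w)" "f None"] by simp
   then show ?thesis using Some by (simp add: le_max_iff_disj)
  qed
 qed (simp add: le_max_iff_disj)
 then show "\<exists>B. \<forall>p. cmod (f p) <= B" by blast
qed

lemma compact_support_bounded:
 fixes \<psi> :: "complex => 'b::real_normed_vector"
 assumes "continuous_on UNIV \<psi>" "\<forall>b. b \<notin> ball 0 R --> \<psi> b = 0"
 obtains D where "D >= 0" "!!b. norm (\<psi> b) <= D"
proof -
 have "compact (\<psi> ` cball 0 R)" by (intro compact_continuous_image continuous_on_subset[OF assms(1)]) auto
 then have "bounded (\<psi> ` cball 0 R)" by (rule compact_imp_bounded)
 then obtain D where "\<forall>b\<in>cball 0 R. norm (\<psi> b) <= D" unfolding bounded_iff by auto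
 then have D: "!!b. b \<in> cball 0 R ==> norm (\<psi> b) <= D" by blast
 have "norm (\<psi> b) <= max D 0" for b
  using D[of b] assms(2) by (cases "b \<in> ball 0 R") auto
 then show ?thesis using that[of "max D 0"] by simp
qed

abbreviation ext0 :: "(complex => 'b::zero) => complex option => 'b" where
 "ext0 \<psi> p \<equiv> (if p = None then 0 else \<psi> (the p))"

context essential_function
begin

text \<open>The test function pulled back along a branch of \<open>root_map\<close> and extended by
  0 to the whole line; the sums over the roots of \<open>p n\<close> and the integral under
  \<open>mu_hat\<close> are both expressed through it.\<close>

definition gfun :: "(complex => real) => nat => real => real" where
 "gfun \<psi> \<nu> x = (if x <= 0 then 0 else \<psi> (unity_root m \<nu> * rt * of_real (x powr (- 1 / real m))))"

lemma gfun_continuous: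
 assumes R: "R > 0" and \<psi>: "continuous_on UNIV \<psi>" "\<forall>b. b \<notin> ball 0 R --> \<psi> b = 0"
 shows "continuous_on UNIV (gfun \<psi> \<nu>)"
proof -
 \<comment> \<open>For 0 < x < x0 the modulus |rt| x^(-1/m) is at least R, so compact support makes
   the pullback vanish near 0 and joins it continuously to the extension.\<close>
 define x0 where "x0 = (cmod rt / R) ^ m"
 have x0: "x0 > 0" using rt_nz R by (simp add: x0_def)
 have "gfun \<psi> \<nu> x = 0" if x: "x < x0" for x
 proof (cases "x <= 0")
  case False
  have "x0 = (cmod rt / R) powr real m" unfolding x0_def using rt_nz R by (simp add: powr_realpow)
  then have "x0 powr (- 1 / real m) = (cmod rt / R) powr (- 1)" using m by (simp add: powr_powr)
  also have "... = R / cmod rt" using rt_nz R by (simp add: powr_minus_divide)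
  finally have "R / cmod rt <= x powr (- 1 / real m)"
   using powr_mono2'[of "- 1 / real m" x x0] x False by simp
  then have "R <= cmod (unity_root m \<nu> * rt * of_real (x powr (- 1 / real m)))"
   using rt_nz by (simp add: norm_mult divide_le_eq mult.commute)
  then show ?thesis unfolding gfun_def using \<psi>(2) False by simp
 qed (simp add: gfun_def)
 then have c1: "continuous_on {..<x0} (gfun \<psi> \<nu>)" by (subst continuous_on_cong[OF refl, of _ _ "%_. 0"]) auto
 have "continuous_on {0<..} (%x. \<psi> (unity_root m \<nu> * rt * of_real (x powr (- 1 / real m))))"
  by (intro continuous_on_compose2[OF \<psi>(1)] continuous_intros) auto
 then have c2: "continuous_on {0<..} (gfun \<psi> \<nu>)" by (rule continuous_on_eq) (simp add: gfun_def)
 have "continuous_on ({..<x0} \<union> {0<..}) (gfun \<psi> \<nu>)" by (rule continuous_on_open_Un[OF _ _ c1 c2]) auto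
 also have "{..<x0} \<union> {0<..} = (UNIV :: real set)" using x0 by auto
 finally show ?thesis .
qed

lemma riemann_sums:
 assumes R: "R > 0" and \<psi>: "continuous_on UNIV \<psi>" "\<forall>b. b \<notin> ball 0 R --> \<psi> b = (0::real)"
  and M: "limit_distribution M m" "weak_conv_m (emp m) M"
 shows "(%n. (\<Sum>i\<in>{..<n} \<times> {..<m}. \<psi> (zt rt n i)) / real (m * n)) \<longlonglongrightarrow> (\<Sum>\<nu><m. \<integral>x. gfun \<psi> \<nu> x \<partial>M) / real m"
proof -
 interpret limit_distribution M m by (rule M(1))
 note cont = gfun_continuous[OF R \<psi>]
 obtain D where D: "D >= 0" "!!b. norm (\<psi> b) <= D" using compact_support_bounded[OF \<psi>] by blast
 have bd: "\<bar>gfun \<psi> \<nu> x\<bar> <= D" for \<nu> x using D by (auto simp: gfun_def)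
 have wc: "(%n. \<integral>x. gfun \<psi> \<nu> x \<partial>emp m n) \<longlonglongrightarrow> (\<integral>x. gfun \<psi> \<nu> x \<partial>M)" for \<nu>
 proof (rule weak_conv_imp_integral_bdd_continuous_conv[OF _ _ M(2)])
  show "real_distribution (emp m n)" for n
   using emp_compact_distribution[OF m] by (simp add: compact_distribution_def)
  show "real_distribution M" by (rule real_distribution_axioms)
  show "isCont (gfun \<psi> \<nu>) x" for x using cont by (simp add: continuous_on_eq_continuous_at)
  show "norm (gfun \<psi> \<nu> x) <= D" for x using bd by simp
 qed
 have "(\<Sum>i\<in>{..<Suc n} \<times> {..<m}. \<psi> (zt rt (Suc n) i)) / real (m * Suc n) = (\<Sum>\<nu><m. \<integral>x. gfun \<psi> \<nu> x \<partial>emp m n) / real m" for n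
 proof -
  have g: "\<psi> (zt rt (Suc n) (j, \<nu>)) = gfun \<psi> \<nu> (droot m (Suc n) j / real (Suc n))" if "j < Suc n" for j \<nu>
   using droot_quot(1)[OF that] by (simp add: zt_def gfun_def)
  have "(\<Sum>i\<in>{..<Suc n} \<times> {..<m}. \<psi> (zt rt (Suc n) i)) = (\<Sum>j<Suc n. \<Sum>\<nu><m. \<psi> (zt rt (Suc n) (j, \<nu>)))"
   by (simp only: sum.cartesian_product split_def prod.collapse)
  also have "... = (\<Sum>\<nu><m. \<Sum>j<Suc n. gfun \<psi> \<nu> (droot m (Suc n) j / real (Suc n)))"
   by (subst sum.swap) (intro sum.cong refl g, simp)
  finally have 1: "(\<Sum>i\<in>{..<Suc n} \<times> {..<m}. \<psi> (zt rt (Suc n) i)) = (\<Sum>\<nu><m. \<Sum>j<Suc n. gfun \<psi> \<nu> (droot m (Suc n) j / real (Suc n)))" .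
  have 2: "(\<integral>x. gfun \<psi> \<nu> x \<partial>emp m n) = (\<Sum>j<Suc n. gfun \<psi> \<nu> (droot m (Suc n) j / real (Suc n))) / real (Suc n)" for \<nu>
   by (subst integral_emp) (use borel_measurable_continuous_onI[OF cont] in \<open>auto simp: divide_inverse mult.commute simp del: sum.lessThan_Suc\<close>)
  show ?thesis unfolding 1 2 sum_divide_distrib[symmetric] by (simp only: divide_divide_eq_left of_nat_mult mult.commute)
 qed
 moreover have "(%n. (\<Sum>\<nu><m. \<integral>x. gfun \<psi> \<nu> x \<partial>emp m n) / real m) \<longlonglongrightarrow> (\<Sum>\<nu><m. \<integral>x. gfun \<psi> \<nu> x \<partial>M) / real m"
  using m by (intro tendsto_intros wc) auto
 \<comment> \<open>\<open>emp m n\<close> belongs to degree n + 1, so the limit is shown for the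
   shifted sequence.\<close>
 ultimately show ?thesis by (subst filterlim_sequentially_Suc[symmetric]) (simp only:)
qed

lemma integral_ext0:
 assumes R: "R > 0" and \<psi>: "continuous_on UNIV \<psi>" "\<forall>b. b \<notin> ball 0 R --> \<psi> b = (0::real)"
  and M: "limit_distribution M m"
 shows "(\<integral>p. ext0 \<psi> p \<partial>mu_hat m (lam m)) = (\<Sum>\<nu><m. \<integral>x. gfun \<psi> \<nu> x \<partial>M) / real m"
proof -
 interpret limit_distribution M m by (rule M)
 obtain D where D: "D >= 0" "!!b. norm (\<psi> b) <= D" using compact_support_bounded[OF \<psi>] by blast
 have meas: "ext0 \<psi> \<in> borel_measurable borel_sphere"
  by (rule case_measurable[OF borel_measurable_continuous_onI[OF \<psi>(1)]])
 have inner: "(\<integral>x. ext0 \<psi> (root_map m rt \<nu> x) \<partial>mu m) = (\<integral>x. gfun \<psi> \<nu> x \<partial>M)" for \<nu>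
 proof -
  have "(\<integral>x. ext0 \<psi> (root_map m rt \<nu> x) \<partial>mu m) = (\<integral>x. gfun \<psi> \<nu> x \<partial>mu m)"
   unfolding mu_eq by (rule Bochner_Integration.integral_cong) (auto simp: space_restrict_space root_map_def gfun_def unity_root_def)
  then show ?thesis unfolding mu_eq
   using integral_restrict[OF borel_measurable_continuous_onI[OF gfun_continuous[OF R \<psi>]]] by simp
 qed
 have "(\<integral>p. ext0 \<psi> p \<partial>mu_hat m (lam m)) = (\<Sum>\<nu><m. \<integral>x. ext0 \<psi> (root_map m rt \<nu> x) \<partial>mu m) /\<^sub>R real m"
  unfolding rt_def by (rule integral_mu_hat[OF m meas, of D]) (use D in auto)
 also have "... = (\<Sum>\<nu><m. \<integral>x. gfun \<psi> \<nu> x \<partial>M) /\<^sub>R real m" by (simp only: inner)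
 finally show ?thesis by (simp add: divide_inverse mult.commute)
qed

lemma zero_limit_real:
 assumes R: "R > 0" and \<psi>: "continuous_on UNIV \<psi>" "\<forall>b. b \<notin> ball 0 R --> \<psi> b = (0::real)"
 shows "(%n. (\<Sum>w\<in>Zs R n. mlt n w * \<psi> w) / real (m * n)) \<longlonglongrightarrow> (\<integral>p. ext0 \<psi> p \<partial>mu_hat m (lam m))"
proof -
 obtain M where M: "limit_distribution M m" "weak_conv_m (emp m) M" using limit_distribution_exists[OF m] by blast
 let ?x = "%n. (\<Sum>w\<in>Zs R n. mlt n w * \<psi> w)" and ?y = "%n. (\<Sum>i\<in>{..<n} \<times> {..<m}. \<psi> (zt rt n i))"
 have "(%n. ?x n / real (m * n) - ?y n / real (m * n)) \<longlonglongrightarrow> 0"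
 proof (rule tendstoI)
  fix e :: real assume e: "e > 0"
  then have "e / 2 > 0" by simp
  from zero_sums[OF R \<psi> this] eventually_gt_at_top[of 0]
  show "\<forall>\<^sub>F n in sequentially. dist (?x n / real (m * n) - ?y n / real (m * n)) 0 < e"
  proof eventually_elim
   case (elim n)
   have mn: "real n <= real (m * n)" "0 < real (m * n)" using m elim(2) by auto
   have "\<bar>?x n - ?y n\<bar> <= e / 2 * real (m * n)" using elim(1) mn(1) e by (meson mult_left_mono order.trans less_imp_le half_gt_zero)
   then have "\<bar>?x n - ?y n\<bar> / real (m * n) <= e / 2" using mn(2) by (simp only: pos_divide_le_eq)
   then have "\<bar>(?x n - ?y n) / real (m * n)\<bar> <= e / 2" using mn(2) by (simp only: abs_divide abs_of_pos)
   then show ?case using e by (simp only: diff_divide_distrib[symmetric] dist_real_def diff_0_right)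
  qed
 qed
 from tendsto_add[OF this riemann_sums[OF R \<psi> M]] show ?thesis unfolding integral_ext0[OF R \<psi> M(1)] by simp
qed

lemma zero_limit:
 fixes \<psi> :: "complex => complex"
 assumes R: "R > 0" and \<psi>: "continuous_on UNIV \<psi>" "\<forall>b. b \<notin> ball 0 R --> \<psi> b = 0"
 shows "(%n. (\<Sum>w\<in>Zs R n. of_real (mlt n w) * \<psi> w) / of_nat (m * n)) \<longlonglongrightarrow> (\<integral>p. ext0 \<psi> p \<partial>mu_hat m (lam m))"
proof -
 interpret H: prob_space "mu_hat m (lam m)" by (rule mu_hat_prob[OF m])
 obtain D where D: "D >= 0" "!!b. norm (\<psi> b) <= D" using compact_support_bounded[OF \<psi>] by blast
 have meas: "ext0 \<psi> \<in> borel_measurable (mu_hat m (lam m))"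
  using case_measurable[OF borel_measurable_continuous_onI[OF \<psi>(1)], of 0] measurable_cong_sets[OF sets_mu_hat[OF m] refl] by blast
 have int: "integrable (mu_hat m (lam m)) (ext0 \<psi>)"
  by (rule H.integrable_const_bound[of _ D]) (use D meas in auto)
 have Re: "Re (\<integral>p. ext0 \<psi> p \<partial>mu_hat m (lam m)) = (\<integral>p. ext0 (%w. Re (\<psi> w)) p \<partial>mu_hat m (lam m))"
  unfolding integral_bounded_linear[OF bounded_linear_Re int, symmetric] by (rule Bochner_Integration.integral_cong) auto
 have Im: "Im (\<integral>p. ext0 \<psi> p \<partial>mu_hat m (lam m)) = (\<integral>p. ext0 (%w. Im (\<psi> w)) p \<partial>mu_hat m (lam m))"
  unfolding integral_bounded_linear[OF bounded_linear_Im int, symmetric] by (rule Bochner_Integration.integral_cong) auto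
 have cr: "continuous_on UNIV (%w. Re (\<psi> w))" "continuous_on UNIV (%w. Im (\<psi> w))"
  using \<psi>(1) by (auto intro: continuous_intros)
 have R2: "Re ((\<Sum>w\<in>Zs R n. of_real (mlt n w) * \<psi> w) / of_nat (m * n)) = (\<Sum>w\<in>Zs R n. mlt n w * Re (\<psi> w)) / real (m * n)" for n
  by (simp add: Re_divide_of_nat Re_sum del: of_nat_mult)
 have I2: "Im ((\<Sum>w\<in>Zs R n. of_real (mlt n w) * \<psi> w) / of_nat (m * n)) = (\<Sum>w\<in>Zs R n. mlt n w * Im (\<psi> w)) / real (m * n)" for n
  by (simp add: Im_divide_of_nat Im_sum del: of_nat_mult)
 show ?thesis
  unfolding tendsto_complex_iff R2 I2 Re Im
  by (intro conjI zero_limit_real R cr) (use \<psi>(2) in auto)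
qed

context
 fixes F :: "complex => complex" and a :: complex and r1 :: real
 assumes F: "\<forall>z. z ~= 0 --> cmod z < r1 --> F (a + z) = G z" and r1: "r1 < r"
begin

lemma sum_support:
 fixes \<psi> :: "complex => complex"
 assumes "n > 0" "\<rho> <= r1" "R <= \<rho> * sc n" "\<forall>b. b \<notin> ball 0 R --> \<psi> b = 0"
 shows "zero_sum m F a \<psi> n \<rho> = (\<Sum>w\<in>Zs R n. of_real (mlt n w) * \<psi> w) / of_nat (m * n)"
proof -
 have "(\<Sum>w\<in>Zs R n. of_real (mlt n w) * \<psi> w) = (\<Sum>w\<in>Zs (\<rho> * sc n) n. of_real (mlt n w) * \<psi> w)"
  by (rule sum.mono_neutral_left[OF zeros_transfer(4)[OF F r1 assms(1,2)] Zs_mono[OF assms(3)]])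
   (use assms(4) in \<open>auto simp: Zs_def\<close>)
 then show ?thesis using zero_sum_eq[OF F r1 assms(1,2), of \<psi>] by simp
qed

lemma sum_support_eventually:
 fixes \<psi> :: "complex => complex" and \<rho> :: "nat => real"
 assumes "\<forall>\<^sub>F n in sequentially. \<rho> n <= r1" "filterlim (%n. \<rho> n * sc n) at_top sequentially" "\<forall>b. b \<notin> ball 0 R --> \<psi> b = 0"
 shows "\<forall>\<^sub>F n in sequentially. zero_sum m F a \<psi> n (\<rho> n) = (\<Sum>w\<in>Zs R n. of_real (mlt n w) * \<psi> w) / of_nat (m * n)"
proof -
 have "\<forall>\<^sub>F n in sequentially. R <= \<rho> n * sc n" using assms(2) by (simp add: filterlim_at_top)
 with assms(1) eventually_gt_at_top[of 0] show ?thesis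
  by eventually_elim (rule sum_support, use assms(3) in auto)
qed

lemma zero_sum_tendsto:
 fixes \<psi> :: "complex => complex" and \<rho> :: "nat => real"
 assumes "R > 0" "continuous_on UNIV \<psi>" "\<forall>b. b \<notin> ball 0 R --> \<psi> b = 0"
  and "\<forall>\<^sub>F n in sequentially. \<rho> n <= r1" "filterlim (%n. \<rho> n * sc n) at_top sequentially"
 shows "(%n. zero_sum m F a \<psi> n (\<rho> n)) \<longlonglongrightarrow> (\<integral>p. ext0 \<psi> p \<partial>mu_hat m (lam m))"
 by (rule Lim_transform_eventually[OF zero_limit[OF assms(1,2,3)] eventually_mono[OF sum_support_eventually[OF assms(4,5,3)]]]) simp

lemma zero_sum_le:
 fixes h :: "complex => complex"
 assumes "n > 0" "\<rho> <= r1" "!!w. cmod (h w) <= e"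
 shows "cmod (zero_sum m F a h n \<rho>) <= e * zero_mass m F a n \<rho>"
proof -
 have "cmod (\<Sum>w\<in>Zs (\<rho> * sc n) n. of_real (mlt n w) * h w) <= (\<Sum>w\<in>Zs (\<rho> * sc n) n. mlt n w * e)"
  by (rule sum_norm_le) (auto simp: norm_mult mlt_nonneg intro!: mult_left_mono assms(3))
 also have "... = e * (\<Sum>w\<in>Zs (\<rho> * sc n) n. mlt n w)" by (simp add: sum_distrib_left mult.commute)
 finally have "cmod (\<Sum>w\<in>Zs (\<rho> * sc n) n. of_real (mlt n w) * h w) / real (m * n) <= e * (\<Sum>w\<in>Zs (\<rho> * sc n) n. mlt n w) / real (m * n)"
  by (rule divide_right_mono) simp
 then show ?thesis
  unfolding zero_sum_eq[OF F r1 assms(1,2)] zero_mass_eq[OF F r1 assms(1,2)]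
  by (simp only: norm_divide norm_of_nat times_divide_eq_right)
qed

lemma zero_sum_linear:
 fixes h k :: "complex => complex"
 shows "zero_sum m F a (%w. c * h w + k w) n \<rho> = c * zero_sum m F a h n \<rho> + zero_sum m F a k n \<rho>"
 unfolding zero_sum_def by (simp add: sum.distrib algebra_simps sum_distrib_left)

lemma zero_sum_one: "zero_sum m F a (%w. 1) n \<rho> = of_real (zero_mass m F a n \<rho>)"
 unfolding zero_sum_def zero_mass_def by simp

text \<open>After subtraction of its value at infinity the test function is small far out and can be
  cut off; the error is at most \<epsilon> times the total mass. The mass hypothesis bounds this
  error and also yields the constant part f None.\<close>

lemma weak_limit:
 fixes f :: "complex option => complex" and \<rho> :: "nat => real"
 assumes \<rho>: "\<forall>\<^sub>F n in sequentially. \<rho> n <= r1" "filterlim (%n. \<rho> n * sc n) at_top sequentially"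
  and mass: "(%n. zero_mass m F a n (\<rho> n)) \<longlonglongrightarrow> 1" and f: "continuous_map riemann_sphere euclidean f"
 shows "(%n. \<integral>p. f p \<partial>zero_measure m F a n (\<rho> n)) \<longlonglongrightarrow> (\<integral>p. f p \<partial>mu_hat m (lam m))"
proof -
 note sf = sphere_function[OF f]
 obtain B where B: "!!p. cmod (f p) <= B" using sf(4) by blast
 interpret P: prob_space "mu_hat m (lam m)" by (rule mu_hat_prob[OF m])
 define h where "h w = f (Some w) - f None" for w
 have hc: "continuous_on UNIV h" unfolding h_def by (intro continuous_intros sf(1))
 have hB: "cmod (h w) <= 2 * B" for w
  unfolding h_def using norm_triangle_ineq4[of "f (Some w)" "f None"] B[of "Some w"] B[of None] by linarith
 have ext_int: "integrable (mu_hat m (lam m)) (ext0 k)" if k: "continuous_on UNIV k" "!!w. cmod (k w) <= D" for k :: "complex => complex" and D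
 proof (rule P.integrable_const_bound[of _ "max D 0"])
  show "ext0 k \<in> borel_measurable (mu_hat m (lam m))"
   using case_measurable[OF borel_measurable_continuous_onI[OF k(1)], of 0] measurable_cong_sets[OF sets_mu_hat[OF m] refl] by blast
  have "norm (ext0 k p) <= max D 0" for p using k(2)[of "the p"] by (cases p) simp_all
  then show "AE p in mu_hat m (lam m). norm (ext0 k p) <= max D 0" by (rule AE_I2)
 qed
 have "(\<integral>p. f p \<partial>mu_hat m (lam m)) = (\<integral>p. f None + ext0 h p \<partial>mu_hat m (lam m))"
 proof (rule Bochner_Integration.integral_cong[OF refl])
  show "f p = f None + ext0 h p" for p by (cases p) (simp_all add: h_def)
 qed
 also have "... = (\<integral>p. f None \<partial>mu_hat m (lam m)) + (\<integral>p. ext0 h p \<partial>mu_hat m (lam m))"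
  by (rule Bochner_Integration.integral_add[OF P.integrable_const ext_int[OF hc hB]])
 also have "(\<integral>p. f None \<partial>mu_hat m (lam m)) = f None" by (simp add: P.prob_space)
 finally have lim: "(\<integral>p. f p \<partial>mu_hat m (lam m)) = f None + (\<integral>p. ext0 h p \<partial>mu_hat m (lam m))" .
 have sumlim: "(%n. zero_sum m F a h n (\<rho> n)) \<longlonglongrightarrow> (\<integral>p. ext0 h p \<partial>mu_hat m (lam m))"
 proof (rule tendstoI)
  fix e :: real assume e: "e > 0"
  \<comment> \<open>Three errors: 2 \<epsilon> from the cut-off at the zeros, whose mass is below 2,
    \<epsilon> from convergence for the cut-off function, \<epsilon> from the cut-off under the
    limit. Their sum 4 \<epsilon> is e/2.\<close>
  define \<epsilon> where "\<epsilon> = e / 8"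
  have \<epsilon>: "\<epsilon> > 0" using e by (simp add: \<epsilon>_def)
  obtain R where R: "R > 0" "!!w. cmod w >= R ==> cmod (h w) < \<epsilon>" using sf(2)[OF \<epsilon>] unfolding h_def by blast
  \<comment> \<open>A continuous cut-off, equal to 1 for |w| <= R and to 0 for |w| >= R + 1.\<close>
  define bump where "bump w = max 0 (min 1 (R + 1 - cmod w))" for w :: complex
  define \<psi> where "\<psi> w = of_real (bump w) * h w" for w
  have bump: "0 <= bump w" "bump w <= 1" for w by (auto simp: bump_def)
  have \<psi>c: "continuous_on UNIV \<psi>" unfolding \<psi>_def bump_def by (intro continuous_intros hc)
  have \<psi>0: "\<forall>b. b \<notin> ball 0 (R + 1) --> \<psi> b = 0" by (simp add: \<psi>_def bump_def)
  have diff: "cmod (h w - \<psi> w) <= \<epsilon>" for w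
  proof (cases "cmod w >= R")
   case True
   have "h w - \<psi> w = of_real (1 - bump w) * h w" by (simp add: \<psi>_def algebra_simps)
   then have "cmod (h w - \<psi> w) = (1 - bump w) * cmod (h w)" using bump[of w] by (simp only: norm_mult norm_of_real)
   also have "... <= 1 * \<epsilon>" using bump[of w] R(2)[OF True] by (intro mult_mono) auto
   finally show ?thesis by simp
  next
   case False
   then show ?thesis using \<epsilon> by (simp add: \<psi>_def bump_def)
  qed
  have \<psi>B: "cmod (\<psi> w) <= 2 * B + \<epsilon>" for w using diff[of w] hB[of w] norm_triangle_sub[of "\<psi> w" "h w"] by (simp add: norm_minus_commute)
  have "(\<integral>p. ext0 h p \<partial>mu_hat m (lam m)) - (\<integral>p. ext0 \<psi> p \<partial>mu_hat m (lam m)) = (\<integral>p. ext0 h p - ext0 \<psi> p \<partial>mu_hat m (lam m))"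
   by (rule Bochner_Integration.integral_diff[symmetric, OF ext_int[OF hc hB] ext_int[OF \<psi>c \<psi>B]])
  also have "cmod ... <= (\<integral>p. \<epsilon> \<partial>mu_hat m (lam m))"
  proof (rule order.trans[OF Bochner_Integration.integral_norm_bound Bochner_Integration.integral_mono])
   show "integrable (mu_hat m (lam m)) (%p. cmod (ext0 h p - ext0 \<psi> p))"
    by (rule integrable_norm[OF Bochner_Integration.integrable_diff[OF ext_int[OF hc hB] ext_int[OF \<psi>c \<psi>B]]])
   show "cmod (ext0 h p - ext0 \<psi> p) <= \<epsilon>" for p using diff[of "the p"] \<epsilon> by (cases p) simp_all
  qed (rule P.integrable_const)
  also have "... = \<epsilon>" by (simp add: P.prob_space)
  finally have i: "cmod ((\<integral>p. ext0 h p \<partial>mu_hat m (lam m)) - (\<integral>p. ext0 \<psi> p \<partial>mu_hat m (lam m))) <= \<epsilon>" .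
  have R1: "R + 1 > 0" using R by simp
  have ev2: "\<forall>\<^sub>F n in sequentially. zero_mass m F a n (\<rho> n) < 2" by (rule order_tendstoD(2)[OF mass]) simp
  have ev3: "\<forall>\<^sub>F n in sequentially. dist (zero_sum m F a \<psi> n (\<rho> n)) (\<integral>p. ext0 \<psi> p \<partial>mu_hat m (lam m)) < \<epsilon>"
   by (rule tendstoD[OF zero_sum_tendsto[OF R1 \<psi>c \<psi>0 \<rho>] \<epsilon>])
  show "\<forall>\<^sub>F n in sequentially. dist (zero_sum m F a h n (\<rho> n)) (\<integral>p. ext0 h p \<partial>mu_hat m (lam m)) < e"
   using ev2 ev3 \<rho>(1) eventually_gt_at_top[of 0]
  proof eventually_elim
   case (elim n)
   have "zero_sum m F a h n (\<rho> n) = zero_sum m F a (%w. 1 * \<psi> w + (h w - \<psi> w)) n (\<rho> n)" by simp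
   also have "... = zero_sum m F a \<psi> n (\<rho> n) + zero_sum m F a (%w. h w - \<psi> w) n (\<rho> n)"
    unfolding zero_sum_linear by simp
   finally have s: "zero_sum m F a h n (\<rho> n) - zero_sum m F a \<psi> n (\<rho> n) = zero_sum m F a (%w. h w - \<psi> w) n (\<rho> n)" by simp
   have "cmod (zero_sum m F a (%w. h w - \<psi> w) n (\<rho> n)) <= \<epsilon> * zero_mass m F a n (\<rho> n)"
    by (rule zero_sum_le[OF elim(4,3) diff])
   also have "... <= \<epsilon> * 2" using elim(1) \<epsilon> by (intro mult_left_mono) auto
   finally have d1: "dist (zero_sum m F a h n (\<rho> n)) (zero_sum m F a \<psi> n (\<rho> n)) <= \<epsilon> * 2" unfolding dist_norm s .
   have d3: "dist (\<integral>p. ext0 \<psi> p \<partial>mu_hat m (lam m)) (\<integral>p. ext0 h p \<partial>mu_hat m (lam m)) <= \<epsilon>"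
    using i by (simp only: dist_norm norm_minus_commute)
   show ?case
    using d1 d3 elim(2) \<epsilon> dist_triangle[of "zero_sum m F a h n (\<rho> n)" "\<integral>p. ext0 h p \<partial>mu_hat m (lam m)" "zero_sum m F a \<psi> n (\<rho> n)"]
     dist_triangle[of "zero_sum m F a \<psi> n (\<rho> n)" "\<integral>p. ext0 h p \<partial>mu_hat m (lam m)" "\<integral>p. ext0 \<psi> p \<partial>mu_hat m (lam m)"]
    unfolding \<epsilon>_def by linarith
  qed
 qed
 have "(%n. f None * of_real (zero_mass m F a n (\<rho> n)) + zero_sum m F a h n (\<rho> n)) \<longlonglongrightarrow> f None * of_real 1 + (\<integral>p. ext0 h p \<partial>mu_hat m (lam m))"
  by (intro tendsto_intros mass sumlim)
 moreover have "\<forall>\<^sub>F n in sequentially. f None * of_real (zero_mass m F a n (\<rho> n)) + zero_sum m F a h n (\<rho> n) = (\<integral>p. f p \<partial>zero_measure m F a n (\<rho> n))"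
  using \<rho>(1) eventually_gt_at_top[of 0]
 proof eventually_elim
  case (elim n)
  have "(\<integral>p. f p \<partial>zero_measure m F a n (\<rho> n)) = zero_sum m F a (%w. f (Some w)) n (\<rho> n)"
   by (rule zero_measure_integral[OF F r1 elim(2,1) sf(3)])
  also have "(%w. f (Some w)) = (%w. f None * 1 + h w)" by (simp add: h_def)
  finally show ?case unfolding zero_sum_linear zero_sum_one by simp
 qed
 ultimately have T: "(%n. \<integral>p. f p \<partial>zero_measure m F a n (\<rho> n)) \<longlonglongrightarrow> f None * of_real 1 + (\<integral>p. ext0 h p \<partial>mu_hat m (lam m))"
  by (rule Lim_transform_eventually)
 have one: "f None * of_real 1 = f None" by simp
 show ?thesis by (rule tendsto_eq_rhs[OF T trans[OF arg_cong2[where f = "(+)", OF one refl] lim[symmetric]]])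
qed

end

end

section \<open>Admissible radii and the assembly of the theorem\<close>

lemma admissible_pos: "admissible_radius a m \<alpha> lam \<phi> F r ==> r > 0"
 unfolding admissible_radius_def by (rule conjunct1)

text \<open>The closed disc has positive distance from the complement of the open set, so \<phi> is
  good on a strictly larger disc. This provides the gap between r1 and r that finiteness of the
  zeros relies on.\<close>

lemma admissible_extend:
 assumes m: "m >= 1" "lam m ~= 0" and adm: "admissible_radius a m \<alpha> lam \<phi> F r"
 obtains r2 U where "r < r2" "essential_function m lam (%z. \<phi> (a + z)) r2 U"
proof -
 have r: "r > 0" by (rule admissible_pos[OF adm])
 have "\<exists>U. open U & cball a r <= U & \<phi> holomorphic_on U & (\<forall>z\<in>U. \<phi> z ~= 0)"
  using adm unfolding admissible_radius_def by (elim conjE)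
 then obtain V where V: "open V" "cball a r <= V" "\<phi> holomorphic_on V" "\<forall>z\<in>V. \<phi> z ~= 0" by blast
 have "compact (cball a r)" "closed (- V)" "cball a r \<inter> - V = {}" using V by auto
 from separate_compact_closed[OF this]
 obtain d where d: "d > 0" "!!x y. x \<in> cball a r ==> y \<in> - V ==> d <= dist x y" by blast
 define U where "U = (%z. a + z) -` V"
 have sub: "cball 0 (r + d / 2) <= U"
 proof
  fix z :: complex assume z: "z \<in> cball 0 (r + d / 2)"
  show "z \<in> U"
  proof (rule ccontr)
   assume "z \<notin> U"
   then have nV: "a + z \<in> - V" by (simp add: U_def)
   have zr: "cmod z > r"
   proof (rule ccontr)
    assume "\<not> r < cmod z"
    then have "a + z \<in> cball a r" by (simp add: dist_norm)
    then show False using V(2) nV by blast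
   qed
   \<comment> \<open>The point of the closed disc on the segment from a to a + z; its distance from
     a + z is |z| - r.\<close>
   define x where "x = a + of_real (r / cmod z) * z"
   have "x \<in> cball a r" using zr r by (simp add: x_def dist_norm norm_mult norm_divide)
   then have le: "d <= dist x (a + z)" using d(2) nV by blast
   have "x - (a + z) = of_real (r / cmod z - 1) * z" by (simp add: x_def algebra_simps)
   then have "dist x (a + z) = \<bar>r / cmod z - 1\<bar> * cmod z" by (simp only: dist_norm norm_mult norm_of_real)
   also have "... = cmod z - r"
   proof -
    have z0: "cmod z > 0" using zr r by linarith
    then have "r / cmod z < 1" using zr by (simp add: divide_less_eq)
    then have "\<bar>r / cmod z - 1\<bar> = 1 - r / cmod z" by simp
    then show ?thesis using z0 by (simp add: left_diff_distrib)
   qed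
   finally have "dist x (a + z) = cmod z - r" .
   then show False using le z d(1) by simp
  qed
 qed
 have "essential_function m lam (%z. \<phi> (a + z)) (r + d / 2) U"
 proof
  show "open U" unfolding U_def
   by (rule open_vimage[OF V(1) continuous_on_add[OF continuous_on_const continuous_on_id]])
  have 1: "(%z. a + z) holomorphic_on U" by (rule holomorphic_on_add[OF holomorphic_on_const holomorphic_on_ident])
  have 2: "(%z. a + z) ` U <= V" by (auto simp: U_def)
  show "(%z. \<phi> (a + z)) holomorphic_on U"
   using holomorphic_on_compose[OF 1 holomorphic_on_subset[OF V(3) 2]] by (simp only: o_def)
  show "1 <= m" "lam m ~= 0" by (rule m)+
  show "0 < r + d / 2" using r d(1) by simp
  show "cball 0 (r + d / 2) <= U" by (rule sub)
  show "\<phi> (a + z) ~= 0" if "z \<in> U" for z using that V(4) by (simp add: U_def)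
 qed
 moreover have "r < r + d / 2" using d(1) by simp
 ultimately show ?thesis by (rule that[rotated])
qed

lemma admissible_eq:
 assumes adm: "admissible_radius a m \<alpha> lam \<phi> F r" and E: "essential_function m lam (%z. \<phi> (a + z)) r2 U"
 shows "\<forall>z. z ~= 0 --> cmod z < r --> F (a + z) = essential_function.G m \<alpha> lam (%z. \<phi> (a + z)) z"
proof (intro allI impI)
 fix z assume z: "z ~= 0" "cmod z < r"
 have "\<forall>z. 0 < cmod (z - a) & cmod (z - a) < r --> F z = essential_form a m \<alpha> lam \<phi> z"
  using adm unfolding admissible_radius_def by (elim conjE)
 from this[rule_format, of "a + z"] z have "F (a + z) = essential_form a m \<alpha> lam \<phi> (a + z)" by simp
 then show "F (a + z) = essential_function.G m \<alpha> lam (%z. \<phi> (a + z)) z"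
  unfolding essential_function.G_def[OF E] essential_form_def by simp
qed

lemma admissible_exists:
 assumes "\<exists>U. open U & a \<in> U & \<phi> holomorphic_on U & (\<forall>z\<in>U. \<phi> z ~= 0)"
  and "\<forall>\<^sub>F z in at a. F z = essential_form a m \<alpha> lam \<phi> z"
 shows "\<exists>r. admissible_radius a m \<alpha> lam \<phi> F r"
proof -
 obtain U where U: "open U" "a \<in> U" "\<phi> holomorphic_on U" "\<forall>z\<in>U. \<phi> z ~= 0" using assms(1) by blast
 obtain e where e: "e > 0" "cball a e <= U" using U(1,2) open_contains_cball by blast
 obtain d where d: "d > 0" "\<forall>z. z ~= a & dist z a < d --> F z = essential_form a m \<alpha> lam \<phi> z"
  using assms(2) unfolding eventually_at by auto
 have "cball a (min e d) <= U" by (rule order.trans[OF subset_cball e(2)]) simp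
 then have "\<exists>U. open U & cball a (min e d) <= U & \<phi> holomorphic_on U & (\<forall>z\<in>U. \<phi> z ~= 0)" using U by blast
 moreover have "F z = essential_form a m \<alpha> lam \<phi> z" if "0 < cmod (z - a)" "cmod (z - a) < min e d" for z
  using d(2)[rule_format, of z] that by (simp add: dist_norm)
 moreover have "min e d > 0" using e(1) d(1) by simp
 ultimately have "admissible_radius a m \<alpha> lam \<phi> F (min e d)" unfolding admissible_radius_def by blast
 then show ?thesis ..
qed

theorem theorem36:
  fixes a :: complex and m :: nat and \<alpha> :: int and lam :: "nat \<Rightarrow> complex"
    and \<phi> F :: "complex \<Rightarrow> complex"
  assumes "m \<ge> 1" and "lam m \<noteq> 0"
    and "\<exists>U. open U \<and> a \<in> U \<and> \<phi> holomorphic_on U \<and> (\<forall>z\<in>U. \<phi> z \<noteq> 0)"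
    and "\<forall>\<^sub>F z in at a. F z = essential_form a m \<alpha> lam \<phi> z"
  shows
    "(\<forall>\<psi>. compactly_supported_continuous \<psi> \<longrightarrow>
        (\<forall>r. admissible_radius a m \<alpha> lam \<phi> F r \<longrightarrow>
           (\<lambda>n. zero_sum m F a \<psi> n r) \<longlonglongrightarrow>
             (LINT p:range Some|mu_hat m (lam m). \<psi> (the p))) \<and>
        (\<forall>r r'. admissible_radius a m \<alpha> lam \<phi> F r \<and> admissible_radius a m \<alpha> lam \<phi> F r' \<longrightarrow>
           (\<forall>\<^sub>F n in sequentially. zero_sum m F a \<psi> n r = zero_sum m F a \<psi> n r'))) \<and>
     (\<forall>\<rho> :: nat \<Rightarrow> real.
        (\<forall>n. \<rho> n > 0) \<and> decseq \<rho> \<and> \<rho> \<longlonglongrightarrow> 0 \<and>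
        filterlim (\<lambda>n. real n powr (1 / real m) * \<rho> n) at_top sequentially \<and>
        (\<lambda>n. zero_mass m F a n (\<rho> n)) \<longlonglongrightarrow> 1 \<longrightarrow>
        weakly_converges_on riemann_sphere (\<lambda>n. zero_measure m F a n (\<rho> n)) (mu_hat m (lam m)))"
proof (intro conjI allI impI)
 fix \<psi> assume "compactly_supported_continuous \<psi>"
 then have cont: "continuous_on UNIV \<psi>" and comp: "compact (closure {z. \<psi> z ~= 0})"
  by (auto simp: compactly_supported_continuous_def)
 have "bounded {z. \<psi> z ~= 0}" by (rule bounded_subset[OF compact_imp_bounded[OF comp] closure_subset])
 then obtain R0 where R0: "R0 > 0" "!!z. \<psi> z ~= 0 ==> cmod z <= R0"
  unfolding bounded_pos by auto
 define R where "R = R0 + 1"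
 have R: "R > 0" using R0 by (simp add: R_def)
 have supp: "\<forall>b. b \<notin> ball 0 R --> \<psi> b = 0"
 proof (intro allI impI)
  fix b :: complex assume "b \<notin> ball 0 R"
  then have "\<not> cmod b <= R0" by (simp add: R_def)
  then show "\<psi> b = 0" using R0(2) by blast
 qed
 have LINT: "(LINT p:range Some|mu_hat m (lam m). \<psi> (the p)) = (\<integral>p. (if p = None then 0 else \<psi> (the p)) \<partial>mu_hat m (lam m))"
  unfolding set_lebesgue_integral_def
 proof (rule Bochner_Integration.integral_cong[OF refl])
  show "indicat_real (range Some) p *\<^sub>R \<psi> (the p) = (if p = None then 0 else \<psi> (the p))" for p
   by (cases p) (simp_all add: indicator_def)
 qed
 {
  fix r assume adm: "admissible_radius a m \<alpha> lam \<phi> F r"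
  then have rpos: "r > 0" by (rule admissible_pos)
  obtain r2 U where r2: "r < r2" and E: "essential_function m lam (%z. \<phi> (a + z)) r2 U"
   by (rule admissible_extend[OF assms(1,2) adm])
  interpret essential_function m \<alpha> lam "%z. \<phi> (a + z)" r2 U by (rule E)
  show "(%n. zero_sum m F a \<psi> n r) \<longlonglongrightarrow> (LINT p:range Some|mu_hat m (lam m). \<psi> (the p))"
   unfolding LINT
  proof (rule zero_sum_tendsto[OF admissible_eq[OF adm E] r2 R cont supp, of "%_. r"])
   show "\<forall>\<^sub>F n in sequentially. r <= r" by (simp only: order.refl eventually_True)
   show "filterlim (%n. r * sc n) at_top sequentially"
    by (rule filterlim_tendsto_pos_mult_at_top[OF tendsto_const rpos sc_at_top])
  qed
 next
  fix r r' assume "admissible_radius a m \<alpha> lam \<phi> F r & admissible_radius a m \<alpha> lam \<phi> F r'"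
  \<comment> \<open>The larger radius is one of the two and hence admissible. For large n both sums
    reduce to the same sum over \<open>Zs R n\<close>.\<close>
  then have adm: "admissible_radius a m \<alpha> lam \<phi> F (max r r')" and rr: "r > 0" "r' > 0"
   by (auto simp: max_def intro: admissible_pos)
  obtain r2 U where r2: "max r r' < r2" and E: "essential_function m lam (%z. \<phi> (a + z)) r2 U"
   by (rule admissible_extend[OF assms(1,2) adm])
  interpret essential_function m \<alpha> lam "%z. \<phi> (a + z)" r2 U by (rule E)
  have S: "\<forall>\<^sub>F n in sequentially. zero_sum m F a \<psi> n t = (\<Sum>w\<in>Zs R n. of_real (mlt n w) * \<psi> w) / of_nat (m * n)"
   if t: "0 < t" "t <= max r r'" for t
  proof (rule sum_support_eventually[OF admissible_eq[OF adm E] r2 _ _ supp, of "%_. t"])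
   show "\<forall>\<^sub>F n in sequentially. t <= max r r'" by (simp only: t(2) eventually_True)
   show "filterlim (%n. t * sc n) at_top sequentially"
    by (rule filterlim_tendsto_pos_mult_at_top[OF tendsto_const t(1) sc_at_top])
  qed
  have "r <= max r r'" "r' <= max r r'" by auto
  from S[OF rr(1) this(1)] S[OF rr(2) this(2)]
  show "\<forall>\<^sub>F n in sequentially. zero_sum m F a \<psi> n r = zero_sum m F a \<psi> n r'" by eventually_elim simp
 }
next
 fix \<rho> :: "nat => real"
 assume \<rho>: "(\<forall>n. \<rho> n > 0) & decseq \<rho> & \<rho> \<longlonglongrightarrow> 0 \<and>
    filterlim (%n. real n powr (1 / real m) * \<rho> n) at_top sequentially \<and>
    (%n. zero_mass m F a n (\<rho> n)) \<longlonglongrightarrow> 1"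
 obtain r where adm: "admissible_radius a m \<alpha> lam \<phi> F r" using admissible_exists[OF assms(3,4)] by blast
 then have rpos: "r > 0" by (rule admissible_pos)
 obtain r2 U where r2: "r < r2" and E: "essential_function m lam (%z. \<phi> (a + z)) r2 U"
  by (rule admissible_extend[OF assms(1,2) adm])
 interpret essential_function m \<alpha> lam "%z. \<phi> (a + z)" r2 U by (rule E)
 have "\<forall>\<^sub>F n in sequentially. \<rho> n < r" using \<rho> rpos by (intro order_tendstoD(2)) auto
 then have 1: "\<forall>\<^sub>F n in sequentially. \<rho> n <= r" by eventually_elim simp
 have 2: "filterlim (%n. \<rho> n * sc n) at_top sequentially" using \<rho> by (simp add: sc_def mult.commute)
 show "weakly_converges_on riemann_sphere (%n. zero_measure m F a n (\<rho> n)) (mu_hat m (lam m))"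
  unfolding weakly_converges_on_def
  using weak_limit[OF admissible_eq[OF adm E] r2 1 2] \<rho> by blast
qed

end
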